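(* Let $E$ be an ordinary (trivially graded) smooth vector bundle over an ordinary smooth manifold $M$. There is a canonical vector bundle isomorphism $\Psi:\mathfrak J^k_E\to\overline{\mathfrak J}{}^k_E$ over the identity $\mathbb 1_M$ for each $k\in\mathbb N_0$, where $\overline{\mathfrak J}{}^k_E$ is the usual $k$-th order jet bundle of $E$.
   Context: $\mathcal C^\infty_M$ is the sheaf of smooth functions, $\Gamma_E$ the sheaf of smooth sections of $E$; $\mathcal C^\infty_{M,a}$, $\Gamma_{E,a}$ denote stalks, $\mathcal J_{M,a}\subseteq\mathcal C^\infty_{M,a}$ the ideal of germs vanishing at $a$. Usual jet bundle: $\Gamma^{[k]}_{E,a}=(\mathcal J_{M,a})^{k+1}\cdot\Gamma_{E,a}$, $\mathfrak J^k_{E,a}=\Gamma_{E,a}/\Gamma^{[k]}_{E,a}$ with quotient map $\mathfrak j^k_a$, and $\overline{\mathfrak J}{}^k_E=\bigsqcup_{a\in M}\mathfrak J^k_{E,a}$ with the obvious projection $\overline\varpi$ to $M$. For a local chart $(U,\varphi)$ on $M$ and a local frame $\{\Phi_\lambda\}_{\lambda=1}^r$ of $E$ over $U$, local trivializations $\overline\varpi{}^{-1}(U)\to U\times\mathbb R^{\ell}$, $\ell=r\binom{n+k}{k}$, $n=\dim M$, are $\mathfrak j^k_a[\psi]_a\mapsto(a,((\partial_{\mathbf I}\psi^\lambda)(a))_{\lambda,\mathbf I})$, with $\psi=\psi^\lambda\Phi_\lambda$ representing the germ $[\psi]_a$, $\lambda\in\{1,\dots,r\}$, $\mathbf I\in(\mathbb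 N_0)^n$ with $|\mathbf I|\le k$; these define the smooth vector bundle structure. Algebraic jet bundle $\mathfrak J^k_E$ (the specialization to the ordinary case of the construction for graded vector bundles): for open $U\subseteq M$ let $\mathcal X(U)=\mathcal{C}^\infty_{M}(U)\otimes_{\mathbb R}\Gamma_{E}(U)$ (algebraic tensor product) with two actions $f\triangleright(g\otimes\psi)=(fg)\otimes\psi$ and $f\blacktriangleright(g\otimes\psi)=g\otimes(f\psi)$; let $\delta_f(x)=f\triangleright x-f\blacktriangleright x$. Let $\mathcal V_{(k)}(U)$ be the real span of all $\delta_{f_1}\cdots\delta_{f_{k+1}}(g\otimes\psi)$ and $\mathrm{pJet}^k_{E}(U)=\mathcal X(U)/\mathcal V_{(k)}(U)$. For a $\mathcal C^\infty_M(U)$-module $P$ let $P^\bullet=\bigcap_{q\in\mathbb N}\bigcap_{a\in U}(\mathcal J^a_M(U))^qP$, where $\mathcal J^a_M(U)$ is the ideal of functions on $U$ vanishing at $a$. Put $\mathrm{gpJet}^k_E(U)=\mathrm{pJet}^k_E(U)/\mathrm{pJet}^k_E(U)^\bullet$ (with respect to $\triangleright$), and let $\mathrm{Jet}^k_E$ be the sheafification of the presheaf $\mathrm{gpJet}^k_E$. $\mathrm{Jet}^k_E$ is a locally free sheaf of $\mathcal C^\infty_M$-modules (via $\triangleright$) of finite constant rank, and $\mathfrak J^k_E$ is the corresponding vector bundle. *)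

theory Defs
  imports
    "HOL-Analysis.Analysis"
    "HOL-Algebra.Module"
    "HOL-Algebra.AbelCoset"
    "HOL-Algebra.Generated_Groups"
    "HOL-Algebra.Free_Abelian_Groups"
begin

section \<open>Smooth functions on open subsets of Euclidean n-space\<close>

text \<open>
  Euclidean n-space is \<^const>\<open>Euclidean_space\<close>, whose points are the sequences that vanish from
  index n on, so that the dimension is an arbitrary natural number (0 included). Coordinates are
  numbered from 0.
\<close>

definition partial :: "nat \<Rightarrow> ((nat \<Rightarrow> real) \<Rightarrow> real) \<Rightarrow> (nat \<Rightarrow> real) \<Rightarrow> real" where
  "partial i f x = deriv (\<lambda>t. f (x(i := t))) (x i)"

primrec cont_diff :: "nat \<Rightarrow> nat \<Rightarrow> (nat \<Rightarrow> real) set \<Rightarrow> ((nat \<Rightarrow> real) \<Rightarrow> real) \<Rightarrow> bool" where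
  "cont_diff n 0 W f \<longleftrightarrow> continuous_on W f"
| "cont_diff n (Suc p) W f \<longleftrightarrow> continuous_on W f \<and>
     (\<forall>i<n. (\<forall>x\<in>W. (\<lambda>t. f (x(i := t))) differentiable (at (x i))) \<and> cont_diff n p W (partial i f))"

text \<open>Only used for W open in Euclidean n-space; then only the values of f on W matter.\<close>

definition smooth_Rn :: "nat \<Rightarrow> (nat \<Rightarrow> real) set \<Rightarrow> ((nat \<Rightarrow> real) \<Rightarrow> real) \<Rightarrow> bool" where
  "smooth_Rn n W f \<longleftrightarrow> (\<forall>p. cont_diff n p W f)"

definition multi_indices :: "nat \<Rightarrow> nat \<Rightarrow> (nat \<Rightarrow> nat) set" where
  "multi_indices n k = {I. (\<forall>i\<ge>n. I i = 0) \<and> (\<Sum>i<n. I i) \<le> k}"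

primrec mpartial :: "nat \<Rightarrow> (nat \<Rightarrow> nat) \<Rightarrow> ((nat \<Rightarrow> real) \<Rightarrow> real) \<Rightarrow> (nat \<Rightarrow> real) \<Rightarrow> real" where
  "mpartial 0 I f = f"
| "mpartial (Suc m) I f = (partial m ^^ I m) (mpartial m I f)"


section \<open>Smooth manifolds\<close>

text \<open>
  A chart is a pair of its domain and its coordinate map; the values of the coordinate map
  outside the domain are irrelevant. The atlas of a smooth manifold is maximal, so its members are
  exactly the local charts.
\<close>

record 'm manifold =
  mtop :: "'m topology"
  mdim :: nat
  atlas :: "('m set \<times> ('m \<Rightarrow> nat \<Rightarrow> real)) set"

abbreviation points :: "'m manifold \<Rightarrow> 'm set" where
  "points M \<equiv> topspace (mtop M)"

definition is_chart :: "'m manifold \<Rightarrow> 'm set \<times> ('m \<Rightarrow> nat \<Rightarrow> real) \<Rightarrow> bool" where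
  "is_chart M = (\<lambda>(U, \<phi>). openin (mtop M) U \<and> openin (Euclidean_space (mdim M)) (\<phi> ` U) \<and>
     homeomorphic_map (subtopology (mtop M) U) (subtopology (Euclidean_space (mdim M)) (\<phi> ` U)) \<phi>)"

definition smooth_transition ::
  "'m manifold \<Rightarrow> 'm set \<times> ('m \<Rightarrow> nat \<Rightarrow> real) \<Rightarrow> 'm set \<times> ('m \<Rightarrow> nat \<Rightarrow> real) \<Rightarrow> bool" where
  "smooth_transition M = (\<lambda>(U, \<phi>) (V, \<eta>).
     \<forall>i<mdim M. smooth_Rn (mdim M) (\<phi> ` (U \<inter> V)) (\<lambda>x. \<eta> (inv_into U \<phi> x) i))"

definition smooth_manifold :: "'m manifold \<Rightarrow> bool" where
  "smooth_manifold M \<longleftrightarrow>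
     Hausdorff_space (mtop M) \<and> second_countable (mtop M) \<and>
     (\<Union>(U, \<phi>)\<in>atlas M. U) = points M \<and>
     (\<forall>c\<in>atlas M. is_chart M c) \<and>
     (\<forall>c\<in>atlas M. \<forall>d\<in>atlas M. smooth_transition M c d) \<and>
     (\<forall>c. is_chart M c \<and> (\<forall>d\<in>atlas M. smooth_transition M c d \<and> smooth_transition M d c)
        \<longrightarrow> c \<in> atlas M)"

definition smooth_fun :: "'m manifold \<Rightarrow> 'm set \<Rightarrow> ('m \<Rightarrow> real) \<Rightarrow> bool" where
  "smooth_fun M U f \<longleftrightarrow>
     (\<forall>(V, \<phi>)\<in>atlas M. smooth_Rn (mdim M) (\<phi> ` (U \<inter> V)) (\<lambda>x. f (inv_into V \<phi> x)))"


section \<open>Modules given by records: quotients, powers of ideals, tensor products\<close>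

text \<open>
  A module is represented by the library's module record, which extends the ring record. Where a
  module is not also a ring, the fields for ring multiplication and unit are left undefined.
  Elements of quotients are additive cosets.
\<close>

definition quot_mod :: "('r, 'a) module \<Rightarrow> 'a set \<Rightarrow> ('r, 'a set) module" where
  "quot_mod P N = \<lparr>carrier = A_RCOSETS P N, monoid.mult = undefined, monoid.one = undefined,
     ring.zero = N, ring.add = set_add P, module.smult = (\<lambda>r X. \<Union>x\<in>X. N +>\<^bsub>P\<^esub> (r \<odot>\<^bsub>P\<^esub> x))\<rparr>"

text \<open>The map into the quotient of P by N which h induces on cosets.\<close>

definition quot_map :: "('r, 'b) module \<Rightarrow> 'b set \<Rightarrow> ('a \<Rightarrow> 'b) \<Rightarrow> 'a set \<Rightarrow> 'b set" where
  "quot_map P N h X = (\<Union>x\<in>X. N +>\<^bsub>P\<^esub> h x)"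

text \<open>The power \<open>I\<^sup>q P\<close> of an ideal I acting on a module P.\<close>

primrec ideal_products :: "('r, 'a) module \<Rightarrow> 'r set \<Rightarrow> nat \<Rightarrow> 'a set" where
  "ideal_products P I 0 = carrier P"
| "ideal_products P I (Suc q) = {f \<odot>\<^bsub>P\<^esub> x | f x. f \<in> I \<and> x \<in> ideal_products P I q}"

definition ideal_power_mod :: "('r, 'a) module \<Rightarrow> 'r set \<Rightarrow> nat \<Rightarrow> 'a set" where
  "ideal_power_mod P I q = generate (add_monoid P) (ideal_products P I q)"

text \<open>
  The tensor product of A and B over the scalars K (which act on both A and B) is the free abelian
  group on the pairs, modulo the following subgroup.
\<close>

definition tensor_relations :: "'r set \<Rightarrow> ('r, 'a) module \<Rightarrow> ('r, 'b) module \<Rightarrow> ('a \<times> 'b \<Rightarrow>\<^sub>0 int) set" where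
  "tensor_relations K A B = generate (free_Abelian_group (carrier A \<times> carrier B))
     ({frag_of (a \<oplus>\<^bsub>A\<^esub> a', b) - frag_of (a, b) - frag_of (a', b) | a a' b.
         a \<in> carrier A \<and> a' \<in> carrier A \<and> b \<in> carrier B} \<union>
      {frag_of (a, b \<oplus>\<^bsub>B\<^esub> b') - frag_of (a, b) - frag_of (a, b') | a b b'.
         a \<in> carrier A \<and> b \<in> carrier B \<and> b' \<in> carrier B} \<union>
      {frag_of (c \<odot>\<^bsub>A\<^esub> a, b) - frag_of (a, c \<odot>\<^bsub>B\<^esub> b) | c a b.
         c \<in> K \<and> a \<in> carrier A \<and> b \<in> carrier B})"

definition free_on_pairs ::
  "('r, 'a) module \<Rightarrow> ('r, 'b) module \<Rightarrow> ('r \<Rightarrow> 'a \<times> 'b \<Rightarrow> 'a \<times> 'b) \<Rightarrow> ('r, 'a \<times> 'b \<Rightarrow>\<^sub>0 int) module" where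
  "free_on_pairs A B act = \<lparr>carrier = carrier (free_Abelian_group (carrier A \<times> carrier B)),
     monoid.mult = undefined, monoid.one = undefined, ring.zero = 0, ring.add = (+),
     module.smult = (\<lambda>r. frag_extend (\<lambda>p. frag_of (act r p)))\<rparr>"

text \<open>The tensor product with scalars acting on the left, respectively on the right factor.\<close>

definition tensor_left ::
  "'r set \<Rightarrow> ('r, 'a) module \<Rightarrow> ('r, 'b) module \<Rightarrow> ('r, ('a \<times> 'b \<Rightarrow>\<^sub>0 int) set) module" where
  "tensor_left K A B =
     quot_mod (free_on_pairs A B (\<lambda>f (a, b). (f \<odot>\<^bsub>A\<^esub> a, b))) (tensor_relations K A B)"

definition tensor_right ::
  "'r set \<Rightarrow> ('r, 'a) module \<Rightarrow> ('r, 'b) module \<Rightarrow> ('r, ('a \<times> 'b \<Rightarrow>\<^sub>0 int) set) module" where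
  "tensor_right K A B =
     quot_mod (free_on_pairs A B (\<lambda>f (a, b). (a, f \<odot>\<^bsub>B\<^esub> b))) (tensor_relations K A B)"

definition pure_tensor ::
  "'r set \<Rightarrow> ('r, 'a) module \<Rightarrow> ('r, 'b) module \<Rightarrow> 'a \<Rightarrow> 'b \<Rightarrow> ('a \<times> 'b \<Rightarrow>\<^sub>0 int) set" where
  "pure_tensor K A B a b =
     tensor_relations K A B +>\<^bsub>free_on_pairs A B (\<lambda>_ p. p)\<^esub> frag_of (a, b)"


section \<open>Presheaves of modules over the smooth functions\<close>

text \<open>
  \<open>res F U V\<close> is the restriction from U to V. Only open sets U and V with V contained in U matter.
  Functions and sections on U are made extensional on U.
\<close>

record ('m, 's) presheaf =
  sec :: "'m set \<Rightarrow> ('m \<Rightarrow> real, 's) module"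
  res :: "'m set \<Rightarrow> 'm set \<Rightarrow> 's \<Rightarrow> 's"

text \<open>The smooth functions, as a ring and as a module over itself.\<close>

definition smooth_functions :: "'m manifold \<Rightarrow> ('m, 'm \<Rightarrow> real) presheaf" where
  "smooth_functions M = \<lparr>
     sec = (\<lambda>U. \<lparr>carrier = {f \<in> extensional U. smooth_fun M U f},
       monoid.mult = (\<lambda>f g. \<lambda>x\<in>U. f x * g x), monoid.one = (\<lambda>x\<in>U. 1), ring.zero = (\<lambda>x\<in>U. 0),
       ring.add = (\<lambda>f g. \<lambda>x\<in>U. f x + g x), module.smult = (\<lambda>f g. \<lambda>x\<in>U. f x * g x)\<rparr>),
     res = (\<lambda>U V f. restrict f V)\<rparr>"

abbreviation smooth_ring :: "'m manifold \<Rightarrow> 'm set \<Rightarrow> ('m \<Rightarrow> real, 'm \<Rightarrow> real) module" where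
  "smooth_ring M U \<equiv> sec (smooth_functions M) U"

definition constants :: "'m set \<Rightarrow> ('m \<Rightarrow> real) set" where
  "constants U = range (\<lambda>c. \<lambda>x\<in>U. c)"

definition vanishing_ideal :: "'m manifold \<Rightarrow> 'm \<Rightarrow> 'm set \<Rightarrow> ('m \<Rightarrow> real) set" where
  "vanishing_ideal M a U = {f \<in> carrier (smooth_ring M U). f a = 0}"

text \<open>The germ at a of the section s over U: the class of all pairs which agree with it near a.\<close>

definition germ :: "'m manifold \<Rightarrow> ('m, 's) presheaf \<Rightarrow> 'm \<Rightarrow> 'm set \<Rightarrow> 's \<Rightarrow> ('m set \<times> 's) set" where
  "germ M F a U s = {(V, t). openin (mtop M) V \<and> a \<in> V \<and> t \<in> carrier (sec F V) \<and>
     (\<exists>W. openin (mtop M) W \<and> a \<in> W \<and> W \<subseteq> U \<inter> V \<and> res F U W s = res F V W t)}"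

text \<open>
  The operation on germs induced by binary operations on sections of F and G with values in sections
  of G. The union ranges over all representatives; all of them give the same germ.
\<close>

definition germ_op ::
  "'m manifold \<Rightarrow> ('m, 'r) presheaf \<Rightarrow> ('m, 's) presheaf \<Rightarrow> 'm \<Rightarrow> ('m set \<Rightarrow> 'r \<Rightarrow> 's \<Rightarrow> 's) \<Rightarrow>
   ('m set \<times> 'r) set \<Rightarrow> ('m set \<times> 's) set \<Rightarrow> ('m set \<times> 's) set" where
  "germ_op M F G a opr x y = (\<Union>(U, r)\<in>x. \<Union>(V, s)\<in>y.
     germ M G a (U \<inter> V) (opr (U \<inter> V) (res F U (U \<inter> V) r) (res G V (U \<inter> V) s)))"

text \<open>
  The stalk, a module over the stalk of \<open>smooth_functions M\<close> (which is a ring by the same definition).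
\<close>

definition stalk :: "'m manifold \<Rightarrow> ('m, 's) presheaf \<Rightarrow> 'm \<Rightarrow>
    (('m set \<times> ('m \<Rightarrow> real)) set, ('m set \<times> 's) set) module" where
  "stalk M F a = \<lparr>
     carrier = {germ M F a U s | U s. openin (mtop M) U \<and> a \<in> U \<and> s \<in> carrier (sec F U)},
     monoid.mult = germ_op M F F a (\<lambda>U. monoid.mult (sec F U)),
     monoid.one = germ M F a (points M) (monoid.one (sec F (points M))),
     ring.zero = germ M F a (points M) (ring.zero (sec F (points M))),
     ring.add = germ_op M F F a (\<lambda>U. ring.add (sec F U)),
     module.smult = germ_op M (smooth_functions M) F a (\<lambda>U. module.smult (sec F U))\<rparr>"

definition vanishing_germs :: "'m manifold \<Rightarrow> 'm \<Rightarrow> ('m set \<times> ('m \<Rightarrow> real)) set set" where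
  "vanishing_germs M a = {x \<in> carrier (stalk M (smooth_functions M) a). \<forall>(U, f)\<in>x. f a = 0}"

definition sheafify :: "'m manifold \<Rightarrow> ('m, 's) presheaf \<Rightarrow> ('m, 'm \<Rightarrow> ('m set \<times> 's) set) presheaf" where
  "sheafify M F = \<lparr>
     sec = (\<lambda>U. \<lparr>
       carrier = {s \<in> extensional U. \<forall>a\<in>U. \<exists>V t. openin (mtop M) V \<and> a \<in> V \<and> V \<subseteq> U \<and>
                    t \<in> carrier (sec F V) \<and> (\<forall>b\<in>V. s b = germ M F b V t)},
       monoid.mult = undefined, monoid.one = undefined,
       ring.zero = (\<lambda>a\<in>U. \<zero>\<^bsub>stalk M F a\<^esub>),
       ring.add = (\<lambda>s t. \<lambda>a\<in>U. s a \<oplus>\<^bsub>stalk M F a\<^esub> t a),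
       module.smult = (\<lambda>f s. \<lambda>a\<in>U. germ M (smooth_functions M) a U f \<odot>\<^bsub>stalk M F a\<^esub> s a)\<rparr>),
     res = (\<lambda>U V s. restrict s V)\<rparr>"

definition sheafify_unit :: "'m manifold \<Rightarrow> ('m, 's) presheaf \<Rightarrow> 'm set \<Rightarrow> 's \<Rightarrow> 'm \<Rightarrow> ('m set \<times> 's) set" where
  "sheafify_unit M F U s = (\<lambda>a\<in>U. germ M F a U s)"

text \<open>\<open>lin_comb F I U V \<Phi> f\<close> is the section \<open>\<Sum>i\<in>I. f i \<Phi> i\<close> over V, where \<open>\<Phi> i\<close> is a section over U.\<close>

definition lin_comb ::
  "('m, 's) presheaf \<Rightarrow> 'i set \<Rightarrow> 'm set \<Rightarrow> 'm set \<Rightarrow> ('i \<Rightarrow> 's) \<Rightarrow> ('i \<Rightarrow> 'm \<Rightarrow> real) \<Rightarrow> 's" where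
  "lin_comb F I U V \<Phi> f = (\<Oplus>\<^bsub>sec F V\<^esub>i\<in>I. f i \<odot>\<^bsub>sec F V\<^esub> res F U V (\<Phi> i))"

definition local_frame :: "'m manifold \<Rightarrow> ('m, 's) presheaf \<Rightarrow> 'i set \<Rightarrow> 'm set \<Rightarrow> ('i \<Rightarrow> 's) \<Rightarrow> bool" where
  "local_frame M F I U \<Phi> \<longleftrightarrow> openin (mtop M) U \<and> (\<forall>i\<in>I. \<Phi> i \<in> carrier (sec F U)) \<and>
     (\<forall>V. openin (mtop M) V \<and> V \<subseteq> U \<longrightarrow>
        (\<forall>s\<in>carrier (sec F V). \<exists>!f. f \<in> I \<rightarrow>\<^sub>E carrier (smooth_ring M V) \<and> s = lin_comb F I U V \<Phi> f))"

definition locally_free :: "'m manifold \<Rightarrow> ('m, 's) presheaf \<Rightarrow> nat \<Rightarrow> bool" where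
  "locally_free M F l \<longleftrightarrow> (\<forall>a\<in>points M. \<exists>U \<Phi>. a \<in> U \<and> local_frame M F {..<l} U \<Phi>)"

definition sheaf_rank :: "'m manifold \<Rightarrow> ('m, 's) presheaf \<Rightarrow> nat" where
  "sheaf_rank M F = (SOME l. locally_free M F l)"


section \<open>Vector bundles\<close>

text \<open>
  A smooth vector bundle is given by a bundle atlas: local trivializations which are linear
  isomorphisms on the fibres and have smooth transition matrices. This determines the topology and
  the smooth structure of the total space. A local trivialization \<open>(U, t)\<close> is the map
  \<open>u \<mapsto> (vproj E u, t u)\<close> on the part of the total space over U. Coordinates in the fibres are
  indexed by the finite set \<open>idx E\<close>, whose cardinality is the rank; \<open>t u\<close> is 0 outside \<open>idx E\<close>.
\<close>

record ('m, 'e, 'i) vbundle =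
  tot :: "'e set"
  vproj :: "'e \<Rightarrow> 'm"
  vzero :: "'m \<Rightarrow> 'e"
  vadd :: "'e \<Rightarrow> 'e \<Rightarrow> 'e"
  vscale :: "real \<Rightarrow> 'e \<Rightarrow> 'e"
  idx :: "'i set"
  trivs :: "('m set \<times> ('e \<Rightarrow> 'i \<Rightarrow> real)) set"

definition fibre :: "('m, 'e, 'i) vbundle \<Rightarrow> 'm \<Rightarrow> 'e set" where
  "fibre E a = {u \<in> tot E. vproj E u = a}"

text \<open>The point of the fibre over a whose coordinates form the j-th unit vector.\<close>

definition unit_point :: "('m, 'e, 'i) vbundle \<Rightarrow> ('e \<Rightarrow> 'i \<Rightarrow> real) \<Rightarrow> 'i \<Rightarrow> 'm \<Rightarrow> 'e" where
  "unit_point E t j a = inv_into (fibre E a) t (\<lambda>i. if i = j then 1 else 0)"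

text \<open>The vector space axioms for the fibres follow from the linear coordinates.\<close>

definition vector_bundle :: "'m manifold \<Rightarrow> ('m, 'e, 'i) vbundle \<Rightarrow> bool" where
  "vector_bundle M E \<longleftrightarrow>
     finite (idx E) \<and>
     (\<forall>u\<in>tot E. vproj E u \<in> points M) \<and>
     (\<forall>a\<in>points M. vzero E a \<in> fibre E a \<and>
        (\<forall>u\<in>fibre E a. \<forall>v\<in>fibre E a. vadd E u v \<in> fibre E a) \<and>
        (\<forall>c. \<forall>u\<in>fibre E a. vscale E c u \<in> fibre E a)) \<and>
     (\<Union>(U, t)\<in>trivs E. U) = points M \<and>
     (\<forall>(U, t)\<in>trivs E. openin (mtop M) U \<and> (\<forall>a\<in>U.
        bij_betw t (fibre E a) {x. \<forall>i. i \<notin> idx E \<longrightarrow> x i = 0} \<and>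
        t (vzero E a) = (\<lambda>i. 0) \<and>
        (\<forall>u\<in>fibre E a. \<forall>v\<in>fibre E a. t (vadd E u v) = (\<lambda>i. t u i + t v i)) \<and>
        (\<forall>c. \<forall>u\<in>fibre E a. t (vscale E c u) = (\<lambda>i. c * t u i)))) \<and>
     (\<forall>(U, t)\<in>trivs E. \<forall>(V, s)\<in>trivs E. \<forall>i\<in>idx E. \<forall>j\<in>idx E.
        smooth_fun M (U \<inter> V) (\<lambda>a. s (unit_point E t j a) i))"

text \<open>
  For a fibrewise linear map, smoothness between the total spaces means that the matrix with respect
  to local trivializations depends smoothly on the base point.
\<close>

definition vb_morphism ::
  "'m manifold \<Rightarrow> ('m, 'e, 'i) vbundle \<Rightarrow> ('m, 'd, 'j) vbundle \<Rightarrow> ('e \<Rightarrow> 'd) \<Rightarrow> bool" where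
  "vb_morphism M B C \<Psi> \<longleftrightarrow> vector_bundle M B \<and> vector_bundle M C \<and>
     (\<forall>a\<in>points M. \<forall>u\<in>fibre B a. \<Psi> u \<in> fibre C a \<and>
        (\<forall>v\<in>fibre B a. \<Psi> (vadd B u v) = vadd C (\<Psi> u) (\<Psi> v)) \<and>
        (\<forall>c. \<Psi> (vscale B c u) = vscale C c (\<Psi> u))) \<and>
     (\<forall>(U, t)\<in>trivs B. \<forall>(V, s)\<in>trivs C. \<forall>i\<in>idx C. \<forall>j\<in>idx B.
        smooth_fun M (U \<inter> V) (\<lambda>a. s (\<Psi> (unit_point B t j a)) i))"

definition vb_isomorphism ::
  "'m manifold \<Rightarrow> ('m, 'e, 'i) vbundle \<Rightarrow> ('m, 'd, 'j) vbundle \<Rightarrow> ('e \<Rightarrow> 'd) \<Rightarrow> bool" where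
  "vb_isomorphism M B C \<Psi> \<longleftrightarrow> vb_morphism M B C \<Psi> \<and> bij_betw \<Psi> (tot B) (tot C) \<and>
     vb_morphism M C B (inv_into (tot B) \<Psi>)"

definition smooth_sections :: "'m manifold \<Rightarrow> ('m, 'e, 'i) vbundle \<Rightarrow> ('m, 'm \<Rightarrow> 'e) presheaf" where
  "smooth_sections M E = \<lparr>
     sec = (\<lambda>U. \<lparr>
       carrier = {\<psi> \<in> extensional U. (\<forall>a\<in>U. \<psi> a \<in> fibre E a) \<and>
                    (\<forall>(V, t)\<in>trivs E. \<forall>i\<in>idx E. smooth_fun M (U \<inter> V) (\<lambda>a. t (\<psi> a) i))},
       monoid.mult = undefined, monoid.one = undefined,
       ring.zero = (\<lambda>a\<in>U. vzero E a),
       ring.add = (\<lambda>\<psi> \<eta>. \<lambda>a\<in>U. vadd E (\<psi> a) (\<eta> a)),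
       module.smult = (\<lambda>f \<psi>. \<lambda>a\<in>U. vscale E (f a) (\<psi> a))\<rparr>),
     res = (\<lambda>U V \<psi>. restrict \<psi> V)\<rparr>"

text \<open>
  The quotient of the stalk \<open>F\<^sub>a\<close> by \<open>J\<^sub>a\<^sup>q F\<^sub>a\<close>, where \<open>J\<^sub>a\<close> consists of the germs vanishing at a,
  and the class in it of a section. For q = k + 1 and the sections of E, these are the
  k-jets at a; for q = 1, the quotient is the fibre at a of the vector bundle of F.
\<close>

definition jet_space :: "'m manifold \<Rightarrow> ('m, 's) presheaf \<Rightarrow> nat \<Rightarrow> 'm \<Rightarrow>
    (('m set \<times> ('m \<Rightarrow> real)) set, ('m set \<times> 's) set set) module" where
  "jet_space M F q a =
     quot_mod (stalk M F a) (ideal_power_mod (stalk M F a) (vanishing_germs M a) q)"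

definition jet_class :: "'m manifold \<Rightarrow> ('m, 's) presheaf \<Rightarrow> nat \<Rightarrow> 'm \<Rightarrow> 'm set \<Rightarrow> 's \<Rightarrow> ('m set \<times> 's) set set" where
  "jet_class M F q a U s =
     ideal_power_mod (stalk M F a) (vanishing_germs M a) q +>\<^bsub>stalk M F a\<^esub> germ M F a U s"

definition disjoint_union_bundle ::
  "'m manifold \<Rightarrow> ('m \<Rightarrow> (('m set \<times> ('m \<Rightarrow> real)) set, 'd) module) \<Rightarrow> 'i set \<Rightarrow>
   ('m set \<times> ('m \<times> 'd \<Rightarrow> 'i \<Rightarrow> real)) set \<Rightarrow> ('m, 'm \<times> 'd, 'i) vbundle" where
  "disjoint_union_bundle M P I T = \<lparr>
     tot = (SIGMA a:points M. carrier (P a)),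
     vproj = fst,
     vzero = (\<lambda>a. (a, \<zero>\<^bsub>P a\<^esub>)),
     vadd = (\<lambda>(a, x) (b, y). (a, x \<oplus>\<^bsub>P a\<^esub> y)),
     vscale = (\<lambda>c (a, x). (a, germ M (smooth_functions M) a (points M) (\<lambda>b\<in>points M. c) \<odot>\<^bsub>P a\<^esub> x)),
     idx = I,
     trivs = T\<rparr>"

text \<open>
  The vector bundle of a locally free sheaf. The trivialization of a local frame reads off the
  coefficients of a representing section at the base point.
\<close>

definition sheaf_bundle :: "'m manifold \<Rightarrow> ('m, 's) presheaf \<Rightarrow> ('m, 'm \<times> ('m set \<times> 's) set set, nat) vbundle" where
  "sheaf_bundle M F = disjoint_union_bundle M (jet_space M F 1) {..<sheaf_rank M F}
     {(U, t). \<exists>\<Phi>. local_frame M F {..<sheaf_rank M F} U \<Phi> \<and>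
        (\<forall>V f. openin (mtop M) V \<and> V \<subseteq> U \<and> f \<in> {..<sheaf_rank M F} \<rightarrow>\<^sub>E carrier (smooth_ring M V) \<longrightarrow>
          (\<forall>a\<in>V. t (a, jet_class M F 1 a V (lin_comb F {..<sheaf_rank M F} U V \<Phi> f)) =
             (\<lambda>i. if i < sheaf_rank M F then f i a else 0)))}"


section \<open>The usual jet bundle\<close>

text \<open>
  The trivialization of a chart \<open>(U, \<phi>)\<close> and a local frame \<open>\<Phi>\<close> over U sends the jet at a of
  \<open>\<Sum>\<lambda>. f \<lambda> \<Phi> \<lambda>\<close> to the partial derivatives up to order k of the coefficients at a.
\<close>

definition usual_jet_bundle :: "'m manifold \<Rightarrow> ('m, 'e, 'i) vbundle \<Rightarrow> nat \<Rightarrow>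
    ('m, 'm \<times> ('m set \<times> ('m \<Rightarrow> 'e)) set set, 'i \<times> (nat \<Rightarrow> nat)) vbundle" where
  "usual_jet_bundle M E k = disjoint_union_bundle M (jet_space M (smooth_sections M E) (Suc k))
     (idx E \<times> multi_indices (mdim M) k)
     {(U, t). \<exists>\<phi> \<Phi>. (U, \<phi>) \<in> atlas M \<and> local_frame M (smooth_sections M E) (idx E) U \<Phi> \<and>
        (\<forall>V f. openin (mtop M) V \<and> V \<subseteq> U \<and> f \<in> idx E \<rightarrow>\<^sub>E carrier (smooth_ring M V) \<longrightarrow>
          (\<forall>a\<in>V. t (a, jet_class M (smooth_sections M E) (Suc k) a V
                         (lin_comb (smooth_sections M E) (idx E) U V \<Phi> f)) =
             (\<lambda>(l, I). if l \<in> idx E \<and> I \<in> multi_indices (mdim M) k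
                       then mpartial (mdim M) I (\<lambda>x. f l (inv_into U \<phi> x)) (\<phi> a) else 0)))}"


section \<open>The algebraic jet bundle\<close>

text \<open>The tensor product of functions and sections over the reals, with the two actions.\<close>

abbreviation X_left where
  "X_left M E U \<equiv> tensor_left (constants U) (smooth_ring M U) (sec (smooth_sections M E) U)"

abbreviation X_right where
  "X_right M E U \<equiv> tensor_right (constants U) (smooth_ring M U) (sec (smooth_sections M E) U)"

abbreviation X_pure where
  "X_pure M E U \<equiv> pure_tensor (constants U) (smooth_ring M U) (sec (smooth_sections M E) U)"

type_synonym ('m, 'e) tens = "(('m \<Rightarrow> real) \<times> ('m \<Rightarrow> 'e) \<Rightarrow>\<^sub>0 int) set"

definition delta :: "'m manifold \<Rightarrow> ('m, 'e, 'i) vbundle \<Rightarrow> 'm set \<Rightarrow> ('m \<Rightarrow> real) \<Rightarrow> ('m, 'e) tens \<Rightarrow> ('m, 'e) tens" where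
  "delta M E U f x = (f \<odot>\<^bsub>X_left M E U\<^esub> x) \<ominus>\<^bsub>X_left M E U\<^esub> (f \<odot>\<^bsub>X_right M E U\<^esub> x)"

primrec delta_products :: "'m manifold \<Rightarrow> ('m, 'e, 'i) vbundle \<Rightarrow> 'm set \<Rightarrow> nat \<Rightarrow> ('m, 'e) tens set" where
  "delta_products M E U 0 =
     {X_pure M E U g \<psi> | g \<psi>. g \<in> carrier (smooth_ring M U) \<and> \<psi> \<in> carrier (sec (smooth_sections M E) U)}"
| "delta_products M E U (Suc m) =
     {delta M E U f x | f x. f \<in> carrier (smooth_ring M U) \<and> x \<in> delta_products M E U m}"

text \<open>The real span is the additive subgroup generated by the real multiples.\<close>

definition V_sub :: "'m manifold \<Rightarrow> ('m, 'e, 'i) vbundle \<Rightarrow> nat \<Rightarrow> 'm set \<Rightarrow> ('m, 'e) tens set" where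
  "V_sub M E k U = generate (add_monoid (X_left M E U))
     {c \<odot>\<^bsub>X_left M E U\<^esub> x | c x. c \<in> constants U \<and> x \<in> delta_products M E U (Suc k)}"

definition pJet :: "'m manifold \<Rightarrow> ('m, 'e, 'i) vbundle \<Rightarrow> nat \<Rightarrow> 'm set \<Rightarrow> ('m \<Rightarrow> real, ('m, 'e) tens set) module" where
  "pJet M E k U = quot_mod (X_left M E U) (V_sub M E k U)"

definition bullet :: "'m manifold \<Rightarrow> 'm set \<Rightarrow> ('m \<Rightarrow> real, 'a) module \<Rightarrow> 'a set" where
  "bullet M U P = {x \<in> carrier P. \<forall>q. \<forall>a\<in>U. x \<in> ideal_power_mod P (vanishing_ideal M a U) q}"

definition gpJet :: "'m manifold \<Rightarrow> ('m, 'e, 'i) vbundle \<Rightarrow> nat \<Rightarrow> ('m, ('m, 'e) tens set set) presheaf" where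
  "gpJet M E k = \<lparr>
     sec = (\<lambda>U. quot_mod (pJet M E k U) (bullet M U (pJet M E k U))),
     res = (\<lambda>U V.
       quot_map (pJet M E k V) (bullet M V (pJet M E k V))
         (quot_map (X_left M E V) (V_sub M E k V)
           (quot_map (free_on_pairs (smooth_ring M V) (sec (smooth_sections M E) V) (\<lambda>_ p. p))
             (tensor_relations (constants V) (smooth_ring M V) (sec (smooth_sections M E) V))
             (frag_extend (\<lambda>(g, \<psi>). frag_of (restrict g V, restrict \<psi> V))))))\<rparr>"

definition Jet :: "'m manifold \<Rightarrow> ('m, 'e, 'i) vbundle \<Rightarrow> nat \<Rightarrow>
    ('m, 'm \<Rightarrow> ('m set \<times> ('m, 'e) tens set set) set) presheaf" where
  "Jet M E k = sheafify M (gpJet M E k)"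

definition algebraic_jet_bundle :: "'m manifold \<Rightarrow> ('m, 'e, 'i) vbundle \<Rightarrow> nat \<Rightarrow>
    ('m, 'm \<times> ('m set \<times> ('m \<Rightarrow> ('m set \<times> ('m, 'e) tens set set) set)) set set, nat) vbundle" where
  "algebraic_jet_bundle M E k = sheaf_bundle M (Jet M E k)"

text \<open>The section of Jet over U represented by \<open>1 \<otimes> \<psi>\<close>.\<close>

definition jet_prolongation :: "'m manifold \<Rightarrow> ('m, 'e, 'i) vbundle \<Rightarrow> nat \<Rightarrow> 'm set \<Rightarrow> ('m \<Rightarrow> 'e) \<Rightarrow>
    'm \<Rightarrow> ('m set \<times> ('m, 'e) tens set set) set" where
  "jet_prolongation M E k U \<psi> = sheafify_unit M (gpJet M E k) U
     (bullet M U (pJet M E k U) +>\<^bsub>pJet M E k U\<^esub>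
       (V_sub M E k U +>\<^bsub>X_left M E U\<^esub> X_pure M E U \<one>\<^bsub>smooth_ring M U\<^esub> \<psi>))"

text \<open>The isomorphism is canonical: it is compatible with the two ways of taking the jet of a section.\<close>

definition preserves_jets :: "'m manifold \<Rightarrow> ('m, 'e, 'i) vbundle \<Rightarrow> nat \<Rightarrow>
    ('m \<times> ('m set \<times> ('m \<Rightarrow> ('m set \<times> ('m, 'e) tens set set) set)) set set \<Rightarrow>
     'm \<times> ('m set \<times> ('m \<Rightarrow> 'e)) set set) \<Rightarrow> bool" where
  "preserves_jets M E k \<Psi> \<longleftrightarrow>
     (\<forall>U \<psi>. openin (mtop M) U \<and> \<psi> \<in> carrier (sec (smooth_sections M E) U) \<longrightarrow>
        (\<forall>a\<in>U. \<Psi> (a, jet_class M (Jet M E k) 1 a U (jet_prolongation M E k U \<psi>)) =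
               (a, jet_class M (smooth_sections M E) (Suc k) a U \<psi>)))"

end

theory Submission
  imports Defs
begin

text \<open>
  A formal combination of pairs of a function g and a section \<open>\<psi>\<close> is evaluated at a
  point b to the combination of the jets \<open>g(b) j\<^sup>k\<^sub>b \<psi>\<close>. Evaluation kills
  the tensor relations, the products of k + 1 of the operators \<open>\<delta>\<^sub>f\<close> (they
  produce (k+1)-fold products of functions vanishing at b) and everything divisible by functions
  vanishing at b. Conversely, over a coordinate cube with a frame, Hadamard's lemma shows that, modulo
  all powers of all the ideals of points, every combination is a combination over the functions of the
  finitely many elements \<open>\<delta>\<^sub>x\<^sup>I (1 \<otimes> \<Phi>\<^sub>l)\<close> with
  \<open>\<bar>I\<bar> \<le> k\<close>, whose coefficients are read off from its evaluations. So
  evaluation is an isomorphism from the sheaf of algebraic jets onto the sheaf of sections of the usual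
  jet bundle, and it takes the class of \<open>1 \<otimes> \<psi>\<close> to the jets of
  \<open>\<psi>\<close>. A sheaf isomorphic to the sections of a vector bundle is locally free, with
  that bundle as its bundle; and every point of it is the value of some \<open>1 \<otimes>
  \<psi>\<close>, whence the uniqueness.
\<close>

section \<open>Calculus on open subsets of Euclidean space\<close>

text \<open>Why the generators suffice: Hadamard's lemma writes a coefficient in the frame as its
  value at a point a plus terms with a factor that is a coordinate minus its value at a. This factor
  acts on the right side of the tensor product. Trading it for the action on the left gains one
  order of vanishing at a, at the price of one more operator \<delta>; and k + 1 of these operators
  give 0. So a finite induction on the missing operators sits inside an induction on the power of
  the ideal. Every power is reached, and the error lies in their intersection, which is divided out.

  Hadamard's lemma is used a second time, on the coefficients of a section: if their derivatives up
  to order k vanish at a, the section lies in the (k+1)-st power of the ideal. This makes the usual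
  trivializations injective on fibres.

  The other obstacle is the form of the objects: algebraic jets are cosets of cosets of cosets of
  formal combinations. Every layer is therefore described by the subgroup of formal combinations
  that it sends to zero, and the algebra happens in one free abelian group. Module laws of the
  sheafification are transported from the sections of the usual jet bundle.\<close>

lemma openin_Euclidean_iff:
  "openin (Euclidean_space n) W \<longleftrightarrow> (\<exists>T. open T \<and> W = T \<inter> {x. \<forall>i\<ge>n. x i = 0})"
  by (simp add: Euclidean_space_def openin_subtopology euclidean_product_topology)

lemma openin_Euclidean_Int_open:
  assumes "openin (Euclidean_space n) W" "open A" shows "openin (Euclidean_space n) (A \<inter> W)"
proof -
  obtain T where "open T" "W = T \<inter> {x. \<forall>i\<ge>n. x i = 0}"
    using assms(1) by (auto simp: openin_Euclidean_iff)
  hence "open (A \<inter> T)" "A \<inter> W = (A \<inter> T) \<inter> {x. \<forall>i\<ge>n. x i = 0}" using assms(2) by auto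
  thus ?thesis unfolding openin_Euclidean_iff by blast
qed

lemma openin_Euclidean_zero: "openin (Euclidean_space n) W ==> x \<in> W ==> n \<le> i ==> x i = 0"
  by (auto simp: openin_Euclidean_iff)

lemma continuous_on_fun_upd_line: "continuous_on S (\<lambda>t. (x::nat => real)(i := t))"
proof (rule continuous_on_coordinatewise_then_product)
  fix j show "continuous_on S (\<lambda>t. (x(i := t)) j)"
    by (cases "j = i") (auto intro: continuous_intros)
qed

lemma open_slice:
  assumes "openin (Euclidean_space n) W" "x \<in> W" "i < n"
  shows "open {t. x(i := t) \<in> W}"
proof -
  obtain T where T: "open T" "W = T \<inter> {x. \<forall>i\<ge>n. x i = 0}"
    using assms(1) by (auto simp: openin_Euclidean_iff)
  have "{t. x(i := t) \<in> W} = (\<lambda>t. x(i := t)) -` T"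
    using T assms by auto
  thus ?thesis
    using continuous_on_fun_upd_line[of UNIV x i] T(1) by (simp add: open_vimage)
qed

lemma eventually_slice:
  assumes "openin (Euclidean_space n) W" "x \<in> W" "i < n"
  shows "\<forall>\<^sub>F t in nhds (x i). x(i := t) \<in> W"
  using open_slice[OF assms] assms(2) by (auto simp: eventually_nhds fun_upd_triv)

text \<open>\<open>partial\<close> comes from the total operator \<open>deriv\<close> and so has a
  value even where no derivative exists; the relation also records differentiability along the
  line.\<close>

definition has_partial :: "nat => ((nat => real) => real) => real => (nat => real) => bool" where
  "has_partial i f d x \<longleftrightarrow> ((\<lambda>t. f (x(i := t))) has_real_derivative d) (at (x i))"

lemma has_partial_imp: "has_partial i f d x ==> partial i f x = d"
  by (simp add: has_partial_def partial_def DERIV_imp_deriv)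

lemma differentiable_iff_has_partial:
  "(\<lambda>t. f (x(i := t))) differentiable (at (x i)) \<longleftrightarrow> has_partial i f (partial i f x) x"
  by (simp add: has_partial_def partial_def DERIV_deriv_iff_real_differentiable)

lemma has_partial_cong:
  assumes "openin (Euclidean_space n) W" "x \<in> W" "i < n" "\<And>y. y \<in> W ==> f y = g y"
  shows "has_partial i f d x \<longleftrightarrow> has_partial i g d x"
  unfolding has_partial_def
  by (rule DERIV_cong_ev)
    (use eventually_slice[OF assms(1-3)] assms(4) in \<open>auto elim: eventually_mono\<close>)

lemma partial_cong:
  assumes "openin (Euclidean_space n) W" "x \<in> W" "i < n" "\<And>y. y \<in> W ==> f y = g y"
  shows "partial i f x = partial i g x"
  unfolding partial_def
  by (rule deriv_cong_ev)
    (use eventually_slice[OF assms(1-3)] assms(4) in \<open>auto elim: eventually_mono\<close>)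

lemma has_partial_const: "has_partial i (\<lambda>_. c) 0 x"
  by (simp add: has_partial_def)

lemma has_partial_coord: "has_partial i (\<lambda>x. x j) (if i = j then 1 else 0) x"
  by (auto simp: has_partial_def)

lemma has_partial_add:
  "has_partial i f d x ==> has_partial i g e x ==> has_partial i (\<lambda>x. f x + g x) (d + e) x"
  unfolding has_partial_def by (rule DERIV_add)

lemma has_partial_mult:
  "has_partial i f d x ==> has_partial i g e x ==> has_partial i (\<lambda>x. f x * g x) (d * g x + f x * e) x"
  unfolding has_partial_def by (drule (1) DERIV_mult) (simp add: mult.commute add.commute)

section \<open>Functions with continuous partial derivatives up to a given order\<close>

lemma cont_diff_Suc_iff:
  "cont_diff n (Suc p) W f \<longleftrightarrow> continuous_on W f \<and>
    (\<forall>i<n. (\<forall>x\<in>W. has_partial i f (partial i f x) x) \<and> cont_diff n p W (partial i f))"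
  by (simp add: differentiable_iff_has_partial)

declare cont_diff.simps(2)[simp del]

lemma cont_diff_cong:
  assumes W: "openin (Euclidean_space n) W" and "\<And>y. y \<in> W ==> f y = g y"
  shows "cont_diff n p W f \<longleftrightarrow> cont_diff n p W g"
  using assms(2)
proof (induction p arbitrary: f g)
  case 0
  thus ?case by (simp cong: continuous_on_cong)
next
  case (Suc p)
  have "continuous_on W f \<longleftrightarrow> continuous_on W g"
    using Suc.prems by (simp cong: continuous_on_cong)
  moreover have eq: "partial i f x = partial i g x" if "i < n" "x \<in> W" for i x
    using partial_cong[OF W that(2,1) Suc.prems] .
  moreover have "cont_diff n p W (partial i f) \<longleftrightarrow> cont_diff n p W (partial i g)" if "i < n" for i
    by (rule Suc.IH) (rule eq[OF that])
  moreover have "has_partial i f (partial i f x) x \<longleftrightarrow> has_partial i g (partial i g x) x"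
    if "i < n" "x \<in> W" for i x
    using has_partial_cong[OF W that(2,1) Suc.prems] eq[OF that] by simp
  ultimately show ?case by (auto simp: cont_diff_Suc_iff)
qed

lemma cont_diff_continuous: "cont_diff n p W f ==> continuous_on W f"
  by (cases p) (auto simp: cont_diff_Suc_iff)

text \<open>Derivatives are usually known through a formula valid on \<open>W\<close> only;
  congruence transfers the differentiability of the formula \<open>g i\<close> to
  \<open>partial i f\<close>.\<close>

lemma cont_diff_SucI:
  assumes W: "openin (Euclidean_space n) W" and "continuous_on W f"
    and d: "\<And>i x. i < n ==> x \<in> W ==> has_partial i f (g i x) x"
    and c: "\<And>i. i < n ==> cont_diff n p W (g i)"
  shows "cont_diff n (Suc p) W f"
proof -
  have eq: "partial i f x = g i x" if "i < n" "x \<in> W" for i x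
    using has_partial_imp[OF d[OF that]] .
  show ?thesis unfolding cont_diff_Suc_iff
    using assms(2) d c eq cont_diff_cong[OF W eq] by auto
qed

lemma cont_diff_SucD: "cont_diff n (Suc p) W f ==> cont_diff n p W f"
  by (induction p arbitrary: f) (auto simp: cont_diff_Suc_iff)

lemma cont_diff_subset:
  assumes "cont_diff n p W f" "W' \<subseteq> W"
  shows "cont_diff n p W' f"
  using assms(1)
  by (induction p arbitrary: f)
    (use assms(2) in \<open>auto simp: cont_diff_Suc_iff intro: continuous_on_subset\<close>)

text \<open>\<open>W\<close> is open in the subspace of sequences vanishing from \<open>n\<close>
  on, not in the whole type, so limits are taken within \<open>W\<close>. An open set
  \<open>T\<close> of the whole type that cuts out \<open>V\<close> shows that the filters within
  \<open>V\<close> and within \<open>W\<close> agree at \<open>x\<close>.\<close>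

lemma continuous_on_local_Euclidean:
  assumes W: "openin (Euclidean_space n) W"
    and *: "\<And>x. x \<in> W ==> \<exists>V. openin (Euclidean_space n) V \<and> x \<in> V \<and> V \<subseteq> W \<and> continuous_on V f"
  shows "continuous_on W f"
  unfolding continuous_on_def
proof
  fix x assume x: "x \<in> W"
  obtain V where V: "openin (Euclidean_space n) V" "x \<in> V" "V \<subseteq> W" "continuous_on V f"
    using *[OF x] by blast
  obtain T where T: "open T" "V = T \<inter> {x. \<forall>i\<ge>n. x i = 0}"
    using V(1) by (auto simp: openin_Euclidean_iff)
  have "V \<inter> T - {x} = W \<inter> T - {x}"
    using T W V(3) by (auto simp: openin_Euclidean_iff)
  hence "at x within V = at x within W"
    using T V(2) by (intro at_within_nhd[of x T]) auto
  thus "(f \<longlongrightarrow> f x) (at x within W)"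
    using V by (auto simp: continuous_on_def)
qed

lemma cont_diff_local:
  assumes W: "openin (Euclidean_space n) W"
    and "\<And>x. x \<in> W ==> \<exists>V. openin (Euclidean_space n) V \<and> x \<in> V \<and> V \<subseteq> W \<and> cont_diff n p V f"
  shows "cont_diff n p W f"
  using assms(2)
proof (induction p arbitrary: f)
  case 0
  thus ?case unfolding cont_diff.simps(1) by (intro continuous_on_local_Euclidean[OF W]) simp
next
  case (Suc p)
  show ?case unfolding cont_diff_Suc_iff
  proof (intro conjI allI impI ballI)
    show "continuous_on W f"
      using continuous_on_local_Euclidean[OF W] Suc.prems cont_diff_continuous by metis
    show "has_partial i f (partial i f x) x" if "i < n" "x \<in> W" for i x
      using Suc.prems[OF that(2)] that(1) by (auto simp: cont_diff_Suc_iff)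
    show "cont_diff n p W (partial i f)" if "i < n" for i
      using Suc.prems that by (intro Suc.IH) (metis cont_diff_Suc_iff)
  qed
qed

lemma cont_diff_const:
  assumes W: "openin (Euclidean_space n) W" shows "cont_diff n p W (\<lambda>_. c)"
proof (induction p arbitrary: c)
  case (Suc p)
  thus ?case by (intro cont_diff_SucI[OF W _ has_partial_const]) auto
qed simp

lemma continuous_on_coord: "continuous_on S (\<lambda>x. x j :: real)"
  by (rule continuous_on_subset[OF continuous_on_product_coordinates]) simp

lemma cont_diff_coord:
  assumes W: "openin (Euclidean_space n) W" shows "cont_diff n p W (\<lambda>x. x j)"
proof (cases p)
  case (Suc q)
  thus ?thesis
    by (auto intro!: cont_diff_SucI[OF W _ has_partial_coord] cont_diff_const[OF W]
      continuous_on_coord)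
qed (simp add: continuous_on_coord)

lemma cont_diff_add:
  assumes W: "openin (Euclidean_space n) W"
  shows "cont_diff n p W f ==> cont_diff n p W g ==> cont_diff n p W (\<lambda>x. f x + g x)"
proof (induction p arbitrary: f g)
  case (Suc p)
  thus ?case
    by (intro cont_diff_SucI[OF W, where g = "\<lambda>i x. partial i f x + partial i g x"])
      (auto simp: cont_diff_Suc_iff intro!: continuous_on_add has_partial_add)
qed (auto intro: continuous_intros)

lemma cont_diff_mult:
  assumes W: "openin (Euclidean_space n) W"
  shows "cont_diff n p W f ==> cont_diff n p W g ==> cont_diff n p W (\<lambda>x. f x * g x)"
proof (induction p arbitrary: f g)
  case (Suc p)
  show ?case
  proof (rule cont_diff_SucI[OF W, where g = "\<lambda>i x. partial i f x * g x + f x * partial i g x"])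
    show "continuous_on W (\<lambda>x. f x * g x)"
      using Suc.prems by (auto simp: cont_diff_Suc_iff intro!: continuous_on_mult)
    show "has_partial i (\<lambda>x. f x * g x) (partial i f x * g x + f x * partial i g x) x"
      if "i < n" "x \<in> W" for i x
      using Suc.prems that by (auto simp: cont_diff_Suc_iff intro!: has_partial_mult)
    show "cont_diff n p W (\<lambda>x. partial i f x * g x + f x * partial i g x)" if "i < n" for i
      using Suc.prems that Suc.prems[THEN cont_diff_SucD]
      by (intro cont_diff_add[OF W] Suc.IH) (auto simp: cont_diff_Suc_iff)
  qed
qed (auto intro: continuous_intros)

lemma cont_diff_sum:
  assumes W: "openin (Euclidean_space n) W"
  shows "(\<And>i. i \<in> I ==> cont_diff n p W (f i)) ==> cont_diff n p W (\<lambda>x. \<Sum>i\<in>I. f i x)"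
  by (induction I rule: infinite_finite_induct) (auto intro: cont_diff_const[OF W] cont_diff_add[OF W])

lemma smooth_Rn_continuous: "smooth_Rn n W f ==> continuous_on W f"
  unfolding smooth_Rn_def by (metis cont_diff.simps(1))

lemma smooth_Rn_has_partial:
  "smooth_Rn n W f ==> i < n ==> x \<in> W ==> has_partial i f (partial i f x) x"
  unfolding smooth_Rn_def by (metis cont_diff_Suc_iff)

lemma smooth_Rn_partial: "smooth_Rn n W f ==> i < n ==> smooth_Rn n W (partial i f)"
  unfolding smooth_Rn_def by (metis cont_diff_Suc_iff)

lemma smooth_Rn_subset: "smooth_Rn n W f ==> W' \<subseteq> W ==> smooth_Rn n W' f"
  unfolding smooth_Rn_def by (metis cont_diff_subset)

lemma smooth_Rn_cong:
  "openin (Euclidean_space n) W ==> (\<And>y. y \<in> W ==> f y = g y) ==> smooth_Rn n W f \<longleftrightarrow> smooth_Rn n W g"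
  unfolding smooth_Rn_def using cont_diff_cong[of n W f g] by simp

lemma smooth_Rn_local:
  assumes "openin (Euclidean_space n) W"
    and "\<And>x. x \<in> W ==> \<exists>V. openin (Euclidean_space n) V \<and> x \<in> V \<and> V \<subseteq> W \<and> smooth_Rn n V f"
  shows "smooth_Rn n W f"
  unfolding smooth_Rn_def
  by (intro allI cont_diff_local[OF assms(1)]) (use assms(2) in \<open>metis smooth_Rn_def\<close>)

context
  fixes n W assumes W: "openin (Euclidean_space n) W"
begin

lemma smooth_Rn_const: "smooth_Rn n W (\<lambda>_. c)"
  and smooth_Rn_coord: "smooth_Rn n W (\<lambda>x. x j)"
  and smooth_Rn_add: "smooth_Rn n W f ==> smooth_Rn n W g ==> smooth_Rn n W (\<lambda>x. f x + g x)"
  and smooth_Rn_mult: "smooth_Rn n W f ==> smooth_Rn n W g ==> smooth_Rn n W (\<lambda>x. f x * g x)"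
  using cont_diff_const[OF W] cont_diff_coord[OF W] cont_diff_add[OF W] cont_diff_mult[OF W]
  by (simp_all add: smooth_Rn_def)

lemma smooth_Rn_sum: "(\<And>i. i \<in> I ==> smooth_Rn n W (h i)) ==> smooth_Rn n W (\<lambda>x. \<Sum>i\<in>I. h i x)"
  unfolding smooth_Rn_def by (intro allI cont_diff_sum[OF W]) auto

lemma smooth_Rn_funpow_partial: "smooth_Rn n W f ==> i < n ==> smooth_Rn n W ((partial i ^^ j) f)"
  by (induction j) (auto intro: smooth_Rn_partial)

lemma smooth_Rn_mpartial: "smooth_Rn n W f ==> m \<le> n ==> smooth_Rn n W (mpartial m I f)"
  by (induction m) (auto intro: smooth_Rn_funpow_partial)

end

section \<open>Hadamard's lemma\<close>

text \<open>Cubes rather than balls: replacing some coordinates of a point by those of another point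
  of the cube never leaves the cube.\<close>

definition cube :: "nat => (nat => real) => real => (nat => real) set" where
  "cube n c r = {x. (\<forall>i<n. \<bar>x i - c i\<bar> < r) \<and> (\<forall>i\<ge>n. x i = 0)}"

lemma openin_cube: "openin (Euclidean_space n) (cube n c r)"
proof -
  have "open (\<Inter>i\<in>{..<n}. {x. \<bar>x i - c i\<bar> < r})"
    by (intro open_INT ballI open_Collect_less continuous_intros continuous_on_product_coordinates) auto
  moreover have "cube n c r = (\<Inter>i\<in>{..<n}. {x. \<bar>x i - c i\<bar> < r}) \<inter> {x. \<forall>i\<ge>n. x i = 0}"
    by (auto simp: cube_def)
  ultimately show ?thesis unfolding openin_Euclidean_iff by blast
qed

lemma cube_subset_open:
  assumes W: "openin (Euclidean_space n) W" and x: "x \<in> W"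
  obtains r where "r > 0" "cube n x r \<subseteq> W"
proof -
  obtain T where T: "open T" "W = T \<inter> {x. \<forall>i\<ge>n. x i = 0}"
    using W by (auto simp: openin_Euclidean_iff)
  have "openin (product_topology (\<lambda>i. euclidean) UNIV) T"
    using T(1) by (simp add: open_fun_def)
  moreover have "x \<in> T" using x T(2) by simp
  ultimately have "\<exists>X. finite {i \<in> UNIV. X i \<noteq> topspace euclidean} \<and> (\<forall>i\<in>UNIV. openin euclidean (X i)) \<and>
      x \<in> Pi\<^sub>E UNIV X \<and> Pi\<^sub>E UNIV X \<subseteq> T"
    using openin_product_topology_alt[THEN iffD1, THEN bspec] by blast
  then obtain X where X: "\<And>i. open (X i)" "x \<in> Pi\<^sub>E UNIV X" "Pi\<^sub>E UNIV X \<subseteq> T"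
    by (auto simp: Ball_def)
  have "\<exists>r>0. \<forall>y. \<bar>y - x i\<bar> < r --> y \<in> X i" for i
    using X(1)[of i] X(2) by (auto simp: open_dist dist_real_def PiE_iff)
  then obtain r where r: "\<And>i. r i > 0" "\<And>i y. \<bar>y - x i\<bar> < r i ==> y \<in> X i" by metis
  \<comment> \<open>The extra 1 keeps \<open>Min\<close> meaningful when \<open>n\<close> is
    0.\<close>
  define s where "s = Min (insert 1 (r ` {..<n}))"
  have "s > 0" using r(1) by (auto simp: s_def)
  moreover have "s \<le> r i" if "i < n" for i using that by (auto simp: s_def)
  hence "y \<in> T" if "y \<in> cube n x s" for y
  proof -
    have "y i \<in> X i" for i
    proof (cases "i < n")
      case True
      thus ?thesis using that \<open>\<And>i. i < n ==> s \<le> r i\<close>[of i] by (intro r(2)) (auto simp: cube_def)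
    next
      case False
      hence "y i = x i" using that x T(2) by (auto simp: cube_def)
      thus ?thesis using X(2) by auto
    qed
    thus ?thesis using X(3) by auto
  qed
  hence "cube n x s \<subseteq> W" using T(2) by (auto simp: cube_def)
  ultimately show thesis using that by blast
qed

text \<open>The i-th of \<open>n\<close> axis-parallel segments that lead from \<open>x\<close> to
  \<open>a\<close>: the coordinates before \<open>i\<close> are already those of \<open>a\<close>,
  the ones after \<open>i\<close> still those of \<open>x\<close>, and \<open>t\<close> runs back
  from 1 to 0.\<close>

definition hybrid :: "(nat => real) => nat => real => (nat => real) => nat => real" where
  "hybrid a i t x = (\<lambda>j. if j < i then a j else if j = i then a j + t * (x j - a j) else x j)"

lemma hybrid_in_cube:
  assumes "x \<in> cube n c r" "a \<in> cube n c r" "0 \<le> t" "t \<le> 1"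
  shows "hybrid a i t x \<in> cube n c r"
proof -
  have "\<bar>a j + t * (x j - a j) - c j\<bar> < r" if "j < n" for j
  proof -
    have 1: "\<bar>a j - c j\<bar> < r" "\<bar>x j - c j\<bar> < r" using assms that by (auto simp: cube_def)
    have "\<bar>a j + t * (x j - a j) - c j\<bar> = \<bar>(1 - t) * (a j - c j) + t * (x j - c j)\<bar>"
      by (simp add: algebra_simps)
    also have "\<dots> \<le> (1 - t) * \<bar>a j - c j\<bar> + t * \<bar>x j - c j\<bar>"
      using assms(3,4) abs_triangle_ineq[of "(1 - t) * (a j - c j)" "t * (x j - c j)"]
      by (simp add: abs_mult)
    also have "\<dots> < r"
      by (rule convex_bound_lt) (use 1 assms in auto)
    finally show ?thesis .
  qed
  thus ?thesis using assms by (auto simp: cube_def hybrid_def)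
qed

text \<open>The integral of \<open>F\<close> along a segment. The weight \<open>t ^ m\<close> makes
  the family closed under differentiation, because the chain rule in coordinate \<open>i\<close>
  produces a factor \<open>t\<close>. Hadamard's quotients themselves have
  \<open>m = 0\<close>.\<close>

definition hadamard :: "(nat => real) => nat => nat => ((nat => real) => real) => (nat => real) => real" where
  "hadamard a i m F x = integral (cbox 0 1) (\<lambda>t. t ^ m * F (hybrid a i t x))"

context
  fixes n c r a
  assumes a: "a \<in> cube n c r"
begin

text \<open>Continuity in the point and in \<open>t\<close> jointly is what continuity of the
  integral in its parameter and differentiation under the integral require.\<close>

lemma continuous_on_hybrid:
  assumes F: "continuous_on (cube n c r) F"
  shows "continuous_on (cube n c r \<times> cbox 0 1) (\<lambda>(x, t). t ^ m * F (hybrid a i t x))"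
proof -
  have "continuous_on (cube n c r \<times> cbox 0 1) (\<lambda>z. hybrid a i (snd z) (fst z))"
  proof (rule continuous_on_coordinatewise_then_product)
    fix j
    have "continuous_on (cube n c r \<times> cbox 0 1) (\<lambda>z. fst z j :: real)"
      by (rule continuous_on_compose2[OF continuous_on_coord[of UNIV j] continuous_on_fst])
        (auto intro: continuous_on_id)
    thus "continuous_on (cube n c r \<times> cbox 0 1) (\<lambda>z. hybrid a i (snd z) (fst z) j)"
      unfolding hybrid_def
      by (cases "j < i"; cases "j = i") (auto simp del: cbox_interval box_real intro!: continuous_intros)
  qed
  hence "continuous_on (cube n c r \<times> cbox 0 1) (\<lambda>z. F (hybrid a i (snd z) (fst z)))"
    by (rule continuous_on_compose2[OF F]) (auto intro: hybrid_in_cube a)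
  thus ?thesis
    by (auto simp: case_prod_unfold intro!: continuous_intros)
qed

lemma has_partial_hybrid:
  assumes F: "\<And>y. y \<in> cube n c r ==> j < n ==> has_partial j F (partial j F y) y"
    and "y \<in> cube n c r" "0 \<le> t" "t \<le> 1" "j < n"
  shows "has_partial j (\<lambda>x. t ^ m * F (hybrid a i t x))
    ((if j < i then 0 else if j = i then t ^ Suc m else t ^ m) * partial j F (hybrid a i t y)) y"
proof -
  consider "j < i" | "j = i" | "j > i" by linarith
  thus ?thesis
  proof cases
    case 1
    hence "hybrid a i t (y(j := s)) = hybrid a i t y" for s by (auto simp: hybrid_def)
    thus ?thesis using 1 by (simp add: has_partial_def)
  next
    case 2
    let ?h = "hybrid a i t y"
    have eq: "hybrid a i t (y(j := s)) = ?h(j := a j + t * (s - a j))" for s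
      using 2 by (auto simp: hybrid_def)
    have h: "?h j = a j + t * (y j - a j)" using 2 by (simp add: hybrid_def)
    have "((\<lambda>u. F (?h(j := u))) has_real_derivative partial j F ?h) (at (a j + t * (y j - a j)))"
      using F[OF hybrid_in_cube[OF assms(2) a assms(3,4), of i] assms(5)] unfolding has_partial_def h .
    moreover have "((\<lambda>s. a j + t * (s - a j)) has_real_derivative t) (at (y j))"
      by (auto intro!: derivative_eq_intros)
    ultimately have "((\<lambda>s. F (?h(j := a j + t * (s - a j)))) has_real_derivative partial j F ?h * t) (at (y j))"
      by (rule DERIV_chain2)
    from DERIV_cmult[OF this, of "t ^ m"] show ?thesis using 2
      unfolding has_partial_def eq by (simp add: mult_ac)
  next
    case 3
    let ?h = "hybrid a i t y"
    have eq: "hybrid a i t (y(j := s)) = ?h(j := s)" for s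
      using 3 by (auto simp: hybrid_def)
    have h: "?h j = y j" using 3 by (simp add: hybrid_def)
    have "((\<lambda>u. F (?h(j := u))) has_real_derivative partial j F ?h) (at (y j))"
      using F[OF hybrid_in_cube[OF assms(2) a assms(3,4), of i] assms(5)] unfolding has_partial_def h .
    from DERIV_cmult[OF this, of "t ^ m"] show ?thesis using 3
      unfolding has_partial_def eq by simp
  qed
qed

text \<open>Induction on \<open>p\<close> for all weights at once: by Leibniz's rule the derivative
  in coordinate \<open>j\<close> is 0 if \<open>j < i\<close>, the integral of
  \<open>partial j F\<close> with weight \<open>Suc m\<close> if \<open>j = i\<close>, and with
  weight \<open>m\<close> if \<open>j > i\<close>.\<close>

lemma cont_diff_hadamard: "cont_diff n p (cube n c r) F ==> cont_diff n p (cube n c r) (hadamard a i m F)"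
proof (induction p arbitrary: m F)
  case 0
  thus ?case
    unfolding hadamard_def cont_diff.simps
    by (intro integral_continuous_on_param continuous_on_hybrid) simp
next
  case (Suc p)
  let ?Q = "cube n c r"
  let ?k = "\<lambda>j. if j = i then Suc m else m"
  let ?g = "\<lambda>j x. if j < i then 0 else hadamard a i (?k j) (partial j F) x"
  have contF: "continuous_on ?Q F" "\<And>j. j < n ==> continuous_on ?Q (partial j F)"
    and part: "\<And>y j. y \<in> ?Q ==> j < n ==> has_partial j F (partial j F y) y"
    using Suc.prems by (auto simp: cont_diff_Suc_iff intro: cont_diff_continuous)
  show ?case
  proof (rule cont_diff_SucI[OF openin_cube, where g = ?g])
    show "continuous_on ?Q (hadamard a i m F)"
      unfolding hadamard_def by (intro integral_continuous_on_param continuous_on_hybrid contF)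
    show "cont_diff n p ?Q (?g j)" if "j < n" for j
      using Suc that by (cases "j < i") (auto simp: cont_diff_Suc_iff cont_diff_const[OF openin_cube])
    fix j x assume j: "j < n" and x: "x \<in> ?Q"
    \<comment> \<open>Leibniz's rule is applied in one real variable, on an interval along which the
      line through \<open>x\<close> stays in the cube.\<close>
    obtain e where e: "e > 0" "\<And>s. s \<in> ball (x j) e ==> x(j := s) \<in> ?Q"
      using open_slice[OF openin_cube x j, unfolded open_contains_ball, rule_format, of "x j"] x
      by (auto simp: subset_iff)
    define U where "U = ball (x j) e"
    let ?f = "\<lambda>s t. t ^ m * F (hybrid a i t (x(j := s)))"
    let ?fx = "\<lambda>s t. (if j < i then 0 else t ^ ?k j) * partial j F (hybrid a i t (x(j := s)))"
    have line: "continuous_on (U \<times> cbox 0 1) (\<lambda>z. (x(j := fst z), snd z :: real))"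
      by (intro continuous_on_Pair continuous_on_snd continuous_on_id
          continuous_on_compose2[OF continuous_on_fun_upd_line[of UNIV] continuous_on_fst]) auto
    have 1: "((\<lambda>s. ?f s t) has_field_derivative ?fx s t) (at s within U)"
      if "s \<in> U" "t \<in> cbox 0 1" for s t
      using has_partial_hybrid[OF part, of j "x(j := s)" t m i] that j e(2)[of s]
      by (auto simp: has_partial_def U_def intro: has_field_derivative_at_within split: if_splits)
    have 2: "?f s integrable_on cbox 0 1" if "s \<in> U" for s
    proof (rule integrable_continuous)
      have "continuous_on (cbox 0 1) (\<lambda>t. case (x(j := s), t) of (y, t) => t ^ m * F (hybrid a i t y))"
        by (rule continuous_on_compose2[OF continuous_on_hybrid[OF contF(1)]])
          (use e(2)[of s] that in \<open>auto simp: U_def intro!: continuous_intros\<close>)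
      thus "continuous_on (cbox 0 1) (?f s)" by (simp only: prod.case)
    qed
    have 3: "continuous_on (U \<times> cbox 0 1) (\<lambda>(s, t). ?fx s t)"
    proof (cases "j < i")
      case False
      have "continuous_on (U \<times> cbox 0 1)
        (\<lambda>z. case (x(j := fst z), snd z) of (y, t) => t ^ ?k j * partial j F (hybrid a i t y))"
        by (rule continuous_on_compose2[OF continuous_on_hybrid[OF contF(2)[OF j], of "?k j" i] line])
          (use e(2) in \<open>auto simp: U_def\<close>)
      thus ?thesis using False by (simp add: case_prod_unfold)
    qed simp
    have U: "at (x j) within U = at (x j)"
      by (rule at_within_open) (use e(1) in \<open>auto simp: U_def\<close>)
    have "((\<lambda>s. integral (cbox 0 1) (?f s)) has_field_derivative integral (cbox 0 1) (?fx (x j))) (at (x j) within U)"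
      by (rule leibniz_rule_field_derivative[OF 1 2 3]) (use e(1) in \<open>auto simp: U_def\<close>)
    hence "((\<lambda>s. integral (cbox 0 1) (?f s)) has_field_derivative integral (cbox 0 1) (?fx (x j))) (at (x j))"
      unfolding U .
    thus "has_partial j (hadamard a i m F) (?g j x) x"
      unfolding has_partial_def hadamard_def by (cases "j < i") auto
  qed
qed

text \<open>The fundamental theorem of calculus on each segment of the broken line from
  \<open>x\<close> to \<open>a\<close>; along a segment only one coordinate moves, so only one
  partial derivative enters.\<close>

lemma hadamard_sum:
  assumes f: "smooth_Rn n (cube n c r) f" and x: "x \<in> cube n c r"
  shows "f x = f a + (\<Sum>i<n. (x i - a i) * hadamard a i 0 (partial i f) x)"
proof -
  have step: "f (hybrid a i 1 x) - f (hybrid a i 0 x) = (x i - a i) * hadamard a i 0 (partial i f) x"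
    if i: "i < n" for i
  proof -
    let ?h = "\<lambda>t. hybrid a i t x"
    have "((\<lambda>t. (x i - a i) * partial i f (?h t)) has_integral f (?h 1) - f (?h 0)) {0..1}"
    proof (rule fundamental_theorem_of_calculus)
      fix t :: real assume t: "t \<in> {0..1}"
      have eq: "?h s = (?h t)(i := a i + s * (x i - a i))" for s by (auto simp: hybrid_def)
      have "((\<lambda>u. f ((?h t)(i := u))) has_real_derivative partial i f (?h t)) (at (a i + t * (x i - a i)))"
        using smooth_Rn_has_partial[OF f i hybrid_in_cube[OF x a, of t i]] t
        by (simp add: has_partial_def hybrid_def[of a i t x])
      moreover have "((\<lambda>s. a i + s * (x i - a i)) has_real_derivative (x i - a i)) (at t)"
        by (auto intro!: derivative_eq_intros)
      ultimately have "((\<lambda>s. f ((?h t)(i := a i + s * (x i - a i)))) has_real_derivative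
          partial i f (?h t) * (x i - a i)) (at t)"
        by (rule DERIV_chain2)
      hence "((\<lambda>s. f (?h s)) has_real_derivative (x i - a i) * partial i f (?h t)) (at t)"
        by (simp only: eq[symmetric] mult.commute)
      thus "((\<lambda>s. f (?h s)) has_vector_derivative (x i - a i) * partial i f (?h t)) (at t within {0..1})"
        by (simp add: has_real_derivative_iff_has_vector_derivative has_vector_derivative_at_within)
    qed simp
    hence "integral {0..1} (\<lambda>t. (x i - a i) * partial i f (?h t)) = f (?h 1) - f (?h 0)"
      by (rule integral_unique)
    thus ?thesis by (simp add: hadamard_def cbox_interval)
  qed
  \<comment> \<open>The end of segment \<open>i\<close> is the start of segment
    \<open>Suc i\<close>, so the sum telescopes.\<close>
  have tele: "hybrid a i 0 x = hybrid a (Suc i) 1 x" for i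
    by (auto simp: hybrid_def less_Suc_eq)
  have "(\<Sum>i<n. (x i - a i) * hadamard a i 0 (partial i f) x)
    = (\<Sum>i<n. f (hybrid a i 1 x) - f (hybrid a (Suc i) 1 x))"
    by (rule sum.cong) (auto simp: step[symmetric] tele)
  also have "\<dots> = f (hybrid a 0 1 x) - f (hybrid a n 1 x)"
    by (rule sum_lessThan_telescope')
  also have "hybrid a 0 1 x = x" by (auto simp: hybrid_def)
  also have "hybrid a n 1 x = a"
    using x a by (auto simp: hybrid_def cube_def fun_eq_iff)
  finally show ?thesis by simp
qed

lemma hadamard_center: "hadamard a i 0 F a = F a"
proof -
  have "hybrid a i t a = a" for t by (auto simp: hybrid_def)
  thus ?thesis by (simp add: hadamard_def)
qed

end

lemma smooth_Rn_hadamard: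
  "a \<in> cube n c r ==> smooth_Rn n (cube n c r) F ==> smooth_Rn n (cube n c r) (hadamard a i m F)"
  by (simp add: smooth_Rn_def cont_diff_hadamard)

section \<open>The chain rule\<close>

text \<open>Caratheodory's form of the derivative: at a zero of \<open>u\<close>, continuity of
  \<open>v\<close> is enough for the product rule. In the chain rule below \<open>v\<close> is a
  Hadamard quotient along a curve, of which only continuity is at hand.\<close>

lemma has_derivative_vanishing_mult:
  fixes u v :: "real => real"
  assumes u: "(u has_real_derivative u') (at t0)" and u0: "u t0 = 0" and v: "isCont v t0"
  shows "((\<lambda>t. u t * v t) has_real_derivative u' * v t0) (at t0)"
proof -
  obtain w where w: "\<forall>z. u z - u t0 = w z * (z - t0)" "isCont w t0" "w t0 = u'"
    using u by (auto simp: CARAT_DERIV)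
  hence "u z = w z * (z - t0)" for z using u0 by simp
  thus ?thesis unfolding CARAT_DERIV
    using w(2,3) u0 v by (intro exI[of _ "\<lambda>t. w t * v t"]) (auto intro: continuous_intros)
qed

lemma eventually_cube:
  assumes c: "\<And>j. j < n ==> isCont (\<lambda>t. c t j) t0" and near: "\<forall>\<^sub>F t in nhds t0. \<forall>i\<ge>n. c t i = 0"
    and r: "r > 0"
  shows "\<forall>\<^sub>F t in nhds (t0::real). c t \<in> cube n (c t0) r"
proof -
  have "\<forall>\<^sub>F t in nhds t0. \<forall>j\<in>{..<n}. \<bar>c t j - c t0 j\<bar> < r"
  proof (rule eventually_ball_finite)
    show "\<forall>j\<in>{..<n}. \<forall>\<^sub>F t in nhds t0. \<bar>c t j - c t0 j\<bar> < r"
      using c r by (auto simp: tendsto_iff dist_real_def eventually_nhds_conv_at isCont_def)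
  qed simp
  thus ?thesis using near by eventually_elim (auto simp: cube_def)
qed

text \<open>Hadamard's lemma at \<open>c t0\<close> takes the place of a total derivative: it writes
  \<open>f (c t)\<close> as a constant plus products in which one factor,
  \<open>c t j - c t0 j\<close>, vanishes at \<open>t0\<close> and the other is continuous with
  value \<open>partial j f (c t0)\<close>.\<close>

lemma partial_chain:
  assumes W: "openin (Euclidean_space n) W" and f: "smooth_Rn n W f"
    and c: "\<And>j. j < n ==> ((\<lambda>t. c t j) has_real_derivative c' j) (at t0)"
    and near: "\<forall>\<^sub>F t in nhds t0. c t \<in> W"
  shows "((\<lambda>t. f (c t)) has_real_derivative (\<Sum>j<n. c' j * partial j f (c t0))) (at t0)"
proof -
  let ?a = "c t0"
  have aW: "?a \<in> W" using near by (auto simp: eventually_nhds)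
  obtain r where r: "r > 0" "cube n ?a r \<subseteq> W" using cube_subset_open[OF W aW] .
  let ?Q = "cube n ?a r"
  have aQ: "?a \<in> ?Q" using r(1) openin_Euclidean_zero[OF W aW] by (auto simp: cube_def)
  have cont: "isCont (\<lambda>t. c t j) t0" if "j < n" for j using c[OF that] DERIV_isCont by blast
  have nearE: "\<forall>\<^sub>F t in nhds t0. \<forall>i\<ge>n. c t i = 0"
    using near by eventually_elim (use openin_Euclidean_zero[OF W] in auto)
  have nearQ: "\<forall>\<^sub>F t in nhds t0. c t \<in> ?Q"
    by (rule eventually_cube[OF cont nearE r(1)])
  have sm: "smooth_Rn n ?Q f" by (rule smooth_Rn_subset[OF f r(2)])
  let ?g = "\<lambda>j t. hadamard ?a j 0 (partial j f) (c t)"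
  have "isCont (?g j) t0" if j: "j < n" for j
  proof -
    let ?h = "hadamard ?a j 0 (partial j f)"
    \<comment> \<open>The curve is continuous in each of the first \<open>dm\<close>-many
      coordinates separately, so the preimage of a ball under \<open>?h\<close> is shrunk to a cube,
      where \<open>eventually_cube\<close> applies.\<close>
    have "continuous_on ?Q ?h"
      by (intro smooth_Rn_continuous[where n = n] smooth_Rn_hadamard aQ smooth_Rn_partial sm j)
    hence "\<forall>\<^sub>F t in nhds t0. dist (?h (c t)) (?h ?a) < e" if "e > 0" for e
    proof -
      obtain A where A: "open A" "A \<inter> ?Q = ?h -` ball (?h ?a) e \<inter> ?Q"
        using \<open>continuous_on ?Q ?h\<close> unfolding continuous_on_open_invariant by (meson open_ball)
      have "openin (Euclidean_space n) (A \<inter> ?Q)"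
        by (rule openin_Euclidean_Int_open[OF openin_cube A(1)])
      moreover have "?a \<in> A \<inter> ?Q" using A(2) aQ that by auto
      ultimately obtain s where s: "s > 0" "cube n ?a s \<subseteq> A \<inter> ?Q" by (rule cube_subset_open)
      show ?thesis
      proof (rule eventually_mono[OF eventually_cube[OF _ nearE s(1)]])
        fix t assume "c t \<in> cube n ?a s"
        hence "c t \<in> ?h -` ball (?h ?a) e" using s(2) A(2) by auto
        thus "dist (?h (c t)) (?h ?a) < e" by (simp add: dist_commute)
      qed (rule cont)
    qed
    thus ?thesis unfolding isCont_def tendsto_iff by (simp add: eventually_nhds_conv_at)
  qed
  hence "((\<lambda>t. (c t j - ?a j) * ?g j t) has_real_derivative c' j * ?g j t0) (at t0)" if "j < n" for j
    using that c[OF that]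
    by (intro has_derivative_vanishing_mult) (auto intro!: derivative_eq_intros)
  hence "((\<lambda>t. f ?a + (\<Sum>j<n. (c t j - ?a j) * ?g j t)) has_real_derivative
      0 + (\<Sum>j<n. c' j * ?g j t0)) (at t0)"
    by (intro DERIV_add DERIV_const DERIV_sum) auto
  hence "((\<lambda>t. f (c t)) has_real_derivative 0 + (\<Sum>j<n. c' j * ?g j t0)) (at t0)"
    by (rule DERIV_cong_ev[THEN iffD1, rotated -1])
      (use nearQ in \<open>auto elim!: eventually_mono simp: hadamard_sum[OF aQ sm, symmetric]\<close>)
  thus ?thesis by (simp add: hadamard_center[OF aQ])
qed

text \<open>The induction is over the class of the composite while \<open>f\<close> stays smooth, so
  that the hypothesis applies to the \<open>partial j f\<close> which the chain rule
  produces.\<close>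

lemma cont_diff_compose:
  assumes W: "openin (Euclidean_space n) W" and W': "openin (Euclidean_space n') W'"
    and h: "\<And>j. j < n ==> smooth_Rn n' W' (\<lambda>x. h x j)" and hW: "h ` W' \<subseteq> W"
  shows "smooth_Rn n W f ==> cont_diff n' p W' (\<lambda>x. f (h x))"
proof (induction p arbitrary: f)
  have conth: "continuous_on W' h"
  proof (rule continuous_on_coordinatewise_then_product)
    fix j show "continuous_on W' (\<lambda>x. h x j)"
    proof (cases "j < n")
      case False
      \<comment> \<open>Points of \<open>W\<close> have zero coordinates from \<open>n\<close> on,
        so these components of \<open>h\<close> are constant.\<close>
      hence "h x j = 0" if "x \<in> W'" for x
        using openin_Euclidean_zero[OF W] hW that by (metis image_subset_iff not_less)
      thus ?thesis by (simp cong: continuous_on_cong)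
    qed (use h smooth_Rn_continuous in blast)
  qed
  have cont: "continuous_on W' (\<lambda>x. f (h x))" if "smooth_Rn n W f" for f
    by (rule continuous_on_compose2[OF smooth_Rn_continuous[OF that] conth hW])
  {
    case 0
    thus ?case using cont by simp
  next
    case (Suc p)
    show ?case
    proof (rule cont_diff_SucI[OF W', where g = "\<lambda>i x. \<Sum>j<n. partial i (\<lambda>x. h x j) x * partial j f (h x)"])
      show "continuous_on W' (\<lambda>x. f (h x))" using cont Suc.prems .
      show "cont_diff n' p W' (\<lambda>x. \<Sum>j<n. partial i (\<lambda>x. h x j) x * partial j f (h x))" if "i < n'" for i
      proof (intro cont_diff_sum[OF W'] cont_diff_mult[OF W'])
        fix j assume "j \<in> {..<n}"
        thus "cont_diff n' p W' (partial i (\<lambda>x. h x j))"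
          using smooth_Rn_partial[OF h that] by (auto simp: smooth_Rn_def)
        show "cont_diff n' p W' (\<lambda>x. partial j f (h x))"
          using Suc.IH smooth_Rn_partial[OF Suc.prems] \<open>j \<in> {..<n}\<close> by auto
      qed
      fix i x assume i: "i < n'" and x: "x \<in> W'"
      have "((\<lambda>t. f (h (x(i := t)))) has_real_derivative
          (\<Sum>j<n. partial i (\<lambda>x. h x j) x * partial j f (h (x(i := x i))))) (at (x i))"
      proof (rule partial_chain[OF W Suc.prems])
        show "((\<lambda>t. h (x(i := t)) j) has_real_derivative partial i (\<lambda>x. h x j) x) (at (x i))" if "j < n" for j
          using smooth_Rn_has_partial[OF h[OF that] i x] by (simp add: has_partial_def)
        show "\<forall>\<^sub>F t in nhds (x i). h (x(i := t)) \<in> W"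
          using eventually_slice[OF W' x i] by eventually_elim (use hW in auto)
      qed
      thus "has_partial i (\<lambda>x. f (h x)) (\<Sum>j<n. partial i (\<lambda>x. h x j) x * partial j f (h x)) x"
        by (simp add: has_partial_def)
    qed
  }
qed

lemma smooth_Rn_compose:
  assumes "openin (Euclidean_space n) W" "openin (Euclidean_space n') W'"
    and "\<And>j. j < n ==> smooth_Rn n' W' (\<lambda>x. h x j)" "h ` W' \<subseteq> W" "smooth_Rn n W f"
  shows "smooth_Rn n' W' (\<lambda>x. f (h x))"
  unfolding smooth_Rn_def using cont_diff_compose[OF assms] by blast

section \<open>Iterated partial derivatives\<close>

text \<open>Vanishing to order \<open>q\<close> at \<open>a\<close>, expressed with all sequences of
  differentiations instead of multi-indices: the product rule can then be iterated without
  interchanging partial derivatives.\<close>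

primrec vanishes :: "nat => nat => (nat => real) => ((nat => real) => real) => bool" where
  "vanishes n 0 a f \<longleftrightarrow> True"
| "vanishes n (Suc q) a f \<longleftrightarrow> f a = 0 \<and> (\<forall>i<n. vanishes n q a (partial i f))"

context
  fixes n W a
  assumes W: "openin (Euclidean_space n) W" and a: "a \<in> W"
begin

lemma vanishes_cong: "(\<And>y. y \<in> W ==> f y = g y) ==> vanishes n q a f \<longleftrightarrow> vanishes n q a g"
proof (induction q arbitrary: f g)
  case (Suc q)
  have "vanishes n q a (partial i f) \<longleftrightarrow> vanishes n q a (partial i g)" if "i < n" for i
    by (rule Suc.IH) (rule partial_cong[OF W _ that Suc.prems])
  thus ?case using Suc.prems[OF a] by simp
qed simp

lemma vanishes_SucD: "vanishes n (Suc q) a f ==> vanishes n q a f"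
  by (induction q arbitrary: f) auto

lemma vanishes_add:
  "smooth_Rn n W f ==> smooth_Rn n W g ==> vanishes n q a f ==> vanishes n q a g ==>
    vanishes n q a (\<lambda>x. f x + g x)"
proof (induction q arbitrary: f g)
  case (Suc q)
  have "vanishes n q a (partial i (\<lambda>x. f x + g x))" if i: "i < n" for i
  proof -
    have "vanishes n q a (\<lambda>x. partial i f x + partial i g x)"
      using Suc i by (auto intro: smooth_Rn_partial)
    moreover have "partial i (\<lambda>x. f x + g x) y = partial i f y + partial i g y" if "y \<in> W" for y
      by (intro has_partial_imp has_partial_add smooth_Rn_has_partial[of n W]) (use Suc.prems i that in auto)
    ultimately show ?thesis
      using vanishes_cong[of "partial i (\<lambda>x. f x + g x)" "\<lambda>x. partial i f x + partial i g x" q] by simp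
  qed
  thus ?case using Suc.prems by simp
qed simp

lemma partial_mult_on:
  assumes "smooth_Rn n W f" "smooth_Rn n W g" "i < n" "y \<in> W"
  shows "partial i (\<lambda>x. f x * g x) y = partial i f y * g y + f y * partial i g y"
  by (intro has_partial_imp has_partial_mult smooth_Rn_has_partial[of n W]) (use assms in auto)

lemma vanishes_mult:
  "smooth_Rn n W f ==> smooth_Rn n W g ==> vanishes n q a g ==> vanishes n q a (\<lambda>x. f x * g x)"
proof (induction q arbitrary: f g)
  case (Suc q)
  have "vanishes n q a (partial i (\<lambda>x. f x * g x))" if i: "i < n" for i
  proof -
    have "vanishes n q a (\<lambda>x. partial i f x * g x)"
      using Suc.IH[OF smooth_Rn_partial[OF Suc.prems(1) i] Suc.prems(2)] vanishes_SucD[OF Suc.prems(3)] .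
    moreover have "vanishes n q a (\<lambda>x. f x * partial i g x)"
      using Suc.IH[OF Suc.prems(1) smooth_Rn_partial[OF Suc.prems(2) i]] Suc.prems(3) i by simp
    ultimately have "vanishes n q a (\<lambda>x. partial i f x * g x + f x * partial i g x)"
      using Suc.prems i by (intro vanishes_add smooth_Rn_mult[OF W] smooth_Rn_partial) auto
    thus ?thesis
      using vanishes_cong[of "partial i (\<lambda>x. f x * g x)" "\<lambda>x. partial i f x * g x + f x * partial i g x"]
        partial_mult_on[OF Suc.prems(1,2) i] by simp
  qed
  thus ?case using Suc.prems by simp
qed simp

text \<open>In the product rule, the summand with \<open>partial i f\<close> keeps the order of
  \<open>g\<close>; the one with \<open>partial i g\<close> has lost an order and gets it back from
  \<open>f\<close> by induction.\<close>

lemma vanishes_Suc_mult: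
  "smooth_Rn n W f ==> smooth_Rn n W g ==> f a = 0 ==> vanishes n q a g ==> vanishes n (Suc q) a (\<lambda>x. f x * g x)"
proof (induction q arbitrary: g)
  case (Suc q)
  have "vanishes n (Suc q) a (partial i (\<lambda>x. f x * g x))" if i: "i < n" for i
  proof -
    have "vanishes n (Suc q) a (\<lambda>x. partial i f x * g x)"
      using vanishes_mult[OF smooth_Rn_partial[OF Suc.prems(1) i] Suc.prems(2)] Suc.prems(4) .
    moreover have "vanishes n (Suc q) a (\<lambda>x. f x * partial i g x)"
      using Suc.IH[OF Suc.prems(1) smooth_Rn_partial[OF Suc.prems(2) i]] Suc.prems i by simp
    ultimately have "vanishes n (Suc q) a (\<lambda>x. partial i f x * g x + f x * partial i g x)"
      using Suc.prems i by (intro vanishes_add smooth_Rn_mult[OF W] smooth_Rn_partial) auto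
    thus ?thesis
      using vanishes_cong[of "partial i (\<lambda>x. f x * g x)" "\<lambda>x. partial i f x * g x + f x * partial i g x"]
        partial_mult_on[OF Suc.prems(1,2) i] by (simp del: vanishes.simps)
  qed
  thus ?case using Suc.prems by simp
qed simp

lemma vanishes_funpow: "vanishes n (q + j) a f ==> i < n ==> vanishes n q a ((partial i ^^ j) f)"
  by (induction j arbitrary: f) (auto simp: funpow_Suc_right simp del: funpow.simps(2))

lemma vanishes_mpartial:
  "vanishes n (q + (\<Sum>i<m. I i)) a f ==> m \<le> n ==> vanishes n q a (mpartial m I f)"
proof (induction m arbitrary: q)
  case (Suc m)
  hence "vanishes n (q + I m) a (mpartial m I f)" by (simp add: add.assoc add.commute)
  thus ?case using Suc.prems by (simp add: vanishes_funpow)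
qed simp

lemma mpartial_vanishes: "vanishes n (Suc k) a f ==> I \<in> multi_indices n k ==> mpartial n I f a = 0"
proof -
  assume f: "vanishes n (Suc k) a f" and I: "I \<in> multi_indices n k"
  \<comment> \<open>At most \<open>k\<close> differentiations leave at least one of the
    \<open>k + 1\<close> orders.\<close>
  have "vanishes n (Suc (k - (\<Sum>i<n. I i))) a (mpartial n I f)"
    by (rule vanishes_mpartial) (use f I in \<open>auto simp: multi_indices_def\<close>)
  thus ?thesis by simp
qed

lemma funpow_partial_cong:
  "(\<And>y. y \<in> W ==> f y = g y) ==> i < n ==> y \<in> W ==> (partial i ^^ j) f y = (partial i ^^ j) g y"
  by (induction j arbitrary: y) (auto intro: partial_cong[OF W])

lemma mpartial_cong:
  "(\<And>y. y \<in> W ==> f y = g y) ==> m \<le> n ==> y \<in> W ==> mpartial m I f y = mpartial m I g y"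
  by (induction m arbitrary: y) (auto intro: funpow_partial_cong)

lemma funpow_partial_linear:
  assumes f: "smooth_Rn n W f" and g: "smooth_Rn n W g" and i: "i < n" and y: "y \<in> W"
  shows "(partial i ^^ j) (\<lambda>x. c * f x + g x) y = c * (partial i ^^ j) f y + (partial i ^^ j) g y"
  using y
proof (induction j arbitrary: y)
  case (Suc j)
  let ?f = "(partial i ^^ j) f" and ?g = "(partial i ^^ j) g"
  have "(partial i ^^ Suc j) (\<lambda>x. c * f x + g x) y = partial i (\<lambda>x. c * ?f x + ?g x) y"
    using partial_cong[OF W Suc.prems i Suc.IH] by simp
  also have "\<dots> = (0 * ?f y + c * partial i ?f y) + partial i ?g y"
    by (intro has_partial_imp has_partial_add has_partial_mult has_partial_const smooth_Rn_has_partial[of n W]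
        smooth_Rn_funpow_partial[OF W]) (use Suc.prems i f g in auto)
  finally show ?case by simp
qed simp

lemma mpartial_linear:
  assumes f: "smooth_Rn n W f" and g: "smooth_Rn n W g" and "m \<le> n" "y \<in> W"
  shows "mpartial m I (\<lambda>x. c * f x + g x) y = c * mpartial m I f y + mpartial m I g y"
  using assms(3,4)
proof (induction m arbitrary: y)
  case (Suc m)
  have "mpartial (Suc m) I (\<lambda>x. c * f x + g x) y
      = (partial m ^^ I m) (\<lambda>x. c * mpartial m I f x + mpartial m I g x) y"
    using Suc by (auto intro: funpow_partial_cong)
  also have "\<dots> = c * mpartial (Suc m) I f y + mpartial (Suc m) I g y"
    using Suc.prems by (auto intro!: funpow_partial_linear smooth_Rn_mpartial[OF W] f g)
  finally show ?case .
qed simp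

end

section \<open>Monomials and their derivatives at the centre\<close>

definition monomial :: "nat => (nat => nat) => (nat => real) => (nat => real) => real" where
  "monomial n I a x = (\<Prod>i<n. (x i - a i) ^ I i)"

definition mfact :: "nat => (nat => nat) => real" where
  "mfact n I = (\<Prod>i<n. fact (I i))"

lemma mfact_pos: "mfact n I > 0"
  by (auto simp: mfact_def intro: prod_pos)

text \<open>The truncated exponent does no harm for \<open>K i = 0\<close>, since the factor
  \<open>K i\<close> is then 0. The constant \<open>c\<close> is carried along so that the formula
  can be iterated.\<close>

lemma partial_monomial:
  assumes i: "i < n"
  shows "partial i (\<lambda>x. c * monomial n K a x) = (\<lambda>x. c * real (K i) * monomial n (K(i := K i - 1)) a x)"
proof
  fix x
  have split: "monomial n L a y = (y i - a i) ^ L i * (\<Prod>j\<in>{..<n} - {i}. (y j - a j) ^ L j)" for L y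
    unfolding monomial_def using i by (subst prod.remove[of _ i]) auto
  let ?C = "\<Prod>j\<in>{..<n} - {i}. (x j - a j) ^ K j"
  have C: "(\<Prod>j\<in>{..<n} - {i}. ((x(i := t)) j - a j) ^ K j) = ?C"
    "(\<Prod>j\<in>{..<n} - {i}. (x j - a j) ^ (K(i := K i - 1)) j) = ?C" for t
    by (rule prod.cong; auto)+
  have "((\<lambda>t. c * ((t - a i) ^ K i * ?C)) has_real_derivative
      c * (real (K i) * (x i - a i) ^ (K i - 1) * ?C)) (at (x i))"
    by (auto intro!: derivative_eq_intros)
  hence "has_partial i (\<lambda>x. c * monomial n K a x) (c * (real (K i) * (x i - a i) ^ (K i - 1) * ?C)) x"
    unfolding has_partial_def split C by simp
  thus "partial i (\<lambda>x. c * monomial n K a x) x = c * real (K i) * monomial n (K(i := K i - 1)) a x"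
    by (simp add: has_partial_imp split C mult_ac)
qed

lemma funpow_partial_monomial:
  assumes i: "i < n"
  shows "(partial i ^^ j) (\<lambda>x. c * monomial n K a x) =
    (\<lambda>x. c * (\<Prod>s<j. real (K i - s)) * monomial n (K(i := K i - j)) a x)"
proof (induction j)
  case (Suc j)
  have "K(i := K i - j, i := (K(i := K i - j)) i - 1) = K(i := K i - Suc j)" by auto
  thus ?case
    unfolding funpow.simps(2) comp_apply Suc partial_monomial[OF i]
    by (simp only: fun_upd_same mult.assoc prod.lessThan_Suc)
qed simp

lemma mpartial_monomial_fun:
  "m \<le> n ==> mpartial m J (monomial n I a) =
    (\<lambda>x. (\<Prod>i<m. \<Prod>s<J i. real (I i - s)) * monomial n (\<lambda>i. if i < m then I i - J i else I i) a x)"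
proof (induction m)
  case (Suc m)
  have "(\<lambda>i. if i < m then I i - J i else I i)(m := I m - J m) = (\<lambda>i. if i < Suc m then I i - J i else I i)"
    by auto
  thus ?case using Suc by (simp add: funpow_partial_monomial mult_ac)
qed simp

text \<open>This duality between monomials and derivatives is the source of all factors
  \<open>mfact\<close> below: it reads off the coefficients of a polynomial and prescribes
  derivatives.\<close>

lemma mpartial_monomial:
  assumes "I \<in> multi_indices n k" "J \<in> multi_indices n l"
  shows "mpartial n J (monomial n I a) a = (if I = J then mfact n I else 0)"
proof -
  \<comment> \<open>One coordinate at the centre: for \<open>i < j\<close> the falling factorial
    contains the factor 0, for \<open>i > j\<close> a positive power of 0 remains.\<close>
  have 1: "(\<Prod>s<j. real (i - s)) * 0 ^ (i - j) = (if i = j then fact i else 0)" for i j :: nat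
  proof (cases "i < j")
    case True
    hence "(\<Prod>s<j. real (i - s)) = 0" by (intro prod_zero) auto
    thus ?thesis using True by simp
  next
    case False
    have "(\<Prod>s<i. real (i - s)) = fact i"
      by (simp add: fact_prod_rev lessThan_atLeast0)
    thus ?thesis using False by auto
  qed
  have "mpartial n J (monomial n I a) a = (\<Prod>i<n. (\<Prod>s<J i. real (I i - s)) * 0 ^ (I i - J i))"
    by (simp add: mpartial_monomial_fun monomial_def prod.distrib)
  also have "\<dots> = (\<Prod>i<n. if I i = J i then fact (I i) else 0)" by (simp only: 1)
  also have "\<dots> = (if I = J then mfact n I else 0)"
  proof (cases "I = J")
    case False
    then obtain i where "I i \<noteq> J i" by auto
    moreover from this have "i < n"
      using assms by (cases "i < n") (auto simp: multi_indices_def)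
    ultimately show ?thesis using False by (auto intro!: prod_zero)
  qed (simp add: mfact_def)
  finally show ?thesis .
qed

lemma smooth_Rn_monomial:
  assumes W: "openin (Euclidean_space n) W"
  shows "smooth_Rn n W (monomial n I a)"
proof -
  have pow: "smooth_Rn n W (\<lambda>x. (x i - a i) ^ k)" for i k
  proof (induction k)
    case (Suc k)
    thus ?case
      using smooth_Rn_mult[OF W smooth_Rn_add[OF W smooth_Rn_coord[OF W] smooth_Rn_const[OF W]] Suc, of i "- a i"]
      by simp
  qed (simp add: smooth_Rn_const[OF W])
  have "smooth_Rn n W (\<lambda>x. \<Prod>i<m. (x i - a i) ^ I i)" for m
    by (induction m) (auto intro: smooth_Rn_const[OF W] smooth_Rn_mult[OF W] pow)
  thus ?thesis by (simp add: monomial_def[abs_def])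
qed

lemma finite_multi_indices: "finite (multi_indices n k)"
proof -
  have "multi_indices n k \<subseteq> (\<lambda>f i. if i < n then f i else 0) ` ({..<n} \<rightarrow>\<^sub>E {..k})"
  proof
    fix I assume I: "I \<in> multi_indices n k"
    have "I i \<le> k" if "i < n" for i
      using I that member_le_sum[of i "{..<n}" I] by (auto simp: multi_indices_def)
    thus "I \<in> (\<lambda>f i. if i < n then f i else 0) ` ({..<n} \<rightarrow>\<^sub>E {..k})"
      using I by (intro image_eqI[of _ _ "restrict I {..<n}"]) (auto simp: multi_indices_def)
  qed
  thus ?thesis by (rule finite_subset) (intro finite_imageI finite_PiE, auto)
qed

section \<open>Charts and smooth functions on a manifold\<close>

locale smooth_mfd =
  fixes M :: "'m manifold"
  assumes smooth_manifold: "smooth_manifold M"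
begin

abbreviation fcts where "fcts U \<equiv> carrier (smooth_ring M U)"

abbreviation opn :: "'m set => bool" where "opn \<equiv> openin (mtop M)"
abbreviation dm :: nat where "dm \<equiv> mdim M"
abbreviation openR :: "(nat => real) set => bool" where "openR \<equiv> openin (Euclidean_space dm)"

lemma opn_points: "opn U ==> U \<subseteq> points M"
  by (rule openin_subset)

lemma chart_is_chart: "(U, \<phi>) \<in> atlas M ==> is_chart M (U, \<phi>)"
  using smooth_manifold unfolding smooth_manifold_def by blast

lemma chart_open: "(U, \<phi>) \<in> atlas M ==> opn U"
  using chart_is_chart by (auto simp: is_chart_def)

lemma chart_homeomorphic:
  "(U, \<phi>) \<in> atlas M ==>
    homeomorphic_map (subtopology (mtop M) U) (subtopology (Euclidean_space dm) (\<phi> ` U)) \<phi>"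
  using chart_is_chart by (auto simp: is_chart_def)

lemma chart_inj: assumes "(U, \<phi>) \<in> atlas M" shows "inj_on \<phi> U"
  using homeomorphic_imp_injective_map[OF chart_homeomorphic[OF assms]] opn_points[OF chart_open[OF assms]]
  by (simp add: Int_absorb1)

lemma chart_inv: "(U, \<phi>) \<in> atlas M ==> x \<in> U ==> inv_into U \<phi> (\<phi> x) = x"
  by (rule inv_into_f_f[OF chart_inj])

lemma chart_image_open:
  assumes c: "(U, \<phi>) \<in> atlas M" and V: "opn V" "V \<subseteq> U" shows "openR (\<phi> ` V)"
proof -
  have "openin (subtopology (mtop M) U) V"
    using V chart_open[OF c] by (simp add: openin_open_subtopology)
  hence "openin (subtopology (Euclidean_space dm) (\<phi> ` U)) (\<phi> ` V)"
    using homeomorphic_imp_open_map[OF chart_homeomorphic[OF c]] by (simp add: open_map_def)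
  moreover have "openR (\<phi> ` U)" using chart_is_chart[OF c] by (auto simp: is_chart_def)
  ultimately show ?thesis by (rule openin_trans_full)
qed

lemma chart_preimage_open:
  assumes c: "(U, \<phi>) \<in> atlas M" and W: "openR W" shows "opn {x \<in> U. \<phi> x \<in> W}"
proof -
  have U: "topspace (subtopology (mtop M) U) = U"
    using opn_points[OF chart_open[OF c]] by (simp add: Int_absorb1)
  have "openin (subtopology (Euclidean_space dm) (\<phi> ` U)) (\<phi> ` U \<inter> W)"
    using W by (auto simp: openin_subtopology)
  hence "openin (subtopology (mtop M) U) {x \<in> U. \<phi> x \<in> \<phi> ` U \<inter> W}"
    using openin_continuous_map_preimage[OF homeomorphic_imp_continuous_map[OF chart_homeomorphic[OF c]]] U
    by fastforce
  moreover have "{x \<in> U. \<phi> x \<in> \<phi> ` U \<inter> W} = {x \<in> U. \<phi> x \<in> W}" by auto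
  ultimately show ?thesis using openin_trans_full[OF _ chart_open[OF c]] by simp
qed

lemma chart_transition:
  assumes "(U, \<phi>) \<in> atlas M" "(V, \<eta>) \<in> atlas M" "i < dm"
  shows "smooth_Rn dm (\<phi> ` (U \<inter> V)) (\<lambda>x. \<eta> (inv_into U \<phi> x) i)"
proof -
  have "smooth_transition M (U, \<phi>) (V, \<eta>)"
    using smooth_manifold assms unfolding smooth_manifold_def by blast
  thus ?thesis using assms(3) by (simp add: smooth_transition_def)
qed

lemma chart_cover: "a \<in> points M ==> \<exists>U \<phi>. (U, \<phi>) \<in> atlas M \<and> a \<in> U"
proof -
  assume "a \<in> points M"
  hence "a \<in> (\<Union>(U, \<phi>)\<in>atlas M. U)" using smooth_manifold unfolding smooth_manifold_def by simp
  thus ?thesis by auto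
qed

text \<open>The atlas is maximal, so it is enough that the restriction is compatible with every
  chart. Compatibility is inherited because the inverses of the restricted and of the full
  coordinate map agree on the smaller image.\<close>

lemma chart_restrict:
  assumes c: "(U, \<phi>) \<in> atlas M" and V: "opn V" "V \<subseteq> U" shows "(V, \<phi>) \<in> atlas M"
proof -
  have inv: "inv_into V \<phi> x = inv_into U \<phi> x" if x: "x \<in> \<phi> ` V" for x
  proof -
    obtain y where y: "y \<in> V" "x = \<phi> y" using x by auto
    have "inj_on \<phi> V" using inj_on_subset[OF chart_inj[OF c] V(2)] .
    thus ?thesis using y V chart_inv[OF c] by (auto simp: inv_into_f_f)
  qed
  have "homeomorphic_map (subtopology (subtopology (mtop M) U) V)
      (subtopology (subtopology (Euclidean_space dm) (\<phi> ` U)) (\<phi> ` V)) \<phi>"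
  proof (rule homeomorphic_map_subtopologies[OF chart_homeomorphic[OF c]])
    have "openR (\<phi> ` U)" using chart_image_open[OF c chart_open[OF c]] by simp
    thus "\<phi> ` (topspace (subtopology (mtop M) U) \<inter> V) =
        topspace (subtopology (Euclidean_space dm) (\<phi> ` U)) \<inter> \<phi> ` V"
      using openin_subset[of "Euclidean_space dm" "\<phi> ` U"] opn_points[OF chart_open[OF c]] V(2) by auto
  qed
  hence "is_chart M (V, \<phi>)"
    using V chart_image_open[OF c V] by (simp add: is_chart_def subtopology_subtopology inf_absorb2 image_mono)
  moreover have "smooth_transition M (V, \<phi>) d" "smooth_transition M d (V, \<phi>)" if d: "d \<in> atlas M" for d
  proof -
    obtain V' \<eta> where d': "d = (V', \<eta>)" by (cases d)
    have "smooth_Rn dm (\<phi> ` (V \<inter> V')) (\<lambda>x. \<eta> (inv_into V \<phi> x) i)" if i: "i < dm" for i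
    proof -
      have op: "openR (\<phi> ` (V \<inter> V'))"
        using V chart_open[of V' \<eta>] d d' by (intro chart_image_open[OF c]) auto
      have "smooth_Rn dm (\<phi> ` (V \<inter> V')) (\<lambda>x. \<eta> (inv_into U \<phi> x) i)"
        by (rule smooth_Rn_subset[OF chart_transition[OF c _ i]]) (use d d' V in auto)
      moreover have "smooth_Rn dm (\<phi> ` (V \<inter> V')) (\<lambda>x. \<eta> (inv_into V \<phi> x) i) \<longleftrightarrow>
          smooth_Rn dm (\<phi> ` (V \<inter> V')) (\<lambda>x. \<eta> (inv_into U \<phi> x) i)"
        by (rule smooth_Rn_cong[OF op]) (use inv in auto)
      ultimately show ?thesis by simp
    qed
    thus "smooth_transition M (V, \<phi>) d" by (auto simp: smooth_transition_def d')
    show "smooth_transition M d (V, \<phi>)"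
      unfolding smooth_transition_def d' using d d' V(2) c
      by (auto intro!: smooth_Rn_subset[OF chart_transition[of V' \<eta> U \<phi>]])
  qed
  ultimately show ?thesis using smooth_manifold unfolding smooth_manifold_def by blast
qed

section \<open>Smooth functions on open subsets of the manifold\<close>

lemma smooth_funD:
  "smooth_fun M U f ==> (V, \<phi>) \<in> atlas M ==> smooth_Rn dm (\<phi> ` (U \<inter> V)) (\<lambda>x. f (inv_into V \<phi> x))"
  by (auto simp: smooth_fun_def)

lemma smooth_funI:
  "(\<And>V \<phi>. (V, \<phi>) \<in> atlas M ==> smooth_Rn dm (\<phi> ` (U \<inter> V)) (\<lambda>x. f (inv_into V \<phi> x))) ==> smooth_fun M U f"
  by (auto simp: smooth_fun_def)

lemma open_chart_image_Int: "opn U ==> (V, \<phi>) \<in> atlas M ==> openR (\<phi> ` (U \<inter> V))"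
  by (intro chart_image_open) (auto intro: chart_open)

lemma smooth_fun_subset: "smooth_fun M U f ==> V \<subseteq> U ==> smooth_fun M V f"
  by (rule smooth_funI, rule smooth_Rn_subset, erule (1) smooth_funD) auto

lemma smooth_fun_cong:
  assumes U: "opn U" and eq: "\<And>x. x \<in> U ==> f x = g x" shows "smooth_fun M U f \<longleftrightarrow> smooth_fun M U g"
proof -
  have "smooth_Rn dm (\<phi> ` (U \<inter> V)) (\<lambda>x. f (inv_into V \<phi> x)) \<longleftrightarrow>
      smooth_Rn dm (\<phi> ` (U \<inter> V)) (\<lambda>x. g (inv_into V \<phi> x))" if c: "(V, \<phi>) \<in> atlas M" for V \<phi>
    by (rule smooth_Rn_cong[OF open_chart_image_Int[OF U c]]) (auto simp: chart_inv[OF c] eq)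
  thus ?thesis by (auto simp: smooth_fun_def)
qed

lemma smooth_fun_local:
  assumes U: "opn U" and *: "\<And>a. a \<in> U ==> \<exists>V. opn V \<and> a \<in> V \<and> V \<subseteq> U \<and> smooth_fun M V f"
  shows "smooth_fun M U f"
proof (rule smooth_funI, rule smooth_Rn_local)
  fix V \<phi> x assume c: "(V, \<phi>) \<in> atlas M" and x: "x \<in> \<phi> ` (U \<inter> V)"
  then obtain a where a: "a \<in> U" "a \<in> V" "x = \<phi> a" by auto
  obtain W where W: "opn W" "a \<in> W" "W \<subseteq> U" "smooth_fun M W f" using *[OF a(1)] by blast
  show "\<exists>Va. openR Va \<and> x \<in> Va \<and> Va \<subseteq> \<phi> ` (U \<inter> V) \<and> smooth_Rn dm Va (\<lambda>x. f (inv_into V \<phi> x))"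
    by (rule exI[of _ "\<phi> ` (W \<inter> V)"])
      (use W a smooth_funD[OF W(4) c] open_chart_image_Int[OF W(1) c] in auto)
qed (use open_chart_image_Int[OF U] in auto)

text \<open>Every other chart sees \<open>g\<close> composed with a transition map, to which the
  chain rule applies.\<close>

lemma smooth_fun_chartI:
  assumes c: "(U, \<phi>) \<in> atlas M" and V: "opn V" "V \<subseteq> U" and g: "smooth_Rn dm (\<phi> ` V) g"
  shows "smooth_fun M V (\<lambda>x. g (\<phi> x))"
proof (rule smooth_funI)
  fix V' \<eta> assume c': "(V', \<eta>) \<in> atlas M"
  show "smooth_Rn dm (\<eta> ` (V \<inter> V')) (\<lambda>x. g (\<phi> (inv_into V' \<eta> x)))"
  proof (rule smooth_Rn_compose[OF chart_image_open[OF c V] open_chart_image_Int[OF V(1) c'] _ _ g])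
    show "smooth_Rn dm (\<eta> ` (V \<inter> V')) (\<lambda>x. \<phi> (inv_into V' \<eta> x) j)" if "j < dm" for j
      by (rule smooth_Rn_subset[OF chart_transition[OF c' c that]]) (use V in auto)
    show "(\<lambda>x. \<phi> (inv_into V' \<eta> x)) ` \<eta> ` (V \<inter> V') \<subseteq> \<phi> ` V"
      by (auto simp: chart_inv[OF c'])
  qed
qed

lemma smooth_fun_coord: "(U, \<phi>) \<in> atlas M ==> smooth_fun M U (\<lambda>x. \<phi> x i)"
  by (rule smooth_fun_chartI[where g = "\<lambda>x. x i"])
    (auto intro: chart_open smooth_Rn_coord chart_image_open)

lemma smooth_fun_const: "opn U ==> smooth_fun M U (\<lambda>_. c)"
  by (auto intro!: smooth_funI smooth_Rn_const open_chart_image_Int)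

lemma smooth_fun_add:
  "opn U ==> smooth_fun M U f ==> smooth_fun M U g ==> smooth_fun M U (\<lambda>x. f x + g x)"
  by (rule smooth_funI, rule smooth_Rn_add[OF open_chart_image_Int]; (assumption | erule (1) smooth_funD)?)

lemma smooth_fun_mult:
  "opn U ==> smooth_fun M U f ==> smooth_fun M U g ==> smooth_fun M U (\<lambda>x. f x * g x)"
  by (rule smooth_funI, rule smooth_Rn_mult[OF open_chart_image_Int]; (assumption | erule (1) smooth_funD)?)

lemma smooth_fun_sum:
  "opn U ==> (\<And>i. i \<in> I ==> smooth_fun M U (f i)) ==> smooth_fun M U (\<lambda>x. \<Sum>i\<in>I. f i x)"
  by (intro smooth_funI smooth_Rn_sum open_chart_image_Int) (auto intro: smooth_funD)

lemma smooth_fun_cmult: "opn U ==> smooth_fun M U f ==> smooth_fun M U (\<lambda>x. c * f x)"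
  by (intro smooth_fun_mult smooth_fun_const)

lemma smooth_fun_diff:
  "opn U ==> smooth_fun M U f ==> smooth_fun M U g ==> smooth_fun M U (\<lambda>x. f x - g x)"
  using smooth_fun_add[of U f "\<lambda>x. (-1) * g x"] smooth_fun_cmult[of U g "-1"] by simp

section \<open>Derivatives and order of vanishing in a chart\<close>

definition chart_partial :: "'m set => ('m => nat => real) => (nat => nat) => ('m => real) => 'm => real" where
  "chart_partial U \<phi> I f a = mpartial dm I (\<lambda>x. f (inv_into U \<phi> x)) (\<phi> a)"

context
  fixes U \<phi> V
  assumes c: "(U, \<phi>) \<in> atlas M" and V: "opn V" "V \<subseteq> U"
begin

lemma smooth_Rn_chart: "smooth_fun M V f ==> smooth_Rn dm (\<phi> ` V) (\<lambda>x. f (inv_into U \<phi> x))"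
  using smooth_funD[OF _ c, of V f] V(2) by (simp add: Int_absorb2)

lemma chart_partial_cong:
  "(\<And>x. x \<in> V ==> f x = g x) ==> a \<in> V ==> chart_partial U \<phi> I f a = chart_partial U \<phi> I g a"
  unfolding chart_partial_def
  by (rule mpartial_cong[OF chart_image_open[OF c V], of "\<phi> a"]) (use V(2) in \<open>auto simp: chart_inv[OF c]\<close>)

lemma smooth_fun_chart_partial:
  "smooth_fun M V f ==> smooth_fun M V (chart_partial U \<phi> I f)"
  unfolding chart_partial_def[abs_def]
  by (rule smooth_fun_chartI[OF c V smooth_Rn_mpartial[OF chart_image_open[OF c V] smooth_Rn_chart order_refl]])

lemma chart_partial_linear:
  assumes "smooth_fun M V f" "smooth_fun M V g" "a \<in> V"
  shows "chart_partial U \<phi> I (\<lambda>x. k * f x + g x) a = k * chart_partial U \<phi> I f a + chart_partial U \<phi> I g a"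
  unfolding chart_partial_def
  by (rule mpartial_linear[OF chart_image_open[OF c V]]) (use assms smooth_Rn_chart in auto)

lemma chart_partial_sum:
  assumes "\<And>i. i \<in> S ==> smooth_fun M V (f i)" "a \<in> V"
  shows "chart_partial U \<phi> I (\<lambda>x. \<Sum>i\<in>S. k i * f i x) a = (\<Sum>i\<in>S. k i * chart_partial U \<phi> I (f i) a)"
  using assms(1)
proof (induction S rule: infinite_finite_induct)
  \<comment> \<open>Linearity with both functions equal to 0 gives \<open>d = d + d\<close>.\<close>
  have "chart_partial U \<phi> I (\<lambda>_. 0) a = 0"
    using chart_partial_linear[where f = "\<lambda>_. 0" and g = "\<lambda>_. 0" and k = 1 and a = a] smooth_fun_const[OF V(1)] assms(2) by simp
  {
    case (infinite A)
    show ?case using infinite \<open>chart_partial U \<phi> I (\<lambda>_. 0) a = 0\<close> by simp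
  next
    case empty
    show ?case using \<open>chart_partial U \<phi> I (\<lambda>_. 0) a = 0\<close> by simp
  }
  case (insert i S)
  have "smooth_fun M V (\<lambda>x. \<Sum>i\<in>S. k i * f i x)"
    using insert by (intro smooth_fun_sum smooth_fun_cmult V(1)) auto
  thus ?case using insert chart_partial_linear[where f = "f i" and g = "\<lambda>x. \<Sum>i\<in>S. k i * f i x" and a = a and k = "k i"] assms(2)
    by simp
qed

lemma chart_partial_monomial:
  assumes "I \<in> multi_indices dm k" "J \<in> multi_indices dm l" "a \<in> V"
  shows "chart_partial U \<phi> J (\<lambda>x. monomial dm I (\<phi> a) (\<phi> x)) a = (if I = J then mfact dm I else 0)"
proof -
  have "chart_partial U \<phi> J (\<lambda>x. monomial dm I (\<phi> a) (\<phi> x)) a = mpartial dm J (monomial dm I (\<phi> a)) (\<phi> a)"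
    unfolding chart_partial_def
    by (rule mpartial_cong[OF chart_image_open[OF c V], of "\<phi> a"])
      (use V(2) assms(3) in \<open>auto simp: chart_inv[OF c]\<close>)
  thus ?thesis using mpartial_monomial assms by simp
qed

lemma smooth_fun_monomial: "smooth_fun M V (\<lambda>x. monomial dm I b (\<phi> x))"
  by (intro smooth_fun_chartI[OF c V] smooth_Rn_monomial chart_image_open[OF c V])

definition chart_vanishes :: "nat => 'm => ('m => real) => bool" where
  "chart_vanishes q a f \<longleftrightarrow> vanishes dm q (\<phi> a) (\<lambda>x. f (inv_into U \<phi> x))"

lemma chart_vanishes_0: "chart_vanishes 0 a f"
  by (simp add: chart_vanishes_def)

lemma chart_vanishes_add:
  "a \<in> V ==> smooth_fun M V f ==> smooth_fun M V g ==> chart_vanishes q a f ==> chart_vanishes q a g ==>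
    chart_vanishes q a (\<lambda>x. f x + g x)"
  unfolding chart_vanishes_def
  by (rule vanishes_add[OF chart_image_open[OF c V]]) (auto intro: smooth_Rn_chart)

lemma chart_vanishes_mult:
  "a \<in> V ==> smooth_fun M V f ==> smooth_fun M V g ==> chart_vanishes q a g ==>
    chart_vanishes q a (\<lambda>x. f x * g x)"
  unfolding chart_vanishes_def
  by (rule vanishes_mult[OF chart_image_open[OF c V]]) (auto intro: smooth_Rn_chart)

lemma chart_vanishes_Suc_mult:
  "a \<in> V ==> smooth_fun M V f ==> smooth_fun M V g ==> f a = 0 ==> chart_vanishes q a g ==>
    chart_vanishes (Suc q) a (\<lambda>x. f x * g x)"
  unfolding chart_vanishes_def
  by (rule vanishes_Suc_mult[OF chart_image_open[OF c V]])
    (use V(2) in \<open>auto intro: smooth_Rn_chart simp: chart_inv[OF c]\<close>)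

lemma chart_vanishes_cong:
  "a \<in> V ==> (\<And>x. x \<in> V ==> f x = g x) ==> chart_vanishes q a f \<longleftrightarrow> chart_vanishes q a g"
  unfolding chart_vanishes_def
  by (rule vanishes_cong[OF chart_image_open[OF c V]]) (use V(2) in \<open>auto simp: chart_inv[OF c]\<close>)

lemma chart_vanishes_partial:
  "a \<in> V ==> chart_vanishes (Suc k) a f ==> I \<in> multi_indices dm k ==> chart_partial U \<phi> I f a = 0"
  unfolding chart_vanishes_def chart_partial_def
  by (rule mpartial_vanishes[OF chart_image_open[OF c V]]) auto

text \<open>The coordinate map stays the same and only the domain shrinks, so Hadamard's lemma on
  the cube can be combined with derivatives and frames belonging to the larger domain.\<close>

lemma cube_subchart:
  assumes "a \<in> V"
  obtains W r where "(W, \<phi>) \<in> atlas M" "opn W" "a \<in> W" "W \<subseteq> V" "\<phi> ` W = cube dm (\<phi> a) r"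
proof -
  obtain r where r: "r > 0" "cube dm (\<phi> a) r \<subseteq> \<phi> ` V"
    using cube_subset_open[OF chart_image_open[OF c V], of "\<phi> a"] assms by blast
  let ?W = "{x \<in> V. \<phi> x \<in> cube dm (\<phi> a) r}"
  have W: "opn ?W" by (rule chart_preimage_open[OF chart_restrict[OF c V] openin_cube])
  have "a \<in> ?W"
    using r(1) assms openin_Euclidean_zero[OF chart_image_open[OF c V], of "\<phi> a"] by (auto simp: cube_def)
  moreover have "\<phi> ` ?W = cube dm (\<phi> a) r" using r(2) by auto
  ultimately show thesis using that[of ?W r] W V chart_restrict[OF c, of ?W] by blast
qed

end

lemma cube_chart:
  assumes "opn W" "a \<in> W"
  obtains V \<phi> r where "(V, \<phi>) \<in> atlas M" "opn V" "a \<in> V" "V \<subseteq> W" "\<phi> ` V = cube dm (\<phi> a) r"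
proof -
  obtain U \<phi> where c: "(U, \<phi>) \<in> atlas M" "a \<in> U" using chart_cover assms opn_points by blast
  show thesis
    by (rule cube_subchart[OF c(1), of "U \<inter> W" a]) (use assms c chart_open[OF c(1)] that in auto)
qed

lemma chart_hadamard:
  assumes c: "(V, \<phi>) \<in> atlas M" and cube: "\<phi> ` V = cube dm b r" and a: "a \<in> V" and f: "smooth_fun M V f"
  obtains h where "\<And>i. i < dm ==> smooth_fun M V (h i)"
    "\<And>x. x \<in> V ==> f x = f a + (\<Sum>i<dm. (\<phi> x i - \<phi> a i) * h i x)"
proof -
  let ?f = "\<lambda>x. f (inv_into V \<phi> x)"
  have V: "opn V" using chart_open[OF c] .
  have sm: "smooth_Rn dm (cube dm b r) ?f" using smooth_Rn_chart[OF c V order_refl f] cube by simp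
  have aQ: "\<phi> a \<in> cube dm b r" using a cube by auto
  let ?h = "\<lambda>i x. hadamard (\<phi> a) i 0 (partial i ?f) (\<phi> x)"
  show thesis
  proof (rule that[of ?h])
    show "smooth_fun M V (?h i)" if "i < dm" for i
      by (intro smooth_fun_chartI[OF c V order_refl])
        (use cube aQ sm that in \<open>auto intro: smooth_Rn_hadamard smooth_Rn_partial\<close>)
    fix x assume x: "x \<in> V"
    hence "\<phi> x \<in> cube dm b r" using cube by auto
    from hadamard_sum[OF aQ sm this] show "f x = f a + (\<Sum>i<dm. (\<phi> x i - \<phi> a i) * ?h i x)"
      using x a chart_inv[OF c] by simp
  qed
qed

subsection \<open>The ring of smooth functions\<close>

lemma smooth_ring_simps:
  "fcts U = {f \<in> extensional U. smooth_fun M U f}"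
  "monoid.mult (smooth_ring M U) = (\<lambda>f g. \<lambda>x\<in>U. f x * g x)"
  "monoid.one (smooth_ring M U) = (\<lambda>x\<in>U. 1)"
  "ring.zero (smooth_ring M U) = (\<lambda>x\<in>U. 0)"
  "ring.add (smooth_ring M U) = (\<lambda>f g. \<lambda>x\<in>U. f x + g x)"
  "module.smult (smooth_ring M U) = (\<lambda>f g. \<lambda>x\<in>U. f x * g x)"
  "res (smooth_functions M) U V f = restrict f V"
  by (simp_all add: smooth_functions_def)

lemma restrict_smooth: "opn U ==> smooth_fun M U f ==> restrict f U \<in> fcts U"
  using smooth_fun_cong[of U f "restrict f U"] by (auto simp: smooth_ring_simps)

lemma smooth_ring_fun: "f \<in> fcts U ==> smooth_fun M U f"
  by (simp add: smooth_ring_simps)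

lemma cring_smooth_ring:
  assumes U: "opn U" shows "cring (smooth_ring M U)"
proof (rule cringI)
  let ?R = "smooth_ring M U"
  show "abelian_group ?R"
  proof (rule abelian_groupI)
    fix f assume f: "f \<in> carrier ?R"
    show "\<exists>g\<in>carrier ?R. g \<oplus>\<^bsub>?R\<^esub> f = \<zero>\<^bsub>?R\<^esub>"
      using f by (intro bexI[OF _ restrict_smooth[OF U smooth_fun_cmult[OF U, of f "-1"]]])
        (auto simp: smooth_ring_simps)
  qed (auto simp: smooth_ring_simps extensional_def fun_eq_iff add_ac
      intro!: restrict_smooth[OF U, unfolded smooth_ring_simps, THEN CollectD, THEN conjunct2]
       smooth_fun_add smooth_fun_const U)
  show "Group.comm_monoid ?R"
    by (rule comm_monoidI)
      (auto simp: smooth_ring_simps extensional_def fun_eq_iff mult_ac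
      intro!: restrict_smooth[OF U, unfolded smooth_ring_simps, THEN CollectD, THEN conjunct2]
       smooth_fun_mult smooth_fun_const U)
qed (auto simp: smooth_ring_simps fun_eq_iff algebra_simps)

lemma const_in_smooth_ring: "opn U ==> (\<lambda>x\<in>U. c) \<in> fcts U"
  by (intro restrict_smooth smooth_fun_const)

end

section \<open>Subgroups and quotients of modules\<close>

lemma additive_subgroupI':
  assumes P: "abelian_group P" and "N \<subseteq> carrier P" "\<zero>\<^bsub>P\<^esub> \<in> N"
    and "\<And>x y. x \<in> N ==> y \<in> N ==> x \<oplus>\<^bsub>P\<^esub> y \<in> N" "\<And>x. x \<in> N ==> \<ominus>\<^bsub>P\<^esub> x \<in> N"
  shows "additive_subgroup N P"
proof -
  interpret abelian_group P by fact
  show ?thesis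
    by (rule additive_subgroupI, rule add.subgroupI) (use assms in \<open>auto simp: a_inv_def\<close>)
qed

lemma (in abelian_group) inv_zero: "\<ominus> \<zero> = \<zero>"
  by (rule minus_equality) simp_all

lemma (in abelian_group) minus_eq_zero_iff:
  assumes "x \<in> carrier G" "y \<in> carrier G" shows "x \<ominus> y = \<zero> \<longleftrightarrow> x = y"
proof
  assume "x \<ominus> y = \<zero>"
  hence "\<ominus> (\<ominus> y) = x" using assms by (intro minus_equality) (auto simp: a_minus_def)
  thus "x = y" using assms by simp
qed (use assms in \<open>simp add: a_minus_def r_neg\<close>)

lemma additive_subgroup_generate:
  assumes P: "abelian_group P" and H: "H \<subseteq> carrier P"
  shows "additive_subgroup (generate (add_monoid P) H) P"
proof -
  interpret abelian_group P by fact
  show ?thesis by (rule additive_subgroupI, rule add.generate_is_subgroup) (use H in simp)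
qed

lemma generate_subset_additive_subgroup:
  assumes P: "abelian_group P" and S: "additive_subgroup S P" and H: "H \<subseteq> S"
  shows "generate (add_monoid P) H \<subseteq> S"
proof -
  interpret abelian_group P by fact
  show ?thesis by (rule add.generate_subgroup_incl[OF H additive_subgroup.a_subgroup[OF S]])
qed

lemma incl_generate: "x \<in> H ==> x \<in> generate (add_monoid P) H"
  by (rule generate.incl)

lemma additive_subgroup_preimage:
  assumes P: "abelian_group P" and Q: "abelian_group Q" and N: "additive_subgroup N Q"
    and h: "\<And>x. x \<in> carrier P ==> h x \<in> carrier Q"
    and add: "\<And>x y. x \<in> carrier P ==> y \<in> carrier P ==> h (x \<oplus>\<^bsub>P\<^esub> y) = h x \<oplus>\<^bsub>Q\<^esub> h y"
  shows "additive_subgroup {x \<in> carrier P. h x \<in> N} P"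
    and "h \<zero>\<^bsub>P\<^esub> = \<zero>\<^bsub>Q\<^esub>"
    and "\<And>x. x \<in> carrier P ==> h (\<ominus>\<^bsub>P\<^esub> x) = \<ominus>\<^bsub>Q\<^esub> h x"
    and "\<And>x y. x \<in> carrier P ==> y \<in> carrier P ==> h (x \<ominus>\<^bsub>P\<^esub> y) = h x \<ominus>\<^bsub>Q\<^esub> h y"
proof -
  interpret P: abelian_group P by fact
  interpret Q: abelian_group Q by fact
  interpret N: additive_subgroup N Q by fact
  show z: "h \<zero>\<^bsub>P\<^esub> = \<zero>\<^bsub>Q\<^esub>"
    using add[of "\<zero>\<^bsub>P\<^esub>" "\<zero>\<^bsub>P\<^esub>"] h[of "\<zero>\<^bsub>P\<^esub>"] Q.add.r_cancel_one by fastforce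
  show inv: "h (\<ominus>\<^bsub>P\<^esub> x) = \<ominus>\<^bsub>Q\<^esub> h x" if x: "x \<in> carrier P" for x
    using add[of "\<ominus>\<^bsub>P\<^esub> x" x] x h z by (intro Q.minus_equality[symmetric]) (auto simp: P.l_neg)
  show "h (x \<ominus>\<^bsub>P\<^esub> y) = h x \<ominus>\<^bsub>Q\<^esub> h y" if "x \<in> carrier P" "y \<in> carrier P" for x y
    using add[of x "\<ominus>\<^bsub>P\<^esub> y"] that inv by (simp add: a_minus_def)
  show "additive_subgroup {x \<in> carrier P. h x \<in> N} P"
    by (rule additive_subgroupI'[OF P]) (auto simp: add z inv)
qed

text \<open>Cosets and their addition depend on the additive group alone; the record may carry any
  scalar operation.\<close>

locale quotient_group = P: abelian_group P + N: additive_subgroup N P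
  for P :: "('r, 'a) module" and N
begin

sublocale S: abelian_subgroup N P
  by (rule abelian_subgroupI3) unfold_locales

abbreviation cl where "cl x \<equiv> N +>\<^bsub>P\<^esub> x"

lemma cl_eq_iff:
  assumes "x \<in> carrier P" "y \<in> carrier P" shows "cl x = cl y \<longleftrightarrow> x \<ominus>\<^bsub>P\<^esub> y \<in> N"
proof
  assume "cl x = cl y"
  hence "x \<in> cl y" using S.a_rcos_self[OF assms(1)] by simp
  then obtain h where "h \<in> N" "x = h \<oplus>\<^bsub>P\<^esub> y" by (auto simp: a_r_coset_def' )
  thus "x \<ominus>\<^bsub>P\<^esub> y \<in> N"
    using assms N.a_subset by (auto simp: a_minus_def P.a_assoc P.r_neg)
next
  assume h: "x \<ominus>\<^bsub>P\<^esub> y \<in> N"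
  have "x = (x \<ominus>\<^bsub>P\<^esub> y) \<oplus>\<^bsub>P\<^esub> y" using assms by (simp add: a_minus_def P.a_assoc P.l_neg)
  hence "x \<in> cl y" using h by (auto simp: a_r_coset_def')
  thus "cl x = cl y" using P.a_repr_independence[OF _ assms(2) N.a_subgroup] by simp
qed

lemma cl_mem: "x \<in> carrier P ==> y \<in> cl x ==> y \<in> carrier P \<and> cl y = cl x"
  using P.a_repr_independence[OF _ _ N.a_subgroup] P.a_r_coset_subset_G[OF N.a_subset] by blast

lemma cl_zero: "cl \<zero>\<^bsub>P\<^esub> = N"
  by (simp add: N.a_subset)

lemma quot_simps:
  "carrier (quot_mod P N) = cl ` carrier P"
  "\<zero>\<^bsub>quot_mod P N\<^esub> = N"
  by (auto simp: quot_mod_def A_RCOSETS_def')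

lemma quot_add:
  "x \<in> carrier P ==> y \<in> carrier P ==> cl x \<oplus>\<^bsub>quot_mod P N\<^esub> cl y = cl (x \<oplus>\<^bsub>P\<^esub> y)"
  by (simp add: quot_mod_def S.a_rcos_sum)

lemma abelian_group_quot: "abelian_group (quot_mod P N)"
proof (rule abelian_groupI; (unfold quot_simps)?)
  have cl0: "N = cl \<zero>\<^bsub>P\<^esub>" by (simp add: cl_zero)
  show "N \<in> cl ` carrier P" by (subst cl0) blast
  fix X assume "X \<in> cl ` carrier P"
  then obtain x where x: "x \<in> carrier P" "X = cl x" by auto
  have "cl (\<ominus>\<^bsub>P\<^esub> x) \<oplus>\<^bsub>quot_mod P N\<^esub> X = N"
    using x quot_add[of "\<ominus>\<^bsub>P\<^esub> x" x] cl0 by (simp add: P.l_neg)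
  thus "\<exists>Y\<in>cl ` carrier P. Y \<oplus>\<^bsub>quot_mod P N\<^esub> X = N" using x by blast
  show "N \<oplus>\<^bsub>quot_mod P N\<^esub> X = X"
    using x quot_add[of "\<zero>\<^bsub>P\<^esub>" x] cl0 by simp
  fix Y assume "Y \<in> cl ` carrier P"
  then obtain y where y: "y \<in> carrier P" "Y = cl y" by auto
  show "X \<oplus>\<^bsub>quot_mod P N\<^esub> Y \<in> cl ` carrier P" using x y quot_add by auto
  show "X \<oplus>\<^bsub>quot_mod P N\<^esub> Y = Y \<oplus>\<^bsub>quot_mod P N\<^esub> X"
    using x y quot_add P.a_comm by simp
  fix Z assume "Z \<in> cl ` carrier P"
  then obtain z where z: "z \<in> carrier P" "Z = cl z" by auto
  show "X \<oplus>\<^bsub>quot_mod P N\<^esub> Y \<oplus>\<^bsub>quot_mod P N\<^esub> Z = X \<oplus>\<^bsub>quot_mod P N\<^esub> (Y \<oplus>\<^bsub>quot_mod P N\<^esub> Z)"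
    using x y z quot_add P.a_assoc by simp
qed

text \<open>The union in \<open>quot_mod\<close> collapses because all representatives lead to the
  same coset. The hypotheses speak of a single scalar \<open>r\<close>, so that one germ acting on a
  stalk can be treated on its own.\<close>

lemma quot_smult:
  assumes add: "\<And>x y. x \<in> carrier P ==> y \<in> carrier P ==> r \<odot>\<^bsub>P\<^esub> (x \<oplus>\<^bsub>P\<^esub> y) = r \<odot>\<^bsub>P\<^esub> x \<oplus>\<^bsub>P\<^esub> r \<odot>\<^bsub>P\<^esub> y"
    and N: "\<And>x. x \<in> N ==> r \<odot>\<^bsub>P\<^esub> x \<in> N" and clos: "r \<odot>\<^bsub>P\<^esub> x \<in> carrier P" and x: "x \<in> carrier P"
  shows "r \<odot>\<^bsub>quot_mod P N\<^esub> cl x = cl (r \<odot>\<^bsub>P\<^esub> x)"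
proof -
  have "cl (r \<odot>\<^bsub>P\<^esub> y) = cl (r \<odot>\<^bsub>P\<^esub> x)" if y: "y \<in> cl x" for y
  proof -
    obtain h where h: "h \<in> N" "y = h \<oplus>\<^bsub>P\<^esub> x" using y by (auto simp: a_r_coset_def')
    hence "r \<odot>\<^bsub>P\<^esub> y = r \<odot>\<^bsub>P\<^esub> h \<oplus>\<^bsub>P\<^esub> r \<odot>\<^bsub>P\<^esub> x" using add[of h x] x N.a_subset by blast
    hence "r \<odot>\<^bsub>P\<^esub> y \<in> cl (r \<odot>\<^bsub>P\<^esub> x)" using N[OF h(1)] unfolding a_r_coset_def' by blast
    thus ?thesis using cl_mem[OF clos] by blast
  qed
  hence "(\<Union>y\<in>cl x. cl (r \<odot>\<^bsub>P\<^esub> y)) = cl (r \<odot>\<^bsub>P\<^esub> x)" using S.a_rcos_self[OF x] by blast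
  thus ?thesis by (simp add: quot_mod_def)
qed

lemma quot_map_cl:
  assumes "\<And>y. y \<in> cl x ==> N' +>\<^bsub>P'\<^esub> h y = N' +>\<^bsub>P'\<^esub> h x" "x \<in> carrier P"
  shows "quot_map P' N' h (cl x) = N' +>\<^bsub>P'\<^esub> h x"
  unfolding quot_map_def using assms(1) S.a_rcos_self[OF assms(2)] by blast

end

lemma additive_subgroup_finsum:
  assumes P: "abelian_group P" and N: "additive_subgroup N P" and f: "\<And>i. i \<in> A ==> f i \<in> N"
  shows "finsum P f A \<in> N"
proof -
  interpret abelian_group P by fact
  show ?thesis
    using f
  proof (induction A rule: infinite_finite_induct)
    case (insert x A)
    have "f \<in> A \<rightarrow> carrier P" "f x \<in> carrier P" using insert.prems additive_subgroup.a_subset[OF N] by blast+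
    hence "finsum P f (insert x A) = f x \<oplus>\<^bsub>P\<^esub> finsum P f A" by (rule finsum_insert[OF insert.hyps])
    thus ?case using additive_subgroup.a_closed[OF N] insert by simp
  qed (auto simp: finsum_infinite additive_subgroup.zero_closed[OF N])
qed

section \<open>Powers of ideals acting on a module\<close>

locale smodule = module R M for R :: "('r, 'x) ring_scheme" and M :: "('r, 'a) module"
begin

lemma ideal_products_subset: "I \<subseteq> carrier R ==> ideal_products M I q \<subseteq> carrier M"
  by (induction q) auto

lemma ideal_power_additive_subgroup: "I \<subseteq> carrier R ==> additive_subgroup (ideal_power_mod M I q) M"
  unfolding ideal_power_mod_def
  by (rule additive_subgroup_generate[OF abelian_group_axioms ideal_products_subset])

end

text \<open>Replaces the generators, which are iterated products, by products with an arbitrary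
  element of the previous power; inductions over powers proceed in this form.\<close>

lemma (in smodule) ideal_power_Suc_subset:
  assumes I: "I \<subseteq> carrier R" and S: "additive_subgroup S M"
    and *: "\<And>f x. f \<in> I ==> x \<in> ideal_power_mod M I q ==> f \<odot>\<^bsub>M\<^esub> x \<in> S"
  shows "ideal_power_mod M I (Suc q) \<subseteq> S"
  unfolding ideal_power_mod_def
  by (rule generate_subset_additive_subgroup[OF abelian_group_axioms S])
    (use * in \<open>auto simp: ideal_power_mod_def incl_generate\<close>)

lemma (in smodule) additive_subgroup_smult_preimage:
  assumes S: "additive_subgroup S M" and f: "f \<in> carrier R"
  shows "additive_subgroup {x \<in> carrier M. f \<odot>\<^bsub>M\<^esub> x \<in> S} M"
  by (rule additive_subgroup_preimage[OF abelian_group_axioms abelian_group_axioms S])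
    (use f in \<open>auto simp: smult_r_distr\<close>)

lemma (in smodule) ideal_power_smult:
  assumes I: "I \<subseteq> carrier R" and f: "f \<in> I" and x: "x \<in> ideal_power_mod M I q"
  shows "f \<odot>\<^bsub>M\<^esub> x \<in> ideal_power_mod M I (Suc q)"
proof -
  have "ideal_power_mod M I q \<subseteq> {x \<in> carrier M. f \<odot>\<^bsub>M\<^esub> x \<in> ideal_power_mod M I (Suc q)}"
    unfolding ideal_power_mod_def[of M I q]
  proof (rule generate_subset_additive_subgroup[OF abelian_group_axioms])
    show "additive_subgroup {x \<in> carrier M. f \<odot>\<^bsub>M\<^esub> x \<in> ideal_power_mod M I (Suc q)} M"
      by (rule additive_subgroup_smult_preimage[OF ideal_power_additive_subgroup[OF I]]) (use f I in auto)
    show "ideal_products M I q \<subseteq> {x \<in> carrier M. f \<odot>\<^bsub>M\<^esub> x \<in> ideal_power_mod M I (Suc q)}"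
      using f ideal_products_subset[OF I] by (auto simp: ideal_power_mod_def intro!: incl_generate)
  qed
  thus ?thesis using x by auto
qed

lemma (in smodule) ideal_power_closed:
  assumes I: "I \<subseteq> carrier R" and f: "f \<in> carrier R" and x: "x \<in> ideal_power_mod M I q"
  shows "f \<odot>\<^bsub>M\<^esub> x \<in> ideal_power_mod M I q"
proof -
  have prod: "f \<odot>\<^bsub>M\<^esub> y \<in> ideal_products M I q" if "y \<in> ideal_products M I q" for y
    using that
  proof (induction q arbitrary: y)
    case 0
    thus ?case using f by simp
  next
    case (Suc q)
    then obtain g z where g: "g \<in> I" "z \<in> ideal_products M I q" "y = g \<odot>\<^bsub>M\<^esub> z" by auto
    have "z \<in> carrier M" "g \<in> carrier R" using g ideal_products_subset[OF I] I by auto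
    hence "f \<odot>\<^bsub>M\<^esub> y = g \<odot>\<^bsub>M\<^esub> (f \<odot>\<^bsub>M\<^esub> z)"
      using f g(3) smult_assoc1[of f g z] smult_assoc1[of g f z] R.m_comm[of f g] by simp
    thus ?case using Suc.IH[OF g(2)] g(1) by auto
  qed
  have "ideal_power_mod M I q \<subseteq> {x \<in> carrier M. f \<odot>\<^bsub>M\<^esub> x \<in> ideal_power_mod M I q}"
    unfolding ideal_power_mod_def[of M I q]
    by (rule generate_subset_additive_subgroup[OF abelian_group_axioms
          additive_subgroup_smult_preimage[OF _ f]])
      (use ideal_products_subset[OF I] prod in
        \<open>auto simp: ideal_power_mod_def intro!: incl_generate additive_subgroup_generate abelian_group_axioms\<close>)
  thus ?thesis using x by auto
qed

lemma (in smodule) ideal_power_0: "ideal_power_mod M I 0 = carrier M"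
proof
  show "ideal_power_mod M I 0 \<subseteq> carrier M"
    unfolding ideal_power_mod_def
    by (rule generate_subset_additive_subgroup[OF abelian_group_axioms]) (auto intro!: additive_subgroupI' abelian_group_axioms)
qed (auto simp: ideal_power_mod_def intro: incl_generate)

text \<open>\<open>h\<close> is only semilinear: the scalars change along \<open>\<rho>\<close>, as
  happens when sections and functions are restricted together.\<close>

lemma ideal_power_hom:
  assumes M: "module R M" and N: "module S N" and I: "I \<subseteq> carrier R" and J: "J \<subseteq> carrier S"
    and \<rho>: "\<And>f. f \<in> I ==> \<rho> f \<in> J"
    and h: "\<And>x. x \<in> carrier M ==> h x \<in> carrier N"
    and add: "\<And>x y. x \<in> carrier M ==> y \<in> carrier M ==> h (x \<oplus>\<^bsub>M\<^esub> y) = h x \<oplus>\<^bsub>N\<^esub> h y"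
    and smult: "\<And>f x. f \<in> I ==> x \<in> carrier M ==> h (f \<odot>\<^bsub>M\<^esub> x) = \<rho> f \<odot>\<^bsub>N\<^esub> h x"
    and x: "x \<in> ideal_power_mod M I q"
  shows "h x \<in> ideal_power_mod N J q"
proof -
  interpret M: smodule R M by (rule smodule.intro) fact
  interpret N: smodule S N by (rule smodule.intro) fact
  have "ideal_power_mod M I q \<subseteq> {x \<in> carrier M. h x \<in> ideal_power_mod N J q}"
  proof (induction q)
    case 0
    thus ?case using h by (auto simp: M.ideal_power_0 N.ideal_power_0)
  next
    case (Suc q)
    show ?case
    proof (rule M.ideal_power_Suc_subset[OF I])
      show "additive_subgroup {x \<in> carrier M. h x \<in> ideal_power_mod N J (Suc q)} M"
        by (rule additive_subgroup_preimage[OF M.abelian_group_axioms N.abelian_group_axioms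
              N.ideal_power_additive_subgroup[OF J]]) (use h add in auto)
      fix f x assume "f \<in> I" "x \<in> ideal_power_mod M I q"
      thus "f \<odot>\<^bsub>M\<^esub> x \<in> {x \<in> carrier M. h x \<in> ideal_power_mod N J (Suc q)}"
        using Suc I smult \<rho> N.ideal_power_smult[OF J] by auto
    qed
  qed
  thus ?thesis using x by auto
qed

section \<open>Presentations of modules by additive groups\<close>

text \<open>
  The map \<open>\<pi>\<close> exhibits the module P as the quotient of the subgroup F of an ordinary additive group
  by N; the action on P comes from the operators \<open>act r\<close> on F.
\<close>

definition presents ::
  "'r set => ('r, 'a) module => 'b::ab_group_add set => ('r => 'b => 'b) => ('b => 'a) => 'b set => bool" where
  "presents R P F act \<pi> N \<longleftrightarrow>
     abelian_group P \<and> \<pi> ` F = carrier P \<and> 0 \<in> F \<and> (\<forall>x\<in>F. \<forall>y\<in>F. x + y \<in> F) \<and> (\<forall>x\<in>F. - x \<in> F) \<and>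
     (\<forall>x\<in>F. \<forall>y\<in>F. \<pi> (x + y) = \<pi> x \<oplus>\<^bsub>P\<^esub> \<pi> y) \<and>
     (\<forall>r\<in>R. \<forall>x\<in>F. act r x \<in> F \<and> \<pi> (act r x) = r \<odot>\<^bsub>P\<^esub> \<pi> x) \<and>
     (\<forall>r\<in>R. \<forall>x\<in>F. \<forall>y\<in>F. act r (x + y) = act r x + act r y) \<and>
     N \<subseteq> F \<and> (\<forall>x\<in>F. \<pi> x = \<zero>\<^bsub>P\<^esub> \<longleftrightarrow> x \<in> N)"

locale presentation =
  fixes R :: "'r set" and P :: "('r, 'a) module" and F :: "'b::ab_group_add set" and act \<pi> N
  assumes presents: "presents R P F act \<pi> N"
begin

sublocale P: abelian_group P using presents by (simp add: presents_def)

lemma F_zero [simp]: "0 \<in> F" and F_add [simp]: "x \<in> F ==> y \<in> F ==> x + y \<in> F"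
  and F_uminus [simp]: "x \<in> F ==> - x \<in> F"
  and pi_image: "\<pi> ` F = carrier P"
  and pi_add: "x \<in> F ==> y \<in> F ==> \<pi> (x + y) = \<pi> x \<oplus>\<^bsub>P\<^esub> \<pi> y"
  and act_F [simp]: "r \<in> R ==> x \<in> F ==> act r x \<in> F"
  and pi_act: "r \<in> R ==> x \<in> F ==> \<pi> (act r x) = r \<odot>\<^bsub>P\<^esub> \<pi> x"
  and act_add: "r \<in> R ==> x \<in> F ==> y \<in> F ==> act r (x + y) = act r x + act r y"
  and pi_zero_iff: "x \<in> F ==> \<pi> x = \<zero>\<^bsub>P\<^esub> \<longleftrightarrow> x \<in> N"
  and N_subset: "N \<subseteq> F"
  using presents unfolding presents_def by blast+

lemma F_diff [simp]: "x \<in> F ==> y \<in> F ==> x - y \<in> F"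
  using F_add[of x "- y"] by simp

lemma pi_closed [simp]: "x \<in> F ==> \<pi> x \<in> carrier P"
  using pi_image by auto

lemma pi_zero: "\<pi> 0 = \<zero>\<^bsub>P\<^esub>"
proof -
  have "\<pi> 0 \<oplus>\<^bsub>P\<^esub> \<pi> 0 = \<pi> 0" using pi_add[of 0 0] by simp
  thus ?thesis using P.add.r_cancel_one[of "\<pi> 0" "\<pi> 0"] by simp
qed

lemma pi_uminus: "x \<in> F ==> \<pi> (- x) = \<ominus>\<^bsub>P\<^esub> \<pi> x"
  using pi_add[of "- x" x] by (intro P.minus_equality[symmetric]) (auto simp: pi_zero)

lemma pi_diff: "x \<in> F ==> y \<in> F ==> \<pi> (x - y) = \<pi> x \<ominus>\<^bsub>P\<^esub> \<pi> y"
  using pi_add[of x "- y"] by (simp add: pi_uminus a_minus_def)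

lemma N_zero [simp]: "0 \<in> N" using pi_zero pi_zero_iff by simp

lemma N_add: "x \<in> N ==> y \<in> N ==> x + y \<in> N"
  using pi_zero_iff[of x] pi_zero_iff[of y] pi_zero_iff[of "x + y"] pi_add[of x y] N_subset by auto

lemma N_uminus: "x \<in> N ==> - x \<in> N"
  using pi_zero_iff[of x] pi_zero_iff[of "- x"] pi_uminus[of x] N_subset by auto

lemma pi_eq_iff: "x \<in> F ==> y \<in> F ==> \<pi> x = \<pi> y \<longleftrightarrow> x - y \<in> N"
  using pi_zero_iff[of "x - y"] pi_diff[of x y] by (simp add: P.minus_eq_zero_iff)

text \<open>A further quotient keeps the group \<open>F\<close> and the operators on it, hence all
  computations with representatives; only the kernel grows. The successive quotients that make up
  the algebraic jets are obtained by iterating this, starting from the free group.\<close>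

lemma presents_quot:
  assumes K: "additive_subgroup K P" and smult: "\<And>r x. r \<in> R ==> x \<in> K ==> r \<odot>\<^bsub>P\<^esub> x \<in> K"
  shows "presents R (quot_mod P K) F act (\<lambda>x. K +>\<^bsub>P\<^esub> \<pi> x) {x \<in> F. \<pi> x \<in> K}"
proof -
  interpret quotient_group P K by (intro quotient_group.intro K P.abelian_group_axioms)
  have add: "r \<odot>\<^bsub>P\<^esub> (x \<oplus>\<^bsub>P\<^esub> y) = r \<odot>\<^bsub>P\<^esub> x \<oplus>\<^bsub>P\<^esub> r \<odot>\<^bsub>P\<^esub> y"
    if r: "r \<in> R" and x: "x \<in> \<pi> ` F" and y: "y \<in> \<pi> ` F" for r x y
  proof -
    obtain u where u: "u \<in> F" "x = \<pi> u" using x by blast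
    obtain v where v: "v \<in> F" "y = \<pi> v" using y by blast
    show ?thesis using r u v by (simp add: pi_act[symmetric] pi_add[symmetric] act_add)
  qed
  have zero_iff: "cl (\<pi> x) = K \<longleftrightarrow> \<pi> x \<in> K" if "x \<in> F" for x
    using cl_eq_iff[of "\<pi> x" "\<zero>\<^bsub>P\<^esub>"] that cl_zero P.inv_zero by (simp add: a_minus_def)
  have smult': "r \<odot>\<^bsub>quot_mod P K\<^esub> cl (\<pi> x) = cl (\<pi> (act r x))" if "r \<in> R" "x \<in> F" for r x
    using quot_smult[of r "\<pi> x", OF add[unfolded pi_image] smult] that pi_act[of r x] pi_closed[of "act r x"] by simp
  have image: "(\<lambda>x. cl (\<pi> x)) ` F = carrier (quot_mod P K)"
    unfolding quot_simps pi_image[symmetric] by blast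
  show ?thesis unfolding presents_def quot_simps(2)
  proof (intro conjI ballI)
    show "cl (\<pi> (x + y)) = cl (\<pi> x) \<oplus>\<^bsub>quot_mod P K\<^esub> cl (\<pi> y)" if "x \<in> F" "y \<in> F" for x y
      using that by (simp add: quot_add pi_add)
    show "cl (\<pi> x) = K \<longleftrightarrow> x \<in> {x \<in> F. \<pi> x \<in> K}" if "x \<in> F" for x
      using zero_iff[OF that] that by simp
  qed (use abelian_group_quot image smult' act_add in auto)
qed

text \<open>On representatives the module laws hold only up to the kernel. Distributivity over the
  scalars, for instance, fails for formal combinations and becomes true after dividing by the tensor
  relations.\<close>

lemma module_presented:
  assumes "cring S" "carrier S = R"
    and one: "\<And>x. x \<in> F ==> act \<one>\<^bsub>S\<^esub> x - x \<in> N"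
    and mult: "\<And>r s x. r \<in> R ==> s \<in> R ==> x \<in> F ==> act (r \<otimes>\<^bsub>S\<^esub> s) x - act r (act s x) \<in> N"
    and add: "\<And>r s x. r \<in> R ==> s \<in> R ==> x \<in> F ==> act (r \<oplus>\<^bsub>S\<^esub> s) x - (act r x + act s x) \<in> N"
  shows "module S P"
proof -
  interpret S: cring S by fact
  have rep: "\<exists>u. u \<in> F \<and> x = \<pi> u" if "x \<in> carrier P" for x using that pi_image by auto
  show ?thesis
  proof (rule moduleI[OF assms(1) P.abelian_group_axioms])
    fix x assume x: "x \<in> carrier P"
    obtain u where u: "u \<in> F" "x = \<pi> u" using rep[OF x] by auto
    show "\<one>\<^bsub>S\<^esub> \<odot>\<^bsub>P\<^esub> x = x"
      using u assms(2) pi_act[of "\<one>\<^bsub>S\<^esub>" u] one[OF u(1)] pi_eq_iff[of "act \<one>\<^bsub>S\<^esub> u" u] by auto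
    fix r assume r: "r \<in> carrier S"
    show "r \<odot>\<^bsub>P\<^esub> x \<in> carrier P" using u r pi_act[of r u] assms(2) pi_closed[of "act r u"] by simp
    {
      fix s assume s: "s \<in> carrier S"
      note rs = r[unfolded assms(2)] s[unfolded assms(2)]
      have rs': "r \<oplus>\<^bsub>S\<^esub> s \<in> R" "r \<otimes>\<^bsub>S\<^esub> s \<in> R" using r s assms(2) by auto
      show "(r \<oplus>\<^bsub>S\<^esub> s) \<odot>\<^bsub>P\<^esub> x = r \<odot>\<^bsub>P\<^esub> x \<oplus>\<^bsub>P\<^esub> s \<odot>\<^bsub>P\<^esub> x"
        using u rs rs' add[OF rs u(1)] pi_eq_iff[of "act (r \<oplus>\<^bsub>S\<^esub> s) u" "act r u + act s u"]
        by (simp add: pi_act[symmetric] pi_add[symmetric])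
      show "(r \<otimes>\<^bsub>S\<^esub> s) \<odot>\<^bsub>P\<^esub> x = r \<odot>\<^bsub>P\<^esub> (s \<odot>\<^bsub>P\<^esub> x)"
        using u rs rs' mult[OF rs u(1)] pi_eq_iff[of "act (r \<otimes>\<^bsub>S\<^esub> s) u" "act r (act s u)"]
        by (simp add: pi_act[symmetric])
    }
    fix y assume y: "y \<in> carrier P"
    obtain v where v: "v \<in> F" "y = \<pi> v" using rep[OF y] by auto
    show "r \<odot>\<^bsub>P\<^esub> (x \<oplus>\<^bsub>P\<^esub> y) = r \<odot>\<^bsub>P\<^esub> x \<oplus>\<^bsub>P\<^esub> r \<odot>\<^bsub>P\<^esub> y"
      using u v r[unfolded assms(2)] by (simp add: pi_act[symmetric] pi_add[symmetric] act_add)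
  qed
qed

end

section \<open>Presheaves of modules, stalks and jets\<close>

text \<open>The axioms are those of a presheaf of modules, so that \<open>gpJet\<close>, which still
  has to be sheafified, is an instance along with functions, sections and the sheaf of jets.\<close>

locale module_presheaf = smooth_mfd M for M :: "'m manifold" +
  fixes F :: "('m, 's) presheaf"
  assumes sec_module: "openin (mtop M) U ==> module (smooth_ring M U) (sec F U)"
    and res_closed: "openin (mtop M) U ==> openin (mtop M) V ==> V \<subseteq> U ==> s \<in> carrier (sec F U) ==>
      res F U V s \<in> carrier (sec F V)"
    and res_add: "openin (mtop M) U ==> openin (mtop M) V ==> V \<subseteq> U ==> s \<in> carrier (sec F U) ==>
      t \<in> carrier (sec F U) ==> res F U V (s \<oplus>\<^bsub>sec F U\<^esub> t) = res F U V s \<oplus>\<^bsub>sec F V\<^esub> res F U V t"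
    and res_smult: "openin (mtop M) U ==> openin (mtop M) V ==> V \<subseteq> U ==> f \<in> carrier (smooth_ring M U) ==>
      s \<in> carrier (sec F U) ==> res F U V (f \<odot>\<^bsub>sec F U\<^esub> s) = restrict f V \<odot>\<^bsub>sec F V\<^esub> res F U V s"
    and res_id: "openin (mtop M) U ==> s \<in> carrier (sec F U) ==> res F U U s = s"
    and res_res: "openin (mtop M) U ==> openin (mtop M) V ==> openin (mtop M) W ==> W \<subseteq> V ==> V \<subseteq> U ==>
      s \<in> carrier (sec F U) ==> res F V W (res F U V s) = res F U W s"
begin

abbreviation sects where "sects U \<equiv> carrier (sec F U)"

lemma sec_smodule: "opn U ==> smodule (smooth_ring M U) (sec F U)"
  by (rule smodule.intro[OF sec_module])

lemma sec_abelian_group: "opn U ==> abelian_group (sec F U)"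
  using sec_module module.axioms(2) by blast

lemma sec_closed:
  assumes "opn U"
  shows "\<zero>\<^bsub>sec F U\<^esub> \<in> sects U"
    and "s \<in> sects U ==> t \<in> sects U ==> s \<oplus>\<^bsub>sec F U\<^esub> t \<in> sects U"
    and "s \<in> sects U ==> t \<in> sects U ==> s \<ominus>\<^bsub>sec F U\<^esub> t \<in> sects U"
    and "s \<in> sects U ==> \<ominus>\<^bsub>sec F U\<^esub> s \<in> sects U"
    and "f \<in> fcts U ==> s \<in> sects U ==> f \<odot>\<^bsub>sec F U\<^esub> s \<in> sects U"
proof -
  interpret smodule "smooth_ring M U" "sec F U" by (rule sec_smodule[OF assms])
  show "\<zero>\<^bsub>sec F U\<^esub> \<in> sects U"
    and "s \<in> sects U ==> t \<in> sects U ==> s \<oplus>\<^bsub>sec F U\<^esub> t \<in> sects U"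
    and "s \<in> sects U ==> t \<in> sects U ==> s \<ominus>\<^bsub>sec F U\<^esub> t \<in> sects U"
    and "s \<in> sects U ==> \<ominus>\<^bsub>sec F U\<^esub> s \<in> sects U"
    and "f \<in> fcts U ==> s \<in> sects U ==> f \<odot>\<^bsub>sec F U\<^esub> s \<in> sects U"
    by auto
qed

lemma res_group:
  assumes "opn U" "opn V" "V \<subseteq> U"
  shows "res F U V \<zero>\<^bsub>sec F U\<^esub> = \<zero>\<^bsub>sec F V\<^esub>"
    and "s \<in> sects U ==> res F U V (\<ominus>\<^bsub>sec F U\<^esub> s) = \<ominus>\<^bsub>sec F V\<^esub> res F U V s"
    and "s \<in> sects U ==> t \<in> sects U ==>
      res F U V (s \<ominus>\<^bsub>sec F U\<^esub> t) = res F U V s \<ominus>\<^bsub>sec F V\<^esub> res F U V t"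
proof -
  interpret V: abelian_group "sec F V" by (rule sec_abelian_group[OF assms(2)])
  have "additive_subgroup (sects V) (sec F V)"
    by (rule additive_subgroupI'[OF V.abelian_group_axioms]) auto
  note * = additive_subgroup_preimage[OF sec_abelian_group[OF assms(1)] V.abelian_group_axioms this, of "res F U V"]
  show "res F U V \<zero>\<^bsub>sec F U\<^esub> = \<zero>\<^bsub>sec F V\<^esub>"
    by (rule *(2)) (use res_closed res_add assms in auto)
  show "s \<in> sects U ==> res F U V (\<ominus>\<^bsub>sec F U\<^esub> s) = \<ominus>\<^bsub>sec F V\<^esub> res F U V s"
    by (rule *(3)) (use res_closed res_add assms in auto)
  show "s \<in> sects U ==> t \<in> sects U ==>
      res F U V (s \<ominus>\<^bsub>sec F U\<^esub> t) = res F U V s \<ominus>\<^bsub>sec F V\<^esub> res F U V t"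
    by (rule *(4)) (use res_closed res_add assms in auto)
qed

section \<open>Germs and stalks\<close>

abbreviation section_at :: "'m => 'm set => 's => bool" where
  "section_at a U s \<equiv> opn U \<and> a \<in> U \<and> s \<in> sects U"

lemma section_at_res: "section_at a U s ==> opn V ==> a \<in> V ==> V \<subseteq> U ==> section_at a V (res F U V s)"
  by (auto intro: res_closed)

lemma germ_memD: "section_at a U s ==> (V, t) \<in> germ M F a U s ==> section_at a V t"
  by (auto simp: germ_def)

lemma germ_self: "section_at a U s ==> (U, s) \<in> germ M F a U s"
  by (auto simp: germ_def)

lemma agree_smaller:
  assumes "section_at a U s" "section_at a V t" "opn W" "W \<subseteq> U \<inter> V" "res F U W s = res F V W t" "opn W'" "W' \<subseteq> W"
  shows "res F U W' s = res F V W' t"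
  using assms res_res[of U W W' s] res_res[of V W W' t] by auto

lemma germ_eqI:
  assumes s: "section_at a U s" and t: "section_at a V t"
    and W: "opn W" "a \<in> W" "W \<subseteq> U \<inter> V" "res F U W s = res F V W t"
  shows "germ M F a U s = germ M F a V t"
proof -
  have *: "germ M F a U s \<subseteq> germ M F a V t"
    if s: "section_at a U s" and t: "section_at a V t"
      and W: "opn W" "a \<in> W" "W \<subseteq> U \<inter> V" "res F U W s = res F V W t" for U V s t
  proof
    fix p assume p: "p \<in> germ M F a U s"
    obtain V' r where pr: "p = (V', r)" by (cases p)
    hence r: "section_at a V' r" using p germ_memD[OF s] by blast
    obtain W' where W': "opn W'" "a \<in> W'" "W' \<subseteq> U \<inter> V'" "res F U W' s = res F V' W' r"
      using p pr by (auto simp: germ_def)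
    have I: "opn (W \<inter> W')" using W W' by auto
    have "res F V (W \<inter> W') t = res F V' (W \<inter> W') r"
      using agree_smaller[OF s t W(1,3,4) I] agree_smaller[OF s r W'(1,3,4) I] by auto
    hence "\<exists>W. opn W \<and> a \<in> W \<and> W \<subseteq> V \<inter> V' \<and> res F V W t = res F V' W r"
      using I W W' by (intro exI[of _ "W \<inter> W'"]) auto
    thus "p \<in> germ M F a V t" using r by (auto simp: germ_def pr)
  qed
  show ?thesis using *[OF s t W] *[OF t s W(1,2) _ W(4)[symmetric]] W(3) by auto
qed

lemma germ_eqD:
  assumes "section_at a U s" "section_at a V t" "germ M F a U s = germ M F a V t"
  obtains W where "opn W" "a \<in> W" "W \<subseteq> U \<inter> V" "res F U W s = res F V W t"
proof -
  have "(V, t) \<in> germ M F a U s" using germ_self assms by blast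
  thus thesis using that by (auto simp: germ_def)
qed

lemma germ_res:
  assumes "section_at a U s" "opn V" "a \<in> V" "V \<subseteq> U"
  shows "germ M F a V (res F U V s) = germ M F a U s"
  by (rule germ_eqI[where W = V]) (use assms section_at_res res_id res_res in auto)

lemma stalk_carrier: "carrier (stalk M F a) = {germ M F a U s | U s. section_at a U s}"
  by (simp add: stalk_def)

lemma germ_in_stalk: "section_at a U s ==> germ M F a U s \<in> carrier (stalk M F a)"
  by (auto simp: stalk_carrier)

text \<open>\<open>germ_op\<close> is a union over all pairs of representatives; naturality of
  \<open>opr\<close> under restriction shows that each pair contributes the same germ. Two
  presheaves occur because scalars and sections may live in different ones.\<close>

lemma germ_op_eq:
  assumes G: "module_presheaf M G"
    and closed: "\<And>W r s. opn W ==> r \<in> carrier (sec G W) ==> s \<in> sects W ==> opr W r s \<in> sects W"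
    and nat: "\<And>W W' r s. opn W ==> opn W' ==> W' \<subseteq> W ==> r \<in> carrier (sec G W) ==> s \<in> sects W ==>
      res F W W' (opr W r s) = opr W' (res G W W' r) (res F W W' s)"
    and r: "opn U" "a \<in> U" "r \<in> carrier (sec G U)" and s: "section_at a V s"
  shows "germ_op M G F a opr (germ M G a U r) (germ M F a V s) =
    germ M F a (U \<inter> V) (opr (U \<inter> V) (res G U (U \<inter> V) r) (res F V (U \<inter> V) s))"
proof -
  interpret G: module_presheaf M G by fact
  let ?g = "\<lambda>(U, r) (V, s). germ M F a (U \<inter> V) (opr (U \<inter> V) (res G U (U \<inter> V) r) (res F V (U \<inter> V) s))"
  have sec: "section_at a (U \<inter> V) (opr (U \<inter> V) (res G U (U \<inter> V) r) (res F V (U \<inter> V) s))"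
    if "G.section_at a U r" "section_at a V s" for U V r s
    using that by (auto intro!: closed G.res_closed res_closed)
  have eq: "?g (U', r') (V', s') = ?g (U, r) (V, s)"
    if r': "(U', r') \<in> germ M G a U r" and s': "(V', s') \<in> germ M F a V s" for U' r' V' s'
  proof -
    have R: "G.section_at a U r" using r by auto
    have R': "G.section_at a U' r'" by (rule G.germ_memD[OF R r'])
    have S': "section_at a V' s'" by (rule germ_memD[OF s s'])
    obtain W1 where W1: "opn W1" "a \<in> W1" "W1 \<subseteq> U \<inter> U'" "res G U W1 r = res G U' W1 r'"
      using r' by (auto simp: germ_def)
    obtain W2 where W2: "opn W2" "a \<in> W2" "W2 \<subseteq> V \<inter> V'" "res F V W2 s = res F V' W2 s'"
      using s' by (auto simp: germ_def)
    let ?W = "W1 \<inter> W2"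
    have W: "opn ?W" using W1 W2 by auto
    have rr: "res G U ?W r = res G U' ?W r'" by (rule G.agree_smaller[OF R R' W1(1,3,4) W]) auto
    have ss: "res F V ?W s = res F V' ?W s'" by (rule agree_smaller[OF s S' W2(1,3,4) W]) auto
    have restr: "res F (U \<inter> V) ?W (opr (U \<inter> V) (res G U (U \<inter> V) r) (res F V (U \<inter> V) s)) =
        opr ?W (res G U ?W r) (res F V ?W s)"
      if "G.section_at a U r" "section_at a V s" "?W \<subseteq> U \<inter> V" for U V r s
      using that W nat[of "U \<inter> V" ?W "res G U (U \<inter> V) r" "res F V (U \<inter> V) s"]
        G.res_res[of U "U \<inter> V" ?W r] res_res[of V "U \<inter> V" ?W s] by (auto intro: res_closed G.res_closed)
    show ?thesis unfolding prod.case
    proof (rule germ_eqI[OF sec[OF R' S'] sec[OF R s] W])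
      show "res F (U' \<inter> V') ?W (opr (U' \<inter> V') (res G U' (U' \<inter> V') r') (res F V' (U' \<inter> V') s')) =
          res F (U \<inter> V) ?W (opr (U \<inter> V) (res G U (U \<inter> V) r) (res F V (U \<inter> V) s))"
        using restr[OF R' S'] restr[OF R s] rr ss W1 W2 by (simp add: le_infI1 le_infI2)
    qed (use W1 W2 in auto)
  qed
  have mem: "(U, r) \<in> germ M G a U r" "(V, s) \<in> germ M F a V s"
    using G.germ_self germ_self r s by auto
  have "germ_op M G F a opr (germ M G a U r) (germ M F a V s) =
      (\<Union>p\<in>germ M G a U r. \<Union>q\<in>germ M F a V s. ?g p q)"
    by (simp add: germ_op_def case_prod_unfold)
  also have "\<dots> = ?g (U, r) (V, s)"
  proof
    show "(\<Union>p\<in>germ M G a U r. \<Union>q\<in>germ M F a V s. ?g p q) \<subseteq> ?g (U, r) (V, s)"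
    proof (rule UN_least, rule UN_least)
      fix p q assume "p \<in> germ M G a U r" "q \<in> germ M F a V s"
      hence "?g p q = ?g (U, r) (V, s)"
        by (cases p; cases q) (use eq in blast)
      thus "?g p q \<subseteq> ?g (U, r) (V, s)" by simp
    qed
    show "?g (U, r) (V, s) \<subseteq> (\<Union>p\<in>germ M G a U r. \<Union>q\<in>germ M F a V s. ?g p q)"
      using mem by blast
  qed
  finally show ?thesis by simp
qed

lemma stalk_add:
  assumes "section_at a U s" "section_at a U t"
  shows "germ M F a U s \<oplus>\<^bsub>stalk M F a\<^esub> germ M F a U t = germ M F a U (s \<oplus>\<^bsub>sec F U\<^esub> t)"
  using germ_op_eq[where opr = "\<lambda>W. ring.add (sec F W)", OF module_presheaf_axioms sec_closed(2) res_add, of U a s U t] assms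
  by (auto simp: stalk_def res_id)

lemma stalk_rep:
  assumes "x \<in> carrier (stalk M F a)" "y \<in> carrier (stalk M F a)"
  obtains U s t where "section_at a U s" "section_at a U t" "x = germ M F a U s" "y = germ M F a U t"
proof -
  obtain U s V t where s: "section_at a U s" "x = germ M F a U s" and t: "section_at a V t" "y = germ M F a V t"
    using assms by (auto simp: stalk_carrier)
  have W: "opn (U \<inter> V)" "a \<in> U \<inter> V" using s t by auto
  show thesis
  proof (rule that)
    show "section_at a (U \<inter> V) (res F U (U \<inter> V) s)" by (rule section_at_res[OF s(1) W]) simp
    show "section_at a (U \<inter> V) (res F V (U \<inter> V) t)" by (rule section_at_res[OF t(1) W]) simp
    show "x = germ M F a (U \<inter> V) (res F U (U \<inter> V) s)" using germ_res[OF s(1) W] s(2) by simp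
    show "y = germ M F a (U \<inter> V) (res F V (U \<inter> V) t)" using germ_res[OF t(1) W] t(2) by simp
  qed
qed

lemma stalk_zero: "opn U ==> a \<in> U ==> \<zero>\<^bsub>stalk M F a\<^esub> = germ M F a U \<zero>\<^bsub>sec F U\<^esub>"
proof -
  assume U: "opn U" "a \<in> U"
  have "germ M F a U (res F (points M) U \<zero>\<^bsub>sec F (points M)\<^esub>) = germ M F a (points M) \<zero>\<^bsub>sec F (points M)\<^esub>"
    by (rule germ_res) (use U opn_points sec_closed(1)[of "points M"] in auto)
  thus ?thesis using res_group(1)[OF openin_topspace U(1) opn_points[OF U(1)]] by (simp add: stalk_def)
qed

lemma stalk_abelian_group: "abelian_group (stalk M F a)" if a: "a \<in> points M"
proof (rule abelian_groupI)
  note mod = sec_abelian_group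
  show "\<zero>\<^bsub>stalk M F a\<^esub> \<in> carrier (stalk M F a)"
    using stalk_zero[OF openin_topspace a] sec_closed(1)[of "points M"] a by (auto intro!: germ_in_stalk)
  fix x assume x: "x \<in> carrier (stalk M F a)"
  {
    fix y assume y: "y \<in> carrier (stalk M F a)"
    obtain U s t where s: "section_at a U s" and t: "section_at a U t" and e: "x = germ M F a U s" "y = germ M F a U t"
      using stalk_rep[OF x y] by metis
    interpret abelian_group "sec F U" using mod s by auto
    show "x \<oplus>\<^bsub>stalk M F a\<^esub> y \<in> carrier (stalk M F a)"
      using s t by (auto simp: e stalk_add intro!: germ_in_stalk)
    show "x \<oplus>\<^bsub>stalk M F a\<^esub> y = y \<oplus>\<^bsub>stalk M F a\<^esub> x"
      using s t by (simp add: e stalk_add a_comm)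
    fix z assume z: "z \<in> carrier (stalk M F a)"
    obtain V r where r: "section_at a V r" "z = germ M F a V r" using z by (auto simp: stalk_carrier)
    let ?W = "U \<inter> V"
    let ?s = "res F U ?W s" and ?t = "res F U ?W t" and ?r = "res F V ?W r"
    have W: "section_at a ?W ?s" "section_at a ?W ?t" "section_at a ?W ?r" using s t r by (auto intro: res_closed)
    have e': "x = germ M F a ?W ?s" "y = germ M F a ?W ?t" "z = germ M F a ?W ?r"
      using W e r(2) germ_res[OF s, of ?W] germ_res[OF t, of ?W] germ_res[OF r(1), of ?W] by simp_all
    interpret W: abelian_group "sec F ?W" using mod W by auto
    have W': "section_at a ?W (?s \<oplus>\<^bsub>sec F ?W\<^esub> ?t)" "section_at a ?W (?t \<oplus>\<^bsub>sec F ?W\<^esub> ?r)" using W by auto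
    show "x \<oplus>\<^bsub>stalk M F a\<^esub> y \<oplus>\<^bsub>stalk M F a\<^esub> z = x \<oplus>\<^bsub>stalk M F a\<^esub> (y \<oplus>\<^bsub>stalk M F a\<^esub> z)"
      unfolding e' stalk_add[OF W(1,2)] stalk_add[OF W(2,3)] stalk_add[OF W'(1) W(3)] stalk_add[OF W(1) W'(2)]
      using W W.a_assoc by simp
  }
  obtain U s where s: "section_at a U s" "x = germ M F a U s" using x by (auto simp: stalk_carrier)
  interpret abelian_group "sec F U" using mod s by auto
  have z: "section_at a U \<zero>\<^bsub>sec F U\<^esub>" "section_at a U (\<ominus>\<^bsub>sec F U\<^esub> s)" using s by auto
  have U: "\<zero>\<^bsub>stalk M F a\<^esub> = germ M F a U \<zero>\<^bsub>sec F U\<^esub>" using stalk_zero s by auto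
  show "\<zero>\<^bsub>stalk M F a\<^esub> \<oplus>\<^bsub>stalk M F a\<^esub> x = x"
    unfolding U s(2) stalk_add[OF z(1) s(1)] using s by simp
  have "germ M F a U (\<ominus>\<^bsub>sec F U\<^esub> s) \<oplus>\<^bsub>stalk M F a\<^esub> x = \<zero>\<^bsub>stalk M F a\<^esub>"
    unfolding U s(2) stalk_add[OF z(2) s(1)] using s by (simp add: l_neg)
  thus "\<exists>y\<in>carrier (stalk M F a). y \<oplus>\<^bsub>stalk M F a\<^esub> x = \<zero>\<^bsub>stalk M F a\<^esub>"
    using germ_in_stalk[OF z(2)] by blast
qed

end

lemma (in smooth_mfd) module_presheaf_smooth_functions: "module_presheaf M (smooth_functions M)"
proof (intro module_presheaf.intro module_presheaf_axioms.intro smooth_mfd_axioms)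
  fix U assume U: "opn U"
  interpret cring "smooth_ring M U" by (rule cring_smooth_ring[OF U])
  have smult: "module.smult (smooth_ring M U) = monoid.mult (smooth_ring M U)" by (simp add: smooth_ring_simps)
  show "module (smooth_ring M U) (smooth_ring M U)"
    by (rule moduleI) (auto simp: smult l_distr r_distr m_assoc abelian_group_axioms is_cring)
next
  fix U V s assume "opn U" "opn V" "V \<subseteq> U" "s \<in> fcts U"
  thus "res (smooth_functions M) U V s \<in> fcts V"
    by (auto simp: smooth_ring_simps(7) intro!: restrict_smooth smooth_fun_subset[OF smooth_ring_fun])
next
  fix U s assume "s \<in> fcts U"
  thus "res (smooth_functions M) U U s = s"
    by (simp add: smooth_ring_simps extensional_restrict)
qed (auto simp: smooth_ring_simps fun_eq_iff restrict_def)

sublocale smooth_mfd \<subseteq> C: module_presheaf M "smooth_functions M"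
  by (rule module_presheaf_smooth_functions)

context module_presheaf
begin

lemma stalk_smult:
  assumes f: "opn U" "a \<in> U" "f \<in> fcts U" and s: "section_at a V s"
  shows "germ M (smooth_functions M) a U f \<odot>\<^bsub>stalk M F a\<^esub> germ M F a V s =
    germ M F a (U \<inter> V) (restrict f (U \<inter> V) \<odot>\<^bsub>sec F (U \<inter> V)\<^esub> res F V (U \<inter> V) s)"
  using germ_op_eq[where opr = "\<lambda>W. module.smult (sec F W)", OF C.module_presheaf_axioms sec_closed(5), of U a f V s] f s
  by (simp add: stalk_def smooth_ring_simps(7) res_smult)

lemma stalk_smult_same:
  assumes f: "f \<in> fcts U" and s: "section_at a U s"
  shows "germ M (smooth_functions M) a U f \<odot>\<^bsub>stalk M F a\<^esub> germ M F a U s = germ M F a U (f \<odot>\<^bsub>sec F U\<^esub> s)"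
proof -
  have "restrict f U = f" using f by (simp add: smooth_ring_simps extensional_restrict)
  thus ?thesis using stalk_smult[of U a f U s] f s by (simp add: res_id)
qed

section \<open>Powers of the ideal of germs vanishing at a point\<close>

abbreviation jet_ideal :: "nat => 'm => ('m set \<times> 's) set set" where
  "jet_ideal q a \<equiv> ideal_power_mod (stalk M F a) (vanishing_germs M a) q"

abbreviation vanishing_sections :: "nat => 'm => 'm set => 's set" where
  "vanishing_sections q a U \<equiv> ideal_power_mod (sec F U) (vanishing_ideal M a U) q"

lemma vanishing_ideal_subset: "vanishing_ideal M a U \<subseteq> fcts U"
  by (auto simp: vanishing_ideal_def)

lemma vanishing_germ_iff:
  assumes f: "C.section_at a U f"
  shows "germ M (smooth_functions M) a U f \<in> vanishing_germs M a \<longleftrightarrow> f a = 0"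
proof -
  have "g a = f a" if gm: "(V, g) \<in> germ M (smooth_functions M) a U f" for V g
  proof -
    obtain W where W: "a \<in> W" "restrict f W = restrict g W"
      using gm by (auto simp: germ_def smooth_ring_simps(7))
    have "restrict f W a = restrict g W a" by (simp only: W(2))
    thus ?thesis using W(1) by (simp only: restrict_apply if_True)
  qed
  hence "(\<forall>p\<in>germ M (smooth_functions M) a U f. snd p a = 0) \<longleftrightarrow> f a = 0"
    using C.germ_self[OF f] by (metis prod.collapse snd_conv)
  thus ?thesis using C.germ_in_stalk[OF f] by (simp add: vanishing_germs_def case_prod_unfold)
qed

lemma vanishing_germE:
  assumes "x \<in> vanishing_germs M a"
  obtains U f where "C.section_at a U f" "f a = 0" "x = germ M (smooth_functions M) a U f"
proof -
  have "x \<in> carrier (stalk M (smooth_functions M) a)" using assms by (simp add: vanishing_germs_def)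
  then obtain U f where f: "C.section_at a U f" "x = germ M (smooth_functions M) a U f"
    by (auto simp: C.stalk_carrier)
  thus thesis using that vanishing_germ_iff[OF f(1)] assms by auto
qed

lemma vanishing_sections_subset: "opn U ==> vanishing_sections q a U \<subseteq> sects U"
  using smodule.ideal_power_additive_subgroup[OF sec_smodule vanishing_ideal_subset]
    additive_subgroup.a_subset by blast

lemma vanishing_sections_res:
  assumes "opn U" "opn V" "a \<in> V" "V \<subseteq> U" "s \<in> vanishing_sections q a U"
  shows "res F U V s \<in> vanishing_sections q a V"
  by (rule ideal_power_hom[OF sec_module[OF assms(1)] sec_module[OF assms(2)] vanishing_ideal_subset
        vanishing_ideal_subset, where \<rho> = "\<lambda>f. restrict f V"])
    (use assms res_closed res_add res_smult C.res_closed[of U V, unfolded smooth_ring_simps(7)] in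
      \<open>auto simp: vanishing_ideal_def\<close>)

lemma stalk_smult_closed:
  assumes "x \<in> carrier (stalk M (smooth_functions M) a)" "y \<in> carrier (stalk M F a)"
  shows "x \<odot>\<^bsub>stalk M F a\<^esub> y \<in> carrier (stalk M F a)"
proof -
  obtain U f V s where f: "C.section_at a U f" "x = germ M (smooth_functions M) a U f"
    and s: "section_at a V s" "y = germ M F a V s"
    using assms by (auto simp: stalk_carrier C.stalk_carrier)
  have "section_at a (U \<inter> V) (restrict f (U \<inter> V) \<odot>\<^bsub>sec F (U \<inter> V)\<^esub> res F V (U \<inter> V) s)"
    using f s C.res_closed[of U "U \<inter> V" f] by (auto intro!: sec_closed(5) res_closed simp: smooth_ring_simps(7))
  thus ?thesis using stalk_smult[of U a f V s] f s germ_in_stalk by auto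
qed

lemma ideal_products_stalk_subset: "ideal_products (stalk M F a) (vanishing_germs M a) q \<subseteq> carrier (stalk M F a)"
  by (induction q) (auto simp: vanishing_germs_def intro!: stalk_smult_closed)

lemma jet_ideal_subgroup: "a \<in> points M ==> additive_subgroup (jet_ideal q a) (stalk M F a)"
  unfolding ideal_power_mod_def
  by (rule additive_subgroup_generate[OF stalk_abelian_group ideal_products_stalk_subset])

lemma stalk_neg:
  assumes s: "section_at a U s"
  shows "\<ominus>\<^bsub>stalk M F a\<^esub> germ M F a U s = germ M F a U (\<ominus>\<^bsub>sec F U\<^esub> s)"
proof -
  interpret U: abelian_group "sec F U" using sec_abelian_group s by auto
  have a: "a \<in> points M" using s opn_points by auto
  interpret abelian_group "stalk M F a" by (rule stalk_abelian_group[OF a])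
  have s': "section_at a U (\<ominus>\<^bsub>sec F U\<^esub> s)" using s by auto
  show ?thesis
    by (rule minus_equality)
      (use s s' stalk_add[OF s' s] stalk_zero[of U a] in \<open>auto simp: U.l_neg intro!: germ_in_stalk\<close>)
qed

lemma stalk_diff:
  assumes s: "section_at a U s" and t: "section_at a U t"
  shows "germ M F a U s \<ominus>\<^bsub>stalk M F a\<^esub> germ M F a U t = germ M F a U (s \<ominus>\<^bsub>sec F U\<^esub> t)"
  using stalk_add[OF s, of "\<ominus>\<^bsub>sec F U\<^esub> t"] sec_closed(4)[of U t] t
  by (simp add: a_minus_def stalk_neg)

text \<open>The germs that come from the q-th power over some neighbourhood form a subgroup, since
  two representatives can be restricted to a common domain, and this subgroup contains all the
  products that generate the power in the stalk.\<close>

lemma jet_ideal_sections: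
  assumes a: "a \<in> points M" and x: "x \<in> jet_ideal q a"
  obtains W s where "opn W" "a \<in> W" "s \<in> vanishing_sections q a W" "x = germ M F a W s"
proof -
  let ?S = "\<lambda>q. {germ M F a W s | W s. opn W \<and> a \<in> W \<and> s \<in> vanishing_sections q a W}"
  have sub: "section_at a W s" if "opn W" "a \<in> W" "s \<in> vanishing_sections q a W" for W s q
    using that vanishing_sections_subset by auto
  have grp: "additive_subgroup (?S q) (stalk M F a)" for q
  proof (rule additive_subgroupI'[OF stalk_abelian_group[OF a]])
    have V: "additive_subgroup (vanishing_sections q a W) (sec F W)" if "opn W" for W
      using smodule.ideal_power_additive_subgroup[OF sec_smodule[OF that] vanishing_ideal_subset] .
    show "?S q \<subseteq> carrier (stalk M F a)" using sub germ_in_stalk by blast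
    show "\<zero>\<^bsub>stalk M F a\<^esub> \<in> ?S q"
      using stalk_zero[OF openin_topspace a] a additive_subgroup.zero_closed[OF V[OF openin_topspace]] by blast
    fix x assume "x \<in> ?S q"
    then obtain U s where s: "opn U" "a \<in> U" "s \<in> vanishing_sections q a U" "x = germ M F a U s" by auto
    show "\<ominus>\<^bsub>stalk M F a\<^esub> x \<in> ?S q"
      using stalk_neg[OF sub[OF s(1-3)]] s additive_subgroup.a_inv_closed[OF V[OF s(1)] s(3)]
      by blast
    fix y assume "y \<in> ?S q"
    then obtain V t where t: "opn V" "a \<in> V" "t \<in> vanishing_sections q a V" "y = germ M F a V t" by auto
    let ?W = "U \<inter> V"
    have W: "opn ?W" "a \<in> ?W" using s t by auto
    have st: "res F U ?W s \<in> vanishing_sections q a ?W" "res F V ?W t \<in> vanishing_sections q a ?W"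
      using vanishing_sections_res[OF s(1) W _ s(3)] vanishing_sections_res[OF t(1) W _ t(3)] by auto
    have "x = germ M F a ?W (res F U ?W s)" "y = germ M F a ?W (res F V ?W t)"
      using germ_res[OF sub[OF s(1-3)] W] germ_res[OF sub[OF t(1-3)] W] s t by auto
    hence "x \<oplus>\<^bsub>stalk M F a\<^esub> y = germ M F a ?W (res F U ?W s \<oplus>\<^bsub>sec F ?W\<^esub> res F V ?W t)"
      using stalk_add[OF sub[OF W st(1)] sub[OF W st(2)]] by simp
    thus "x \<oplus>\<^bsub>stalk M F a\<^esub> y \<in> ?S q"
      using additive_subgroup.a_closed[OF V[OF W(1)] st] W by blast
  qed
  have "ideal_products (stalk M F a) (vanishing_germs M a) q \<subseteq> ?S q" for q
  proof (induction q)
    case 0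
    show ?case
    proof
      fix x assume "x \<in> ideal_products (stalk M F a) (vanishing_germs M a) 0"
      then obtain U s where s: "section_at a U s" "x = germ M F a U s" by (auto simp: stalk_carrier)
      hence "s \<in> vanishing_sections 0 a U" using smodule.ideal_power_0[OF sec_smodule] by simp
      thus "x \<in> ?S 0" using s by blast
    qed
  next
    case (Suc q)
    show ?case
    proof
      fix z assume "z \<in> ideal_products (stalk M F a) (vanishing_germs M a) (Suc q)"
      then obtain x y where x: "x \<in> vanishing_germs M a" "z = x \<odot>\<^bsub>stalk M F a\<^esub> y"
        and y: "y \<in> ideal_products (stalk M F a) (vanishing_germs M a) q"
        by auto
      note xy = x(1) subsetD[OF Suc y] x(2)
      obtain U f where f: "C.section_at a U f" "f a = 0" "x = germ M (smooth_functions M) a U f"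
        using vanishing_germE[OF xy(1)] .
      obtain V s where s: "opn V" "a \<in> V" "s \<in> vanishing_sections q a V" "y = germ M F a V s" using xy(2) by auto
      let ?W = "U \<inter> V"
      have W: "opn ?W" "a \<in> ?W" using f s by auto
      have "restrict f ?W \<in> vanishing_ideal M a ?W"
        using f W C.res_closed[of U ?W f] by (auto simp: vanishing_ideal_def smooth_ring_simps(7))
      hence "restrict f ?W \<odot>\<^bsub>sec F ?W\<^esub> res F V ?W s \<in> vanishing_sections (Suc q) a ?W"
        using vanishing_sections_res[OF s(1) W _ s(3)]
        by (intro smodule.ideal_power_smult[OF sec_smodule[OF W(1)] vanishing_ideal_subset]) auto
      moreover have "z = germ M F a ?W (restrict f ?W \<odot>\<^bsub>sec F ?W\<^esub> res F V ?W s)"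
        using stalk_smult[of U a f V s] f sub[OF s(1-3)] xy(3) s(4) by auto
      ultimately show "z \<in> ?S (Suc q)" using W by blast
    qed
  qed
  hence "jet_ideal q a \<subseteq> ?S q"
    unfolding ideal_power_mod_def[of "stalk M F a"]
    by (rule generate_subset_additive_subgroup[OF stalk_abelian_group[OF a] grp])
  thus thesis using x that by blast
qed

lemma germ_in_jet_ideal:
  assumes W: "opn W" "a \<in> W" and s: "s \<in> vanishing_sections q a W"
  shows "germ M F a W s \<in> jet_ideal q a"
proof -
  have a: "a \<in> points M" using W opn_points by auto
  have prod: "s \<in> ideal_products (sec F W) (vanishing_ideal M a W) q ==>
      germ M F a W s \<in> ideal_products (stalk M F a) (vanishing_germs M a) q" for s
  proof (induction q arbitrary: s)
    case 0
    thus ?case using W by (auto intro: germ_in_stalk)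
  next
    case (Suc q)
    then obtain f t where f: "f \<in> vanishing_ideal M a W" "t \<in> ideal_products (sec F W) (vanishing_ideal M a W) q"
      "s = f \<odot>\<^bsub>sec F W\<^esub> t" by auto
    have "t \<in> sects W"
      using smodule.ideal_products_subset[OF sec_smodule[OF W(1)] vanishing_ideal_subset] f(2) by auto
    moreover have fc: "C.section_at a W f" "f a = 0" using f(1) W by (auto simp: vanishing_ideal_def)
    ultimately have "germ M F a W s = germ M (smooth_functions M) a W f \<odot>\<^bsub>stalk M F a\<^esub> germ M F a W t"
      using stalk_smult_same[of f W a t] f(3) W by simp
    thus ?case using Suc.IH[OF f(2)] vanishing_germ_iff[OF fc(1)] fc(2) by auto
  qed
  have "vanishing_sections q a W \<subseteq> {s \<in> sects W. germ M F a W s \<in> jet_ideal q a}"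
    unfolding ideal_power_mod_def[of "sec F W"]
  proof (rule generate_subset_additive_subgroup[OF sec_abelian_group[OF W(1)]])
    show "additive_subgroup {s \<in> sects W. germ M F a W s \<in> jet_ideal q a} (sec F W)"
      by (rule additive_subgroup_preimage[OF sec_abelian_group[OF W(1)] stalk_abelian_group[OF a]
            jet_ideal_subgroup[OF a]]) (use W in \<open>auto intro: germ_in_stalk simp: stalk_add\<close>)
    show "ideal_products (sec F W) (vanishing_ideal M a W) q
        \<subseteq> {s \<in> sects W. germ M F a W s \<in> jet_ideal q a}"
      using prod smodule.ideal_products_subset[OF sec_smodule[OF W(1)] vanishing_ideal_subset]
      by (auto simp: ideal_power_mod_def[of "stalk M F a"] intro!: incl_generate)
  qed
  thus ?thesis using s by auto
qed

text \<open>Moves the question from the stalk, where scalars are germs, to the module of sections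
  over a small open set. Comparisons of jets below use this form.\<close>

lemma germ_in_jet_ideal_iff:
  assumes s: "section_at a U s"
  shows "germ M F a U s \<in> jet_ideal q a \<longleftrightarrow>
    (\<exists>W. opn W \<and> a \<in> W \<and> W \<subseteq> U \<and> res F U W s \<in> vanishing_sections q a W)"
proof
  assume g: "germ M F a U s \<in> jet_ideal q a"
  have a: "a \<in> points M" using s opn_points by auto
  obtain V t where t: "opn V" "a \<in> V" "t \<in> vanishing_sections q a V" "germ M F a U s = germ M F a V t"
    using jet_ideal_sections[OF a g] by metis
  have "section_at a V t" using t(2,3) t(1) vanishing_sections_subset[OF t(1)] by blast
  then obtain W where W: "opn W" "a \<in> W" "W \<subseteq> U \<inter> V" "res F U W s = res F V W t"
    using germ_eqD[OF s _ t(4)] by blast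
  thus "\<exists>W. opn W \<and> a \<in> W \<and> W \<subseteq> U \<and> res F U W s \<in> vanishing_sections q a W"
    using vanishing_sections_res[OF t(1) W(1,2) _ t(3)] by auto
next
  assume "\<exists>W. opn W \<and> a \<in> W \<and> W \<subseteq> U \<and> res F U W s \<in> vanishing_sections q a W"
  then obtain W where W: "opn W" "a \<in> W" "W \<subseteq> U" "res F U W s \<in> vanishing_sections q a W" by blast
  thus "germ M F a U s \<in> jet_ideal q a"
    using germ_in_jet_ideal[OF W(1,2,4)] germ_res[OF s W(1,2,3)] by simp
qed

section \<open>Jet spaces and their operations\<close>

lemma jet_space_quotient: "a \<in> points M ==> quotient_group (stalk M F a) (jet_ideal q a)"
  by (intro quotient_group.intro stalk_abelian_group jet_ideal_subgroup)

lemma jet_space_carrier: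
  "a \<in> points M ==> carrier (jet_space M F q a) = {jet_class M F q a U s | U s. section_at a U s}"
  using quotient_group.quot_simps(1)[OF jet_space_quotient]
  by (auto simp: jet_space_def jet_class_def stalk_carrier)

lemma jet_class_in: "section_at a U s ==> jet_class M F q a U s \<in> carrier (jet_space M F q a)"
  using jet_space_carrier opn_points by blast

lemma jet_class_res:
  "section_at a U s ==> opn V ==> a \<in> V ==> V \<subseteq> U ==> jet_class M F q a V (res F U V s) = jet_class M F q a U s"
  by (simp add: jet_class_def germ_res)

lemma jet_add:
  assumes "section_at a U s" "section_at a U t"
  shows "jet_class M F q a U s \<oplus>\<^bsub>jet_space M F q a\<^esub> jet_class M F q a U t = jet_class M F q a U (s \<oplus>\<^bsub>sec F U\<^esub> t)"
proof -
  have a: "a \<in> points M" using assms opn_points by auto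
  show ?thesis
    using quotient_group.quot_add[OF jet_space_quotient[OF a] germ_in_stalk[OF assms(1)] germ_in_stalk[OF assms(2)]]
    by (simp add: jet_space_def jet_class_def stalk_add[OF assms])
qed

lemma jet_zero: "opn U ==> a \<in> U ==> \<zero>\<^bsub>jet_space M F q a\<^esub> = jet_class M F q a U \<zero>\<^bsub>sec F U\<^esub>"
  using quotient_group.cl_zero[OF jet_space_quotient, of a q] opn_points[of U]
  by (auto simp: jet_space_def jet_class_def quot_mod_def stalk_zero)

lemma jet_eq_iff:
  assumes "section_at a U s" "section_at a U t"
  shows "jet_class M F q a U s = jet_class M F q a U t \<longleftrightarrow>
    (\<exists>W. opn W \<and> a \<in> W \<and> W \<subseteq> U \<and> res F U W (s \<ominus>\<^bsub>sec F U\<^esub> t) \<in> vanishing_sections q a W)"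
proof -
  have "a \<in> points M" using assms opn_points by auto
  thus ?thesis
    using quotient_group.cl_eq_iff[OF jet_space_quotient germ_in_stalk[OF assms(1)] germ_in_stalk[OF assms(2)]] assms
      germ_in_jet_ideal_iff[of U a "s \<ominus>\<^bsub>sec F U\<^esub> t" q] sec_closed(3)[of U s t]
    by (simp add: jet_class_def stalk_diff)
qed

lemma jet_smult:
  assumes f: "f \<in> fcts U" and s: "section_at a U s"
  shows "germ M (smooth_functions M) a U f \<odot>\<^bsub>jet_space M F q a\<^esub> jet_class M F q a U s =
    jet_class M F q a U (f \<odot>\<^bsub>sec F U\<^esub> s)"
proof -
  have a: "a \<in> points M" using s opn_points by auto
  let ?r = "germ M (smooth_functions M) a U f"
  have r: "C.section_at a U f" using f s by auto
  have "?r \<odot>\<^bsub>quot_mod (stalk M F a) (jet_ideal q a)\<^esub> (jet_ideal q a +>\<^bsub>stalk M F a\<^esub> germ M F a U s) =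
      jet_ideal q a +>\<^bsub>stalk M F a\<^esub> (?r \<odot>\<^bsub>stalk M F a\<^esub> germ M F a U s)"
  proof (rule quotient_group.quot_smult[OF jet_space_quotient[OF a]])
    fix x y assume x: "x \<in> carrier (stalk M F a)" and y: "y \<in> carrier (stalk M F a)"
    obtain V s t where s: "section_at a V s" and t: "section_at a V t" and e: "x = germ M F a V s" "y = germ M F a V t"
      using stalk_rep[OF x y] by metis
    let ?W = "U \<inter> V"
    have W: "section_at a ?W (res F V ?W s)" "section_at a ?W (res F V ?W t)" "restrict f ?W \<in> fcts ?W"
      using r s t C.res_closed[of U ?W f] by (auto intro!: res_closed simp: smooth_ring_simps(7))
    interpret W: smodule "smooth_ring M ?W" "sec F ?W" using sec_smodule W by auto
    have st: "section_at a V (s \<oplus>\<^bsub>sec F V\<^esub> t)" using s t sec_closed by auto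
    show "?r \<odot>\<^bsub>stalk M F a\<^esub> (x \<oplus>\<^bsub>stalk M F a\<^esub> y) =
        ?r \<odot>\<^bsub>stalk M F a\<^esub> x \<oplus>\<^bsub>stalk M F a\<^esub> ?r \<odot>\<^bsub>stalk M F a\<^esub> y"
      unfolding e stalk_add[OF s t]
      using r s t W stalk_smult[of U a f V s] stalk_smult[of U a f V t] stalk_smult[of U a f V "s \<oplus>\<^bsub>sec F V\<^esub> t"]
        st stalk_add[of ?W a "restrict f ?W \<odot>\<^bsub>sec F ?W\<^esub> res F V ?W s" "restrict f ?W \<odot>\<^bsub>sec F ?W\<^esub> res F V ?W t"]
      by (simp add: res_add W.smult_r_distr)
  next
    fix x assume "x \<in> jet_ideal q a"
    then obtain V s where s: "opn V" "a \<in> V" "s \<in> vanishing_sections q a V" "x = germ M F a V s"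
      using jet_ideal_sections[OF a] by metis
    let ?W = "U \<inter> V"
    have W: "opn ?W" "a \<in> ?W" "restrict f ?W \<in> fcts ?W"
      using r s C.res_closed[of U ?W f] by (auto simp: smooth_ring_simps(7))
    have "restrict f ?W \<odot>\<^bsub>sec F ?W\<^esub> res F V ?W s \<in> vanishing_sections q a ?W"
      by (rule smodule.ideal_power_closed[OF sec_smodule[OF W(1)] vanishing_ideal_subset W(3)
            vanishing_sections_res[OF s(1) W(1,2) _ s(3)]]) auto
    thus "?r \<odot>\<^bsub>stalk M F a\<^esub> x \<in> jet_ideal q a"
      using stalk_smult[of U a f V s] r s(1,2,4) subsetD[OF vanishing_sections_subset[OF s(1)] s(3)]
        germ_in_jet_ideal[OF W(1,2)] by simp
  qed (use f s r stalk_smult_closed C.germ_in_stalk germ_in_stalk in auto)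
  thus ?thesis using f s by (simp add: jet_space_def jet_class_def stalk_smult_same)
qed

text \<open>\<open>disjoint_union_bundle\<close> scales by the germ of a constant on all of
  \<open>M\<close>, which is also the germ of the same constant on \<open>U\<close>.\<close>

lemma jet_scale:
  assumes s: "section_at a U s"
  shows "germ M (smooth_functions M) a (points M) (\<lambda>b\<in>points M. c) \<odot>\<^bsub>jet_space M F q a\<^esub> jet_class M F q a U s =
    jet_class M F q a U ((\<lambda>b\<in>U. c) \<odot>\<^bsub>sec F U\<^esub> s)"
proof -
  have U: "U \<subseteq> points M" "a \<in> points M" using s opn_points by auto
  have "restrict (\<lambda>b\<in>points M. c) U = (\<lambda>b\<in>U. c)" using U by (auto simp: restrict_def fun_eq_iff)
  hence "germ M (smooth_functions M) a (points M) (\<lambda>b\<in>points M. c) = germ M (smooth_functions M) a U (\<lambda>b\<in>U. c)"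
    using C.germ_res[of "points M" a "\<lambda>b\<in>points M. c" U] s U const_in_smooth_ring[of "points M" c]
    by (simp add: smooth_ring_simps(7))
  thus ?thesis using jet_smult[OF const_in_smooth_ring s] s by auto
qed

lemma jet_space_rep:
  assumes "a \<in> points M" "x \<in> carrier (jet_space M F q a)" "opn V" "a \<in> V"
  obtains U s where "section_at a U s" "U \<subseteq> V" "x = jet_class M F q a U s"
proof -
  obtain U s where s: "section_at a U s" "x = jet_class M F q a U s"
    using assms(2) unfolding jet_space_carrier[OF assms(1)] by blast
  have W: "opn (U \<inter> V)" "a \<in> U \<inter> V" using s assms by auto
  show thesis
  proof (rule that)
    show "section_at a (U \<inter> V) (res F U (U \<inter> V) s)" by (rule section_at_res[OF s(1) W]) simp
    show "x = jet_class M F q a (U \<inter> V) (res F U (U \<inter> V) s)" using jet_class_res[OF s(1) W] s(2) by simp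
  qed simp
qed

end

section \<open>Local frames\<close>

locale framed_presheaf = module_presheaf M F for M :: "'m manifold" and F :: "('m, 's) presheaf" +
  fixes I :: "'i set" and U :: "'m set" and \<Phi> :: "'i => 's"
  assumes finite_I: "finite I" and frame: "local_frame M F I U \<Phi>"
begin

lemma frame_open: "opn U" and frame_in: "i \<in> I ==> \<Phi> i \<in> sects U"
  using frame by (auto simp: local_frame_def)

lemma frame_ex1:
  "opn V ==> V \<subseteq> U ==> s \<in> sects V ==>
    \<exists>!f. f \<in> I \<rightarrow>\<^sub>E fcts V \<and> s = lin_comb F I U V \<Phi> f"
  by (rule frame[unfolded local_frame_def, THEN conjunct2, THEN conjunct2, rule_format, OF conjI])

abbreviation coeffs :: "'m set => ('i => 'm => real) set" where
  "coeffs V \<equiv> I \<rightarrow>\<^sub>E fcts V"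

definition coef :: "'m set => 's => 'i => 'm => real" where
  "coef V s = (THE f. f \<in> coeffs V \<and> s = lin_comb F I U V \<Phi> f)"

context
  fixes V assumes V: "opn V" "V \<subseteq> U"
begin

interpretation V: smodule "smooth_ring M V" "sec F V" by (rule sec_smodule[OF V(1)])

lemma frame_res: "i \<in> I ==> res F U V (\<Phi> i) \<in> sects V"
  by (rule res_closed[OF frame_open V frame_in])

lemma term_in: "f \<in> coeffs V ==> (\<lambda>i. f i \<odot>\<^bsub>sec F V\<^esub> res F U V (\<Phi> i)) \<in> I \<rightarrow> sects V"
  using frame_res by (auto simp: PiE_iff)

lemma lin_comb_closed: "f \<in> coeffs V ==> lin_comb F I U V \<Phi> f \<in> sects V"
  unfolding lin_comb_def using V.finsum_closed[OF term_in] .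

lemma coef_exists:
  assumes "s \<in> sects V"
  shows coef_in': "coef V s \<in> coeffs V" and lin_comb_coef: "lin_comb F I U V \<Phi> (coef V s) = s"
proof -
  from theI'[OF frame_ex1[OF V assms]] show "coef V s \<in> coeffs V" "lin_comb F I U V \<Phi> (coef V s) = s"
    by (simp_all add: coef_def)
qed

lemma coef_in: "s \<in> sects V ==> i \<in> I ==> coef V s i \<in> fcts V"
  using coef_in' by (auto simp: PiE_iff)

lemma coef_smooth: "s \<in> sects V ==> i \<in> I ==> smooth_fun M V (coef V s i)"
  by (rule smooth_ring_fun[OF coef_in])

lemma coef_lin_comb: "f \<in> coeffs V ==> coef V (lin_comb F I U V \<Phi> f) = f"
  unfolding coef_def by (rule the1_equality[OF frame_ex1[OF V lin_comb_closed]]) auto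

lemma coef_add:
  assumes s: "s \<in> sects V" and t: "t \<in> sects V" and x: "x \<in> V" and i: "i \<in> I"
  shows "coef V (s \<oplus>\<^bsub>sec F V\<^esub> t) i x = coef V s i x + coef V t i x"
proof -
  let ?h = "\<lambda>i\<in>I. coef V s i \<oplus>\<^bsub>smooth_ring M V\<^esub> coef V t i"
  have h: "?h \<in> coeffs V" using coef_in[OF s] coef_in[OF t] by auto
  have "lin_comb F I U V \<Phi> ?h = (\<Oplus>\<^bsub>sec F V\<^esub>i\<in>I. coef V s i \<odot>\<^bsub>sec F V\<^esub> res F U V (\<Phi> i) \<oplus>\<^bsub>sec F V\<^esub>
      coef V t i \<odot>\<^bsub>sec F V\<^esub> res F U V (\<Phi> i))"
    unfolding lin_comb_def
    by (rule V.finsum_cong') (use coef_in[OF s] coef_in[OF t] frame_res in \<open>auto simp: V.smult_l_distr\<close>)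
  also have "\<dots> = s \<oplus>\<^bsub>sec F V\<^esub> t"
    by (subst V.finsum_addf)
      (use term_in[OF coef_in'[OF s]] term_in[OF coef_in'[OF t]] lin_comb_coef[OF s] lin_comb_coef[OF t]
        in \<open>auto simp: lin_comb_def\<close>)
  finally have "coef V (s \<oplus>\<^bsub>sec F V\<^esub> t) = ?h" using coef_lin_comb[OF h] by simp
  thus ?thesis using i x by (simp add: smooth_ring_simps)
qed

lemma coef_smult:
  assumes g: "g \<in> fcts V" and s: "s \<in> sects V" and x: "x \<in> V" and i: "i \<in> I"
  shows "coef V (g \<odot>\<^bsub>sec F V\<^esub> s) i x = g x * coef V s i x"
proof -
  let ?h = "\<lambda>i\<in>I. g \<otimes>\<^bsub>smooth_ring M V\<^esub> coef V s i"
  have h: "?h \<in> coeffs V" using coef_in[OF s] g by auto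
  have "lin_comb F I U V \<Phi> ?h = (\<Oplus>\<^bsub>sec F V\<^esub>i\<in>I. g \<odot>\<^bsub>sec F V\<^esub> (coef V s i \<odot>\<^bsub>sec F V\<^esub> res F U V (\<Phi> i)))"
    unfolding lin_comb_def
    by (rule V.finsum_cong') (use coef_in[OF s] g frame_res in \<open>auto simp: V.smult_assoc1\<close>)
  also have "\<dots> = g \<odot>\<^bsub>sec F V\<^esub> s"
    using V.finsum_smult_ldistr[OF finite_I g term_in[OF coef_in'[OF s]]] lin_comb_coef[OF s]
    by (simp add: lin_comb_def)
  finally have "coef V (g \<odot>\<^bsub>sec F V\<^esub> s) = ?h" using coef_lin_comb[OF h] by simp
  thus ?thesis using i x by (simp add: smooth_ring_simps)
qed

lemma res_lin_comb:
  assumes f: "f \<in> coeffs V" and W: "opn W" "W \<subseteq> V"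
  shows "res F V W (lin_comb F I U V \<Phi> f) = lin_comb F I U W \<Phi> (\<lambda>i\<in>I. restrict (f i) W)"
    and "(\<lambda>i\<in>I. restrict (f i) W) \<in> I \<rightarrow>\<^sub>E fcts W"
proof -
  interpret W: smodule "smooth_ring M W" "sec F W" by (rule sec_smodule[OF W(1)])
  have fW: "restrict (f i) W \<in> fcts W" if "i \<in> I" for i
    using C.res_closed[OF V(1) W, of "f i"] f that by (auto simp: smooth_ring_simps(7))
  thus "(\<lambda>i\<in>I. restrict (f i) W) \<in> I \<rightarrow>\<^sub>E fcts W" by auto
  have \<Phi>W: "res F U W (\<Phi> i) \<in> sects W" if "i \<in> I" for i
    using res_closed[OF frame_open W(1) _ frame_in[OF that]] V(2) W(2) by auto
  have tm: "res F V W (f i \<odot>\<^bsub>sec F V\<^esub> res F U V (\<Phi> i)) = restrict (f i) W \<odot>\<^bsub>sec F W\<^esub> res F U W (\<Phi> i)"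
    if "i \<in> I" for i
    using res_smult[OF V(1) W _ frame_res[OF that], of "f i"] res_res[OF frame_open V(1) W(1,2) V(2) frame_in[OF that]]
      f that by (auto simp: PiE_iff)
  have "res F V W (\<Oplus>\<^bsub>sec F V\<^esub>i\<in>J. f i \<odot>\<^bsub>sec F V\<^esub> res F U V (\<Phi> i)) =
      (\<Oplus>\<^bsub>sec F W\<^esub>i\<in>J. restrict (f i) W \<odot>\<^bsub>sec F W\<^esub> res F U W (\<Phi> i))" if "J \<subseteq> I" for J
    using finite_subset[OF that finite_I] that
  proof (induction J)
    case empty
    show ?case using res_group(1)[OF V(1) W] by simp
  next
    case (insert i J)
    have 1: "(\<lambda>i. f i \<odot>\<^bsub>sec F V\<^esub> res F U V (\<Phi> i)) \<in> J \<rightarrow> sects V"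
      "f i \<odot>\<^bsub>sec F V\<^esub> res F U V (\<Phi> i) \<in> sects V"
      using term_in[OF f] insert.prems by auto
    have 2: "(\<lambda>i. restrict (f i) W \<odot>\<^bsub>sec F W\<^esub> res F U W (\<Phi> i)) \<in> J \<rightarrow> sects W"
      "restrict (f i) W \<odot>\<^bsub>sec F W\<^esub> res F U W (\<Phi> i) \<in> sects W"
      using fW \<Phi>W insert.prems by auto
    show ?case
      unfolding V.finsum_insert[OF insert.hyps 1] W.finsum_insert[OF insert.hyps 2]
        res_add[OF V(1) W 1(2) V.finsum_closed[OF 1(1)]] insert.IH[OF subset_trans[OF subset_insertI insert.prems]]
        tm[OF subsetD[OF insert.prems insertI1]] ..
  qed
  hence "res F V W (lin_comb F I U V \<Phi> f) = (\<Oplus>\<^bsub>sec F W\<^esub>i\<in>I. restrict (f i) W \<odot>\<^bsub>sec F W\<^esub> res F U W (\<Phi> i))"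
    unfolding lin_comb_def by auto
  also have "\<dots> = lin_comb F I U W \<Phi> (\<lambda>i\<in>I. restrict (f i) W)"
    unfolding lin_comb_def by (rule W.finsum_cong') (use fW \<Phi>W in auto)
  finally show "res F V W (lin_comb F I U V \<Phi> f) = lin_comb F I U W \<Phi> (\<lambda>i\<in>I. restrict (f i) W)" .
qed

lemma lin_comb_single:
  assumes g: "g \<in> fcts V" and j: "j \<in> I"
  shows "lin_comb F I U V \<Phi> (\<lambda>i\<in>I. if i = j then g else (\<lambda>x\<in>V. 0)) = g \<odot>\<^bsub>sec F V\<^esub> res F U V (\<Phi> j)"
    and "(\<lambda>i\<in>I. if i = j then g else (\<lambda>x\<in>V. 0)) \<in> coeffs V"
proof -
  show c: "(\<lambda>i\<in>I. if i = j then g else (\<lambda>x\<in>V. 0)) \<in> coeffs V"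
    using g const_in_smooth_ring[OF V(1)] by auto
  have z: "(\<lambda>x\<in>V. 0) \<odot>\<^bsub>sec F V\<^esub> s = \<zero>\<^bsub>sec F V\<^esub>" if "s \<in> sects V" for s
    using V.smult_l_null[OF that] by (simp add: smooth_ring_simps)
  have "lin_comb F I U V \<Phi> (\<lambda>i\<in>I. if i = j then g else (\<lambda>x\<in>V. 0)) =
      (\<Oplus>\<^bsub>sec F V\<^esub>i\<in>I. if j = i then g \<odot>\<^bsub>sec F V\<^esub> res F U V (\<Phi> i) else \<zero>\<^bsub>sec F V\<^esub>)"
    unfolding lin_comb_def
    by (rule V.finsum_cong') (use g frame_res z in auto)
  also have "\<dots> = g \<odot>\<^bsub>sec F V\<^esub> res F U V (\<Phi> j)"
    by (rule V.finsum_singleton[OF j finite_I]) (use g frame_res in auto)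
  finally show "lin_comb F I U V \<Phi> (\<lambda>i\<in>I. if i = j then g else (\<lambda>x\<in>V. 0)) = g \<odot>\<^bsub>sec F V\<^esub> res F U V (\<Phi> j)" .
qed

lemma coef_frame:
  assumes "j \<in> I" "g \<in> fcts V" "i \<in> I" "x \<in> V"
  shows "coef V (g \<odot>\<^bsub>sec F V\<^esub> res F U V (\<Phi> j)) i x = (if i = j then g x else 0)"
  using coef_lin_comb[OF lin_comb_single(2)[OF assms(2,1)]] lin_comb_single(1)[OF assms(2,1)] assms by simp

lemma section_eqI_coef:
  assumes "s \<in> sects V" "t \<in> sects V" "\<And>i x. i \<in> I ==> x \<in> V ==> coef V s i x = coef V t i x"
  shows "s = t"
proof -
  have "coef V s i = coef V t i" for i
  proof (cases "i \<in> I")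
    case True
    show ?thesis
      by (rule extensionalityI[of _ V]) (use coef_in[OF assms(1) True] coef_in[OF assms(2) True] assms(3) True
          in \<open>auto simp: smooth_ring_simps\<close>)
  next
    case False
    thus ?thesis using coef_in'[OF assms(1)] coef_in'[OF assms(2)] by (auto simp: PiE_iff extensional_def)
  qed
  hence "coef V s = coef V t" by (rule ext)
  thus ?thesis using lin_comb_coef[OF assms(1)] lin_comb_coef[OF assms(2)] by metis
qed

end

text \<open>The trivializations are specified on linear combinations with given coefficients; a
  frame makes this the same as a specification on all sections in terms of
  \<open>coef\<close>.\<close>

lemma sections_iff_lin_combs:
  "(\<forall>V f. opn V \<and> V \<subseteq> U \<and> f \<in> coeffs V --> (\<forall>a\<in>V. P a V (lin_comb F I U V \<Phi> f) f)) \<longleftrightarrow>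
    (\<forall>V s a. V \<subseteq> U --> section_at a V s --> P a V s (coef V s))" (is "?l \<longleftrightarrow> ?r")
proof
  assume l: ?l
  show ?r
  proof (intro allI impI)
    fix V s a assume V: "V \<subseteq> U" and s: "section_at a V s"
    hence "opn V \<and> V \<subseteq> U \<and> coef V s \<in> coeffs V" using coef_in' by blast
    from l[rule_format, OF this, of a] show "P a V s (coef V s)" using s V lin_comb_coef[of V s] by simp
  qed
next
  assume r: ?r
  show ?l
  proof (intro allI impI ballI)
    fix V f a assume V: "opn V \<and> V \<subseteq> U \<and> f \<in> coeffs V" and a: "a \<in> V"
    hence "section_at a V (lin_comb F I U V \<Phi> f)" using lin_comb_closed by blast
    from r[rule_format, OF _ this] show "P a V (lin_comb F I U V \<Phi> f) f" using V coef_lin_comb[of V f] by simp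
  qed
qed

lemma coef_res:
  assumes V: "opn V" "V \<subseteq> U" and W: "opn W" "W \<subseteq> V" and s: "s \<in> sects V" and i: "i \<in> I" and x: "x \<in> W"
  shows "coef W (res F V W s) i x = coef V s i x"
  using res_lin_comb[OF V coef_in'[OF V s] W] coef_lin_comb[of W "\<lambda>i\<in>I. restrict (coef V s i) W"] assms
    lin_comb_coef[OF V s] by auto

end

section \<open>Vector bundles and their sections\<close>

locale vbdl = smooth_mfd M for M :: "'m manifold" +
  fixes E :: "('m, 'e, 'i) vbundle"
  assumes vb: "vector_bundle M E"
begin

abbreviation \<Gamma> where "\<Gamma> \<equiv> smooth_sections M E"

abbreviation sects where "sects U \<equiv> carrier (sec \<Gamma> U)"

abbreviation jidx where "jidx k \<equiv> idx E \<times> multi_indices dm k"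

lemma finite_idx: "finite (idx E)"
  using vb by (simp add: vector_bundle_def)

lemma tot_proj: "u \<in> tot E ==> vproj E u \<in> points M"
  using vb by (simp add: vector_bundle_def)

lemma fibre_closed:
  assumes "a \<in> points M"
  shows "vzero E a \<in> fibre E a"
    and "u \<in> fibre E a ==> v \<in> fibre E a ==> vadd E u v \<in> fibre E a"
    and "u \<in> fibre E a ==> vscale E c u \<in> fibre E a"
  using vb assms by (simp_all add: vector_bundle_def)

lemma triv_cover:
  assumes "a \<in> points M" obtains U t where "(U, t) \<in> trivs E" "a \<in> U"
proof -
  have "a \<in> (\<Union>(U, t)\<in>trivs E. U)" using vb assms by (simp add: vector_bundle_def)
  thus thesis using that by auto
qed

lemma triv_props:
  assumes "(U, t) \<in> trivs E"
  shows triv_open: "opn U"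
    and triv_bij: "a \<in> U ==> bij_betw t (fibre E a) {x. \<forall>i. i \<notin> idx E --> x i = 0}"
    and triv_zero: "a \<in> U ==> t (vzero E a) = (\<lambda>i. 0)"
    and triv_add: "a \<in> U ==> u \<in> fibre E a ==> v \<in> fibre E a ==> t (vadd E u v) = (\<lambda>i. t u i + t v i)"
    and triv_scale: "a \<in> U ==> u \<in> fibre E a ==> t (vscale E c u) = (\<lambda>i. c * t u i)"
proof -
  have "openin (mtop M) U \<and> (\<forall>a\<in>U.
        bij_betw t (fibre E a) {x. \<forall>i. i \<notin> idx E --> x i = 0} \<and>
        t (vzero E a) = (\<lambda>i. 0) \<and>
        (\<forall>u\<in>fibre E a. \<forall>v\<in>fibre E a. t (vadd E u v) = (\<lambda>i. t u i + t v i)) \<and>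
        (\<forall>c. \<forall>u\<in>fibre E a. t (vscale E c u) = (\<lambda>i. c * t u i)))"
    using vb assms unfolding vector_bundle_def by blast
  thus "opn U"
    and "a \<in> U ==> bij_betw t (fibre E a) {x. \<forall>i. i \<notin> idx E --> x i = 0}"
    and "a \<in> U ==> t (vzero E a) = (\<lambda>i. 0)"
    and "a \<in> U ==> u \<in> fibre E a ==> v \<in> fibre E a ==> t (vadd E u v) = (\<lambda>i. t u i + t v i)"
    and "a \<in> U ==> u \<in> fibre E a ==> t (vscale E c u) = (\<lambda>i. c * t u i)"
    by blast+
qed

lemma triv_smooth:
  assumes "(U, t) \<in> trivs E" "(V, s) \<in> trivs E" "i \<in> idx E" "j \<in> idx E"
  shows "smooth_fun M (U \<inter> V) (\<lambda>a. s (unit_point E t j a) i)"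
proof -
  have "\<forall>(U, t)\<in>trivs E. \<forall>(V, s)\<in>trivs E. \<forall>i\<in>idx E. \<forall>j\<in>idx E.
      smooth_fun M (U \<inter> V) (\<lambda>a. s (unit_point E t j a) i)"
    using vb unfolding vector_bundle_def by (elim conjE)
  from bspec[OF bspec[OF this assms(1), unfolded prod.case] assms(2), unfolded prod.case] assms(3,4)
  show ?thesis by simp
qed

context
  fixes U t a assumes t: "(U, t) \<in> trivs E" and a: "a \<in> U"
begin

lemma triv_supp: "u \<in> fibre E a ==> i \<notin> idx E ==> t u i = 0"
  using bij_betw_apply[OF triv_bij[OF t a]] by auto

lemma triv_inj:
  assumes "u \<in> fibre E a" "v \<in> fibre E a" "\<And>i. i \<in> idx E ==> t u i = t v i" shows "u = v"
proof -
  have "t u i = t v i" for i using assms triv_supp by (cases "i \<in> idx E") auto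
  hence "t u = t v" by (rule ext)
  thus ?thesis
    using bij_betw_imp_inj_on[OF triv_bij[OF t a]] assms(1,2) by (auto simp: inj_on_def)
qed

lemma unit_point_props:
  assumes j: "j \<in> idx E"
  shows "unit_point E t j a \<in> fibre E a" and "t (unit_point E t j a) = (\<lambda>i. if i = j then 1 else 0)"
proof -
  have "(\<lambda>i. if i = j then 1 else 0) \<in> t ` fibre E a"
    using bij_betw_imp_surj_on[OF triv_bij[OF t a]] j by auto
  thus "unit_point E t j a \<in> fibre E a" "t (unit_point E t j a) = (\<lambda>i. if i = j then 1 else 0)"
    unfolding unit_point_def by (auto intro: inv_into_into f_inv_into_f)
qed

end

text \<open>Fibres come with \<open>vadd\<close> and \<open>vscale\<close>, so the sum is assembled
  from these; linearity of each trivialization then gives the coordinates in all of them at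
  once.\<close>

lemma fibre_sum_exists:
  assumes a: "a \<in> points M" and S: "finite S" and u: "\<And>p. p \<in> S ==> u p \<in> fibre E a"
  shows "\<exists>v\<in>fibre E a. \<forall>V s. (V, s) \<in> trivs E --> a \<in> V --> (\<forall>i. s v i = (\<Sum>p\<in>S. c p * s (u p) i))"
  using S u
proof (induction S)
  case empty
  thus ?case using triv_zero fibre_closed(1)[OF a] by (intro bexI[of _ "vzero E a"]) auto
next
  case (insert p S)
  then obtain v where v: "v \<in> fibre E a"
    "\<And>V s i. (V, s) \<in> trivs E ==> a \<in> V ==> s v i = (\<Sum>p\<in>S. c p * s (u p) i)"
    by auto
  have up: "vscale E (c p) (u p) \<in> fibre E a" using fibre_closed(3)[OF a] insert.prems by auto
  have "s (vadd E (vscale E (c p) (u p)) v) i = (\<Sum>p\<in>insert p S. c p * s (u p) i)"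
    if "(V, s) \<in> trivs E" "a \<in> V" for V s i
    using v(2)[OF that] triv_add[OF that up v(1)] triv_scale[OF that insert.prems[of p]] insert.hyps by simp
  thus ?case using fibre_closed(2)[OF a up v(1)] by blast
qed

definition fibre_sum :: "'m => 'p set => ('p => real) => ('p => 'e) => 'e" where
  "fibre_sum a S c u = (SOME v. v \<in> fibre E a \<and>
    (\<forall>V s. (V, s) \<in> trivs E --> a \<in> V --> (\<forall>i. s v i = (\<Sum>p\<in>S. c p * s (u p) i))))"

lemma fibre_sum:
  assumes "a \<in> points M" "finite S" "\<And>p. p \<in> S ==> u p \<in> fibre E a"
  shows "fibre_sum a S c u \<in> fibre E a"
    and "(V, s) \<in> trivs E ==> a \<in> V ==> s (fibre_sum a S c u) i = (\<Sum>p\<in>S. c p * s (u p) i)"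
  using someI_ex[OF fibre_sum_exists[where u = u and c = c, OF assms, unfolded Bex_def]] unfolding fibre_sum_def[symmetric] by auto

text \<open>\<open>u\<close> is the combination of the unit points of \<open>t\<close> with
  coefficients \<open>t u\<close>, by injectivity of \<open>t\<close> on the fibre; apply
  \<open>s\<close> to this combination.\<close>

lemma triv_change:
  assumes t: "(U, t) \<in> trivs E" "a \<in> U" and s: "(V, s) \<in> trivs E" "a \<in> V" and u: "u \<in> fibre E a"
  shows "s u i = (\<Sum>j\<in>idx E. t u j * s (unit_point E t j a) i)"
proof -
  have a: "a \<in> points M" using opn_points[OF triv_open[OF t(1)]] t(2) by auto
  let ?v = "fibre_sum a (idx E) (t u) (\<lambda>j. unit_point E t j a)"
  have up: "unit_point E t j a \<in> fibre E a" if "j \<in> idx E" for j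
    by (rule unit_point_props(1)[OF t that])
  note v = fibre_sum[where u = "\<lambda>j. unit_point E t j a" and c = "t u", OF a finite_idx up]
  have "t ?v i = t u i" if "i \<in> idx E" for i
    using v(2)[OF _ t, where i = i] that finite_idx
    by (simp add: unit_point_props(2)[OF t] if_distrib[of "(*) _"] sum.delta cong: if_cong)
  hence "?v = u" by (intro triv_inj[OF t v(1) u]) auto
  thus ?thesis using v(2)[OF _ s, where i = i] by simp
qed

section \<open>Smooth sections as a presheaf of modules\<close>

lemma section_simps:
  "sects U = {\<psi> \<in> extensional U. (\<forall>a\<in>U. \<psi> a \<in> fibre E a) \<and>
      (\<forall>(V, t)\<in>trivs E. \<forall>i\<in>idx E. smooth_fun M (U \<inter> V) (\<lambda>a. t (\<psi> a) i))}"
  "\<zero>\<^bsub>sec \<Gamma> U\<^esub> = (\<lambda>a\<in>U. vzero E a)"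
  "ring.add (sec \<Gamma> U) = (\<lambda>\<psi> \<eta>. \<lambda>a\<in>U. vadd E (\<psi> a) (\<eta> a))"
  "module.smult (sec \<Gamma> U) = (\<lambda>f \<psi>. \<lambda>a\<in>U. vscale E (f a) (\<psi> a))"
  "res \<Gamma> U V \<psi> = restrict \<psi> V"
  by (simp_all add: smooth_sections_def)

lemma section_fibre: "\<psi> \<in> sects U ==> a \<in> U ==> \<psi> a \<in> fibre E a"
  and section_ext: "\<psi> \<in> sects U ==> \<psi> \<in> extensional U"
  by (auto simp: section_simps)

lemma section_smooth:
  "\<psi> \<in> sects U ==> (V, t) \<in> trivs E ==> i \<in> idx E ==> smooth_fun M (U \<inter> V) (\<lambda>a. t (\<psi> a) i)"
  by (auto simp: section_simps)

text \<open>By \<open>triv_change\<close> the coordinates in any other trivialization are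
  combinations of the given ones with entries of a smooth transition matrix.\<close>

lemma section_local:
  assumes U: "opn U" and ext: "\<psi> \<in> extensional U" and fib: "\<And>a. a \<in> U ==> \<psi> a \<in> fibre E a"
    and loc: "\<And>a. a \<in> U ==> \<exists>V t W. (V, t) \<in> trivs E \<and> opn W \<and> a \<in> W \<and> W \<subseteq> U \<inter> V \<and>
      (\<forall>i\<in>idx E. smooth_fun M W (\<lambda>a. t (\<psi> a) i))"
  shows "\<psi> \<in> sects U"
proof -
  have "smooth_fun M (U \<inter> V') (\<lambda>a. s (\<psi> a) i)" if s: "(V', s) \<in> trivs E" and i: "i \<in> idx E" for V' s i
  proof (rule smooth_fun_local)
    show "opn (U \<inter> V')" using U triv_open[OF s] by auto
    fix a assume a: "a \<in> U \<inter> V'"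
    then obtain V t W where t: "(V, t) \<in> trivs E" and W: "opn W" "a \<in> W" "W \<subseteq> U \<inter> V"
      and sm: "\<And>i. i \<in> idx E ==> smooth_fun M W (\<lambda>a. t (\<psi> a) i)" using loc[of a] by auto
    let ?W = "W \<inter> V'"
    have W': "opn ?W" using W triv_open[OF s] by auto
    have "smooth_fun M ?W (\<lambda>a. \<Sum>j\<in>idx E. t (\<psi> a) j * s (unit_point E t j a) i)"
    proof (intro smooth_fun_sum smooth_fun_mult W')
      fix j assume j: "j \<in> idx E"
      show "smooth_fun M ?W (\<lambda>a. t (\<psi> a) j)" by (rule smooth_fun_subset[OF sm[OF j]]) auto
      show "smooth_fun M ?W (\<lambda>a. s (unit_point E t j a) i)"
        by (rule smooth_fun_subset[OF triv_smooth[OF t s i j]]) (use W in auto)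
    qed
    moreover have "s (\<psi> b) i = (\<Sum>j\<in>idx E. t (\<psi> b) j * s (unit_point E t j b) i)" if "b \<in> ?W" for b
      by (rule triv_change[OF t _ s _ fib]) (use that W in auto)
    ultimately have "smooth_fun M ?W (\<lambda>a. s (\<psi> a) i)" using smooth_fun_cong[OF W', of "\<lambda>a. s (\<psi> a) i"] by simp
    thus "\<exists>V. opn V \<and> a \<in> V \<and> V \<subseteq> U \<inter> V' \<and> smooth_fun M V (\<lambda>a. s (\<psi> a) i)"
      using W W' a by (intro exI[of _ ?W]) auto
  qed
  thus ?thesis using ext fib by (auto simp: section_simps)
qed

lemma section_eqI:
  assumes "\<psi> \<in> extensional U" "\<eta> \<in> extensional U" "\<And>a. a \<in> U ==> \<psi> a \<in> fibre E a" "\<And>a. a \<in> U ==> \<eta> a \<in> fibre E a"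
    "\<And>a V t i. a \<in> U ==> (V, t) \<in> trivs E ==> a \<in> V ==> t (\<psi> a) i = t (\<eta> a) i" "opn U"
  shows "\<psi> = \<eta>"
proof (rule extensionalityI[OF assms(1,2)])
  fix a assume a: "a \<in> U"
  then obtain V t where t: "(V, t) \<in> trivs E" "a \<in> V" using triv_cover opn_points[OF assms(6)] by blast
  show "\<psi> a = \<eta> a" by (rule triv_inj[OF t assms(3,4)[OF a]]) (rule assms(5)[OF a t])
qed

lemma section_restrict: "\<psi> \<in> sects U ==> opn V ==> V \<subseteq> U ==> restrict \<psi> V \<in> sects V"
proof -
  assume \<psi>: "\<psi> \<in> sects U" and V: "opn V" "V \<subseteq> U"
  have "smooth_fun M (V \<inter> W) (\<lambda>a. t (restrict \<psi> V a) i)" if t: "(W, t) \<in> trivs E" and i: "i \<in> idx E" for W t i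
  proof -
    have op: "opn (V \<inter> W)" using V triv_open[OF t] by auto
    have "smooth_fun M (V \<inter> W) (\<lambda>a. t (\<psi> a) i)"
      by (rule smooth_fun_subset[OF section_smooth[OF \<psi> t i]]) (use V in auto)
    thus ?thesis using smooth_fun_cong[OF op, of "\<lambda>a. t (restrict \<psi> V a) i" "\<lambda>a. t (\<psi> a) i"] by auto
  qed
  thus ?thesis using section_fibre[OF \<psi>] V by (auto simp: section_simps)
qed

lemma section_ops:
  assumes U: "opn U" and \<psi>: "\<psi> \<in> sects U"
  shows section_zero: "\<zero>\<^bsub>sec \<Gamma> U\<^esub> \<in> sects U"
    and section_add: "\<eta> \<in> sects U ==> \<psi> \<oplus>\<^bsub>sec \<Gamma> U\<^esub> \<eta> \<in> sects U"
    and section_smult: "f \<in> fcts U ==> f \<odot>\<^bsub>sec \<Gamma> U\<^esub> \<psi> \<in> sects U"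
proof -
  have UM: "a \<in> points M" if "a \<in> U" for a using opn_points[OF U] that by auto
  \<comment> \<open>It is enough to find, in each trivialization, a smooth function that agrees with
    the coordinate on the overlap.\<close>
  have key: "\<phi> \<in> sects U"
    if "\<phi> \<in> extensional U" "\<And>a. a \<in> U ==> \<phi> a \<in> fibre E a"
      "\<And>V t i. (V, t) \<in> trivs E ==> i \<in> idx E ==> \<exists>g. smooth_fun M (U \<inter> V) g \<and> (\<forall>a\<in>U \<inter> V. t (\<phi> a) i = g a)" for \<phi>
  proof -
    have "smooth_fun M (U \<inter> V) (\<lambda>a. t (\<phi> a) i)" if "(V, t) \<in> trivs E" "i \<in> idx E" for V t i
    proof -
      obtain g where g: "smooth_fun M (U \<inter> V) g" "\<forall>a\<in>U \<inter> V. t (\<phi> a) i = g a"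
        using \<open>\<And>V t i. (V, t) \<in> trivs E ==> i \<in> idx E ==> \<exists>g. smooth_fun M (U \<inter> V) g \<and> (\<forall>a\<in>U \<inter> V. t (\<phi> a) i = g a)\<close>[OF \<open>(V, t) \<in> trivs E\<close> \<open>i \<in> idx E\<close>] by auto
      have "opn (U \<inter> V)" using U triv_open[OF \<open>(V, t) \<in> trivs E\<close>] by auto
      from smooth_fun_cong[OF this, of "\<lambda>a. t (\<phi> a) i" g] show ?thesis using g by auto
    qed
    thus ?thesis using that(1,2) by (auto simp: section_simps)
  qed
  have op: "opn (U \<inter> V)" if "(V, t) \<in> trivs E" for V t using U triv_open[OF that] by auto
  show "\<zero>\<^bsub>sec \<Gamma> U\<^esub> \<in> sects U"
  proof (rule key)
    fix V t i assume t: "(V, t) \<in> trivs E"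
    show "\<exists>g. smooth_fun M (U \<inter> V) g \<and> (\<forall>a\<in>U \<inter> V. t (\<zero>\<^bsub>sec \<Gamma> U\<^esub> a) i = g a)"
      by (intro exI[of _ "\<lambda>_. 0"] conjI smooth_fun_const op[OF t]) (use triv_zero[OF t] in \<open>auto simp: section_simps\<close>)
  qed (use fibre_closed(1) UM in \<open>auto simp: section_simps\<close>)
  show "\<psi> \<oplus>\<^bsub>sec \<Gamma> U\<^esub> \<eta> \<in> sects U" if \<eta>: "\<eta> \<in> sects U"
  proof (rule key)
    fix V t i assume t: "(V, t) \<in> trivs E" and i: "i \<in> idx E"
    show "\<exists>g. smooth_fun M (U \<inter> V) g \<and> (\<forall>a\<in>U \<inter> V. t ((\<psi> \<oplus>\<^bsub>sec \<Gamma> U\<^esub> \<eta>) a) i = g a)"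
      by (intro exI[of _ "\<lambda>a. t (\<psi> a) i + t (\<eta> a) i"] conjI smooth_fun_add op[OF t] section_smooth[OF \<psi> t i]
          section_smooth[OF \<eta> t i])
        (use triv_add[OF t] section_fibre[OF \<psi>] section_fibre[OF \<eta>] in \<open>auto simp: section_simps(3)\<close>)
  qed (use fibre_closed(2) UM section_fibre[OF \<psi>] section_fibre[OF \<eta>] in \<open>auto simp: section_simps(3)\<close>)
  show "f \<odot>\<^bsub>sec \<Gamma> U\<^esub> \<psi> \<in> sects U" if f: "f \<in> fcts U"
  proof (rule key)
    fix V t i assume t: "(V, t) \<in> trivs E" and i: "i \<in> idx E"
    show "\<exists>g. smooth_fun M (U \<inter> V) g \<and> (\<forall>a\<in>U \<inter> V. t ((f \<odot>\<^bsub>sec \<Gamma> U\<^esub> \<psi>) a) i = g a)"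
      by (intro exI[of _ "\<lambda>a. f a * t (\<psi> a) i"] conjI smooth_fun_mult op[OF t] section_smooth[OF \<psi> t i]
          smooth_fun_subset[OF smooth_ring_fun[OF f]])
        (use triv_scale[OF t] section_fibre[OF \<psi>] in \<open>auto simp: section_simps(4)\<close>)
  qed (use fibre_closed(3) UM section_fibre[OF \<psi>] in \<open>auto simp: section_simps(4)\<close>)
qed

lemma section_coord:
  assumes "\<psi> \<in> sects U" "(V, t) \<in> trivs E" "a \<in> U" "a \<in> V"
  shows "t (\<zero>\<^bsub>sec \<Gamma> U\<^esub> a) i = 0"
    and "\<eta> \<in> sects U ==> t ((\<psi> \<oplus>\<^bsub>sec \<Gamma> U\<^esub> \<eta>) a) i = t (\<psi> a) i + t (\<eta> a) i"
    and "t ((f \<odot>\<^bsub>sec \<Gamma> U\<^esub> \<psi>) a) i = f a * t (\<psi> a) i"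
  using triv_zero[OF assms(2,4)] triv_add[OF assms(2,4)] triv_scale[OF assms(2,4)] section_fibre assms
  by (auto simp: section_simps(2-4))

lemma zero_section: "opn U ==> (\<lambda>a\<in>U. vzero E a) \<in> sects U"
proof -
  assume U: "opn U"
  have "smooth_fun M (U \<inter> V) (\<lambda>a. t (restrict (vzero E) U a) i)" if t: "(V, t) \<in> trivs E" for V t i
  proof -
    have "opn (U \<inter> V)" using U triv_open[OF t] by auto
    thus ?thesis
      using smooth_fun_cong[of "U \<inter> V" "\<lambda>a. t (restrict (vzero E) U a) i" "\<lambda>_. 0"] triv_zero[OF t] smooth_fun_const by auto
  qed
  thus ?thesis using fibre_closed(1) opn_points[OF U] by (auto simp: section_simps)
qed

text \<open>\<open>vector_bundle\<close> does not list the vector space laws; they hold because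
  coordinates are injective on fibres and turn the operations into those of real-valued
  functions.\<close>

lemma module_sections: assumes U: "opn U" shows "module (smooth_ring M U) (sec \<Gamma> U)"
proof -
  let ?G = "sec \<Gamma> U"
  note closed = section_add[OF U] section_smult[OF U] zero_section[OF U, folded section_simps(2)]
  have eqI: "\<psi> = \<eta>" if "\<psi> \<in> carrier ?G" "\<eta> \<in> carrier ?G"
    "\<And>a V t i. a \<in> U ==> (V, t) \<in> trivs E ==> a \<in> V ==> t (\<psi> a) i = t (\<eta> a) i" for \<psi> \<eta>
    by (rule section_eqI[of _ U]) (use that U section_ext section_fibre in auto)
  interpret R: cring "smooth_ring M U" by (rule cring_smooth_ring[OF U])
  show ?thesis
  proof (rule moduleI[OF R.is_cring])
    show "abelian_group ?G"
    proof (rule abelian_groupI)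
      fix x assume x: "x \<in> carrier ?G"
      let ?y = "(\<lambda>a\<in>U. -1) \<odot>\<^bsub>?G\<^esub> x"
      have y: "?y \<in> carrier ?G" using closed x const_in_smooth_ring[OF U] by auto
      moreover have "?y \<oplus>\<^bsub>?G\<^esub> x = \<zero>\<^bsub>?G\<^esub>"
        by (rule eqI) (use x y closed in \<open>auto simp: section_coord[of _ U]\<close>)
      ultimately show "\<exists>y\<in>carrier ?G. y \<oplus>\<^bsub>?G\<^esub> x = \<zero>\<^bsub>?G\<^esub>" by blast
      show "\<zero>\<^bsub>?G\<^esub> \<oplus>\<^bsub>?G\<^esub> x = x" by (rule eqI) (use x closed in \<open>auto simp: section_coord[of _ U]\<close>)
      fix y assume y: "y \<in> carrier ?G"
      show "x \<oplus>\<^bsub>?G\<^esub> y = y \<oplus>\<^bsub>?G\<^esub> x" by (rule eqI) (use x y closed in \<open>auto simp: section_coord[of _ U]\<close>)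
      fix z assume z: "z \<in> carrier ?G"
      show "x \<oplus>\<^bsub>?G\<^esub> y \<oplus>\<^bsub>?G\<^esub> z = x \<oplus>\<^bsub>?G\<^esub> (y \<oplus>\<^bsub>?G\<^esub> z)"
        by (rule eqI) (use x y z closed in \<open>auto simp: section_coord[of _ U]\<close>)
    qed (use closed in auto)
  next
    fix x assume x: "x \<in> carrier ?G"
    show "\<one>\<^bsub>smooth_ring M U\<^esub> \<odot>\<^bsub>?G\<^esub> x = x"
      by (rule eqI) (use x closed R.one_closed in \<open>auto simp: section_coord[of _ U] smooth_ring_simps(3)\<close>)
    fix f assume f: "f \<in> fcts U"
    show "f \<odot>\<^bsub>?G\<^esub> x \<in> carrier ?G" using f x closed by auto
    {
      fix y assume y: "y \<in> carrier ?G"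
      show "f \<odot>\<^bsub>?G\<^esub> (x \<oplus>\<^bsub>?G\<^esub> y) = f \<odot>\<^bsub>?G\<^esub> x \<oplus>\<^bsub>?G\<^esub> f \<odot>\<^bsub>?G\<^esub> y"
        by (rule eqI) (use f x y closed in \<open>auto simp: section_coord[of _ U] algebra_simps\<close>)
    }
    fix g assume g: "g \<in> fcts U"
    show "(f \<oplus>\<^bsub>smooth_ring M U\<^esub> g) \<odot>\<^bsub>?G\<^esub> x = f \<odot>\<^bsub>?G\<^esub> x \<oplus>\<^bsub>?G\<^esub> g \<odot>\<^bsub>?G\<^esub> x"
      by (rule eqI) (use f g x closed R.a_closed[OF f g] in \<open>auto simp: section_coord[of _ U] smooth_ring_simps(5) algebra_simps\<close>)
    show "(f \<otimes>\<^bsub>smooth_ring M U\<^esub> g) \<odot>\<^bsub>?G\<^esub> x = f \<odot>\<^bsub>?G\<^esub> (g \<odot>\<^bsub>?G\<^esub> x)"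
      by (rule eqI) (use f g x closed R.m_closed[OF f g] in \<open>auto simp: section_coord[of _ U] smooth_ring_simps(2) algebra_simps\<close>)
  qed
qed

lemma module_presheaf_sections: "module_presheaf M \<Gamma>"
proof (intro module_presheaf.intro module_presheaf_axioms.intro smooth_mfd_axioms)
  fix U V s assume "opn U" "opn V" "V \<subseteq> U" "s \<in> sects U"
  thus "res \<Gamma> U V s \<in> sects V" using section_restrict by (simp add: section_simps(5))
next
  fix U s assume "s \<in> sects U"
  thus "res \<Gamma> U U s = s"
    using section_ext by (simp add: section_simps(5) extensional_restrict)
qed (auto simp: section_simps(2-5) fun_eq_iff module_sections restrict_def)

sublocale S: module_presheaf M \<Gamma>
  by (rule module_presheaf_sections)

lemma lin_comb_section:
  assumes V: "opn V" and U: "opn U" "V \<subseteq> U" and I: "finite I" and \<Phi>: "\<And>i. i \<in> I ==> \<Phi> i \<in> sects U"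
    and f: "f \<in> I \<rightarrow>\<^sub>E fcts V"
  shows "lin_comb \<Gamma> I U V \<Phi> f \<in> sects V"
    and "(W, t) \<in> trivs E ==> a \<in> V ==> a \<in> W ==> t (lin_comb \<Gamma> I U V \<Phi> f a) j = (\<Sum>i\<in>I. f i a * t (\<Phi> i a) j)"
proof -
  interpret V: smodule "smooth_ring M V" "sec \<Gamma> V" by (rule S.sec_smodule[OF V])
  have tm: "f i \<odot>\<^bsub>sec \<Gamma> V\<^esub> res \<Gamma> U V (\<Phi> i) \<in> sects V" if "i \<in> I" for i
    using f that S.res_closed[OF U(1) V U(2) \<Phi>[OF that]] by auto
  have fin: "(\<Oplus>\<^bsub>sec \<Gamma> V\<^esub>i\<in>J. f i \<odot>\<^bsub>sec \<Gamma> V\<^esub> res \<Gamma> U V (\<Phi> i)) \<in> sects V" if "J \<subseteq> I" for J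
    using tm that by (intro V.finsum_closed) auto
  show "lin_comb \<Gamma> I U V \<Phi> f \<in> sects V" unfolding lin_comb_def by (rule fin) simp
  assume W: "(W, t) \<in> trivs E" "a \<in> V" "a \<in> W"
  have "t ((\<Oplus>\<^bsub>sec \<Gamma> V\<^esub>i\<in>J. f i \<odot>\<^bsub>sec \<Gamma> V\<^esub> res \<Gamma> U V (\<Phi> i)) a) j = (\<Sum>i\<in>J. f i a * t (\<Phi> i a) j)"
    if "J \<subseteq> I" for J
    using finite_subset[OF that I] that
  proof (induction J)
    case empty
    show ?case using section_coord(1)[OF zero_section[OF V] W] by simp
  next
    case (insert i J)
    have r: "res \<Gamma> U V (\<Phi> i) \<in> sects V" using S.res_closed[OF U(1) V U(2) \<Phi>] insert.prems by auto
    have 1: "(\<lambda>i. f i \<odot>\<^bsub>sec \<Gamma> V\<^esub> res \<Gamma> U V (\<Phi> i)) \<in> J \<rightarrow> sects V"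
      "f i \<odot>\<^bsub>sec \<Gamma> V\<^esub> res \<Gamma> U V (\<Phi> i) \<in> sects V"
      using tm insert.prems by auto
    have "res \<Gamma> U V (\<Phi> i) a = \<Phi> i a" using W(2) by (simp add: section_simps(5))
    thus ?case
      unfolding V.finsum_insert[OF insert.hyps 1] section_coord(2)[OF 1(2) W fin[OF subset_trans[OF subset_insertI insert.prems]]]
        section_coord(3)[OF r W] insert.IH[OF subset_trans[OF subset_insertI insert.prems]]
      using insert.hyps by simp
  qed
  thus "t (lin_comb \<Gamma> I U V \<Phi> f a) j = (\<Sum>i\<in>I. f i a * t (\<Phi> i a) j)" unfolding lin_comb_def by simp
qed

section \<open>Frames that come from trivializations\<close>

definition triv_frame :: "('e => 'i => real) => 'm set => 'i => 'm => 'e" where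
  "triv_frame t W j = (\<lambda>a\<in>W. unit_point E t j a)"

lemma triv_frame_section:
  assumes t: "(U, t) \<in> trivs E" and W: "opn W" "W \<subseteq> U" and j: "j \<in> idx E"
  shows "triv_frame t W j \<in> sects W"
proof -
  have "smooth_fun M (W \<inter> V) (\<lambda>a. s (triv_frame t W j a) i)" if s: "(V, s) \<in> trivs E" and i: "i \<in> idx E" for V s i
  proof -
    have "opn (W \<inter> V)" using W triv_open[OF s] by auto
    from smooth_fun_cong[OF this, of "\<lambda>a. s (triv_frame t W j a) i" "\<lambda>a. s (unit_point E t j a) i"]
    show ?thesis using smooth_fun_subset[OF triv_smooth[OF t s i j], of "W \<inter> V"] W by (auto simp: triv_frame_def)
  qed
  thus ?thesis using unit_point_props(1)[OF t _ j] W(2) by (auto simp: section_simps triv_frame_def)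
qed

text \<open>Frames of a bundle are indexed by \<open>idx E\<close>, while
  \<open>locally_free\<close> asks for an initial segment of the natural numbers; the bijection
  \<open>e\<close> serves both.\<close>

lemma triv_local_frame_reindex:
  assumes t: "(U, t) \<in> trivs E" and W: "opn W" "W \<subseteq> U" and e: "bij_betw e J (idx E)"
  shows "local_frame M \<Gamma> J W (\<lambda>j. triv_frame t W (e j))"
  unfolding local_frame_def
proof (intro conjI allI impI ballI)
  have J: "finite J" using bij_betw_finite[OF e] finite_idx by simp
  have eJ: "e j \<in> idx E" if "j \<in> J" for j using bij_betw_apply[OF e that] .
  let ?\<Phi> = "\<lambda>j. triv_frame t W (e j)"
  have \<Phi>: "?\<Phi> j \<in> sects W" if "j \<in> J" for j by (rule triv_frame_section[OF t W eJ[OF that]])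
  show "opn W" by fact
  show "?\<Phi> j \<in> sects W" if "j \<in> J" for j by (rule \<Phi>[OF that])
  fix V s assume V: "opn V \<and> V \<subseteq> W" and s: "s \<in> sects V"
  \<comment> \<open>Unit points have unit vectors as coordinates, so coordinate \<open>e j\<close>
    of a combination is its j-th coefficient. Existence and uniqueness of the coefficients both
    follow.\<close>
  have coord: "t (lin_comb \<Gamma> J W V ?\<Phi> f a) (e j) = f j a"
    if f: "f \<in> J \<rightarrow>\<^sub>E fcts V" and a: "a \<in> V" and j: "j \<in> J" for f a j
  proof -
    have aU: "a \<in> U" "a \<in> W" using a V W by auto
    have "t (lin_comb \<Gamma> J W V ?\<Phi> f a) (e j) = (\<Sum>i\<in>J. f i a * t (?\<Phi> i a) (e j))"
      by (rule lin_comb_section(2)[OF _ W(1) _ J \<Phi> f t a aU(1)]) (use V in auto)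
    also have "\<dots> = (\<Sum>i\<in>J. if j = i then f i a else 0)"
      by (rule sum.cong)
        (use aU unit_point_props(2)[OF t aU(1) eJ] bij_betw_imp_inj_on[OF e] j in \<open>auto simp: triv_frame_def inj_on_def\<close>)
    finally show ?thesis using j J by simp
  qed
  let ?f = "\<lambda>j\<in>J. \<lambda>a\<in>V. t (s a) (e j)"
  have f: "?f \<in> J \<rightarrow>\<^sub>E fcts V"
    using section_smooth[OF s t eJ] V W(2) by (auto intro!: restrict_smooth simp: Int_absorb2 subset_trans)
  have lcf: "lin_comb \<Gamma> J W V ?\<Phi> ?f \<in> sects V"
    by (rule lin_comb_section(1)[OF _ W(1) _ J \<Phi> f]) (use V in auto)
  show "\<exists>!f. f \<in> J \<rightarrow>\<^sub>E fcts V \<and> s = lin_comb \<Gamma> J W V ?\<Phi> f"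
  proof (rule ex1I[of _ ?f])
    have "s = lin_comb \<Gamma> J W V ?\<Phi> ?f"
    proof (rule extensionalityI[OF section_ext[OF s] section_ext[OF lcf]])
      fix a assume a: "a \<in> V"
      hence "a \<in> U" using V W by auto
      thus "s a = lin_comb \<Gamma> J W V ?\<Phi> ?f a"
      proof (rule triv_inj[OF t _ section_fibre[OF s a] section_fibre[OF lcf a]])
        fix i assume "i \<in> idx E"
        then obtain j where "j \<in> J" "i = e j" using bij_betw_imp_surj_on[OF e] by auto
        thus "t (s a) i = t (lin_comb \<Gamma> J W V ?\<Phi> ?f a) i" using coord[OF f a] a by simp
      qed
    qed
    thus "?f \<in> J \<rightarrow>\<^sub>E fcts V \<and> s = lin_comb \<Gamma> J W V ?\<Phi> ?f"
      using f by blast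
    fix g assume g: "g \<in> J \<rightarrow>\<^sub>E fcts V \<and> s = lin_comb \<Gamma> J W V ?\<Phi> g"
    show "g = ?f"
    proof (rule extensionalityI[of _ J])
      fix j assume j: "j \<in> J"
      show "g j = ?f j"
        by (rule extensionalityI[of _ V]) (use g j coord[of g _ j] in \<open>auto simp: PiE_iff smooth_ring_simps\<close>)
    qed (use g in \<open>auto simp: PiE_iff\<close>)
  qed
qed

lemma triv_local_frame:
  "(U, t) \<in> trivs E ==> opn W ==> W \<subseteq> U ==> local_frame M \<Gamma> (idx E) W (triv_frame t W)"
  using triv_local_frame_reindex[of U t W "\<lambda>j. j" "idx E"] by (simp add: bij_betw_def)

end

section \<open>Bundles of jets\<close>

lemma disjoint_union_bundle_simps [simp]:
  "tot (disjoint_union_bundle M P I T) = (SIGMA a:points M. carrier (P a))"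
  "vproj (disjoint_union_bundle M P I T) = fst"
  "idx (disjoint_union_bundle M P I T) = I"
  "trivs (disjoint_union_bundle M P I T) = T"
  "vzero (disjoint_union_bundle M P I T) a = (a, \<zero>\<^bsub>P a\<^esub>)"
  "vadd (disjoint_union_bundle M P I T) (a, x) (b, y) = (a, x \<oplus>\<^bsub>P a\<^esub> y)"
  "vscale (disjoint_union_bundle M P I T) c (a, x) =
    (a, germ M (smooth_functions M) a (points M) (\<lambda>b\<in>points M. c) \<odot>\<^bsub>P a\<^esub> x)"
  by (simp_all add: disjoint_union_bundle_def)

lemma disjoint_union_bundle_fibre:
  "a \<in> points M ==> fibre (disjoint_union_bundle M P I T) a = {a} \<times> carrier (P a)"
  by (auto simp: fibre_def)

context module_presheaf
begin

context
  fixes q and I :: "'i set" and T and D :: "('m, 'm \<times> ('m set \<times> 's) set set, 'i) vbundle"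
  assumes D: "D = disjoint_union_bundle M (jet_space M F q) I T"
begin

lemma jet_fibre: "section_at a U s ==> (a, jet_class M F q a U s) \<in> fibre D a"
  using jet_class_in[of U a s] opn_points[of U] by (auto simp: D disjoint_union_bundle_fibre)

lemma jet_fibreE:
  assumes "u \<in> fibre D a" "a \<in> V" "opn V"
  obtains U s where "section_at a U s" "U \<subseteq> V" "u = (a, jet_class M F q a U s)"
proof -
  have a: "a \<in> points M" using assms opn_points by auto
  then obtain x where x: "u = (a, x)" "x \<in> carrier (jet_space M F q a)"
    using assms(1) by (auto simp: D disjoint_union_bundle_fibre)
  show thesis using jet_space_rep[OF a x(2) assms(3,2)] that x(1) by metis
qed

lemma jet_vadd:
  "section_at a U s ==> section_at a U t ==>
    vadd D (a, jet_class M F q a U s) (a, jet_class M F q a U t) = (a, jet_class M F q a U (s \<oplus>\<^bsub>sec F U\<^esub> t))"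
  by (simp add: D jet_add)

lemma jet_vscale:
  "section_at a U s ==>
    vscale D c (a, jet_class M F q a U s) = (a, jet_class M F q a U ((\<lambda>b\<in>U. c) \<odot>\<^bsub>sec F U\<^esub> s))"
  by (simp add: D jet_scale)

lemma jet_vzero: "opn U ==> a \<in> U ==> vzero D a = (a, jet_class M F q a U \<zero>\<^bsub>sec F U\<^esub>)"
  using jet_zero[of U a q] by (simp add: D)

lemma jet_common_domain:
  assumes "section_at a U s" "section_at a V t"
  obtains W s' t' where "section_at a W s'" "section_at a W t'" "W \<subseteq> U \<inter> V"
    "jet_class M F q a U s = jet_class M F q a W s'" "jet_class M F q a V t = jet_class M F q a W t'"
proof (rule that)
  have W: "opn (U \<inter> V)" "a \<in> U \<inter> V" using assms by auto
  show "section_at a (U \<inter> V) (res F U (U \<inter> V) s)" by (rule section_at_res[OF assms(1) W]) simp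
  show "section_at a (U \<inter> V) (res F V (U \<inter> V) t)" by (rule section_at_res[OF assms(2) W]) simp
  show "jet_class M F q a U s = jet_class M F q a (U \<inter> V) (res F U (U \<inter> V) s)"
    using jet_class_res[OF assms(1) W] by simp
  show "jet_class M F q a V t = jet_class M F q a (U \<inter> V) (res F V (U \<inter> V) t)"
    using jet_class_res[OF assms(2) W] by simp
qed simp

text \<open>Serves the usual jet bundle (\<open>q = Suc k\<close>) and the bundle of a locally free
  sheaf (\<open>q = Suc 0\<close>). The conditions on fibres are stated for representing sections.
  The hypothesis \<open>smooth\<close> may use that trivializations are injective on fibres:
  \<open>unit_point\<close> is an inverse image, and it is identified by exhibiting a point with the
  right coordinates.\<close>

lemma jet_bundleI:
  assumes I: "finite I" and cover: "\<And>a. a \<in> points M ==> \<exists>U t. (U, t) \<in> T \<and> a \<in> U"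
    and op: "\<And>U t. (U, t) \<in> T ==> opn U"
    and supp: "\<And>U t a V s i. (U, t) \<in> T ==> V \<subseteq> U ==> section_at a V s ==> i \<notin> I ==>
      t (a, jet_class M F q a V s) i = 0"
    and add: "\<And>U t a V s s' i. (U, t) \<in> T ==> V \<subseteq> U ==> section_at a V s ==> section_at a V s' ==> i \<in> I ==>
      t (a, jet_class M F q a V (s \<oplus>\<^bsub>sec F V\<^esub> s')) i = t (a, jet_class M F q a V s) i + t (a, jet_class M F q a V s') i"
    and scale: "\<And>U t a V s c i. (U, t) \<in> T ==> V \<subseteq> U ==> section_at a V s ==> i \<in> I ==>
      t (a, jet_class M F q a V ((\<lambda>b\<in>V. c) \<odot>\<^bsub>sec F V\<^esub> s)) i = c * t (a, jet_class M F q a V s) i"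
    and inj: "\<And>U t a V s. (U, t) \<in> T ==> V \<subseteq> U ==> section_at a V s ==>
      (\<And>i. i \<in> I ==> t (a, jet_class M F q a V s) i = 0) ==> jet_class M F q a V s = jet_class M F q a V \<zero>\<^bsub>sec F V\<^esub>"
    and surj: "\<And>U t a x. (U, t) \<in> T ==> a \<in> U ==>
      \<exists>V s. section_at a V s \<and> V \<subseteq> U \<and> (\<forall>i\<in>I. t (a, jet_class M F q a V s) i = x i)"
    and smooth: "\<And>U t V s i j. (\<And>U t a. (U, t) \<in> T ==> a \<in> U ==> inj_on t (fibre D a)) ==> (U, t) \<in> T ==> (V, s) \<in> T ==>
      i \<in> I ==> j \<in> I ==> smooth_fun M (U \<inter> V) (\<lambda>a. s (unit_point D t j a) i)"
  shows "vector_bundle M D"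
proof -
  let ?jc = "jet_class M F q"
  have add': "t (a, ?jc a V (s \<oplus>\<^bsub>sec F V\<^esub> s')) = (\<lambda>i. t (a, ?jc a V s) i + t (a, ?jc a V s') i)"
    if "(U, t) \<in> T" "V \<subseteq> U" "section_at a V s" "section_at a V s'" for U t a V s s'
    using add[OF that] supp[OF that(1-3)] supp[OF that(1,2,4)] supp[OF that(1,2), of a "s \<oplus>\<^bsub>sec F V\<^esub> s'"]
      sec_closed(2)[of V s s'] that by (intro ext) (metis add_0)
  have scale': "t (a, ?jc a V ((\<lambda>b\<in>V. c) \<odot>\<^bsub>sec F V\<^esub> s)) = (\<lambda>i. c * t (a, ?jc a V s) i)"
    if "(U, t) \<in> T" "V \<subseteq> U" "section_at a V s" for U t a V s c
    using scale[OF that, of _ c] supp[OF that] supp[OF that(1,2), of a "(\<lambda>b\<in>V. c) \<odot>\<^bsub>sec F V\<^esub> s"]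
      sec_closed(5)[of V "\<lambda>b\<in>V. c" s] const_in_smooth_ring[of V c] that by (intro ext) (metis mult_zero_right)
  have inj_t: "inj_on t (fibre D a)" if t: "(U, t) \<in> T" "a \<in> U" for U t a
  proof (rule inj_onI)
    fix u v assume u: "u \<in> fibre D a" and v: "v \<in> fibre D a" and eq: "t u = t v"
    obtain V1 s1 where s1: "section_at a V1 s1" "V1 \<subseteq> U" "u = (a, ?jc a V1 s1)" using jet_fibreE[OF u t(2) op[OF t(1)]] .
    obtain V2 s2 where s2: "section_at a V2 s2" "V2 \<subseteq> U" "v = (a, ?jc a V2 s2)" using jet_fibreE[OF v t(2) op[OF t(1)]] .
    obtain W s s' where W: "section_at a W s" "section_at a W s'" "W \<subseteq> V1 \<inter> V2" "?jc a V1 s1 = ?jc a W s" "?jc a V2 s2 = ?jc a W s'"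
      using jet_common_domain[OF s1(1) s2(1)] .
    have WU: "W \<subseteq> U" using W s1 by auto
    \<comment> \<open>Two points of a fibre are compared through the difference of representatives
      over a common domain, which reduces injectivity to the kernel.\<close>
    let ?d = "s \<ominus>\<^bsub>sec F W\<^esub> s'"
    interpret W: smodule "smooth_ring M W" "sec F W" using sec_smodule W by auto
    have d: "section_at a W ?d" using W by auto
    have "?d \<oplus>\<^bsub>sec F W\<^esub> s' = s" using W by (simp add: a_minus_def W.a_assoc W.l_neg)
    hence "t (a, ?jc a W ?d) i = 0" for i
      using fun_cong[OF add'[OF t(1) WU d W(2)], of i] eq unfolding s1(3) s2(3) W(4,5) by simp
    hence "?jc a W ?d = ?jc a W \<zero>\<^bsub>sec F W\<^esub>" by (rule inj[OF t(1) WU d])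
    hence "\<exists>W'. opn W' \<and> a \<in> W' \<and> W' \<subseteq> W \<and> res F W W' (?d \<ominus>\<^bsub>sec F W\<^esub> \<zero>\<^bsub>sec F W\<^esub>) \<in> vanishing_sections q a W'"
      using jet_eq_iff[OF d, of "\<zero>\<^bsub>sec F W\<^esub>" q] W by auto
    moreover have "?d \<ominus>\<^bsub>sec F W\<^esub> \<zero>\<^bsub>sec F W\<^esub> = ?d" using d by (simp add: a_minus_def W.inv_zero)
    ultimately show "u = v" using jet_eq_iff[OF W(1,2)] s1(3) s2(3) W(4,5) by simp
  qed
  have bij: "bij_betw t (fibre D a) {x. \<forall>i. i \<notin> I --> x i = 0}" if t: "(U, t) \<in> T" "a \<in> U" for U t a
    unfolding bij_betw_def
  proof (intro conjI inj_t[OF t] equalityI subsetI)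
    fix x assume "x \<in> t ` fibre D a"
    then obtain u where u: "u \<in> fibre D a" "x = t u" by auto
    obtain V s where s: "section_at a V s" "V \<subseteq> U" "u = (a, ?jc a V s)" using jet_fibreE[OF u(1) t(2) op[OF t(1)]] .
    thus "x \<in> {x. \<forall>i. i \<notin> I --> x i = 0}" using supp[OF t(1) s(2,1)] u by simp
  next
    fix x :: "'i => real" assume x: "x \<in> {x. \<forall>i. i \<notin> I --> x i = 0}"
    obtain V s where s: "section_at a V s" "V \<subseteq> U" "\<forall>i\<in>I. t (a, ?jc a V s) i = x i" using surj[OF t] by blast
    have "t (a, ?jc a V s) i = x i" for i
      using supp[OF t(1) s(2,1), of i] s(3) x by (cases "i \<in> I") auto
    hence "x = t (a, ?jc a V s)" by auto
    thus "x \<in> t ` fibre D a" using jet_fibre[OF s(1)] by (rule image_eqI)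
  qed
  have z: "section_at a U \<zero>\<^bsub>sec F U\<^esub>" if "opn U" "a \<in> U" for a U
    using that sec_closed(1) by auto
  have tz: "t (vzero D a) = (\<lambda>i. 0)" if t: "(U, t) \<in> T" "a \<in> U" for U t a
  proof -
    have U: "opn U" by (rule op[OF t(1)])
    interpret U: abelian_group "sec F U" by (rule sec_abelian_group[OF U])
    show ?thesis using add'[OF t(1) order_refl z[OF U t(2)] z[OF U t(2)]] jet_vzero[OF U t(2)]
      by (simp add: fun_eq_iff)
  qed
  show ?thesis unfolding vector_bundle_def
  proof (intro conjI ballI)
    show "finite (idx D)" using I by (simp add: D)
    show "(\<Union>(U, t)\<in>trivs D. U) = points M"
    proof (intro equalityI subsetI)
      fix a assume "a \<in> points M"
      then obtain U t where "(U, t) \<in> T" "a \<in> U" using cover by blast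
      thus "a \<in> (\<Union>(U, t)\<in>trivs D. U)" by (intro UN_I[of "(U, t)"]) (simp_all add: D)
    qed (use opn_points[OF op] in \<open>auto simp: D\<close>)
    show "vproj D u \<in> points M" if "u \<in> tot D" for u using that by (auto simp: D)
  next
    fix a assume a: "a \<in> points M"
    show "vzero D a \<in> fibre D a" using jet_vzero[OF openin_topspace a] jet_fibre[OF z[OF openin_topspace a]] by simp
    show "vadd D u v \<in> fibre D a" if u: "u \<in> fibre D a" and v: "v \<in> fibre D a" for u v
    proof -
      obtain V1 s1 where s1: "section_at a V1 s1" "u = (a, ?jc a V1 s1)" using jet_fibreE[OF u a openin_topspace] .
      obtain V2 s2 where s2: "section_at a V2 s2" "v = (a, ?jc a V2 s2)" using jet_fibreE[OF v a openin_topspace] .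
      obtain W s s' where W: "section_at a W s" "section_at a W s'" "W \<subseteq> V1 \<inter> V2" "?jc a V1 s1 = ?jc a W s" "?jc a V2 s2 = ?jc a W s'"
        using jet_common_domain[OF s1(1) s2(1)] .
      show ?thesis unfolding s1 s2 W(4,5) jet_vadd[OF W(1,2)] using W sec_closed(2) by (intro jet_fibre) auto
    qed
    show "\<forall>c. \<forall>u\<in>fibre D a. vscale D c u \<in> fibre D a"
    proof (intro allI ballI)
      fix c u assume u: "u \<in> fibre D a"
      obtain V s where s: "section_at a V s" "u = (a, ?jc a V s)" using jet_fibreE[OF u a openin_topspace] .
      show "vscale D c u \<in> fibre D a"
        unfolding s(2) jet_vscale[OF s(1)] using s sec_closed(5) const_in_smooth_ring by (intro jet_fibre) auto
    qed
  next
    fix p assume "p \<in> trivs D"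
    then obtain U t where t: "p = (U, t)" "(U, t) \<in> T" by (cases p) (auto simp: D)
    have "t (vadd D u v) = (\<lambda>i. t u i + t v i)" if a: "a \<in> U" and u: "u \<in> fibre D a" and v: "v \<in> fibre D a" for a u v
    proof -
      obtain V1 s1 where s1: "section_at a V1 s1" "V1 \<subseteq> U" "u = (a, ?jc a V1 s1)" using jet_fibreE[OF u a op[OF t(2)]] .
      obtain V2 s2 where s2: "section_at a V2 s2" "V2 \<subseteq> U" "v = (a, ?jc a V2 s2)" using jet_fibreE[OF v a op[OF t(2)]] .
      obtain W s s' where W: "section_at a W s" "section_at a W s'" "W \<subseteq> V1 \<inter> V2" "?jc a V1 s1 = ?jc a W s" "?jc a V2 s2 = ?jc a W s'"
        using jet_common_domain[OF s1(1) s2(1)] .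
      have WU: "W \<subseteq> U" using W(3) s1(2) by auto
      show ?thesis unfolding s1(3) s2(3) W(4,5) jet_vadd[OF W(1,2)] by (rule add'[OF t(2) WU W(1,2)])
    qed
    moreover have "t (vscale D c u) = (\<lambda>i. c * t u i)" if a: "a \<in> U" and u: "u \<in> fibre D a" for a u c
    proof -
      obtain V s where s: "section_at a V s" "V \<subseteq> U" "u = (a, ?jc a V s)" using jet_fibreE[OF u a op[OF t(2)]] .
      show ?thesis unfolding s(3) jet_vscale[OF s(1)] by (rule scale'[OF t(2) s(2,1)])
    qed
    ultimately show "case p of (U, t) => openin (mtop M) U \<and> (\<forall>a\<in>U.
        bij_betw t (fibre D a) {x. \<forall>i. i \<notin> idx D --> x i = 0} \<and>
        t (vzero D a) = (\<lambda>i. 0) \<and>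
        (\<forall>u\<in>fibre D a. \<forall>v\<in>fibre D a. t (vadd D u v) = (\<lambda>i. t u i + t v i)) \<and>
        (\<forall>c. \<forall>u\<in>fibre D a. t (vscale D c u) = (\<lambda>i. c * t u i)))"
      using op[OF t(2)] bij[OF t(2)] tz[OF t(2)] by (auto simp: t(1)) (simp_all add: D)
  next
    fix p assume "p \<in> trivs D"
    then obtain U t where t: "p = (U, t)" "(U, t) \<in> T" by (cases p) (auto simp: D)
    have "smooth_fun M (U \<inter> V) (\<lambda>a. s (unit_point D t j a) i)"
      if "(V, s) \<in> T" "i \<in> I" "j \<in> I" for V s i j
      by (rule smooth[OF inj_t t(2) that])
    thus "case p of (U, t) => \<forall>(V, s)\<in>trivs D. \<forall>i\<in>idx D. \<forall>j\<in>idx D.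
        smooth_fun M (U \<inter> V) (\<lambda>a. s (unit_point D t j a) i)"
      using t(1) by (auto simp: D)
  qed
qed

end

end

section \<open>Jets in a chart and a frame\<close>

context vbdl
begin

text \<open>The product of all \<open>f - f a\<close> applied to \<open>s\<close>. Up to sign,
  evaluation at \<open>a\<close> turns a word of operators \<delta> into such a product.\<close>

primrec shift_prod :: "'m set => 'm => ('m => real) list => ('m => 'e) => 'm => 'e" where
  "shift_prod V a [] s = s"
| "shift_prod V a (f # fs) s = (\<lambda>x\<in>V. f x - f a) \<odot>\<^bsub>sec \<Gamma> V\<^esub> shift_prod V a fs s"

text \<open>Coordinate \<open>i\<close> occurs \<open>I i\<close> times, so that the product of the
  shifted letters is the monomial of exponent \<open>I\<close> centred at \<open>a\<close>.\<close>

definition coord_word :: "('m => nat => real) => (nat => nat) => ('m => real) list" where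
  "coord_word \<phi> I = concat (map (\<lambda>i. replicate (I i) (\<lambda>x. \<phi> x i)) [0..<dm])"

lemma length_coord_word: "length (coord_word \<phi> I) = (\<Sum>i<dm. I i)"
  by (simp add: coord_word_def length_concat comp_def sum_list_distinct_conv_sum_set lessThan_atLeast0)

lemma prod_coord_word: "(\<Prod>f\<leftarrow>coord_word \<phi> I. f x - f a) = monomial dm I (\<phi> a) (\<phi> x)"
proof -
  have "(\<Prod>f\<leftarrow>concat (map (\<lambda>i. replicate (I i) (\<lambda>x. \<phi> x i)) is). f x - f a) = (\<Prod>i\<leftarrow>is. (\<phi> x i - \<phi> a i) ^ I i)" for "is"
    by (induction "is") auto
  thus ?thesis
    using prod.distinct_set_conv_list[of "[0..<dm]" "\<lambda>i. (\<phi> x i - \<phi> a i) ^ I i"]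
    by (simp add: coord_word_def monomial_def lessThan_atLeast0 del: map_concat)
qed

lemma set_coord_word: "f \<in> set (coord_word \<phi> I) ==> \<exists>i. f = (\<lambda>x. \<phi> x i)"
  by (auto simp: coord_word_def)

context
  fixes V assumes V: "opn V"
begin

interpretation V: smodule "smooth_ring M V" "sec \<Gamma> V" by (rule S.sec_smodule[OF V])

lemma shift_factor: "smooth_fun M V f ==> (\<lambda>x\<in>V. f x - f a) \<in> fcts V"
  by (intro restrict_smooth V smooth_fun_diff smooth_fun_const)

lemma shift_prod_section:
  "\<forall>f\<in>set fs. smooth_fun M V f ==> s \<in> sects V ==> shift_prod V a fs s \<in> sects V"
  by (induction fs) (auto simp: shift_factor)

lemma shift_prod_vanishing:
  "\<forall>f\<in>set fs. smooth_fun M V f ==> s \<in> sects V ==> a \<in> V ==>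
    shift_prod V a fs s \<in> S.vanishing_sections (length fs) a V"
proof (induction fs)
  case Nil
  thus ?case by (simp add: V.ideal_power_0)
next
  case (Cons f fs)
  have "(\<lambda>x\<in>V. f x - f a) \<in> vanishing_ideal M a V"
    using Cons.prems shift_factor[of f a] by (simp add: vanishing_ideal_def)
  thus ?case
    using V.ideal_power_smult[OF S.vanishing_ideal_subset _ Cons.IH] Cons.prems by simp
qed

lemma shift_prod_smult:
  "\<forall>f\<in>set fs. smooth_fun M V f ==> s \<in> sects V ==> g \<in> fcts V ==>
    shift_prod V a fs (g \<odot>\<^bsub>sec \<Gamma> V\<^esub> s) = g \<odot>\<^bsub>sec \<Gamma> V\<^esub> shift_prod V a fs s"
proof (induction fs)
  case (Cons f fs)
  let ?h = "\<lambda>x\<in>V. f x - f a"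
  have h: "?h \<in> fcts V" "shift_prod V a fs s \<in> sects V"
    using Cons.prems by (auto intro: shift_factor shift_prod_section)
  have "?h \<odot>\<^bsub>sec \<Gamma> V\<^esub> (g \<odot>\<^bsub>sec \<Gamma> V\<^esub> shift_prod V a fs s) = g \<odot>\<^bsub>sec \<Gamma> V\<^esub> (?h \<odot>\<^bsub>sec \<Gamma> V\<^esub> shift_prod V a fs s)"
    using V.smult_assoc1[OF h(1) Cons.prems(3) h(2)] V.smult_assoc1[OF Cons.prems(3) h(1,2)]
      V.R.m_comm[OF h(1) Cons.prems(3)] by simp
  thus ?case using Cons by simp
qed simp

text \<open>Here the section itself varies with the point \<open>a\<close> at which it is read.
  Expanding \<open>f - f a\<close> removes this dependence one factor at a time: \<open>T a\<close>
  of \<open>(f - f a) p\<close> is \<open>T a (f p) - f a * T a p\<close>, and \<open>f\<close> can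
  be moved into the fixed section \<open>s\<close>, leaving a product with fewer shifts.\<close>

lemma smooth_shift_prod:
  assumes add: "\<And>a s t. a \<in> V ==> s \<in> sects V ==> t \<in> sects V ==> T a (s \<oplus>\<^bsub>sec \<Gamma> V\<^esub> t) = T a s + T a t"
    and scale: "\<And>a s c. a \<in> V ==> s \<in> sects V ==> T a ((\<lambda>x\<in>V. c) \<odot>\<^bsub>sec \<Gamma> V\<^esub> s) = c * T a s"
    and smooth: "\<And>s. s \<in> sects V ==> smooth_fun M V (\<lambda>a. T a s)"
  shows "\<forall>f\<in>set fs. smooth_fun M V f ==> s \<in> sects V ==> smooth_fun M V (\<lambda>a. T a (shift_prod V a fs s))"
proof (induction fs arbitrary: s)
  case Nil
  thus ?case using smooth by simp
next
  case (Cons f fs)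
  have f: "smooth_fun M V f" using Cons.prems by simp
  let ?f = "restrict f V"
  have fV: "?f \<in> fcts V" by (rule restrict_smooth[OF V f])
  have "T a (shift_prod V a (f # fs) s) = T a (shift_prod V a fs (?f \<odot>\<^bsub>sec \<Gamma> V\<^esub> s)) - f a * T a (shift_prod V a fs s)"
    if a: "a \<in> V" for a
  proof -
    let ?p = "shift_prod V a fs s" and ?c = "\<lambda>x\<in>V. f a"
    have p: "?p \<in> sects V" using Cons.prems by (auto intro: shift_prod_section)
    have c: "?c \<in> fcts V" by (rule const_in_smooth_ring[OF V])
    have "?f = (\<lambda>x\<in>V. f x - f a) \<oplus>\<^bsub>smooth_ring M V\<^esub> ?c" by (auto simp: smooth_ring_simps)
    hence "?f \<odot>\<^bsub>sec \<Gamma> V\<^esub> ?p = shift_prod V a (f # fs) s \<oplus>\<^bsub>sec \<Gamma> V\<^esub> ?c \<odot>\<^bsub>sec \<Gamma> V\<^esub> ?p"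
      using V.smult_l_distr[OF shift_factor[OF f] c p] by simp
    hence "T a (?f \<odot>\<^bsub>sec \<Gamma> V\<^esub> ?p) = T a (shift_prod V a (f # fs) s) + f a * T a ?p"
      using add[OF a, of "shift_prod V a (f # fs) s" "?c \<odot>\<^bsub>sec \<Gamma> V\<^esub> ?p"] scale[OF a p] p c
        V.smult_closed[OF shift_factor[OF f] p] by simp
    thus ?thesis using shift_prod_smult[of fs s ?f a] Cons.prems fV by simp
  qed
  moreover have "smooth_fun M V (\<lambda>a. T a (shift_prod V a fs (?f \<odot>\<^bsub>sec \<Gamma> V\<^esub> s)) - f a * T a (shift_prod V a fs s))"
    by (intro smooth_fun_diff smooth_fun_mult V f Cons.IH) (use Cons.prems fV in auto)
  ultimately show ?case
    using smooth_fun_cong[OF V, of "\<lambda>a. T a (shift_prod V a (f # fs) s)"] by simp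
qed

end

end

locale chart_frame = vbdl M E for M :: "'m manifold" and E :: "('m, 'e, 'i) vbundle" +
  fixes U :: "'m set" and \<phi> :: "'m => nat => real" and \<Phi> :: "'i => 'm => 'e"
  assumes chart: "(U, \<phi>) \<in> atlas M" and frame: "local_frame M (smooth_sections M E) (idx E) U \<Phi>"
begin

sublocale F: framed_presheaf M \<Gamma> "idx E" U \<Phi>
  by unfold_locales (use finite_idx frame in auto)

text \<open>The coordinates that a usual trivialization reads, first defined on sections; that they
  depend on the k-jet alone is \<open>jcoord_welldefined\<close>.\<close>

definition jcoord :: "nat => 'm set => ('m => 'e) => 'm => 'i \<times> (nat => nat) => real" where
  "jcoord k V s a = (\<lambda>(l, I). if l \<in> idx E \<and> I \<in> multi_indices dm k
    then chart_partial U \<phi> I (F.coef V s l) a else 0)"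

lemma jcoord_res:
  assumes "opn V" "V \<subseteq> U" "opn W" "W \<subseteq> V" "s \<in> sects V" "a \<in> W"
  shows "jcoord k W (res \<Gamma> V W s) a = jcoord k V s a"
proof -
  have "chart_partial U \<phi> I (F.coef W (res \<Gamma> V W s) l) a = chart_partial U \<phi> I (F.coef V s l) a" if "l \<in> idx E" for l I
    by (rule chart_partial_cong[OF chart assms(3) subset_trans[OF assms(4,2)] _ assms(6)])
      (rule F.coef_res[OF assms(1-5) that])
  thus ?thesis by (auto simp: jcoord_def)
qed

context
  fixes V assumes V: "opn V" "V \<subseteq> U"
begin

interpretation V: smodule "smooth_ring M V" "sec \<Gamma> V" by (rule S.sec_smodule[OF V(1)])

lemma jcoord_add:
  assumes s: "s \<in> sects V" and t: "t \<in> sects V" and a: "a \<in> V"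
  shows "jcoord k V (s \<oplus>\<^bsub>sec \<Gamma> V\<^esub> t) a i = jcoord k V s a i + jcoord k V t a i"
proof -
  have "chart_partial U \<phi> I (F.coef V (s \<oplus>\<^bsub>sec \<Gamma> V\<^esub> t) l) a =
      chart_partial U \<phi> I (F.coef V s l) a + chart_partial U \<phi> I (F.coef V t l) a" if l: "l \<in> idx E" for l I
  proof -
    have "chart_partial U \<phi> I (F.coef V (s \<oplus>\<^bsub>sec \<Gamma> V\<^esub> t) l) a =
        chart_partial U \<phi> I (\<lambda>x. 1 * F.coef V s l x + F.coef V t l x) a"
      by (rule chart_partial_cong[OF chart V _ a]) (use F.coef_add[OF V s t _ l] in simp)
    thus ?thesis
      using chart_partial_linear[OF chart V F.coef_smooth[OF V s l] F.coef_smooth[OF V t l] a, where k = 1 and I = I] by simp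
  qed
  thus ?thesis by (cases i) (auto simp: jcoord_def)
qed

lemma jcoord_scale:
  assumes s: "s \<in> sects V" and a: "a \<in> V"
  shows "jcoord k V ((\<lambda>b\<in>V. c) \<odot>\<^bsub>sec \<Gamma> V\<^esub> s) a i = c * jcoord k V s a i"
proof -
  have "chart_partial U \<phi> I (F.coef V ((\<lambda>b\<in>V. c) \<odot>\<^bsub>sec \<Gamma> V\<^esub> s) l) a = c * chart_partial U \<phi> I (F.coef V s l) a"
    if l: "l \<in> idx E" for l I
  proof -
    \<comment> \<open>A sum over a one-element set turns \<open>chart_partial_sum\<close> into
      homogeneity.\<close>
    have "chart_partial U \<phi> I (F.coef V ((\<lambda>b\<in>V. c) \<odot>\<^bsub>sec \<Gamma> V\<^esub> s) l) a =
        chart_partial U \<phi> I (\<lambda>x. \<Sum>p\<in>{()}. c * F.coef V s l x) a"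
      by (rule chart_partial_cong[OF chart V _ a]) (use F.coef_smult[OF V const_in_smooth_ring[OF V(1)] s _ l] in simp)
    thus ?thesis
      using chart_partial_sum[OF chart V, of "{()}" "\<lambda>_. F.coef V s l" a I "\<lambda>_. c"] F.coef_smooth[OF V s l] a by simp
  qed
  thus ?thesis by (cases i) (auto simp: jcoord_def)
qed

lemma smooth_jcoord:
  assumes s: "s \<in> sects V"
  shows "smooth_fun M V (\<lambda>a. jcoord k V s a i)"
proof (cases i)
  case (Pair l I)
  thus ?thesis
    using smooth_fun_chart_partial[OF chart V F.coef_smooth[OF V s], of l I] smooth_fun_const[OF V(1), of 0]
    by (cases "l \<in> idx E \<and> I \<in> multi_indices dm k") (simp_all add: jcoord_def, auto)
qed

text \<open>The sections whose coefficients vanish to order \<open>q\<close> at \<open>a\<close>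
  form a subgroup, and multiplication by a function vanishing at \<open>a\<close> raises the order
  by one; so the q-th power of the ideal stays inside. This is the easy half of the description of
  jets by derivatives, the product rule; Hadamard's lemma gives the other half.\<close>

lemma coef_vanishes:
  assumes a: "a \<in> V" and s: "s \<in> S.vanishing_sections q a V" and l: "l \<in> idx E"
  shows "chart_vanishes U \<phi> q a (F.coef V s l)"
proof -
  let ?S = "\<lambda>q. {s \<in> sects V. \<forall>l\<in>idx E. chart_vanishes U \<phi> q a (F.coef V s l)}"
  have cong: "chart_vanishes U \<phi> q a f \<longleftrightarrow> chart_vanishes U \<phi> q a g" if "\<And>x. x \<in> V ==> f x = g x" for f g q
    by (rule chart_vanishes_cong[OF chart V a that])
  have smult: "chart_vanishes U \<phi> q' a (F.coef V (g \<odot>\<^bsub>sec \<Gamma> V\<^esub> t) l)"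
    if "g \<in> fcts V" "t \<in> sects V" "l \<in> idx E"
      "chart_vanishes U \<phi> q' a (\<lambda>x. g x * F.coef V t l x)" for g t l q'
    using cong[of "F.coef V (g \<odot>\<^bsub>sec \<Gamma> V\<^esub> t) l" "\<lambda>x. g x * F.coef V t l x"] that F.coef_smult[OF V that(1,2) _ that(3)] by simp
  have zero: "chart_vanishes U \<phi> q' a (\<lambda>x. 0)" for q'
  proof (induction q')
    case (Suc q')
    thus ?case
      using chart_vanishes_Suc_mult[OF chart V a smooth_fun_const[OF V(1), of 0] smooth_fun_const[OF V(1), of 0], of q']
      by simp
  qed (simp add: chart_vanishes_0[OF chart V])
  have grp: "additive_subgroup (?S q) (sec \<Gamma> V)" for q
  proof (rule additive_subgroupI'[OF V.abelian_group_axioms])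
    have z: "(\<lambda>x\<in>V. 0) \<in> fcts V" by (rule const_in_smooth_ring[OF V(1)])
    have "\<zero>\<^bsub>sec \<Gamma> V\<^esub> = (\<lambda>x\<in>V. 0) \<odot>\<^bsub>sec \<Gamma> V\<^esub> \<zero>\<^bsub>sec \<Gamma> V\<^esub>"
      using V.smult_l_null[OF V.zero_closed] by (simp add: smooth_ring_simps(4))
    thus "\<zero>\<^bsub>sec \<Gamma> V\<^esub> \<in> ?S q"
      using smult[OF z V.zero_closed] zero cong[of "\<lambda>x. (\<lambda>x\<in>V. 0) x * F.coef V \<zero>\<^bsub>sec \<Gamma> V\<^esub> l x" "\<lambda>x. 0" for l] by auto
    fix s assume s: "s \<in> ?S q"
    have m: "(\<lambda>x\<in>V. -1) \<in> fcts V" by (rule const_in_smooth_ring[OF V(1)])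
    have "\<ominus>\<^bsub>smooth_ring M V\<^esub> \<one>\<^bsub>smooth_ring M V\<^esub> = (\<lambda>b\<in>V. -1)"
      by (rule V.R.minus_equality) (use const_in_smooth_ring[OF V(1)] in \<open>auto simp: smooth_ring_simps\<close>)
    hence "\<ominus>\<^bsub>sec \<Gamma> V\<^esub> s = (\<lambda>x\<in>V. -1) \<odot>\<^bsub>sec \<Gamma> V\<^esub> s"
      using V.smult_l_minus[of "\<one>\<^bsub>smooth_ring M V\<^esub>" s] s by simp
    moreover have "chart_vanishes U \<phi> q a (F.coef V ((\<lambda>x\<in>V. -1) \<odot>\<^bsub>sec \<Gamma> V\<^esub> s) l)" if l: "l \<in> idx E" for l
      using smult[OF m _ l, of s] s l
        chart_vanishes_mult[OF chart V a smooth_ring_fun[OF m] F.coef_smooth[OF V _ l], of s q] by auto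
    ultimately show "\<ominus>\<^bsub>sec \<Gamma> V\<^esub> s \<in> ?S q" using s V.smult_closed[OF m, of s] by auto
    fix t assume t: "t \<in> ?S q"
    have "chart_vanishes U \<phi> q a (F.coef V (s \<oplus>\<^bsub>sec \<Gamma> V\<^esub> t) l)" if l: "l \<in> idx E" for l
      using cong[of "F.coef V (s \<oplus>\<^bsub>sec \<Gamma> V\<^esub> t) l" "\<lambda>x. F.coef V s l x + F.coef V t l x"] F.coef_add[OF V _ _ _ l, of s t]
        chart_vanishes_add[OF chart V a F.coef_smooth[OF V _ l] F.coef_smooth[OF V _ l], of s t q] s t l by auto
    thus "s \<oplus>\<^bsub>sec \<Gamma> V\<^esub> t \<in> ?S q" using s t by auto
  qed auto
  have "S.vanishing_sections q a V \<subseteq> ?S q"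
  proof (induction q)
    case 0
    show ?case using V.ideal_power_0 by (simp add: chart_vanishes_0[OF chart V])
  next
    case (Suc q)
    show ?case
    proof (rule V.ideal_power_Suc_subset[OF S.vanishing_ideal_subset grp])
      fix f x assume f: "f \<in> vanishing_ideal M a V" and "x \<in> S.vanishing_sections q a V"
      hence x: "x \<in> ?S q" using Suc by auto
      have f': "f \<in> fcts V" "f a = 0" using f by (auto simp: vanishing_ideal_def)
      have "chart_vanishes U \<phi> (Suc q) a (F.coef V (f \<odot>\<^bsub>sec \<Gamma> V\<^esub> x) l)" if l: "l \<in> idx E" for l
        using smult[OF f'(1) _ l, of x "Suc q"] x l f'(2)
          chart_vanishes_Suc_mult[OF chart V a smooth_ring_fun[OF f'(1)] F.coef_smooth[OF V _ l], of x q] by auto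
      thus "f \<odot>\<^bsub>sec \<Gamma> V\<^esub> x \<in> ?S (Suc q)" using x f'(1) by auto
    qed
  qed
  thus ?thesis using s l by auto
qed

lemma jcoord_vanishing:
  assumes "a \<in> V" "s \<in> S.vanishing_sections (Suc k) a V"
  shows "jcoord k V s a = (\<lambda>_. 0)"
proof -
  have "chart_partial U \<phi> I (F.coef V s l) a = 0" if "l \<in> idx E" "I \<in> multi_indices dm k" for l I
    by (rule chart_vanishes_partial[OF chart V assms(1) coef_vanishes[OF assms that(1)] that(2)])
  thus ?thesis by (auto simp: jcoord_def fun_eq_iff)
qed

end

section \<open>Jets of monomials centred at the base point\<close>

lemma coef_shift_prod:
  assumes V: "opn V" "V \<subseteq> U" and l: "l \<in> idx E" and s: "s \<in> sects V" and x: "x \<in> V"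
  shows "\<forall>f\<in>set fs. smooth_fun M V f ==>
    F.coef V (shift_prod V a fs s) l x = (\<Prod>f\<leftarrow>fs. f x - f a) * F.coef V s l x"
proof (induction fs)
  case (Cons f fs)
  thus ?case
    using F.coef_smult[OF V shift_factor[OF V(1)] shift_prod_section[OF V(1) _ s] x l] x by simp
qed simp

lemma coord_word_smooth: "V \<subseteq> U ==> \<forall>f\<in>set (coord_word \<phi> I). smooth_fun M V f"
proof
  fix f assume V: "V \<subseteq> U" and "f \<in> set (coord_word \<phi> I)"
  then obtain i where "f = (\<lambda>x. \<phi> x i)" using set_coord_word by blast
  thus "smooth_fun M V f" using smooth_fun_subset[OF smooth_fun_coord[OF chart] V] by simp
qed

text \<open>Up to the factor \<open>mfact\<close>, the jets of monomials times frame elements are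
  dual to the jet coordinates. They give the unit points of the usual bundle and, through
  evaluation, the coordinates of the generators of the algebraic jets.\<close>

lemma jcoord_shift_prod:
  assumes V: "opn V" "V \<subseteq> U" and a: "a \<in> V" and l: "l \<in> idx E" and I: "I \<in> multi_indices dm k"
  shows "jcoord k V (shift_prod V a (coord_word \<phi> I) (res \<Gamma> U V (\<Phi> l))) a =
    (\<lambda>i. if i = (l, I) then mfact dm I else 0)"
proof -
  let ?s = "res \<Gamma> U V (\<Phi> l)"
  have s: "?s \<in> sects V" by (rule F.frame_res[OF V l])
  interpret V: smodule "smooth_ring M V" "sec \<Gamma> V" by (rule S.sec_smodule[OF V(1)])
  have cs: "F.coef V ?s l' x = (if l' = l then 1 else 0)" if "l' \<in> idx E" "x \<in> V" for l' x
    using F.coef_frame[OF V l V.R.one_closed that] V.smult_one[OF s] that by (simp add: smooth_ring_simps(3))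
  have "chart_partial U \<phi> J (F.coef V (shift_prod V a (coord_word \<phi> I) ?s) l') a =
      (if (l', J) = (l, I) then mfact dm I else 0)" if l': "l' \<in> idx E" and J: "J \<in> multi_indices dm k" for l' J
  proof -
    have "chart_partial U \<phi> J (F.coef V (shift_prod V a (coord_word \<phi> I) ?s) l') a =
        chart_partial U \<phi> J (\<lambda>x. \<Sum>p\<in>{()}. (if l' = l then 1 else 0) * monomial dm I (\<phi> a) (\<phi> x)) a"
      by (rule chart_partial_cong[OF chart V _ a])
        (use coef_shift_prod[OF V l' s _ coord_word_smooth[OF V(2)]] cs[OF l'] in \<open>simp add: prod_coord_word\<close>)
    also have "\<dots> = (\<Sum>p\<in>{()}. (if l' = l then 1 else 0) * chart_partial U \<phi> J (\<lambda>x. monomial dm I (\<phi> a) (\<phi> x)) a)"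
      by (rule chart_partial_sum[OF chart V _ a]) (rule smooth_fun_monomial[OF chart V])
    finally show ?thesis using chart_partial_monomial[OF chart V I J a] by auto
  qed
  note key = this
  show ?thesis
  proof
    fix i :: "'i \<times> (nat => nat)"
    obtain l' J where i: "i = (l', J)" by (cases i)
    show "jcoord k V (shift_prod V a (coord_word \<phi> I) ?s) a i = (if i = (l, I) then mfact dm I else 0)"
    proof (cases "l' \<in> idx E \<and> J \<in> multi_indices dm k")
      case True
      thus ?thesis using key[of l' J] by (simp add: jcoord_def i)
    next
      case False
      thus ?thesis using l I by (auto simp: jcoord_def i)
    qed
  qed
qed

text \<open>
  Hadamard's lemma, applied repeatedly, writes g near a as a polynomial of degree at most k plus an
  element of the (k+1)-st power of the ideal; the derivatives of g determine the polynomial.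
\<close>

lemma vanishing_from_partials:
  assumes c: "(W, \<phi>) \<in> atlas M" and W: "W \<subseteq> U" and cube: "\<phi> ` W = cube dm b r" and a: "a \<in> W" and l: "l \<in> idx E"
    and g: "g \<in> fcts W"
    and z: "\<And>I. I \<in> multi_indices dm k ==> chart_partial U \<phi> I g a = 0"
  shows "g \<odot>\<^bsub>sec \<Gamma> W\<^esub> res \<Gamma> U W (\<Phi> l) \<in> S.vanishing_sections (Suc k) a W"
proof -
  have oW: "opn W" by (rule chart_open[OF c])
  interpret W: smodule "smooth_ring M W" "sec \<Gamma> W" by (rule S.sec_smodule[OF oW])
  let ?s = "res \<Gamma> U W (\<Phi> l)" and ?N = "S.vanishing_sections (Suc k) a W"
  let ?m = "\<lambda>I x. monomial dm I (\<phi> a) (\<phi> x)"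
  let ?p = "\<lambda>p x. \<Sum>J\<in>multi_indices dm k. p J * ?m J x"
  have s: "?s \<in> sects W" by (rule F.frame_res[OF oW W l])
  have N: "additive_subgroup ?N (sec \<Gamma> W)" by (rule W.ideal_power_additive_subgroup[OF S.vanishing_ideal_subset])
  have m: "smooth_fun M W (?m I)" for I by (rule smooth_fun_monomial[OF c oW order_refl])
  \<comment> \<open>The functions whose multiple of the frame element lies in the power: a set
    closed under sums, inside which the expansion is carried out.\<close>
  define K where "K f \<longleftrightarrow> smooth_fun M W f \<and> restrict f W \<odot>\<^bsub>sec \<Gamma> W\<^esub> ?s \<in> ?N" for f
  have K_cong: "K f \<longleftrightarrow> K h" if "\<And>x. x \<in> W ==> f x = h x" for f h
  proof -
    have "restrict f W = restrict h W" using that by (auto simp: restrict_def)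
    thus ?thesis using smooth_fun_cong[OF oW that] by (simp add: K_def)
  qed
  have K_add: "K (\<lambda>x. f x + h x)" if "K f" "K h" for f h
  proof -
    have "restrict (\<lambda>x. f x + h x) W = restrict f W \<oplus>\<^bsub>smooth_ring M W\<^esub> restrict h W"
      by (auto simp: smooth_ring_simps)
    thus ?thesis
      using that W.smult_l_distr[OF restrict_smooth[OF oW] restrict_smooth[OF oW] s, of f h] smooth_fun_add[OF oW, of f h]
        additive_subgroup.a_closed[OF N] by (simp add: K_def)
  qed
  have zero: "restrict (\<lambda>_. 0) W = \<zero>\<^bsub>smooth_ring M W\<^esub>" by (simp add: smooth_ring_simps)
  have K_zero: "K (\<lambda>_. 0)"
    unfolding K_def zero using W.smult_l_null[OF s] additive_subgroup.zero_closed[OF N] smooth_fun_const[OF oW] by simp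
  have K_sum: "K (\<lambda>x. \<Sum>i\<in>A. f i x)" if "\<And>i. i \<in> A ==> K (f i)" for A :: "nat set" and f
    using that by (induction A rule: infinite_finite_induct) (auto simp: K_zero K_add)
  \<comment> \<open>\<open>d\<close> counts the factors that the monomial lacks for degree
    \<open>k + 1\<close>. One application of Hadamard's lemma splits off the constant
    \<open>f a\<close>, which enters the polynomial, and raises the degree of the monomial in each
    remaining term by one.\<close>
  have poly: "\<exists>p. K (\<lambda>x. ?m I x * f x - ?p p x)"
    if "(\<Sum>i<dm. I i) + d = Suc k" "\<forall>i\<ge>dm. I i = 0" "smooth_fun M W f" for I f d
    using that
  proof (induction d arbitrary: I f)
    case 0
    let ?f = "restrict f W"
    have fs: "?f \<odot>\<^bsub>sec \<Gamma> W\<^esub> ?s \<in> sects W" using restrict_smooth[OF oW 0(3)] s by simp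
    have sm: "smooth_fun M W (\<lambda>x. ?m I x * f x)" by (rule smooth_fun_mult[OF oW m 0(3)])
    have "restrict (\<lambda>x. ?m I x * f x) W \<odot>\<^bsub>sec \<Gamma> W\<^esub> ?s = shift_prod W a (coord_word \<phi> I) (?f \<odot>\<^bsub>sec \<Gamma> W\<^esub> ?s)"
    proof (rule F.section_eqI_coef[OF oW W])
      show "restrict (\<lambda>x. ?m I x * f x) W \<odot>\<^bsub>sec \<Gamma> W\<^esub> ?s \<in> sects W" using restrict_smooth[OF oW sm] s by simp
      show "shift_prod W a (coord_word \<phi> I) (?f \<odot>\<^bsub>sec \<Gamma> W\<^esub> ?s) \<in> sects W"
        by (rule shift_prod_section[OF oW coord_word_smooth[OF W] fs])
      fix i x assume i: "i \<in> idx E" and x: "x \<in> W"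
      show "F.coef W (restrict (\<lambda>x. ?m I x * f x) W \<odot>\<^bsub>sec \<Gamma> W\<^esub> ?s) i x =
          F.coef W (shift_prod W a (coord_word \<phi> I) (?f \<odot>\<^bsub>sec \<Gamma> W\<^esub> ?s)) i x"
        using F.coef_smult[OF oW W restrict_smooth[OF oW sm] s x i] F.coef_smult[OF oW W restrict_smooth[OF oW 0(3)] s x i]
          coef_shift_prod[OF oW W i fs x coord_word_smooth[OF W], of a I] x by (simp add: prod_coord_word)
    qed
    hence "K (\<lambda>x. ?m I x * f x)"
      using shift_prod_vanishing[OF oW coord_word_smooth[OF W] fs a, of I] 0(1) sm by (simp add: K_def length_coord_word)
    thus ?case by (intro exI[of _ "\<lambda>_. 0"]) simp
  next
    case (Suc d)
    obtain h where h: "\<And>i. i < dm ==> smooth_fun M W (h i)"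
      "\<And>x. x \<in> W ==> f x = f a + (\<Sum>i<dm. (\<phi> x i - \<phi> a i) * h i x)"
      using chart_hadamard[OF c cube a Suc.prems(3)] by metis
    let ?I = "\<lambda>i. I(i := Suc (I i))"
    have "\<exists>p. K (\<lambda>x. ?m (?I i) x * h i x - ?p p x)" if i: "i < dm" for i
    proof (rule Suc.IH)
      have "(\<Sum>j<dm. (?I i) j) = (\<Sum>j<dm. I j + (if j = i then 1 else 0))" by (rule sum.cong) auto
      hence "(\<Sum>j<dm. (?I i) j) = Suc (\<Sum>j<dm. I j)" using i by (simp add: sum.distrib)
      thus "(\<Sum>j<dm. (?I i) j) + d = Suc k" using Suc.prems(1) by simp
    qed (use Suc.prems(2) h(1) i in auto)
    hence "\<forall>i. \<exists>p. i < dm --> K (\<lambda>x. ?m (?I i) x * h i x - ?p p x)"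
      by blast
    from choice[OF this]
    obtain p where p: "\<forall>i. i < dm --> K (\<lambda>x. ?m (?I i) x * h i x - ?p (p i) x)"
      by (rule exE)
    have I: "I \<in> multi_indices dm k" using Suc.prems(1,2) by (simp add: multi_indices_def)
    have mI: "?m (?I i) x = (\<phi> x i - \<phi> a i) * ?m I x" if "i < dm" for i x
    proof -
      have "monomial dm (?I i) (\<phi> a) (\<phi> x) = (\<Prod>j<dm. (if j = i then \<phi> x i - \<phi> a i else 1) * (\<phi> x j - \<phi> a j) ^ I j)"
        unfolding monomial_def by (rule prod.cong) auto
      thus ?thesis using that by (simp add: prod.distrib monomial_def)
    qed
    let ?q = "\<lambda>J. (if J = I then f a else 0) + (\<Sum>i<dm. p i J)"
    have "K (\<lambda>x. \<Sum>i<dm. ?m (?I i) x * h i x - ?p (p i) x)"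
      by (rule K_sum) (use p in auto)
    moreover have "(\<Sum>i<dm. ?m (?I i) x * h i x - ?p (p i) x) =
        ?m I x * f x - ?p ?q x" if x: "x \<in> W" for x
    proof -
      have "?p ?q x =
          (\<Sum>J\<in>multi_indices dm k. if J = I then f a * ?m J x else 0) + (\<Sum>J\<in>multi_indices dm k. \<Sum>i<dm. p i J * ?m J x)"
        by (simp add: sum.distrib[symmetric] distrib_right sum_distrib_right if_distrib[of "\<lambda>y. y * _"] cong: if_cong)
      also have "\<dots> = f a * ?m I x + (\<Sum>i<dm. \<Sum>J\<in>multi_indices dm k. p i J * ?m J x)"
        using I by (subst sum.swap) (simp add: finite_multi_indices)
      finally show ?thesis
        unfolding h(2)[OF x] by (simp add: sum_subtractf mI distrib_left sum_distrib_left mult_ac)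
    qed
    ultimately have "K (\<lambda>x. ?m I x * f x - ?p ?q x)"
      using K_cong[of "\<lambda>x. \<Sum>i<dm. ?m (?I i) x * h i x - ?p (p i) x"] by simp
    thus ?case by (rule exI[of _ ?q])
  qed
  have g': "smooth_fun M W g" by (rule smooth_ring_fun[OF g])
  obtain p where "K (\<lambda>x. ?m (\<lambda>_. 0) x * g x - ?p p x)"
    using poly[of "\<lambda>_. 0" "Suc k" g] g' by auto
  hence Kp: "K (\<lambda>x. g x - ?p p x)" (is "K ?r")
    by (simp add: monomial_def)
  hence r: "smooth_fun M W ?r" "restrict ?r W \<odot>\<^bsub>sec \<Gamma> W\<^esub> ?s \<in> ?N" by (simp_all add: K_def)
  \<comment> \<open>The remainder has zero derivatives up to order \<open>k\<close> by the easy
    half, and so has \<open>g\<close> by assumption; orthogonality leaves \<open>p I\<close> times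
    \<open>mfact dm I\<close> equal to 0.\<close>
  have p0: "p I = 0" if I: "I \<in> multi_indices dm k" for I
  proof -
    have "chart_partial U \<phi> I (F.coef W (restrict ?r W \<odot>\<^bsub>sec \<Gamma> W\<^esub> ?s) l) a = 0"
      using fun_cong[OF jcoord_vanishing[OF oW W a r(2)], of "(l, I)"] l I by (simp add: jcoord_def)
    moreover have "chart_partial U \<phi> I (F.coef W (restrict ?r W \<odot>\<^bsub>sec \<Gamma> W\<^esub> ?s) l) a = chart_partial U \<phi> I ?r a"
      by (rule chart_partial_cong[OF chart oW W _ a]) (use F.coef_frame[OF oW W l restrict_smooth[OF oW r(1)] l] in simp)
    moreover have "chart_partial U \<phi> I ?r a = - (\<Sum>J\<in>multi_indices dm k. p J * chart_partial U \<phi> I (?m J) a)"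
    proof -
      let ?P = "\<lambda>x. \<Sum>J\<in>multi_indices dm k. p J * ?m J x"
      have P: "smooth_fun M W ?P" by (intro smooth_fun_sum smooth_fun_cmult oW m)
      have "chart_partial U \<phi> I (\<lambda>x. (-1) * ?P x + g x) a = (-1) * chart_partial U \<phi> I ?P a + chart_partial U \<phi> I g a"
        by (rule chart_partial_linear[OF chart oW W P g' a])
      moreover have "chart_partial U \<phi> I ?P a = (\<Sum>J\<in>multi_indices dm k. p J * chart_partial U \<phi> I (?m J) a)"
        by (rule chart_partial_sum[OF chart oW W m a])
      ultimately show ?thesis using z[OF I] by simp
    qed
    moreover have "(\<Sum>J\<in>multi_indices dm k. p J * chart_partial U \<phi> I (?m J) a) = (\<Sum>J\<in>multi_indices dm k. if J = I then p J * mfact dm J else 0)"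
      by (rule sum.cong) (use chart_partial_monomial[OF chart oW W _ I a] in auto)
    ultimately show ?thesis using I mfact_pos[of dm I] by (simp add: finite_multi_indices)
  qed
  have "?r x = g x" for x using p0 by simp
  moreover have "restrict g W = g" using g by (simp add: smooth_ring_simps extensional_restrict)
  ultimately show ?thesis using r(2) by simp
qed

abbreviation jet where "jet k \<equiv> jet_class M \<Gamma> (Suc k)"

text \<open>On a cube around \<open>a\<close> each term of the expansion in the frame lies in the
  power of the ideal, and a jet is unchanged when its section is restricted to the cube.\<close>

lemma jcoord_zero_imp:
  assumes V: "V \<subseteq> U" and s: "S.section_at a V s" and z: "\<And>i. i \<in> jidx k ==> jcoord k V s a i = 0"
  shows "jet k a V s = jet k a V \<zero>\<^bsub>sec \<Gamma> V\<^esub>"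
proof -
  have oV: "opn V" and a: "a \<in> V" and sV: "s \<in> sects V" using s by auto
  obtain W r where W: "(W, \<phi>) \<in> atlas M" "opn W" "a \<in> W" "W \<subseteq> V" "\<phi> ` W = cube dm (\<phi> a) r"
    using cube_subchart[OF chart oV V a] .
  have WU: "W \<subseteq> U" using W V by auto
  interpret W: smodule "smooth_ring M W" "sec \<Gamma> W" by (rule S.sec_smodule[OF W(2)])
  interpret V: smodule "smooth_ring M V" "sec \<Gamma> V" by (rule S.sec_smodule[OF oV])
  let ?s = "res \<Gamma> V W s"
  have sW: "?s \<in> sects W" by (rule S.res_closed[OF oV W(2,4) sV])
  have "chart_partial U \<phi> I (F.coef W ?s l) a = 0" if "l \<in> idx E" "I \<in> multi_indices dm k" for l I
    using z[of "(l, I)"] fun_cong[OF jcoord_res[OF oV V W(2,4) sV W(3), of k], of "(l, I)"] that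
    by (simp add: jcoord_def)
  hence "F.coef W ?s l \<odot>\<^bsub>sec \<Gamma> W\<^esub> res \<Gamma> U W (\<Phi> l) \<in> S.vanishing_sections (Suc k) a W" if "l \<in> idx E" for l
    using that by (intro vanishing_from_partials[OF W(1) WU W(5,3) that F.coef_in[OF W(2) WU sW that]]) auto
  hence "lin_comb \<Gamma> (idx E) U W \<Phi> (F.coef W ?s) \<in> S.vanishing_sections (Suc k) a W"
    unfolding lin_comb_def
    by (intro additive_subgroup_finsum[OF W.abelian_group_axioms W.ideal_power_additive_subgroup[OF S.vanishing_ideal_subset]])
  hence "res \<Gamma> V W (s \<ominus>\<^bsub>sec \<Gamma> V\<^esub> \<zero>\<^bsub>sec \<Gamma> V\<^esub>) \<in> S.vanishing_sections (Suc k) a W"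
    using F.lin_comb_coef[OF W(2) WU sW] sV by (simp add: a_minus_def V.inv_zero)
  thus ?thesis using S.jet_eq_iff[OF s, of "\<zero>\<^bsub>sec \<Gamma> V\<^esub>" "Suc k"] oV a W(2-4) by auto
qed

text \<open>Representatives of the same jet differ, near \<open>a\<close>, by an element of the
  power of the ideal, on which all coordinates are 0.\<close>

lemma jcoord_welldefined:
  assumes s: "S.section_at a V s" "V \<subseteq> U" and t: "S.section_at a V' t" "V' \<subseteq> U" and eq: "jet k a V s = jet k a V' t"
  shows "jcoord k V s a = jcoord k V' t a"
proof -
  let ?W = "V \<inter> V'"
  have W: "opn ?W" "a \<in> ?W" "?W \<subseteq> V" "?W \<subseteq> V'" using s t by auto
  have s': "S.section_at a ?W (res \<Gamma> V ?W s)" by (rule S.section_at_res[OF s(1) W(1-3)])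
  have t': "S.section_at a ?W (res \<Gamma> V' ?W t)" by (rule S.section_at_res[OF t(1) W(1,2,4)])
  have "jet k a ?W (res \<Gamma> V ?W s) = jet k a ?W (res \<Gamma> V' ?W t)"
    using eq S.jet_class_res[OF s(1) W(1-3)] S.jet_class_res[OF t(1) W(1,2,4)] by simp
  then obtain X where X: "opn X" "a \<in> X" "X \<subseteq> ?W"
    "res \<Gamma> ?W X (res \<Gamma> V ?W s \<ominus>\<^bsub>sec \<Gamma> ?W\<^esub> res \<Gamma> V' ?W t) \<in> S.vanishing_sections (Suc k) a X"
    using S.jet_eq_iff[OF s' t'] by blast
  let ?s = "res \<Gamma> V X s" and ?t = "res \<Gamma> V' X t"
  interpret X: smodule "smooth_ring M X" "sec \<Gamma> X" by (rule S.sec_smodule[OF X(1)])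
  have XU: "X \<subseteq> U" "X \<subseteq> V" "X \<subseteq> V'" using X s by auto
  have st: "?s \<in> sects X" "?t \<in> sects X" using S.res_closed X(1) XU s t by auto
  have "res \<Gamma> ?W X (res \<Gamma> V ?W s \<ominus>\<^bsub>sec \<Gamma> ?W\<^esub> res \<Gamma> V' ?W t) = ?s \<ominus>\<^bsub>sec \<Gamma> X\<^esub> ?t"
    using S.res_group(3)[OF W(1) X(1,3)] s' t' S.res_res[of V ?W X s] S.res_res[of V' ?W X t] W X s t by simp
  hence van: "?s \<ominus>\<^bsub>sec \<Gamma> X\<^esub> ?t \<in> S.vanishing_sections (Suc k) a X" using X(4) by simp
  have d: "?s \<ominus>\<^bsub>sec \<Gamma> X\<^esub> ?t \<in> sects X" using st by simp
  have "?s = (?s \<ominus>\<^bsub>sec \<Gamma> X\<^esub> ?t) \<oplus>\<^bsub>sec \<Gamma> X\<^esub> ?t" using st by (simp add: a_minus_def X.a_assoc X.l_neg)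
  hence "jcoord k X ?s a i = jcoord k X ?t a i" for i
    using jcoord_add[OF X(1) XU(1) d st(2) X(2), of k i] fun_cong[OF jcoord_vanishing[OF X(1) XU(1) X(2) van]] by simp
  thus ?thesis
    using jcoord_res[of V X s a k] jcoord_res[of V' X t a k] s t X XU by (simp add: fun_eq_iff)
qed

lemma jcoord_surj:
  assumes a: "a \<in> U"
  shows "\<exists>s\<in>sects U. \<forall>i\<in>jidx k. jcoord k U s a i = x i"
proof -
  note oU = F.frame_open
  let ?m = "\<lambda>I y. monomial dm I (\<phi> a) (\<phi> y)"
  \<comment> \<open>Taylor's polynomial with prescribed derivatives at \<open>a\<close>; the
    division undoes the factor of \<open>mpartial_monomial\<close>.\<close>
  define g where "g l y = (\<Sum>I\<in>multi_indices dm k. (x (l, I) / mfact dm I) * ?m I y)" for l y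
  have m: "smooth_fun M U (?m I)" for I by (rule smooth_fun_monomial[OF chart oU order_refl])
  have g: "smooth_fun M U (g l)" for l unfolding g_def[abs_def] by (intro smooth_fun_sum smooth_fun_cmult oU m)
  define f where "f = (\<lambda>l\<in>idx E. restrict (g l) U)"
  have f: "f \<in> F.coeffs U" using restrict_smooth[OF oU g] by (auto simp: f_def)
  have "chart_partial U \<phi> I (F.coef U (lin_comb \<Gamma> (idx E) U U \<Phi> f) l) a = x (l, I)"
    if l: "l \<in> idx E" and I: "I \<in> multi_indices dm k" for l I
  proof -
    have "chart_partial U \<phi> I (F.coef U (lin_comb \<Gamma> (idx E) U U \<Phi> f) l) a = chart_partial U \<phi> I (g l) a"
      by (rule chart_partial_cong[OF chart oU order_refl _ a]) (use F.coef_lin_comb[OF oU order_refl f] l in \<open>simp add: f_def\<close>)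
    also have "\<dots> = (\<Sum>J\<in>multi_indices dm k. (x (l, J) / mfact dm J) * chart_partial U \<phi> I (?m J) a)"
      unfolding g_def[abs_def] by (rule chart_partial_sum[OF chart oU order_refl m a])
    also have "\<dots> = (\<Sum>J\<in>multi_indices dm k. if J = I then x (l, J) else 0)"
      by (rule sum.cong) (use chart_partial_monomial[OF chart oU order_refl _ I a] mfact_pos in \<open>auto simp: less_imp_neq[symmetric]\<close>)
    finally show ?thesis using I by (simp add: finite_multi_indices)
  qed
  thus ?thesis
    by (intro bexI[OF _ F.lin_comb_closed[OF oU order_refl f]]) (auto simp: jcoord_def)
qed

end

section \<open>The usual jet bundle is a vector bundle\<close>

context vbdl
begin

abbreviation jbun where "jbun k \<equiv> usual_jet_bundle M E k"

abbreviation jets where "jets k \<equiv> jet_class M \<Gamma> (Suc k)"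

lemma chart_frameI:
  "(U, \<phi>) \<in> atlas M ==> local_frame M \<Gamma> (idx E) U \<Phi> ==> chart_frame M E U \<phi> \<Phi>"
  by (intro chart_frame.intro chart_frame_axioms.intro vbdl_axioms)

lemma chart_frame_iff: "chart_frame M E U \<phi> \<Phi> \<longleftrightarrow> (U, \<phi>) \<in> atlas M \<and> local_frame M \<Gamma> (idx E) U \<Phi>"
  by (auto intro: chart_frameI dest: chart_frame.chart chart_frame.frame)

text \<open>The condition in the atlas of the usual jet bundle, with the chart and the frame made
  explicit and arbitrary sections in place of linear combinations.\<close>

definition reads_jets :: "nat => 'm set => ('m => nat => real) => ('i => 'm => 'e) =>
    ('m \<times> ('m set \<times> ('m => 'e)) set set => 'i \<times> (nat => nat) => real) => bool" where
  "reads_jets k U \<phi> \<Phi> t \<longleftrightarrow> chart_frame M E U \<phi> \<Phi> \<and>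
    (\<forall>V s a. V \<subseteq> U --> S.section_at a V s --> t (a, jets k a V s) = chart_frame.jcoord M E U \<phi> \<Phi> k V s a)"

lemma usual_trivs: "(U, t) \<in> trivs (jbun k) \<longleftrightarrow> (\<exists>\<phi> \<Phi>. reads_jets k U \<phi> \<Phi> t)"
proof -
  have iff: "(\<forall>V f. opn V \<and> V \<subseteq> U \<and> f \<in> idx E \<rightarrow>\<^sub>E fcts V -->
          (\<forall>a\<in>V. t (a, jets k a V (lin_comb \<Gamma> (idx E) U V \<Phi> f)) =
             (\<lambda>(l, I). if l \<in> idx E \<and> I \<in> multi_indices dm k
                       then mpartial dm I (\<lambda>x. f l (inv_into U \<phi> x)) (\<phi> a) else 0))) \<longleftrightarrow>
    (\<forall>V s a. V \<subseteq> U --> S.section_at a V s --> t (a, jets k a V s) = chart_frame.jcoord M E U \<phi> \<Phi> k V s a)"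
    if cf: "chart_frame M E U \<phi> \<Phi>" for \<phi> \<Phi>
  proof -
    interpret chart_frame M E U \<phi> \<Phi> by (rule cf)
    show ?thesis
      unfolding jcoord_def chart_partial_def
      by (rule F.sections_iff_lin_combs[where P = "\<lambda>a V s f. t (a, jets k a V s) =
        (\<lambda>(l, I). if l \<in> idx E \<and> I \<in> multi_indices dm k then mpartial dm I (\<lambda>x. f l (inv_into U \<phi> x)) (\<phi> a) else 0)"])
  qed
  show ?thesis
    unfolding usual_jet_bundle_def reads_jets_def disjoint_union_bundle_simps mem_Collect_eq prod.case
  proof ((rule ex_cong1)+, goal_cases)
    case (1 \<phi> \<Phi>)
    show ?case
    proof (cases "chart_frame M E U \<phi> \<Phi>")
      case True
      hence "(U, \<phi>) \<in> atlas M" "local_frame M \<Gamma> (idx E) U \<Phi>" by (simp_all only: chart_frame_iff)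
      thus ?thesis using True iff[OF True] by (simp only: simp_thms)
    next
      case False
      hence "\<not> ((U, \<phi>) \<in> atlas M \<and> local_frame M \<Gamma> (idx E) U \<Phi>)" by (simp only: chart_frame_iff not_False_eq_True)
      thus ?thesis using False by blast
    qed
  qed
qed

text \<open>The condition prescribes values on jets through their representing sections. Choosing
  one section for each jet defines \<open>t\<close>, and \<open>jcoord_welldefined\<close> makes the
  choice immaterial.\<close>

lemma reads_jets_exists:
  assumes "chart_frame M E U \<phi> \<Phi>" shows "\<exists>t. reads_jets k U \<phi> \<Phi> t"
proof -
  interpret chart_frame M E U \<phi> \<Phi> by (rule assms)
  define rep where "rep a z = (SOME p. S.section_at a (fst p) (snd p) \<and> fst p \<subseteq> U \<and> z = jets k a (fst p) (snd p))" for a z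
  have "jcoord k (fst (rep a (jets k a V s))) (snd (rep a (jets k a V s))) a = jcoord k V s a"
    if V: "V \<subseteq> U" and s: "S.section_at a V s" for V s a
  proof -
    let ?p = "rep a (jets k a V s)"
    have "S.section_at a (fst ?p) (snd ?p) \<and> fst ?p \<subseteq> U \<and> jets k a V s = jets k a (fst ?p) (snd ?p)"
      unfolding rep_def by (rule someI[of _ "(V, s)"]) (use V s in simp)
    thus ?thesis using jcoord_welldefined[OF s V, of "fst ?p" "snd ?p" k] by simp
  qed
  hence "reads_jets k U \<phi> \<Phi> (\<lambda>(a, z). jcoord k (fst (rep a z)) (snd (rep a z)) a)"
    using assms by (simp add: reads_jets_def)
  thus ?thesis by blast
qed

text \<open>A chart shrunk to a cube inside a trivializing set, with the frame of that
  trivialization: the setting in which Hadamard's lemma can be applied to coefficients.\<close>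

lemma chart_frame_cover:
  assumes "opn W" "a \<in> W"
  obtains U \<phi> \<Phi> r where "chart_frame M E U \<phi> \<Phi>" "a \<in> U" "U \<subseteq> W" "\<phi> ` U = cube dm (\<phi> a) r"
proof -
  have "a \<in> points M" using assms opn_points by auto
  then obtain V t where t: "(V, t) \<in> trivs E" "a \<in> V" using triv_cover by blast
  obtain U \<phi> r where U: "(U, \<phi>) \<in> atlas M" "opn U" "a \<in> U" "U \<subseteq> V \<inter> W" "\<phi> ` U = cube dm (\<phi> a) r"
    using cube_chart[of "V \<inter> W" a] triv_open[OF t(1)] assms t(2) by blast
  have "local_frame M \<Gamma> (idx E) U (triv_frame t U)" by (rule triv_local_frame[OF t(1) U(2)]) (use U in auto)
  thus thesis using that[OF chart_frameI[OF U(1)]] U by auto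
qed

theorem vector_bundle_usual_jet_bundle: "vector_bundle M (jbun k)"
proof (rule S.jet_bundleI[where q = "Suc k" and I = "jidx k" and T = "trivs (jbun k)"])
  show "jbun k = disjoint_union_bundle M (jet_space M \<Gamma> (Suc k)) (jidx k) (trivs (jbun k))"
    by (simp add: usual_jet_bundle_def)
  show "finite (jidx k)" by (simp add: finite_idx finite_multi_indices)
  show op: "opn U" if "(U, t) \<in> trivs (jbun k)" for U t
    using that chart_open by (auto simp: usual_trivs reads_jets_def chart_frame_iff)
  show "\<exists>U t. (U, t) \<in> trivs (jbun k) \<and> a \<in> U" if a: "a \<in> points M" for a
  proof -
    obtain U \<phi> \<Phi> r where U: "chart_frame M E U \<phi> \<Phi>" "a \<in> U"
      by (rule chart_frame_cover[OF openin_topspace a])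
    obtain t where "reads_jets k U \<phi> \<Phi> t" using reads_jets_exists[OF U(1)] ..
    hence "(U, t) \<in> trivs (jbun k)" unfolding usual_trivs by (intro exI)
    thus ?thesis using U(2) by (intro exI conjI)
  qed
  {
    fix U t assume t: "(U, t) \<in> trivs (jbun k)"
    then obtain \<phi> \<Phi> where r: "reads_jets k U \<phi> \<Phi> t" by (auto simp: usual_trivs)
    then interpret chart_frame M E U \<phi> \<Phi> by (simp add: reads_jets_def)
    have t_eq: "t (a, jets k a V s) = jcoord k V s a" if "V \<subseteq> U" "S.section_at a V s" for a V s
      using r that by (simp add: reads_jets_def)
    {
      fix a V s assume V: "V \<subseteq> U" and s: "S.section_at a V s"
      have oV: "opn V" and aV: "a \<in> V" and sV: "s \<in> sects V" using s by auto
      show "t (a, jets k a V s) i = 0" if "i \<notin> jidx k" for i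
        using that by (cases i) (auto simp: t_eq[OF V s] jcoord_def)
      show "t (a, jets k a V (s \<oplus>\<^bsub>sec \<Gamma> V\<^esub> s')) i = t (a, jets k a V s) i + t (a, jets k a V s') i"
        if s': "S.section_at a V s'" for s' i
        using t_eq[OF V s] t_eq[OF V s'] t_eq[OF V, of a "s \<oplus>\<^bsub>sec \<Gamma> V\<^esub> s'"] S.sec_closed(2)[OF oV sV, of s'] s'
          jcoord_add[OF oV V sV _ aV, of s'] by simp
      show "t (a, jets k a V ((\<lambda>b\<in>V. c) \<odot>\<^bsub>sec \<Gamma> V\<^esub> s)) i = c * t (a, jets k a V s) i" for c i
        using t_eq[OF V s] t_eq[OF V, of a "(\<lambda>b\<in>V. c) \<odot>\<^bsub>sec \<Gamma> V\<^esub> s"] S.sec_closed(5)[OF oV const_in_smooth_ring[OF oV] sV]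
          oV aV jcoord_scale[OF oV V sV aV] by simp
      show "jets k a V s = jets k a V \<zero>\<^bsub>sec \<Gamma> V\<^esub>"
        if "\<And>i. i \<in> jidx k ==> t (a, jets k a V s) i = 0"
        by (rule jcoord_zero_imp[OF V s]) (use that t_eq[OF V s] in simp)
    }
    fix a x assume a: "a \<in> U"
    obtain s where s: "s \<in> sects U" "\<forall>i\<in>jidx k. jcoord k U s a i = x i"
      using jcoord_surj[OF a, of k x] by blast
    hence "S.section_at a U s" using a F.frame_open by simp
    thus "\<exists>V s. S.section_at a V s \<and> V \<subseteq> U \<and> (\<forall>i\<in>jidx k. t (a, jets k a V s) i = x i)"
      using s(2) t_eq[OF order_refl] by (intro exI[of _ U] exI[of _ s]) auto
  }
  fix U t V s i j
  assume inj: "\<And>U t a. (U, t) \<in> trivs (jbun k) ==> a \<in> U ==> inj_on t (fibre (jbun k) a)"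
    and t: "(U, t) \<in> trivs (jbun k)" and s: "(V, s) \<in> trivs (jbun k)"
    and i: "i \<in> jidx k" and j: "j \<in> jidx k"
  obtain l I where lI: "j = (l, I)" "l \<in> idx E" "I \<in> multi_indices dm k" using j by auto
  let ?W = "U \<inter> V"
  have W: "opn ?W" using op[OF t] op[OF s] by auto
  obtain \<phi> \<Phi> where r: "reads_jets k U \<phi> \<Phi> t" using t by (auto simp: usual_trivs)
  obtain \<phi>' \<Phi>' where r': "reads_jets k V \<phi>' \<Phi>' s" using s by (auto simp: usual_trivs)
  interpret A: chart_frame M E U \<phi> \<Phi> using r by (simp add: reads_jets_def)
  interpret B: chart_frame M E V \<phi>' \<Phi>' using r' by (simp add: reads_jets_def)
  \<comment> \<open>The unit point with index \<open>(l, I)\<close> over \<open>a\<close> is the jet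
    of the monomial centred at \<open>a\<close>, divided by \<open>mfact dm I\<close>, times
    \<open>\<Phi> l\<close>. This section depends on \<open>a\<close>, which is the situation of
    \<open>smooth_shift_prod\<close>.\<close>
  let ?\<Phi> = "(\<lambda>x\<in>?W. 1 / mfact dm I) \<odot>\<^bsub>sec \<Gamma> ?W\<^esub> res \<Gamma> U ?W (\<Phi> l)"
  have \<Phi>W: "res \<Gamma> U ?W (\<Phi> l) \<in> sects ?W" using A.F.frame_res[OF W _ lI(2)] by simp
  have c: "(\<lambda>x\<in>?W. 1 / mfact dm I) \<in> fcts ?W" by (rule const_in_smooth_ring[OF W])
  have \<Phi>: "?\<Phi> \<in> sects ?W" by (rule S.sec_closed(5)[OF W c \<Phi>W])
  have word: "\<forall>f\<in>set (coord_word \<phi> I). smooth_fun M ?W f" by (rule A.coord_word_smooth) simp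
  let ?p = "\<lambda>a. shift_prod ?W a (coord_word \<phi> I) ?\<Phi>"
  have p: "S.section_at a ?W (?p a)" if "a \<in> ?W" for a using shift_prod_section[OF W word \<Phi>] W that by simp
  have unit: "unit_point (jbun k) t j a = (a, jets k a ?W (?p a))" if a: "a \<in> ?W" for a
  proof -
    have fib: "(a, jets k a ?W (?p a)) \<in> fibre (jbun k) a"
      by (rule S.jet_fibre[OF _ p[OF a]]) (simp add: usual_jet_bundle_def)
    have "t (a, jets k a ?W (?p a)) = A.jcoord k ?W (?p a) a"
      using r p[OF a] unfolding reads_jets_def by blast
    also have "\<dots> = (\<lambda>i. if i = j then 1 else 0)"
    proof
      fix i
      have eq: "?p a = (\<lambda>x\<in>?W. 1 / mfact dm I) \<odot>\<^bsub>sec \<Gamma> ?W\<^esub> shift_prod ?W a (coord_word \<phi> I) (res \<Gamma> U ?W (\<Phi> l))"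
        by (rule shift_prod_smult[OF W word \<Phi>W c])
      have "A.jcoord k ?W (?p a) a i = 1 / mfact dm I * A.jcoord k ?W (shift_prod ?W a (coord_word \<phi> I) (res \<Gamma> U ?W (\<Phi> l))) a i"
        unfolding eq by (rule A.jcoord_scale[OF W _ shift_prod_section[OF W word \<Phi>W] a]) simp
      thus "A.jcoord k ?W (?p a) a i = (if i = j then 1 else 0)"
        using A.jcoord_shift_prod[OF W _ a lI(2,3)] lI(1) mfact_pos[of dm I] by simp
    qed
    finally have tj: "t (a, jets k a ?W (?p a)) = (\<lambda>i. if i = j then 1 else 0)" .
    show ?thesis unfolding unit_point_def
      by (rule inv_into_f_eq[OF inj[OF t] fib tj]) (use a in simp)
  qed
  have "smooth_fun M ?W (\<lambda>a. B.jcoord k ?W (?p a) a i)"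
    by (rule smooth_shift_prod[OF W _ _ _ word \<Phi>, where T = "\<lambda>a s. B.jcoord k ?W s a i"])
      (use B.jcoord_add[OF W] B.jcoord_scale[OF W] B.smooth_jcoord[OF W] in auto)
  moreover have "s (unit_point (jbun k) t j a) i = B.jcoord k ?W (?p a) a i" if "a \<in> ?W" for a
    using unit[OF that] r' p[OF that] by (simp add: reads_jets_def)
  ultimately show "smooth_fun M (U \<inter> V) (\<lambda>a. s (unit_point (jbun k) t j a) i)"
    using smooth_fun_cong[OF W, of "\<lambda>a. s (unit_point (jbun k) t j a) i"] by simp
qed

end

section \<open>The vector bundle of a locally free sheaf\<close>

context module_presheaf
begin

lemma vanishing_sections_1:
  assumes U: "opn U" and S: "additive_subgroup S (sec F U)"
    and *: "\<And>f s. f \<in> fcts U ==> f a = 0 ==> s \<in> sects U ==> f \<odot>\<^bsub>sec F U\<^esub> s \<in> S"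
  shows "vanishing_sections (Suc 0) a U \<subseteq> S"
  by (rule smodule.ideal_power_Suc_subset[OF sec_smodule[OF U] vanishing_ideal_subset S])
    (use * smodule.ideal_power_0[OF sec_smodule[OF U]] in \<open>auto simp: vanishing_ideal_def\<close>)

lemma smult_in_vanishing_sections_1:
  assumes "opn U" "f \<in> fcts U" "f a = 0" "s \<in> sects U"
  shows "f \<odot>\<^bsub>sec F U\<^esub> s \<in> vanishing_sections (Suc 0) a U"
  by (rule smodule.ideal_power_smult[OF sec_smodule[OF assms(1)] vanishing_ideal_subset])
    (use assms smodule.ideal_power_0[OF sec_smodule[OF assms(1)]] in \<open>auto simp: vanishing_ideal_def\<close>)

abbreviation value_class where "value_class \<equiv> jet_class M F (Suc 0)"

end

context framed_presheaf
begin

lemma local_frame_cong: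
  assumes eq: "\<And>i. i \<in> I ==> \<Phi>' i = \<Phi> i"
  shows "local_frame M F I U \<Phi>'"
  unfolding local_frame_def
proof (intro conjI allI impI ballI frame_open)
  show "\<Phi>' i \<in> sects U" if "i \<in> I" for i using frame_in eq that by simp
  fix V s assume V: "opn V \<and> V \<subseteq> U" and s: "s \<in> sects V"
  interpret V: smodule "smooth_ring M V" "sec F V" using sec_smodule V by blast
  have "lin_comb F I U V \<Phi>' f = lin_comb F I U V \<Phi> f" if "f \<in> coeffs V" for f
    unfolding lin_comb_def by (rule V.finsum_cong') (use term_in[OF _ _ that] V eq in auto)
  hence "f \<in> coeffs V \<and> s = lin_comb F I U V \<Phi>' f \<longleftrightarrow> f \<in> coeffs V \<and> s = lin_comb F I U V \<Phi> f" for f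
    by auto
  thus "\<exists>!f. f \<in> coeffs V \<and> s = lin_comb F I U V \<Phi>' f" using frame_ex1[of V s] V s by simp
qed

lemma coef_vanishing:
  assumes V: "opn V" "V \<subseteq> U" and a: "a \<in> V" and s: "s \<in> vanishing_sections (Suc 0) a V" and i: "i \<in> I"
  shows "coef V s i a = 0"
proof -
  interpret V: smodule "smooth_ring M V" "sec F V" by (rule sec_smodule[OF V(1)])
  have z: "coef V \<zero>\<^bsub>sec F V\<^esub> i a = 0"
    using coef_add[OF V V.zero_closed V.zero_closed a i] by simp
  have neg: "coef V (\<ominus>\<^bsub>sec F V\<^esub> s) i a = - coef V s i a" if "s \<in> sects V" for s
    using coef_add[OF V that _ a i, of "\<ominus>\<^bsub>sec F V\<^esub> s"] that z by (simp add: V.r_neg)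
  have "vanishing_sections (Suc 0) a V \<subseteq> {s \<in> sects V. coef V s i a = 0}"
  proof (rule vanishing_sections_1[OF V(1)])
    show "additive_subgroup {s \<in> sects V. coef V s i a = 0} (sec F V)"
      by (rule additive_subgroupI'[OF V.abelian_group_axioms]) (use z neg coef_add[OF V _ _ a i] in auto)
  qed (use coef_smult[OF V _ _ a i] in auto)
  thus ?thesis using s by auto
qed

text \<open>The expansion in the frame exhibits the section as a sum of multiples by functions that
  vanish at \<open>a\<close>.\<close>

lemma coef_zero_imp:
  assumes V: "opn V" "V \<subseteq> U" and a: "a \<in> V" and s: "s \<in> sects V" and z: "\<And>i. i \<in> I ==> coef V s i a = 0"
  shows "s \<in> vanishing_sections (Suc 0) a V"
proof -
  interpret V: smodule "smooth_ring M V" "sec F V" by (rule sec_smodule[OF V(1)])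
  have "lin_comb F I U V \<Phi> (coef V s) \<in> vanishing_sections (Suc 0) a V"
    unfolding lin_comb_def
    by (rule additive_subgroup_finsum[OF V.abelian_group_axioms V.ideal_power_additive_subgroup[OF vanishing_ideal_subset]])
      (use smult_in_vanishing_sections_1[OF V(1) coef_in[OF V s] z frame_res[OF V]] in auto)
  thus ?thesis using lin_comb_coef[OF V s] by simp
qed

text \<open>So the fibre over \<open>a\<close> is parametrized by the values at \<open>a\<close> of
  the coefficients in a frame, and the trivializations of \<open>sheaf_bundle\<close> are well
  defined and injective.\<close>

lemma value_class_eq_iff:
  assumes s: "section_at a V s" "V \<subseteq> U" and t: "section_at a W t" "W \<subseteq> U"
  shows "value_class a V s = value_class a W t \<longleftrightarrow> (\<forall>i\<in>I. coef V s i a = coef W t i a)"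
proof -
  let ?X = "V \<inter> W"
  have X: "opn ?X" "a \<in> ?X" "?X \<subseteq> V" "?X \<subseteq> W" "?X \<subseteq> U" using s t by auto
  let ?s = "res F V ?X s" and ?t = "res F W ?X t"
  have s': "section_at a ?X ?s" by (rule section_at_res[OF s(1) X(1-3)])
  have t': "section_at a ?X ?t" by (rule section_at_res[OF t(1) X(1,2,4)])
  have c: "coef ?X ?s i a = coef V s i a" "coef ?X ?t i a = coef W t i a" if "i \<in> I" for i
    using coef_res[OF _ s(2) X(1,3) _ that X(2), of s] coef_res[OF _ t(2) X(1,4) _ that X(2), of t] s t by auto
  interpret X: smodule "smooth_ring M ?X" "sec F ?X" by (rule sec_smodule[OF X(1)])
  have cd: "coef Y (p \<ominus>\<^bsub>sec F Y\<^esub> q) i a = coef Y p i a - coef Y q i a"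
    if Y: "opn Y" "Y \<subseteq> U" "a \<in> Y" and pq: "p \<in> sects Y" "q \<in> sects Y" and i: "i \<in> I" for Y p q i
  proof -
    interpret Y: smodule "smooth_ring M Y" "sec F Y" by (rule sec_smodule[OF Y(1)])
    have "p \<ominus>\<^bsub>sec F Y\<^esub> q \<oplus>\<^bsub>sec F Y\<^esub> q = p" using pq by (simp add: a_minus_def Y.a_assoc Y.l_neg)
    thus ?thesis using coef_add[OF Y(1,2) _ pq(2) Y(3) i, of "p \<ominus>\<^bsub>sec F Y\<^esub> q"] pq by simp
  qed
  have d: "?s \<ominus>\<^bsub>sec F ?X\<^esub> ?t \<in> sects ?X" using s' t' by simp
  have "value_class a V s = value_class a W t \<longleftrightarrow> value_class a ?X ?s = value_class a ?X ?t"
    using jet_class_res[OF s(1) X(1-3)] jet_class_res[OF t(1) X(1,2,4)] by simp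
  also have "\<dots> \<longleftrightarrow> (\<forall>i\<in>I. coef ?X ?s i a = coef ?X ?t i a)"
  proof
    assume "value_class a ?X ?s = value_class a ?X ?t"
    then obtain Y where Y: "opn Y" "a \<in> Y" "Y \<subseteq> ?X" "res F ?X Y (?s \<ominus>\<^bsub>sec F ?X\<^esub> ?t) \<in> vanishing_sections (Suc 0) a Y"
      using jet_eq_iff[OF s' t'] by auto
    have YU: "Y \<subseteq> U" using Y(3) X(5) by auto
    show "\<forall>i\<in>I. coef ?X ?s i a = coef ?X ?t i a"
    proof
      fix i assume i: "i \<in> I"
      have "coef Y (res F ?X Y (?s \<ominus>\<^bsub>sec F ?X\<^esub> ?t)) i a = 0" by (rule coef_vanishing[OF Y(1) YU Y(2,4) i])
      hence "coef ?X (?s \<ominus>\<^bsub>sec F ?X\<^esub> ?t) i a = 0" using coef_res[OF X(1,5) Y(1,3) d i Y(2)] by simp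
      thus "coef ?X ?s i a = coef ?X ?t i a" using cd[OF X(1,5,2) _ _ i, of ?s ?t] s' t' by simp
    qed
  next
    assume eq: "\<forall>i\<in>I. coef ?X ?s i a = coef ?X ?t i a"
    have "?s \<ominus>\<^bsub>sec F ?X\<^esub> ?t \<in> vanishing_sections (Suc 0) a ?X"
      by (rule coef_zero_imp[OF X(1,5,2) d]) (use cd[OF X(1,5,2)] eq s' t' in simp)
    thus "value_class a ?X ?s = value_class a ?X ?t"
      using jet_eq_iff[OF s' t'] X res_id[OF X(1) d] by auto
  qed
  finally show ?thesis using c by auto
qed

end

context module_presheaf
begin

context
  fixes r assumes lf: "locally_free M F r" and rank: "sheaf_rank M F = r"
begin

abbreviation sbun where "sbun \<equiv> sheaf_bundle M F"

definition reads_coefs :: "'m set => (nat => 's) => ('m \<times> ('m set \<times> 's) set set => nat => real) => bool" where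
  "reads_coefs U \<Phi> t \<longleftrightarrow> local_frame M F {..<r} U \<Phi> \<and>
    (\<forall>V s a. V \<subseteq> U --> section_at a V s -->
      t (a, value_class a V s) = (\<lambda>i. if i < r then framed_presheaf.coef M F {..<r} U \<Phi> V s i a else 0))"

lemma framedI: "local_frame M F {..<r} U \<Phi> ==> framed_presheaf M F {..<r} U \<Phi>"
  by (intro framed_presheaf.intro framed_presheaf_axioms.intro module_presheaf_axioms) auto

lemma sheaf_trivs: "(U, t) \<in> trivs sbun \<longleftrightarrow> (\<exists>\<Phi>. reads_coefs U \<Phi> t)"
proof -
  have iff: "(\<forall>V f. opn V \<and> V \<subseteq> U \<and> f \<in> {..<r} \<rightarrow>\<^sub>E fcts V -->
          (\<forall>a\<in>V. t (a, value_class a V (lin_comb F {..<r} U V \<Phi> f)) = (\<lambda>i. if i < r then f i a else 0))) \<longleftrightarrow>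
    (\<forall>V s a. V \<subseteq> U --> section_at a V s -->
      t (a, value_class a V s) = (\<lambda>i. if i < r then framed_presheaf.coef M F {..<r} U \<Phi> V s i a else 0))"
    if fr: "local_frame M F {..<r} U \<Phi>" for \<Phi>
  proof -
    interpret P: framed_presheaf M F "{..<r}" U \<Phi> by (rule framedI[OF fr])
    show ?thesis
      by (rule P.sections_iff_lin_combs[where P = "\<lambda>a V s f. t (a, value_class a V s) = (\<lambda>i. if i < r then f i a else 0)"])
  qed
  show ?thesis
    unfolding sheaf_bundle_def reads_coefs_def disjoint_union_bundle_simps mem_Collect_eq prod.case rank One_nat_def
    by (intro ex_cong1 conj_cong refl iff)
qed

lemma reads_coefs_exists:
  assumes "local_frame M F {..<r} U \<Phi>" shows "\<exists>t. reads_coefs U \<Phi> t"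
proof -
  interpret P: framed_presheaf M F "{..<r}" U \<Phi> by (rule framedI[OF assms])
  define rep where "rep a z = (SOME p. section_at a (fst p) (snd p) \<and> fst p \<subseteq> U \<and> z = value_class a (fst p) (snd p))" for a z
  have "P.coef (fst (rep a (value_class a V s))) (snd (rep a (value_class a V s))) i a = P.coef V s i a"
    if V: "V \<subseteq> U" and s: "section_at a V s" and i: "i < r" for V s a i
  proof -
    let ?p = "rep a (value_class a V s)"
    have "section_at a (fst ?p) (snd ?p) \<and> fst ?p \<subseteq> U \<and> value_class a V s = value_class a (fst ?p) (snd ?p)"
      unfolding rep_def by (rule someI[of _ "(V, s)"]) (use V s in simp)
    thus ?thesis using P.value_class_eq_iff[OF s V, of "fst ?p" "snd ?p"] i by simp
  qed
  hence "reads_coefs U \<Phi> (\<lambda>(a, z) i. if i < r then P.coef (fst (rep a z)) (snd (rep a z)) i a else 0)"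
    using assms by (auto simp: reads_coefs_def fun_eq_iff)
  thus ?thesis by blast
qed

lemma sheaf_bundle_fibre: "sbun = disjoint_union_bundle M (jet_space M F (Suc 0)) {..<r} (trivs sbun)"
  by (simp add: sheaf_bundle_def rank)

lemma sheaf_triv_cover:
  assumes "a \<in> points M" obtains U t where "(U, t) \<in> trivs sbun" "a \<in> U"
proof -
  obtain U \<Phi> where U: "a \<in> U" "local_frame M F {..<r} U \<Phi>" using lf assms unfolding locally_free_def by blast
  obtain t where "reads_coefs U \<Phi> t" using reads_coefs_exists[OF U(2)] ..
  hence "(U, t) \<in> trivs sbun" unfolding sheaf_trivs by (intro exI)
  thus thesis using that U(1) by blast
qed

lemma sheaf_unit_point:
  assumes inj: "inj_on t (fibre sbun a)" and t: "reads_coefs U \<Phi> t" and a: "a \<in> U" and j: "j < r"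
  shows "unit_point sbun t j a = (a, value_class a U (\<Phi> j))"
proof -
  interpret P: framed_presheaf M F "{..<r}" U \<Phi> using t by (intro framedI) (simp add: reads_coefs_def)
  note oU = P.frame_open
  interpret U: smodule "smooth_ring M U" "sec F U" by (rule sec_smodule[OF oU])
  have \<Phi>: "section_at a U (\<Phi> j)" using oU a P.frame_in j by simp
  have "P.coef U (\<Phi> j) i a = (if i = j then 1 else 0)" if "i < r" for i
  proof -
    have "\<one>\<^bsub>smooth_ring M U\<^esub> a = 1" using a by (simp add: smooth_ring_simps)
    thus ?thesis
      using P.coef_frame[OF oU order_refl _ U.R.one_closed, of j i a] res_id[OF oU, of "\<Phi> j"] \<Phi> j that a by simp
  qed
  hence tj: "t (a, value_class a U (\<Phi> j)) = (\<lambda>i. if i = j then 1 else 0)"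
    using t \<Phi> j unfolding reads_coefs_def by (auto simp: fun_eq_iff)
  show ?thesis unfolding unit_point_def
    by (rule inv_into_f_eq[OF inj jet_fibre[OF sheaf_bundle_fibre \<Phi>] tj])
qed

theorem vector_bundle_sheaf_bundle: "vector_bundle M sbun"
proof (rule jet_bundleI[OF sheaf_bundle_fibre])
  show op: "opn U" if "(U, t) \<in> trivs sbun" for U t
    using that by (auto simp: sheaf_trivs reads_coefs_def local_frame_def)
  show "\<exists>U t. (U, t) \<in> trivs sbun \<and> a \<in> U" if "a \<in> points M" for a
    by (rule sheaf_triv_cover[OF that]) blast
  {
    fix U t assume t: "(U, t) \<in> trivs sbun"
    then obtain \<Phi> where r: "reads_coefs U \<Phi> t" by (auto simp: sheaf_trivs)
    then interpret P: framed_presheaf M F "{..<r}" U \<Phi> by (intro framedI) (simp add: reads_coefs_def)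
    have t_eq: "t (a, value_class a V s) = (\<lambda>i. if i < r then P.coef V s i a else 0)" if "V \<subseteq> U" "section_at a V s" for a V s
      using r that by (simp add: reads_coefs_def)
    {
      fix a V s assume V: "V \<subseteq> U" and s: "section_at a V s"
      have oV: "opn V" and aV: "a \<in> V" and sV: "s \<in> sects V" using s by auto
      show "t (a, value_class a V s) i = 0" if "i \<notin> {..<r}" for i
        using that by (simp add: t_eq[OF V s])
      show "t (a, value_class a V (s \<oplus>\<^bsub>sec F V\<^esub> s')) i = t (a, value_class a V s) i + t (a, value_class a V s') i"
        if s': "section_at a V s'" and i: "i \<in> {..<r}" for s' i
        using t_eq[OF V s] t_eq[OF V s'] t_eq[OF V, of a "s \<oplus>\<^bsub>sec F V\<^esub> s'"] sec_closed(2)[OF oV sV, of s'] s'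
          P.coef_add[OF oV V sV _ aV i, of s'] i by simp
      show "t (a, value_class a V ((\<lambda>b\<in>V. c) \<odot>\<^bsub>sec F V\<^esub> s)) i = c * t (a, value_class a V s) i" if i: "i \<in> {..<r}" for c i
        using t_eq[OF V s] t_eq[OF V, of a "(\<lambda>b\<in>V. c) \<odot>\<^bsub>sec F V\<^esub> s"] sec_closed(5)[OF oV const_in_smooth_ring[OF oV] sV]
          oV aV P.coef_smult[OF oV V const_in_smooth_ring[OF oV] sV aV i] i by simp
      show "value_class a V s = value_class a V \<zero>\<^bsub>sec F V\<^esub>"
        if z: "\<And>i. i \<in> {..<r} ==> t (a, value_class a V s) i = 0"
      proof -
        interpret V: smodule "smooth_ring M V" "sec F V" by (rule sec_smodule[OF oV])
        have z0: "section_at a V \<zero>\<^bsub>sec F V\<^esub>" using oV aV by simp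
        have "P.coef V \<zero>\<^bsub>sec F V\<^esub> i a = 0" if "i \<in> {..<r}" for i
          using P.coef_add[OF oV V V.zero_closed V.zero_closed aV that] by simp
        thus ?thesis using P.value_class_eq_iff[OF s V z0 V] z t_eq[OF V s] by simp
      qed
    }
    fix a and x :: "nat => real" assume a: "a \<in> U"
    let ?f = "\<lambda>i\<in>{..<r}. \<lambda>b\<in>U. x i"
    have f: "?f \<in> P.coeffs U" using const_in_smooth_ring[OF P.frame_open] by auto
    have "section_at a U (lin_comb F {..<r} U U \<Phi> ?f)" using a P.frame_open P.lin_comb_closed[OF P.frame_open order_refl f] by simp
    thus "\<exists>V s. section_at a V s \<and> V \<subseteq> U \<and> (\<forall>i\<in>{..<r}. t (a, value_class a V s) i = x i)"
      using t_eq[OF order_refl] P.coef_lin_comb[OF P.frame_open order_refl f] a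
      by (intro exI[of _ U] exI[of _ "lin_comb F {..<r} U U \<Phi> ?f"]) auto
  }
  fix U t V s i j
  assume inj: "\<And>U t a. (U, t) \<in> trivs sbun ==> a \<in> U ==> inj_on t (fibre sbun a)"
    and t: "(U, t) \<in> trivs sbun" and s: "(V, s) \<in> trivs sbun"
    and i: "i \<in> {..<r}" and j: "j \<in> {..<r}"
  let ?W = "U \<inter> V"
  have W: "opn ?W" using op[OF t] op[OF s] by auto
  obtain \<Phi> where r: "reads_coefs U \<Phi> t" using t by (auto simp: sheaf_trivs)
  obtain \<Phi>' where r': "reads_coefs V \<Phi>' s" using s by (auto simp: sheaf_trivs)
  interpret A: framed_presheaf M F "{..<r}" U \<Phi> using r by (intro framedI) (simp add: reads_coefs_def)
  interpret B: framed_presheaf M F "{..<r}" V \<Phi>' using r' by (intro framedI) (simp add: reads_coefs_def)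
  let ?\<Phi> = "res F U ?W (\<Phi> j)"
  have \<Phi>: "?\<Phi> \<in> sects ?W" using A.frame_res[OF W _ j] by simp
  have "s (unit_point sbun t j a) i = B.coef ?W ?\<Phi> i a" if a: "a \<in> ?W" for a
  proof -
    have "section_at a U (\<Phi> j)" using a A.frame_open A.frame_in[OF j] by simp
    hence "unit_point sbun t j a = (a, value_class a ?W ?\<Phi>)"
      using sheaf_unit_point[OF inj[OF t] r, of a j] jet_class_res[of U a "\<Phi> j" ?W "Suc 0"] W a j by simp
    thus ?thesis using r' \<Phi> W a i by (simp add: reads_coefs_def)
  qed
  thus "smooth_fun M (U \<inter> V) (\<lambda>a. s (unit_point sbun t j a) i)"
    using smooth_fun_cong[OF W, of "\<lambda>a. s (unit_point sbun t j a) i"] B.coef_smooth[OF W _ \<Phi> i] by simp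
qed simp

end

end

section \<open>Sheaves isomorphic to the sections of a vector bundle\<close>

text \<open>Each law is an equation in \<open>P\<close> that becomes true after the injective map
  \<open>h\<close>; for \<open>P\<close> itself, closure under its operations is enough.\<close>

lemma module_transport:
  assumes N: "module R N" and bij: "bij_betw h (carrier P) (carrier N)"
    and zero: "\<zero>\<^bsub>P\<^esub> \<in> carrier P" "h \<zero>\<^bsub>P\<^esub> = \<zero>\<^bsub>N\<^esub>"
    and add: "\<And>x y. x \<in> carrier P ==> y \<in> carrier P ==> x \<oplus>\<^bsub>P\<^esub> y \<in> carrier P \<and> h (x \<oplus>\<^bsub>P\<^esub> y) = h x \<oplus>\<^bsub>N\<^esub> h y"
    and smult: "\<And>f x. f \<in> carrier R ==> x \<in> carrier P ==> f \<odot>\<^bsub>P\<^esub> x \<in> carrier P \<and> h (f \<odot>\<^bsub>P\<^esub> x) = f \<odot>\<^bsub>N\<^esub> h x"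
  shows "module R P"
proof -
  interpret N: module R N by fact
  have inj: "x = y" if "x \<in> carrier P" "y \<in> carrier P" "h x = h y" for x y
    using inj_onD[OF bij_betw_imp_inj_on[OF bij] that(3,1,2)] .
  have h: "h x \<in> carrier N" if "x \<in> carrier P" for x using bij_betw_apply[OF bij that] .
  show ?thesis
  proof (rule moduleI[OF N.R.is_cring])
    show "abelian_group P"
    proof (rule abelian_groupI)
      fix x assume x: "x \<in> carrier P"
      have "\<ominus>\<^bsub>N\<^esub> h x \<in> h ` carrier P" using bij_betw_imp_surj_on[OF bij] h[OF x] by simp
      then obtain y where y: "y \<in> carrier P" "h y = \<ominus>\<^bsub>N\<^esub> h x" by auto
      have "y \<oplus>\<^bsub>P\<^esub> x = \<zero>\<^bsub>P\<^esub>" by (rule inj) (use x y add zero h N.l_neg in auto)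
      thus "\<exists>y\<in>carrier P. y \<oplus>\<^bsub>P\<^esub> x = \<zero>\<^bsub>P\<^esub>" using y by blast
      show "\<zero>\<^bsub>P\<^esub> \<oplus>\<^bsub>P\<^esub> x = x" by (rule inj) (use x add zero h in auto)
      fix y assume y: "y \<in> carrier P"
      show "x \<oplus>\<^bsub>P\<^esub> y = y \<oplus>\<^bsub>P\<^esub> x" by (rule inj) (use x y add h N.a_comm in auto)
      fix z assume z: "z \<in> carrier P"
      show "x \<oplus>\<^bsub>P\<^esub> y \<oplus>\<^bsub>P\<^esub> z = x \<oplus>\<^bsub>P\<^esub> (y \<oplus>\<^bsub>P\<^esub> z)"
        by (rule inj) (use x y z add h N.a_assoc in auto)
    qed (use zero add in auto)
    fix x assume x: "x \<in> carrier P"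
    show "\<one>\<^bsub>R\<^esub> \<odot>\<^bsub>P\<^esub> x = x" by (rule inj) (use x smult h in auto)
    fix f assume f: "f \<in> carrier R"
    show "f \<odot>\<^bsub>P\<^esub> x \<in> carrier P" using x f smult by auto
    {
      fix g assume g: "g \<in> carrier R"
      show "(f \<oplus>\<^bsub>R\<^esub> g) \<odot>\<^bsub>P\<^esub> x = f \<odot>\<^bsub>P\<^esub> x \<oplus>\<^bsub>P\<^esub> g \<odot>\<^bsub>P\<^esub> x"
        by (rule inj) (use x f g smult add h N.smult_l_distr in auto)
      show "(f \<otimes>\<^bsub>R\<^esub> g) \<odot>\<^bsub>P\<^esub> x = f \<odot>\<^bsub>P\<^esub> (g \<odot>\<^bsub>P\<^esub> x)"
        by (rule inj) (use x f g smult h N.smult_assoc1 in auto)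
    }
    fix y assume y: "y \<in> carrier P"
    show "f \<odot>\<^bsub>P\<^esub> (x \<oplus>\<^bsub>P\<^esub> y) = f \<odot>\<^bsub>P\<^esub> x \<oplus>\<^bsub>P\<^esub> f \<odot>\<^bsub>P\<^esub> y"
      by (rule inj) (use x y f smult add h N.smult_r_distr in auto)
  qed
qed

text \<open>The inverse of a fibrewise linear bijection is again linear on fibres, so that only
  smoothness has to be checked in both directions.\<close>

lemma vb_isomorphismI:
  assumes B: "vector_bundle M B" and C: "vector_bundle M C" and bij: "bij_betw \<Psi> (tot B) (tot C)"
    and fib: "\<And>a u. a \<in> points M ==> u \<in> fibre B a ==> \<Psi> u \<in> fibre C a"
    and add: "\<And>a u v. a \<in> points M ==> u \<in> fibre B a ==> v \<in> fibre B a ==> \<Psi> (vadd B u v) = vadd C (\<Psi> u) (\<Psi> v)"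
    and scale: "\<And>a u c. a \<in> points M ==> u \<in> fibre B a ==> \<Psi> (vscale B c u) = vscale C c (\<Psi> u)"
    and smooth: "\<And>U t V s i j. (U, t) \<in> trivs B ==> (V, s) \<in> trivs C ==> i \<in> idx C ==> j \<in> idx B ==>
      smooth_fun M (U \<inter> V) (\<lambda>a. s (\<Psi> (unit_point B t j a)) i)"
    and smooth': "\<And>U t V s i j. (U, t) \<in> trivs C ==> (V, s) \<in> trivs B ==> i \<in> idx B ==> j \<in> idx C ==>
      smooth_fun M (U \<inter> V) (\<lambda>a. s (inv_into (tot B) \<Psi> (unit_point C t j a)) i)"
  shows "vb_isomorphism M B C \<Psi>"
proof -
  let ?i = "inv_into (tot B) \<Psi>"
  have proj: "vproj B u \<in> points M" if "u \<in> tot B" for u using B that by (simp add: vector_bundle_def)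
  have closed: "vadd B u v \<in> fibre B a" "vscale B c u \<in> fibre B a"
    if "a \<in> points M" "u \<in> fibre B a" "v \<in> fibre B a" for a u v c
    using B that by (simp_all add: vector_bundle_def)
  have tot: "u \<in> tot B" if "u \<in> fibre B a" for a u using that by (simp add: fibre_def)
  have inv: "?i (\<Psi> u) = u" if "u \<in> tot B" for u
    by (rule inv_into_f_f[OF bij_betw_imp_inj_on[OF bij] that])
  have rep: "\<exists>w\<in>fibre B a. u = \<Psi> w" if a: "a \<in> points M" and u: "u \<in> fibre C a" for a u
  proof -
    have "u \<in> \<Psi> ` tot B" using u bij_betw_imp_surj_on[OF bij] by (simp add: fibre_def)
    then obtain w where w: "w \<in> tot B" "u = \<Psi> w" by auto
    hence "\<Psi> w \<in> fibre C (vproj B w)" using fib[OF proj[OF w(1)], of w] by (simp add: fibre_def)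
    hence "vproj B w = a" using u w(2) by (simp add: fibre_def)
    thus ?thesis using w by (auto simp: fibre_def)
  qed
  have "vb_morphism M B C \<Psi>"
    unfolding vb_morphism_def using B C fib add scale smooth by auto
  moreover have "vb_morphism M C B ?i"
    unfolding vb_morphism_def
  proof (intro conjI ballI)
    fix a u assume a: "a \<in> points M" and u: "u \<in> fibre C a"
    obtain w where w: "w \<in> fibre B a" "u = \<Psi> w" using rep[OF a u] by blast
    show "?i u \<in> fibre B a" using w inv[OF tot[OF w(1)]] by simp
    show "?i (vadd C u v) = vadd B (?i u) (?i v)" if v: "v \<in> fibre C a" for v
    proof -
      obtain x where x: "x \<in> fibre B a" "v = \<Psi> x" using rep[OF a v] by blast
      show ?thesis
        using w x inv[OF tot[OF w(1)]] inv[OF tot[OF x(1)]] inv[OF tot[OF closed(1)[OF a w(1) x(1)]]] add[OF a w(1) x(1)] by simp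
    qed
    show "\<forall>c. ?i (vscale C c u) = vscale B c (?i u)"
      using w inv[OF tot[OF w(1)]] inv[OF tot[OF closed(2)[OF a w(1) w(1)]]] scale[OF a w(1)] by (metis (no_types))
  qed (use B C smooth' in auto)
  ultimately show ?thesis using bij by (simp add: vb_isomorphism_def)
qed

text \<open>\<open>F\<close> enters as a family of records with closed operations; that it is a
  presheaf of modules is a consequence, transported through \<open>h\<close>. In this way the module
  structure of the sheafification is obtained from the sections of a bundle.\<close>

locale sheaf_iso = vbdl M B for M :: "'m manifold" and B :: "('m, 'e, 'i) vbundle" +
  fixes F :: "('m, 's) presheaf" and h :: "'m set => 's => 'm => 'e"
  assumes h_bij: "openin (mtop M) U ==> bij_betw (h U) (carrier (sec F U)) (carrier (sec (smooth_sections M B) U))"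
    and h_zero: "openin (mtop M) U ==> \<zero>\<^bsub>sec F U\<^esub> \<in> carrier (sec F U) \<and> h U \<zero>\<^bsub>sec F U\<^esub> = \<zero>\<^bsub>sec (smooth_sections M B) U\<^esub>"
    and h_add: "openin (mtop M) U ==> s \<in> carrier (sec F U) ==> t \<in> carrier (sec F U) ==>
      s \<oplus>\<^bsub>sec F U\<^esub> t \<in> carrier (sec F U) \<and> h U (s \<oplus>\<^bsub>sec F U\<^esub> t) = h U s \<oplus>\<^bsub>sec (smooth_sections M B) U\<^esub> h U t"
    and h_smult: "openin (mtop M) U ==> f \<in> carrier (smooth_ring M U) ==> s \<in> carrier (sec F U) ==>
      f \<odot>\<^bsub>sec F U\<^esub> s \<in> carrier (sec F U) \<and> h U (f \<odot>\<^bsub>sec F U\<^esub> s) = f \<odot>\<^bsub>sec (smooth_sections M B) U\<^esub> h U s"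
    and h_res: "openin (mtop M) U ==> openin (mtop M) V ==> V \<subseteq> U ==> s \<in> carrier (sec F U) ==>
      res F U V s \<in> carrier (sec F V) \<and> h V (res F U V s) = restrict (h U s) V"
begin

lemma h_section: "opn U ==> s \<in> carrier (sec F U) ==> h U s \<in> sects U"
  using bij_betw_apply[OF h_bij] .

lemma h_inj: "opn U ==> s \<in> carrier (sec F U) ==> t \<in> carrier (sec F U) ==> h U s = h U t ==> s = t"
  using inj_onD[OF bij_betw_imp_inj_on[OF h_bij]] by blast

lemma h_surj: assumes "opn U" "\<psi> \<in> sects U" obtains s where "s \<in> carrier (sec F U)" "h U s = \<psi>"
proof -
  have "\<psi> \<in> h U ` carrier (sec F U)" using bij_betw_imp_surj_on[OF h_bij[OF assms(1)]] assms(2) by simp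
  thus thesis using that by auto
qed

lemma module_presheaf_F: "module_presheaf M F"
proof (intro module_presheaf.intro module_presheaf_axioms.intro smooth_mfd_axioms)
  show "module (smooth_ring M U) (sec F U)" if "opn U" for U
    by (rule module_transport[OF module_sections[OF that] h_bij[OF that]])
      (use h_zero[OF that] h_add[OF that] h_smult[OF that] in auto)
  show "res F U V s \<in> carrier (sec F V)" if "opn U" "opn V" "V \<subseteq> U" "s \<in> carrier (sec F U)" for U V s
    using h_res that by auto
  show "res F U V (s \<oplus>\<^bsub>sec F U\<^esub> t) = res F U V s \<oplus>\<^bsub>sec F V\<^esub> res F U V t"
    if U: "opn U" and V: "opn V" "V \<subseteq> U" and s: "s \<in> carrier (sec F U)" and t: "t \<in> carrier (sec F U)" for U V s t
  proof (rule h_inj[OF V(1)])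
    note r = h_res[OF U V s] h_res[OF U V t] h_res[OF U V] h_add[OF U s t] h_add[OF V(1), of "res F U V s" "res F U V t"]
    show "res F U V (s \<oplus>\<^bsub>sec F U\<^esub> t) \<in> carrier (sec F V)" "res F U V s \<oplus>\<^bsub>sec F V\<^esub> res F U V t \<in> carrier (sec F V)"
      using r by auto
    show "h V (res F U V (s \<oplus>\<^bsub>sec F U\<^esub> t)) = h V (res F U V s \<oplus>\<^bsub>sec F V\<^esub> res F U V t)"
      using r S.res_add[OF U V h_section[OF U s] h_section[OF U t]] by (simp add: section_simps(5))
  qed
  show "res F U V (f \<odot>\<^bsub>sec F U\<^esub> s) = restrict f V \<odot>\<^bsub>sec F V\<^esub> res F U V s"
    if U: "opn U" and V: "opn V" "V \<subseteq> U" and f: "f \<in> fcts U" and s: "s \<in> carrier (sec F U)" for U V f s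
  proof (rule h_inj[OF V(1)])
    have fV: "restrict f V \<in> fcts V" using C.res_closed[OF U V f] by (simp add: smooth_ring_simps(7))
    note r = h_res[OF U V s] h_res[OF U V] h_smult[OF U f s] h_smult[OF V(1) fV, of "res F U V s"]
    show "res F U V (f \<odot>\<^bsub>sec F U\<^esub> s) \<in> carrier (sec F V)" "restrict f V \<odot>\<^bsub>sec F V\<^esub> res F U V s \<in> carrier (sec F V)"
      using r by auto
    show "h V (res F U V (f \<odot>\<^bsub>sec F U\<^esub> s)) = h V (restrict f V \<odot>\<^bsub>sec F V\<^esub> res F U V s)"
      using r S.res_smult[OF U V f h_section[OF U s]] by (simp add: section_simps(5))
  qed
  show "res F U U s = s" if U: "opn U" and s: "s \<in> carrier (sec F U)" for U s
    by (rule h_inj[OF U]) (use h_res[OF U U order_refl s] s section_ext[OF h_section[OF U s]] in \<open>auto simp: extensional_restrict\<close>)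
  show "res F V W (res F U V s) = res F U W s"
    if U: "opn U" and V: "opn V" and W: "opn W" "W \<subseteq> V" and VU: "V \<subseteq> U" and s: "s \<in> carrier (sec F U)" for U V W s
  proof (rule h_inj[OF W(1)])
    have WU: "W \<subseteq> U" using W VU by auto
    note r = h_res[OF U V VU s] h_res[OF U W(1) WU s] h_res[OF V W, of "res F U V s"]
    show "res F V W (res F U V s) \<in> carrier (sec F W)" "res F U W s \<in> carrier (sec F W)" using r by auto
    show "h W (res F V W (res F U V s)) = h W (res F U W s)" using r W(2) by (simp add: Int_absorb1)
  qed
qed

sublocale F: module_presheaf M F by (rule module_presheaf_F)

lemma h_lin_comb:
  assumes V: "opn V" and U: "opn U" "V \<subseteq> U" and I: "finite I" and \<Phi>: "\<And>i. i \<in> I ==> \<Phi> i \<in> carrier (sec F U)"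
    and f: "f \<in> I \<rightarrow>\<^sub>E fcts V"
  shows "lin_comb F I U V \<Phi> f \<in> carrier (sec F V)"
    and "h V (lin_comb F I U V \<Phi> f) = lin_comb \<Gamma> I U V (\<lambda>i. h U (\<Phi> i)) f"
proof -
  interpret P: smodule "smooth_ring M V" "sec F V" by (rule F.sec_smodule[OF V])
  interpret N: smodule "smooth_ring M V" "sec \<Gamma> V" by (rule S.sec_smodule[OF V])
  have tm: "f i \<odot>\<^bsub>sec F V\<^esub> res F U V (\<Phi> i) \<in> carrier (sec F V)"
    and tm': "f i \<odot>\<^bsub>sec \<Gamma> V\<^esub> res \<Gamma> U V (h U (\<Phi> i)) \<in> sects V"
    and ht: "h V (f i \<odot>\<^bsub>sec F V\<^esub> res F U V (\<Phi> i)) = f i \<odot>\<^bsub>sec \<Gamma> V\<^esub> res \<Gamma> U V (h U (\<Phi> i))" if i: "i \<in> I" for i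
  proof -
    have fi: "f i \<in> fcts V" using f i by auto
    note r = h_res[OF U(1) V U(2) \<Phi>[OF i]]
    show "f i \<odot>\<^bsub>sec F V\<^esub> res F U V (\<Phi> i) \<in> carrier (sec F V)"
      "h V (f i \<odot>\<^bsub>sec F V\<^esub> res F U V (\<Phi> i)) = f i \<odot>\<^bsub>sec \<Gamma> V\<^esub> res \<Gamma> U V (h U (\<Phi> i))"
      using h_smult[OF V fi conjunct1[OF r]] r by (auto simp: section_simps(5))
    show "f i \<odot>\<^bsub>sec \<Gamma> V\<^esub> res \<Gamma> U V (h U (\<Phi> i)) \<in> sects V"
      using fi S.res_closed[OF U(1) V U(2) h_section[OF U(1) \<Phi>[OF i]]] by simp
  qed
  have "(\<Oplus>\<^bsub>sec F V\<^esub>i\<in>J. f i \<odot>\<^bsub>sec F V\<^esub> res F U V (\<Phi> i)) \<in> carrier (sec F V) \<and>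
      h V (\<Oplus>\<^bsub>sec F V\<^esub>i\<in>J. f i \<odot>\<^bsub>sec F V\<^esub> res F U V (\<Phi> i)) = (\<Oplus>\<^bsub>sec \<Gamma> V\<^esub>i\<in>J. f i \<odot>\<^bsub>sec \<Gamma> V\<^esub> res \<Gamma> U V (h U (\<Phi> i)))"
    if "J \<subseteq> I" for J
    using finite_subset[OF that I] that
  proof (induction J)
    case empty
    show ?case using h_zero[OF V] by simp
  next
    case (insert i J)
    have i: "i \<in> I" and J: "J \<subseteq> I" using insert.prems by auto
    have 1: "(\<lambda>i. f i \<odot>\<^bsub>sec F V\<^esub> res F U V (\<Phi> i)) \<in> J \<rightarrow> carrier (sec F V)" using tm J by blast
    have 2: "(\<lambda>i. f i \<odot>\<^bsub>sec \<Gamma> V\<^esub> res \<Gamma> U V (h U (\<Phi> i))) \<in> J \<rightarrow> sects V" using tm' J by blast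
    note IH = insert.IH[OF J]
    show ?case
      unfolding P.finsum_insert[OF insert.hyps 1 tm[OF i]] N.finsum_insert[OF insert.hyps 2 tm'[OF i]]
      using h_add[OF V tm[OF i] conjunct1[OF IH]] IH ht[OF i] by simp
  qed
  thus "lin_comb F I U V \<Phi> f \<in> carrier (sec F V)"
    and "h V (lin_comb F I U V \<Phi> f) = lin_comb \<Gamma> I U V (\<lambda>i. h U (\<Phi> i)) f"
    unfolding lin_comb_def by auto
qed

text \<open>\<open>h\<close> carries the expansion of a section in \<open>\<Phi>\<close> to an
  expansion of its image with the same coefficients, and it is injective.\<close>

lemma local_frame_h:
  assumes I: "finite I" and U: "opn U" and \<Phi>: "\<And>i. i \<in> I ==> \<Phi> i \<in> carrier (sec F U)"
    and fr: "local_frame M \<Gamma> I U (\<lambda>i. h U (\<Phi> i))"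
  shows "local_frame M F I U \<Phi>"
  unfolding local_frame_def
proof (intro conjI allI impI ballI U \<Phi>)
  interpret N: framed_presheaf M \<Gamma> I U "\<lambda>i. h U (\<Phi> i)"
    by (intro framed_presheaf.intro framed_presheaf_axioms.intro S.module_presheaf_axioms I fr)
  fix V s assume V: "opn V \<and> V \<subseteq> U" and s: "s \<in> carrier (sec F V)"
  note lc = h_lin_comb[OF conjunct1[OF V] U conjunct2[OF V] I \<Phi>]
  have hs: "h V s \<in> sects V" using h_section V s by auto
  have iff: "(f \<in> I \<rightarrow>\<^sub>E fcts V \<and> s = lin_comb F I U V \<Phi> f) \<longleftrightarrow>
    (f \<in> I \<rightarrow>\<^sub>E fcts V \<and> h V s = lin_comb \<Gamma> I U V (\<lambda>i. h U (\<Phi> i)) f)" for f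
    using lc[of "\<lambda>i. i" f] h_inj[OF conjunct1[OF V] s, of "lin_comb F I U V \<Phi> f"] by auto
  show "\<exists>!f. f \<in> I \<rightarrow>\<^sub>E fcts V \<and> s = lin_comb F I U V \<Phi> f"
    unfolding iff by (rule N.frame_ex1) (use V hs in auto)
qed

lemma locally_free_F: "locally_free M F (card (idx B))"
  unfolding locally_free_def
proof
  fix a assume a: "a \<in> points M"
  obtain U t where t: "(U, t) \<in> trivs B" "a \<in> U" using triv_cover[OF a] .
  obtain e where e: "bij_betw e {..<card (idx B)} (idx B)"
    using ex_bij_betw_nat_finite[OF finite_idx] by (auto simp: lessThan_atLeast0)
  note U = triv_open[OF t(1)]
  let ?\<Phi> = "\<lambda>j. inv_into (carrier (sec F U)) (h U) (triv_frame t U (e j))"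
  have sec: "triv_frame t U (e j) \<in> h U ` carrier (sec F U)" if "j \<in> {..<card (idx B)}" for j
    using triv_frame_section[OF t(1) U order_refl bij_betw_apply[OF e that]] bij_betw_imp_surj_on[OF h_bij[OF U]] by simp
  have \<Phi>: "?\<Phi> j \<in> carrier (sec F U)" and h\<Phi>: "h U (?\<Phi> j) = triv_frame t U (e j)" if "j \<in> {..<card (idx B)}" for j
    using inv_into_into[OF sec[OF that]] f_inv_into_f[OF sec[OF that]] by auto
  interpret N: framed_presheaf M \<Gamma> "{..<card (idx B)}" U "\<lambda>j. triv_frame t U (e j)"
    by (intro framed_presheaf.intro framed_presheaf_axioms.intro S.module_presheaf_axioms
        triv_local_frame_reindex[OF t(1) U order_refl e]) simp
  have "local_frame M \<Gamma> {..<card (idx B)} U (\<lambda>j. h U (?\<Phi> j))"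
    by (rule N.local_frame_cong) (rule h\<Phi>)
  hence "local_frame M F {..<card (idx B)} U ?\<Phi>" by (intro local_frame_h U \<Phi>) auto
  thus "\<exists>U \<Phi>. a \<in> U \<and> local_frame M F {..<card (idx B)} U \<Phi>" using t(2) by blast
qed

abbreviation SB where "SB \<equiv> sheaf_bundle M F"

text \<open>\<open>sheaf_rank\<close> is chosen among the ranks of \<open>F\<close>; since
  \<open>locally_free_F\<close> provides one, the chosen number is a rank too.\<close>

lemma rank_F: "locally_free M F (sheaf_rank M F)"
  unfolding sheaf_rank_def by (rule someI[of "locally_free M F", OF locally_free_F])

lemmas SB_fibre = F.sheaf_bundle_fibre[OF rank_F refl]

lemma vector_bundle_SB: "vector_bundle M SB"
  by (rule F.vector_bundle_sheaf_bundle[OF rank_F refl])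

lemma h_vanishing:
  assumes V: "opn V" and a: "a \<in> V" and s: "s \<in> F.vanishing_sections (Suc 0) a V"
  shows "h V s a = vzero B a"
proof -
  have aM: "a \<in> points M" using opn_points[OF V] a by auto
  obtain W t where t: "(W, t) \<in> trivs B" "a \<in> W" using triv_cover[OF aM] .
  let ?S = "{s \<in> carrier (sec F V). \<forall>i. t (h V s a) i = 0}"
  interpret P: smodule "smooth_ring M V" "sec F V" by (rule F.sec_smodule[OF V])
  have coord: "t (h V (s \<oplus>\<^bsub>sec F V\<^esub> s') a) i = t (h V s a) i + t (h V s' a) i"
    if s: "s \<in> carrier (sec F V)" and s': "s' \<in> carrier (sec F V)" for s s' i
    using h_add[OF V s s'] section_coord(2)[OF h_section[OF V s] t(1) a t(2) h_section[OF V s']] by simp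
  have z: "t (h V \<zero>\<^bsub>sec F V\<^esub> a) i = 0" for i
    using h_zero[OF V] section_coord(1)[OF zero_section[OF V] t(1) a t(2)] by simp
  have neg: "t (h V (\<ominus>\<^bsub>sec F V\<^esub> s) a) i = - t (h V s a) i" if s: "s \<in> carrier (sec F V)" for s i
    using coord[OF s, of "\<ominus>\<^bsub>sec F V\<^esub> s" i] s z by (simp add: P.r_neg)
  have "F.vanishing_sections (Suc 0) a V \<subseteq> ?S"
  proof (rule F.vanishing_sections_1[OF V])
    show "additive_subgroup ?S (sec F V)"
      by (rule additive_subgroupI'[OF P.abelian_group_axioms]) (use coord z neg in auto)
    fix f s assume f: "f \<in> fcts V" "f a = 0" and s: "s \<in> carrier (sec F V)"
    show "f \<odot>\<^bsub>sec F V\<^esub> s \<in> ?S"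
      using h_smult[OF V f(1) s] section_coord(3)[OF h_section[OF V s] t(1) a t(2), of f] f(2) by simp
  qed
  hence "\<forall>i. t (h V s a) i = 0" and sV: "s \<in> carrier (sec F V)" using s by auto
  thus ?thesis
    by (intro triv_inj[OF t section_fibre[OF h_section[OF V sV] a] fibre_closed(1)[OF aM]]) (simp add: triv_zero[OF t])
qed

text \<open>Over a trivializing set the section is a combination of the preimages of a frame, and
  its coefficients at \<open>a\<close> are the coordinates of \<open>h V s a\<close>, hence 0. The
  domain is shrunk to make this frame available.\<close>

lemma vzero_imp_vanishing:
  assumes V: "opn V" and a: "a \<in> V" and s: "s \<in> carrier (sec F V)" and z: "h V s a = vzero B a"
  obtains W where "opn W" "a \<in> W" "W \<subseteq> V" "res F V W s \<in> F.vanishing_sections (Suc 0) a W"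
proof -
  have aM: "a \<in> points M" using opn_points[OF V] a by auto
  obtain U \<Phi> where U: "a \<in> U" "local_frame M F {..<card (idx B)} U \<Phi>"
    using locally_free_F aM unfolding locally_free_def by blast
  obtain W' t where t: "(W', t) \<in> trivs B" "a \<in> W'" using triv_cover[OF aM] .
  let ?W = "W' \<inter> V"
  have W: "opn ?W" "a \<in> ?W" "?W \<subseteq> V" "?W \<subseteq> W'" using t a V triv_open[OF t(1)] by auto
  let ?s = "res F V ?W s"
  have sW: "?s \<in> carrier (sec F ?W)" and hW: "h ?W ?s = restrict (h V s) ?W" using h_res[OF V W(1,3) s] by auto
  interpret P: smodule "smooth_ring M ?W" "sec F ?W" by (rule F.sec_smodule[OF W(1)])
  interpret N: framed_presheaf M \<Gamma> "idx B" ?W "triv_frame t ?W"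
    by (intro framed_presheaf.intro framed_presheaf_axioms.intro S.module_presheaf_axioms
        triv_local_frame[OF t(1) W(1,4)] finite_idx)
  let ?f = "N.coef ?W (h ?W ?s)"
  have f: "?f \<in> N.coeffs ?W" by (rule N.coef_in'[OF W(1) order_refl h_section[OF W(1) sW]])
  let ?\<Phi> = "\<lambda>j. inv_into (carrier (sec F ?W)) (h ?W) (triv_frame t ?W j)"
  have sec: "triv_frame t ?W j \<in> h ?W ` carrier (sec F ?W)" if "j \<in> idx B" for j
    using triv_frame_section[OF t(1) W(1,4) that] bij_betw_imp_surj_on[OF h_bij[OF W(1)]] by simp
  have \<Phi>: "?\<Phi> j \<in> carrier (sec F ?W)" and h\<Phi>: "h ?W (?\<Phi> j) = triv_frame t ?W j" if "j \<in> idx B" for j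
    using inv_into_into[OF sec[OF that]] f_inv_into_f[OF sec[OF that]] by auto
  have "t (h ?W ?s a) j = ?f j a" if j: "j \<in> idx B" for j
  proof -
    have "t (h ?W ?s a) j = (\<Sum>i\<in>idx B. ?f i a * t (triv_frame t ?W i a) j)"
      using lin_comb_section(2)[where \<Phi> = "triv_frame t ?W" and j = j,
          OF W(1) W(1) order_refl finite_idx triv_frame_section[OF t(1) W(1,4)] f t(1) W(2) t(2)]
        N.lin_comb_coef[OF W(1) order_refl h_section[OF W(1) sW]] by simp
    also have "\<dots> = (\<Sum>i\<in>idx B. if j = i then ?f i a else 0)"
      by (rule sum.cong) (use W(2) unit_point_props(2)[OF t] in \<open>auto simp: triv_frame_def\<close>)
    finally show ?thesis using j finite_idx by simp
  qed
  hence f0: "?f j a = 0" if "j \<in> idx B" for j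
    using that hW W(2) z triv_zero[OF t] by simp
  have "local_frame M \<Gamma> (idx B) ?W (\<lambda>j. h ?W (?\<Phi> j))" by (rule N.local_frame_cong) (rule h\<Phi>)
  then interpret N': framed_presheaf M \<Gamma> "idx B" ?W "\<lambda>j. h ?W (?\<Phi> j)"
    by (intro framed_presheaf.intro framed_presheaf_axioms.intro S.module_presheaf_axioms finite_idx)
  interpret G: smodule "smooth_ring M ?W" "sec \<Gamma> ?W" by (rule S.sec_smodule[OF W(1)])
  have "lin_comb \<Gamma> (idx B) ?W ?W (\<lambda>j. h ?W (?\<Phi> j)) ?f = lin_comb \<Gamma> (idx B) ?W ?W (triv_frame t ?W) ?f"
    unfolding lin_comb_def by (rule G.finsum_cong') (use N.term_in[OF W(1) order_refl f] h\<Phi> in auto)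
  hence "h ?W (lin_comb F (idx B) ?W ?W ?\<Phi> ?f) = h ?W ?s"
    using h_lin_comb(2)[OF W(1) W(1) order_refl finite_idx \<Phi> f] N.lin_comb_coef[OF W(1) order_refl h_section[OF W(1) sW]] by simp
  from h_inj[OF W(1) h_lin_comb(1)[OF W(1) W(1) order_refl finite_idx \<Phi> f] sW this]
  have "lin_comb F (idx B) ?W ?W ?\<Phi> ?f = ?s" .
  moreover have "lin_comb F (idx B) ?W ?W ?\<Phi> ?f \<in> F.vanishing_sections (Suc 0) a ?W"
    unfolding lin_comb_def
    by (rule additive_subgroup_finsum[OF P.abelian_group_axioms P.ideal_power_additive_subgroup[OF F.vanishing_ideal_subset]],
        rule F.smult_in_vanishing_sections_1[OF W(1)])
      (use N.coef_in[OF W(1) order_refl h_section[OF W(1) sW]] f0 F.res_closed[OF W(1) W(1) order_refl \<Phi>] in auto)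
  ultimately show thesis using that[of ?W] W by simp
qed

text \<open>Apply the two preceding lemmas to the difference of the sections. The fibre of the sheaf
  at \<open>a\<close> is thus the fibre of the bundle, which makes the map between the bundles well
  defined and injective.\<close>

lemma value_class_h:
  assumes s: "F.section_at a U s" and t: "F.section_at a V t"
  shows "F.value_class a U s = F.value_class a V t \<longleftrightarrow> h U s a = h V t a"
proof -
  let ?X = "U \<inter> V"
  have X: "opn ?X" "a \<in> ?X" "?X \<subseteq> U" "?X \<subseteq> V" using s t by auto
  let ?s = "res F U ?X s" and ?t = "res F V ?X t"
  have s': "F.section_at a ?X ?s" by (rule F.section_at_res[OF s X(1-3)])
  have t': "F.section_at a ?X ?t" by (rule F.section_at_res[OF t X(1,2,4)])
  have hs: "h ?X ?s a = h U s a" "h ?X ?t a = h V t a"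
    using h_res[of U ?X s] h_res[of V ?X t] s t X by auto
  interpret P: smodule "smooth_ring M ?X" "sec F ?X" by (rule F.sec_smodule[OF X(1)])
  let ?d = "?s \<ominus>\<^bsub>sec F ?X\<^esub> ?t"
  have d: "?d \<in> carrier (sec F ?X)" using s' t' by simp
  have sd: "?d \<oplus>\<^bsub>sec F ?X\<^esub> ?t = ?s" using s' t' by (simp add: a_minus_def P.a_assoc P.l_neg)
  have aM: "a \<in> points M" using opn_points[OF X(1)] X(2) by auto
  obtain W r where r: "(W, r) \<in> trivs B" "a \<in> W" using triv_cover[OF aM] .
  have fib: "h ?X ?d a \<in> fibre B a" "h ?X ?s a \<in> fibre B a" "h ?X ?t a \<in> fibre B a"
    using section_fibre[OF h_section[OF X(1)] X(2)] d s' t' by auto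
  have co: "r (h ?X ?s a) i = r (h ?X ?d a) i + r (h ?X ?t a) i" for i
    using h_add[OF X(1) d, of ?t] sd t' section_coord(2)[OF h_section[OF X(1) d] r(1) X(2) r(2) h_section[OF X(1), of ?t]] by simp
  have zero_iff: "h ?X ?s a = h ?X ?t a \<longleftrightarrow> h ?X ?d a = vzero B a"
    using triv_inj[OF r fib(2,3)] triv_inj[OF r fib(1) fibre_closed(1)[OF aM]] triv_zero[OF r] co by force
  have "F.value_class a U s = F.value_class a V t \<longleftrightarrow> F.value_class a ?X ?s = F.value_class a ?X ?t"
    using F.jet_class_res[OF s X(1-3)] F.jet_class_res[OF t X(1,2,4)] by simp
  also have "\<dots> \<longleftrightarrow> (\<exists>Y. opn Y \<and> a \<in> Y \<and> Y \<subseteq> ?X \<and> res F ?X Y ?d \<in> F.vanishing_sections (Suc 0) a Y)"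
    using F.jet_eq_iff[OF s' t', of "Suc 0"] by simp
  also have "\<dots> \<longleftrightarrow> h ?X ?d a = vzero B a"
  proof
    assume "\<exists>Y. opn Y \<and> a \<in> Y \<and> Y \<subseteq> ?X \<and> res F ?X Y ?d \<in> F.vanishing_sections (Suc 0) a Y"
    then obtain Y where Y: "opn Y" "a \<in> Y" "Y \<subseteq> ?X" "res F ?X Y ?d \<in> F.vanishing_sections (Suc 0) a Y" by blast
    thus "h ?X ?d a = vzero B a" using h_vanishing[OF Y(1,2,4)] h_res[OF X(1) Y(1,3) d] by simp
  next
    assume "h ?X ?d a = vzero B a"
    from vzero_imp_vanishing[OF X(1,2) d this]
    show "\<exists>Y. opn Y \<and> a \<in> Y \<and> Y \<subseteq> ?X \<and> res F ?X Y ?d \<in> F.vanishing_sections (Suc 0) a Y" by metis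
  qed
  finally show ?thesis using zero_iff hs by simp
qed

text \<open>The matrices are smooth in both directions because unit points extend to sections: on
  one side to elements of a frame of the sheaf, on the other to the frame of a trivialization, which
  has a preimage under \<open>h\<close>.\<close>

theorem sheaf_bundle_iso:
  obtains \<Psi> where "\<Psi> \<in> extensional (tot SB)" "vb_isomorphism M SB B \<Psi>"
    "\<And>a U s. F.section_at a U s ==> \<Psi> (a, F.value_class a U s) = h U s a"
proof -
  define rep where "rep u = (SOME p. F.section_at (fst u) (fst p) (snd p) \<and> snd u = F.value_class (fst u) (fst p) (snd p))" for u
  define \<Psi> where "\<Psi> = (\<lambda>u\<in>tot SB. h (fst (rep u)) (snd (rep u)) (fst u))"
  have totI: "(a, F.value_class a U s) \<in> tot SB" if "F.section_at a U s" for a U s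
    using F.jet_fibre[OF SB_fibre that] by (simp add: fibre_def)
  have val: "\<Psi> (a, F.value_class a U s) = h U s a" if s: "F.section_at a U s" for a U s
  proof -
    let ?u = "(a, F.value_class a U s)"
    have "F.section_at a (fst (rep ?u)) (snd (rep ?u)) \<and> F.value_class a U s = F.value_class a (fst (rep ?u)) (snd (rep ?u))"
      unfolding rep_def by (rule someI2[of _ "(U, s)"]) (use s in auto)
    thus ?thesis
      using value_class_h[OF s, of "fst (rep ?u)" "snd (rep ?u)"] totI[OF s] by (simp add: \<Psi>_def)
  qed
  have repr: thesis' if u: "u \<in> fibre SB a" and a: "a \<in> points M"
    and *: "\<And>U s. F.section_at a U s ==> u = (a, F.value_class a U s) ==> thesis'" for u a thesis'
    using F.jet_fibreE[OF SB_fibre u a openin_topspace] * by metis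
  have fibI: "u \<in> fibre SB (vproj SB u)" "vproj SB u \<in> points M" if "u \<in> tot SB" for u
    using that vector_bundle_SB by (auto simp: fibre_def vector_bundle_def)
  have repr2: thesis' if u: "u \<in> fibre SB a" and v: "v \<in> fibre SB a" and a: "a \<in> points M"
    and *: "\<And>U s t. F.section_at a U s ==> F.section_at a U t ==> u = (a, F.value_class a U s) ==>
      v = (a, F.value_class a U t) ==> thesis'" for u v a thesis'
  proof (rule repr[OF u a], rule repr[OF v a])
    fix U s V t assume s: "F.section_at a U s" "u = (a, F.value_class a U s)" and t: "F.section_at a V t" "v = (a, F.value_class a V t)"
    show thesis' by (rule F.jet_common_domain[OF SB_fibre s(1) t(1)]) (use * s t in metis)
  qed
  have iso: "vb_isomorphism M SB B \<Psi>"
  proof (rule vb_isomorphismI[OF vector_bundle_SB vb])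
    show fib: "\<Psi> u \<in> fibre B a" if a: "a \<in> points M" and u: "u \<in> fibre SB a" for a u
      by (rule repr[OF u a]) (use val section_fibre[OF h_section] in auto)
    have inj: "inj_on \<Psi> (tot SB)"
    proof (rule inj_onI)
      fix u v assume u: "u \<in> tot SB" and v: "v \<in> tot SB" and eq: "\<Psi> u = \<Psi> v"
      have "\<Psi> u \<in> fibre B (vproj SB u)" "\<Psi> v \<in> fibre B (vproj SB v)" using fib fibI u v by auto
      hence p: "vproj SB u = vproj SB v" using eq by (auto simp: fibre_def)
      have v': "v \<in> fibre SB (vproj SB u)" using fibI(1)[OF v] p by simp
      show "u = v"
      proof (rule repr2[OF fibI(1)[OF u] v' fibI(2)[OF u]])
        fix U s t
        assume s: "F.section_at (vproj SB u) U s" "u = (vproj SB u, F.value_class (vproj SB u) U s)"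
          and t: "F.section_at (vproj SB u) U t" "v = (vproj SB u, F.value_class (vproj SB u) U t)"
        have "h U s (vproj SB u) = h U t (vproj SB u)"
          using eq val[OF s(1)] val[OF t(1)] s(2)[symmetric] t(2)[symmetric] by simp
        thus "u = v" using value_class_h[OF s(1) t(1)] s(2) t(2) by simp
      qed
    qed
    \<comment> \<open>Constant coefficients in the frame of a trivialization give a section through
      any prescribed point of the fibre.\<close>
    have surj: "\<exists>w\<in>fibre SB a. \<Psi> w = u" if a: "a \<in> points M" and u: "u \<in> fibre B a" for a u
    proof -
      obtain U t where t: "(U, t) \<in> trivs B" "a \<in> U" using triv_cover[OF a] .
      note U = triv_open[OF t(1)]
      let ?f = "\<lambda>i\<in>idx B. \<lambda>b\<in>U. t u i"
      have f: "?f \<in> idx B \<rightarrow>\<^sub>E fcts U" using const_in_smooth_ring[OF U] by auto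
      let ?\<psi> = "lin_comb \<Gamma> (idx B) U U (triv_frame t U) ?f"
      note lc = lin_comb_section[where \<Phi> = "triv_frame t U",
          OF U U order_refl finite_idx triv_frame_section[OF t(1) U order_refl] f]
      obtain s where s: "s \<in> carrier (sec F U)" "h U s = ?\<psi>" using h_surj[OF U lc(1)] by auto
      have "t (?\<psi> a) j = t u j" if j: "j \<in> idx B" for j
      proof -
        have "t (?\<psi> a) j = (\<Sum>i\<in>idx B. ?f i a * t (triv_frame t U i a) j)" by (rule lc(2)[OF _ t(1) t(2) t(2)])
        also have "\<dots> = (\<Sum>i\<in>idx B. if j = i then t u i else 0)"
          by (rule sum.cong) (use t(2) unit_point_props(2)[OF t] in \<open>auto simp: triv_frame_def\<close>)
        finally show ?thesis using j finite_idx by simp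
      qed
      hence "?\<psi> a = u" by (intro triv_inj[OF t section_fibre[OF lc(1) t(2)] u]) auto
      thus ?thesis
        using val[of U a s] s U t(2) F.jet_fibre[OF SB_fibre, of U a s] by (intro bexI[of _ "(a, F.value_class a U s)"]) auto
    qed
    show "bij_betw \<Psi> (tot SB) (tot B)"
      unfolding bij_betw_def
    proof (intro conjI inj equalityI subsetI)
      fix u assume "u \<in> \<Psi> ` tot SB"
      then obtain w where "w \<in> tot SB" "u = \<Psi> w" by auto
      thus "u \<in> tot B" using fib[OF fibI(2) fibI(1)] by (auto simp: fibre_def)
    next
      fix u assume u: "u \<in> tot B"
      hence "u \<in> fibre B (vproj B u)" by (simp add: fibre_def)
      from surj[OF tot_proj[OF u] this] show "u \<in> \<Psi> ` tot SB" by (auto simp: fibre_def)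
    qed
    show "\<Psi> (vadd SB u v) = vadd B (\<Psi> u) (\<Psi> v)"
      if a: "a \<in> points M" and u: "u \<in> fibre SB a" and v: "v \<in> fibre SB a" for a u v
    proof (rule repr2[OF u v a])
      fix U s t assume s: "F.section_at a U s" and t: "F.section_at a U t"
        and e: "u = (a, F.value_class a U s)" "v = (a, F.value_class a U t)"
      have "F.section_at a U (s \<oplus>\<^bsub>sec F U\<^esub> t)" using s t F.sec_closed(2) by auto
      thus ?thesis
        unfolding e F.jet_vadd[OF SB_fibre s t] val[OF s] val[OF t]
        using val[of U a "s \<oplus>\<^bsub>sec F U\<^esub> t"] h_add[of U s t] s t by (simp add: section_simps(3))
    qed
    show "\<Psi> (vscale SB c u) = vscale B c (\<Psi> u)" if a: "a \<in> points M" and u: "u \<in> fibre SB a" for a u c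
    proof (rule repr[OF u a])
      fix U s assume s: "F.section_at a U s" and e: "u = (a, F.value_class a U s)"
      have c: "(\<lambda>b\<in>U. c) \<in> fcts U" using const_in_smooth_ring s by auto
      hence "F.section_at a U ((\<lambda>b\<in>U. c) \<odot>\<^bsub>sec F U\<^esub> s)" using s F.sec_closed(5) by auto
      thus ?thesis
        unfolding e F.jet_vscale[OF SB_fibre s] val[OF s]
        using val[of U a "(\<lambda>b\<in>U. c) \<odot>\<^bsub>sec F U\<^esub> s"] h_smult[OF _ c, of s] s by (simp add: section_simps(4))
    qed
    have inj_t: "inj_on t (fibre SB a)" if "(U, t) \<in> trivs SB" "a \<in> U" for U t a
    proof -
      interpret V: vbdl M SB by (intro vbdl.intro vbdl_axioms.intro smooth_mfd_axioms vector_bundle_SB)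
      show ?thesis by (rule bij_betw_imp_inj_on[OF V.triv_bij[OF that]])
    qed
    fix U t V s i j
    {
      assume t: "(U, t) \<in> trivs SB" and s: "(V, s) \<in> trivs B" and i: "i \<in> idx B" and j: "j \<in> idx SB"
      obtain \<Phi> where r: "F.reads_coefs (sheaf_rank M F) U \<Phi> t" using t by (auto simp: F.sheaf_trivs[OF rank_F refl])
      interpret A: framed_presheaf M F "{..<sheaf_rank M F}" U \<Phi>
        by (rule F.framedI[OF rank_F refl]) (use r in \<open>simp add: F.reads_coefs_def[OF rank_F refl]\<close>)
      have j': "j < sheaf_rank M F" using j by (simp add: sheaf_bundle_def)
      have \<Phi>: "\<Phi> j \<in> carrier (sec F U)" using A.frame_in j' by simp
      have W: "opn (U \<inter> V)" using A.frame_open triv_open[OF s] by auto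
      have "\<Psi> (unit_point SB t j a) = h U (\<Phi> j) a" if "a \<in> U \<inter> V" for a
        using F.sheaf_unit_point[OF rank_F refl inj_t[OF t] r _ j', of a] val[of U a "\<Phi> j"] \<Phi> A.frame_open that by simp
      thus "smooth_fun M (U \<inter> V) (\<lambda>a. s (\<Psi> (unit_point SB t j a)) i)"
        using smooth_fun_cong[OF W, of "\<lambda>a. s (\<Psi> (unit_point SB t j a)) i" "\<lambda>a. s (h U (\<Phi> j) a) i"]
          section_smooth[OF h_section[OF A.frame_open \<Phi>] s i] by simp
    }
    {
      assume t: "(U, t) \<in> trivs B" and s: "(V, s) \<in> trivs SB" and i: "i \<in> idx SB" and j: "j \<in> idx B"
      obtain \<Phi> where r: "F.reads_coefs (sheaf_rank M F) V \<Phi> s" using s by (auto simp: F.sheaf_trivs[OF rank_F refl])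
      interpret A: framed_presheaf M F "{..<sheaf_rank M F}" V \<Phi>
        by (rule F.framedI[OF rank_F refl]) (use r in \<open>simp add: F.reads_coefs_def[OF rank_F refl]\<close>)
      have i': "i < sheaf_rank M F" using i by (simp add: sheaf_bundle_def)
      let ?W = "U \<inter> V"
      have W: "opn ?W" using A.frame_open triv_open[OF t] by auto
      obtain x where x: "x \<in> carrier (sec F ?W)" "h ?W x = triv_frame t ?W j"
        using h_surj[OF W triv_frame_section[OF t W _ j]] by auto
      have "s (inv_into (tot SB) \<Psi> (unit_point B t j a)) i = A.coef ?W x i a" if a: "a \<in> ?W" for a
      proof -
        have xa: "F.section_at a ?W x" using x W a by simp
        have "\<Psi> (a, F.value_class a ?W x) = unit_point B t j a" using val[OF xa] x(2) a by (simp add: triv_frame_def)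
        hence "inv_into (tot SB) \<Psi> (unit_point B t j a) = (a, F.value_class a ?W x)"
          using inv_into_f_eq[OF inj totI[OF xa]] by simp
        thus ?thesis using r xa i' by (simp add: F.reads_coefs_def[OF rank_F refl])
      qed
      thus "smooth_fun M ?W (\<lambda>a. s (inv_into (tot SB) \<Psi> (unit_point B t j a)) i)"
        using smooth_fun_cong[OF W, of "\<lambda>a. s (inv_into (tot SB) \<Psi> (unit_point B t j a)) i"]
          A.coef_smooth[OF W _ x(1), of i] i' by simp
    }
  qed
  show thesis by (rule that[OF _ iso val]) (simp only: \<Psi>_def restrict_extensional)
qed

end

section \<open>Formal combinations of functions and sections\<close>

lemma additive_eq_on_frags:
  fixes h h' :: "('a \<Rightarrow>\<^sub>0 int) => 'b::ab_group_add"
  assumes "\<And>x y. h (x - y) = h x - h y" "\<And>x y. h' (x - y) = h' x - h' y"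
    and "\<And>p. p \<in> S ==> h (frag_of p) = h' (frag_of p)" and x: "Poly_Mapping.keys x \<subseteq> S"
  shows "h x = h' x"
proof -
  have "h 0 = 0" "h' 0 = 0" using assms(1)[of 0 0] assms(2)[of 0 0] by simp_all
  from x show ?thesis by (induction x rule: frag_induction) (use assms \<open>h 0 = 0\<close> \<open>h' 0 = 0\<close> in auto)
qed

text \<open>The counterpart of \<open>frag_extend\<close> with real values.\<close>

definition int_extend :: "('a => real) => ('a \<Rightarrow>\<^sub>0 int) => real" where
  "int_extend \<phi> x = (\<Sum>p\<in>Poly_Mapping.keys x. of_int (Poly_Mapping.lookup x p) * \<phi> p)"

lemma int_extend_superset:
  assumes "finite S" "Poly_Mapping.keys x \<subseteq> S"
  shows "int_extend \<phi> x = (\<Sum>p\<in>S. of_int (Poly_Mapping.lookup x p) * \<phi> p)"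
  unfolding int_extend_def by (rule sum.mono_neutral_left) (use assms in \<open>auto simp: in_keys_iff\<close>)

lemma int_extend_diff: "int_extend \<phi> (x - y) = int_extend \<phi> x - int_extend \<phi> y"
proof -
  let ?S = "Poly_Mapping.keys x \<union> Poly_Mapping.keys y"
  have "Poly_Mapping.keys (x - y) \<subseteq> ?S" by (rule keys_diff)
  thus ?thesis
    by (subst (1 2 3) int_extend_superset[of ?S]) (auto simp: lookup_minus left_diff_distrib sum_subtractf)
qed

lemma int_extend_0 [simp]: "int_extend \<phi> 0 = 0"
  by (simp add: int_extend_def)

lemma int_extend_minus: "int_extend \<phi> (- x) = - int_extend \<phi> x"
  using int_extend_diff[of \<phi> 0 x] by simp

lemma int_extend_add: "int_extend \<phi> (x + y) = int_extend \<phi> x + int_extend \<phi> y"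
  using int_extend_diff[of \<phi> x "- y"] by (simp add: int_extend_minus)

lemma int_extend_of [simp]: "int_extend \<phi> (frag_of p) = \<phi> p"
  by (simp add: int_extend_def)

lemma int_extend_frag_extend:
  assumes "Poly_Mapping.keys x \<subseteq> S" "\<And>p. p \<in> S ==> \<phi> (g p) = \<psi> p"
  shows "int_extend \<phi> (frag_extend (\<lambda>p. frag_of (g p)) x) = int_extend \<psi> x"
  by (rule additive_eq_on_frags[where S = S and h = "\<lambda>x. int_extend \<phi> (frag_extend (\<lambda>p. frag_of (g p)) x)"])
    (use assms in \<open>auto simp: frag_extend_diff int_extend_diff\<close>)

lemma keys_frag_extend_of:
  assumes "Poly_Mapping.keys x \<subseteq> S" "\<And>p. p \<in> S ==> g p \<in> T"
  shows "Poly_Mapping.keys (frag_extend (\<lambda>p. frag_of (g p)) x) \<subseteq> T"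
  using assms(1)
proof (induction x rule: frag_induction)
  case (diff a b)
  thus ?case using keys_diff[of "frag_extend (\<lambda>p. frag_of (g p)) a" "frag_extend (\<lambda>p. frag_of (g p)) b"]
    by (auto simp: frag_extend_diff)
qed (use assms(2) in auto)

lemma keys_add_subset: "Poly_Mapping.keys x \<subseteq> S ==> Poly_Mapping.keys y \<subseteq> S ==> Poly_Mapping.keys (x + y) \<subseteq> S"
  using Poly_Mapping.keys_add[of x y] by blast

lemma abelian_group_free_on_pairs: "abelian_group (free_on_pairs A B act)"
proof (rule abelian_groupI)
  fix x assume "x \<in> carrier (free_on_pairs A B act)"
  thus "\<exists>y\<in>carrier (free_on_pairs A B act). y \<oplus>\<^bsub>free_on_pairs A B act\<^esub> x = \<zero>\<^bsub>free_on_pairs A B act\<^esub>"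
    by (intro bexI[of _ "- x"]) (auto simp: free_on_pairs_def)
qed (auto simp: free_on_pairs_def keys_add_subset algebra_simps)

lemma presents_free_on_pairs:
  assumes "\<And>r p. r \<in> R ==> p \<in> carrier A \<times> carrier B ==> act r p \<in> carrier A \<times> carrier B"
  shows "presents R (free_on_pairs A B act) {x. Poly_Mapping.keys x \<subseteq> carrier A \<times> carrier B}
    (\<lambda>r. frag_extend (\<lambda>p. frag_of (act r p))) (\<lambda>x. x) {0}"
  using keys_frag_extend_of[of _ "carrier A \<times> carrier B" "act _" "carrier A \<times> carrier B"] assms abelian_group_free_on_pairs
  by (auto simp: presents_def free_on_pairs_def keys_add_subset frag_extend_add)

lemma free_on_pairs_coset: "N +>\<^bsub>free_on_pairs A B act\<^esub> x = (\<lambda>n. n + x) ` N"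
  by (auto simp: a_r_coset_def' free_on_pairs_def)

text \<open>\<open>tensor_relations\<close> is generated in \<open>free_Abelian_group\<close>, while
  the quotient is taken in \<open>free_on_pairs\<close>. The two records share carrier, operation
  and unit, on which inverses depend as well.\<close>

lemma generate_cong:
  assumes "carrier G = carrier G'" "monoid.mult G = monoid.mult G'" "monoid.one G = monoid.one G'"
  shows "generate G H = generate G' H"
proof -
  have inv: "inv\<^bsub>G\<^esub> x = inv\<^bsub>G'\<^esub> x" for x using assms by (simp add: m_inv_def)
  show ?thesis
  proof (intro equalityI subsetI)
    fix x assume "x \<in> generate G H"
    thus "x \<in> generate G' H"
      by (induction rule: generate.induct) (auto simp: inv assms intro: generate.intros)
  next
    fix x assume "x \<in> generate G' H"
    thus "x \<in> generate G H"
      by (induction rule: generate.induct) (auto simp: inv[symmetric] assms[symmetric] intro: generate.intros)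
  qed
qed

text \<open>Subgroups with respect to the operations of the type class: formal combinations form a
  type that is a group, and subsets of it can be handled without records.\<close>

definition additive_closed :: "'a::ab_group_add set => bool" where
  "additive_closed S \<longleftrightarrow> 0 \<in> S \<and> (\<forall>x\<in>S. \<forall>y\<in>S. x + y \<in> S) \<and> (\<forall>x\<in>S. - x \<in> S)"

lemma additive_closedD:
  assumes "additive_closed S"
  shows "0 \<in> S" "x \<in> S ==> y \<in> S ==> x + y \<in> S" "x \<in> S ==> - x \<in> S" "x \<in> S ==> y \<in> S ==> x - y \<in> S"
proof -
  show "0 \<in> S" "x \<in> S ==> y \<in> S ==> x + y \<in> S" "x \<in> S ==> - x \<in> S" using assms by (auto simp: additive_closed_def)
  show "x \<in> S ==> y \<in> S ==> x - y \<in> S" using assms unfolding additive_closed_def by (metis add_uminus_conv_diff)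
qed

lemma additive_closed_sum: "additive_closed S ==> (\<And>i. i \<in> I ==> f i \<in> S) ==> sum f I \<in> S"
  by (induction I rule: infinite_finite_induct) (auto intro: additive_closedD)

lemma additive_closed_congruent:
  assumes "additive_closed S" "x - y \<in> S" shows "x \<in> S \<longleftrightarrow> y \<in> S"
  using additive_closedD(2)[OF assms(1) assms(2), of y] additive_closedD(4)[OF assms(1) _ assms(2), of x] by auto

context presentation
begin

lemma additive_closed_F: "additive_closed F" and additive_closed_N: "additive_closed N"
  by (auto simp: additive_closed_def N_add N_uminus)

text \<open>The classes all of whose representatives lie in \<open>S\<close> form a subgroup,
  because \<open>S\<close> contains the kernel. Inductions over subgroups given by generators are in
  this way carried out on formal combinations, whichever quotient the generators live in.\<close>

lemma generate_preimage:
  assumes S: "additive_closed S" and N: "N \<subseteq> S" and G: "G \<subseteq> F" "G \<subseteq> S"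
    and x: "x \<in> F" "\<pi> x \<in> generate (add_monoid P) (\<pi> ` G)"
  shows "x \<in> S"
proof -
  let ?T = "{X \<in> carrier P. \<forall>y\<in>F. \<pi> y = X --> y \<in> S}"
  have T: "\<pi> y \<in> ?T" if y: "y \<in> F" "y \<in> S" for y
  proof -
    have "z \<in> S" if z: "z \<in> F" "\<pi> z = \<pi> y" for z
      using additive_closed_congruent[OF S, of z y] pi_eq_iff[OF z(1) y(1)] z(2) N y(2) by auto
    thus ?thesis using y by simp
  qed
  have rep: "\<exists>y\<in>F. y \<in> S \<and> X = \<pi> y" if "X \<in> ?T" for X using that pi_image by force
  have sub: "additive_subgroup ?T P"
  proof (rule additive_subgroupI'[OF P.abelian_group_axioms])
    show "\<zero>\<^bsub>P\<^esub> \<in> ?T" using T[of 0] additive_closedD(1)[OF S] by (simp only: pi_zero F_zero)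
    fix X assume "X \<in> ?T"
    then obtain u where u: "u \<in> F" "u \<in> S" "X = \<pi> u" using rep by blast
    show "\<ominus>\<^bsub>P\<^esub> X \<in> ?T" using T[of "- u"] u additive_closedD(3)[OF S] by (simp only: pi_uminus F_uminus)
    fix Y assume "Y \<in> ?T"
    then obtain v where v: "v \<in> F" "v \<in> S" "Y = \<pi> v" using rep by blast
    show "X \<oplus>\<^bsub>P\<^esub> Y \<in> ?T" using T[of "u + v"] u v additive_closedD(2)[OF S] by (simp only: pi_add F_add)
  qed auto
  have "generate (add_monoid P) (\<pi> ` G) \<subseteq> ?T"
    by (rule generate_subset_additive_subgroup[OF P.abelian_group_axioms sub]) (use T G in blast)
  thus ?thesis using x by auto
qed

text \<open>If a map is induced by \<open>\<rho>\<close> on representatives and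
  \<open>\<rho>\<close> respects the subgroups divided out, the map on cosets is induced by
  \<open>\<rho>\<close> too. The restriction of algebraic jets nests three such maps.\<close>

lemma quot_map_induced:
  assumes K: "additive_subgroup K P"
    and P': "presentation R' P' F' act' \<pi>' N'" and K': "additive_subgroup K' P'"
    and h: "\<And>z. z \<in> F ==> h (\<pi> z) = \<pi>' (\<rho> z)"
    and \<rho>: "\<And>z. z \<in> F ==> \<rho> z \<in> F'" "\<And>y z. \<rho> (y - z) = \<rho> y - \<rho> z"
    and KK': "\<And>z. z \<in> F ==> \<pi> z \<in> K ==> \<pi>' (\<rho> z) \<in> K'" and x: "x \<in> F"
  shows "quot_map P' K' h (K +>\<^bsub>P\<^esub> \<pi> x) = K' +>\<^bsub>P'\<^esub> \<pi>' (\<rho> x)"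
proof -
  interpret P': presentation R' P' F' act' \<pi>' N' by fact
  interpret Q: quotient_group P K by (intro quotient_group.intro K P.abelian_group_axioms)
  interpret Q': quotient_group P' K' by (intro quotient_group.intro K' P'.P.abelian_group_axioms)
  have "Q'.cl (h y) = Q'.cl (h (\<pi> x))" if y: "y \<in> Q.cl (\<pi> x)" for y
  proof -
    have yP: "y \<in> carrier P" "Q.cl y = Q.cl (\<pi> x)" using Q.cl_mem[OF pi_closed[OF x] y] by auto
    then obtain z where z: "z \<in> F" "y = \<pi> z" using pi_image by auto
    have "\<pi> (z - x) \<in> K" using Q.cl_eq_iff[of y "\<pi> x"] yP z x pi_diff by simp
    hence "\<pi>' (\<rho> (z - x)) \<in> K'" using KK'[of "z - x"] z x by simp
    hence "\<pi>' (\<rho> z) \<ominus>\<^bsub>P'\<^esub> \<pi>' (\<rho> x) \<in> K'" using \<rho> z x P'.pi_diff by simp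
    thus ?thesis using Q'.cl_eq_iff \<rho>(1) z x h by simp
  qed
  thus ?thesis using Q.quot_map_cl[where x = "\<pi> x" and N' = K' and P' = P' and h = h] h[OF x] x by simp
qed

end

section \<open>The presentation of the algebraic jets over an open set\<close>

type_synonym ('m, 'e) fpairs = "(('m => real) \<times> ('m => 'e)) \<Rightarrow>\<^sub>0 int"

locale jet_presentation = vbdl M E for M :: "'m manifold" and E :: "('m, 'e, 'i) vbundle" +
  fixes U :: "'m set" and k :: nat
  assumes U: "openin (mtop M) U"
begin

abbreviation CU where "CU \<equiv> smooth_ring M U"
abbreviation GU where "GU \<equiv> sec \<Gamma> U"
abbreviation XL where "XL \<equiv> X_left M E U"
abbreviation XR where "XR \<equiv> X_right M E U"

sublocale GU: smodule CU GU by (rule S.sec_smodule[OF U])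

definition frags :: "('m, 'e) fpairs set" where
  "frags = {x. Poly_Mapping.keys x \<subseteq> carrier CU \<times> carrier GU}"

definition lact :: "('m => real) => ('m, 'e) fpairs => ('m, 'e) fpairs" where
  "lact f = frag_extend (\<lambda>p. frag_of ((\<lambda>f (a, b). (f \<odot>\<^bsub>CU\<^esub> a, b)) f p))"

definition ract :: "('m => real) => ('m, 'e) fpairs => ('m, 'e) fpairs" where
  "ract f = frag_extend (\<lambda>p. frag_of ((\<lambda>f (a, b). (a, f \<odot>\<^bsub>GU\<^esub> b)) f p))"

definition dact where "dact f x = lact f x - ract f x"

abbreviation N0 where "N0 \<equiv> tensor_relations (constants U) CU GU"
definition cl0 where "cl0 x = (\<lambda>n. n + x) ` N0"

lemma smult_mult: "f \<odot>\<^bsub>CU\<^esub> g = f \<otimes>\<^bsub>CU\<^esub> g"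
  by (simp add: smooth_ring_simps)

lemma frags_of [simp]: "frag_of p \<in> frags \<longleftrightarrow> p \<in> carrier CU \<times> carrier GU"
  by (simp add: frags_def)

lemma additive_closed_frags: "additive_closed frags"
  by (auto simp: additive_closed_def frags_def keys_add_subset)

lemmas frags_closed = additive_closedD[OF additive_closed_frags]

lemma lact_of: "lact f (frag_of (g, \<psi>)) = frag_of (f \<otimes>\<^bsub>CU\<^esub> g, \<psi>)"
  and ract_of: "ract f (frag_of (g, \<psi>)) = frag_of (g, f \<odot>\<^bsub>GU\<^esub> \<psi>)"
  and lact_diff: "lact f (x - y) = lact f x - lact f y" and ract_diff: "ract f (x - y) = ract f x - ract f y"
  and lact_add: "lact f (x + y) = lact f x + lact f y" and ract_add: "ract f (x + y) = ract f x + ract f y"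
  and lact_minus: "lact f (- x) = - lact f x" and ract_minus: "ract f (- x) = - ract f x"
  and lact_0: "lact f 0 = 0" and ract_0: "ract f 0 = 0"
  by (simp_all add: lact_def ract_def frag_extend_diff frag_extend_add frag_extend_minus smult_mult)

lemma dact_diff: "dact f (x - y) = dact f x - dact f y" and dact_add: "dact f (x + y) = dact f x + dact f y"
  and dact_minus: "dact f (- x) = - dact f x" and dact_0: "dact f 0 = 0"
  by (simp_all add: dact_def lact_diff ract_diff lact_add ract_add lact_minus ract_minus lact_0 ract_0)

lemma lact_frags: "f \<in> carrier CU ==> x \<in> frags ==> lact f x \<in> frags"
  and ract_frags: "f \<in> carrier CU ==> x \<in> frags ==> ract f x \<in> frags"
  unfolding lact_def ract_def frags_def mem_Collect_eq
  by (rule keys_frag_extend_of, assumption, force simp: smult_mult)+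

lemma dact_frags: "f \<in> carrier CU ==> x \<in> frags ==> dact f x \<in> frags"
  unfolding dact_def by (intro frags_closed lact_frags ract_frags)

lemma frags_eqI:
  fixes h h' :: "_ => 'b::ab_group_add"
  assumes "x \<in> frags" "\<And>x y. h (x - y) = h x - h y" "\<And>x y. h' (x - y) = h' x - h' y"
    and "\<And>g \<psi>. g \<in> carrier CU ==> \<psi> \<in> carrier GU ==> h (frag_of (g, \<psi>)) = h' (frag_of (g, \<psi>))"
  shows "h x = h' x"
  by (rule additive_eq_on_frags[where S = "carrier CU \<times> carrier GU"]) (use assms in \<open>auto simp: frags_def\<close>)

lemma frags_induct:
  assumes x: "x \<in> frags" and S: "additive_closed S"
    and "\<And>g \<psi>. g \<in> carrier CU ==> \<psi> \<in> carrier GU ==> frag_of (g, \<psi>) \<in> S"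
  shows "x \<in> S"
  using x unfolding frags_def mem_Collect_eq
  by (induction x rule: frag_induction) (use assms additive_closedD[OF S] in auto)

context
  fixes x assumes x: "x \<in> frags"
begin

lemma lact_lact: "f \<in> carrier CU ==> g \<in> carrier CU ==> lact f (lact g x) = lact (f \<otimes>\<^bsub>CU\<^esub> g) x"
  by (rule frags_eqI[OF x]) (auto simp: lact_diff lact_of GU.R.m_assoc)

lemma lact_commute: "f \<in> carrier CU ==> g \<in> carrier CU ==> lact f (lact g x) = lact g (lact f x)"
  by (simp add: lact_lact GU.R.m_comm)

lemma ract_commute: "f \<in> carrier CU ==> g \<in> carrier CU ==> ract f (ract g x) = ract g (ract f x)"
  by (rule frags_eqI[OF x]) (auto simp: ract_diff ract_of GU.smult_assoc1[symmetric] GU.R.m_comm)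

lemma lact_ract: "f \<in> carrier CU ==> g \<in> carrier CU ==> lact f (ract g x) = ract g (lact f x)"
  by (rule frags_eqI[OF x]) (auto simp: ract_diff ract_of lact_diff lact_of)

lemma lact_one: "lact \<one>\<^bsub>CU\<^esub> x = x"
  by (rule frags_eqI[OF x]) (auto simp: lact_diff lact_of)

lemma lact_dact: "f \<in> carrier CU ==> g \<in> carrier CU ==> lact f (dact g x) = dact g (lact f x)"
  by (simp add: dact_def lact_diff lact_commute lact_ract)

lemma dact_commute: "f \<in> carrier CU ==> g \<in> carrier CU ==> dact f (dact g x) = dact g (dact f x)"
  by (simp add: dact_def lact_diff ract_diff lact_commute ract_commute lact_ract)

end

subsection \<open>The tensor product\<close>

lemma frags_carrier: "carrier (free_on_pairs CU GU act) = frags"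
  by (auto simp: free_on_pairs_def frags_def free_Abelian_group_def)

lemma presents_left: "presents (carrier CU) (free_on_pairs CU GU (\<lambda>f (a, b). (f \<odot>\<^bsub>CU\<^esub> a, b))) frags lact (\<lambda>x. x) {0}"
  unfolding frags_def lact_def by (rule presents_free_on_pairs) (auto simp: smult_mult)

lemma presents_right: "presents (carrier CU) (free_on_pairs CU GU (\<lambda>f (a, b). (a, f \<odot>\<^bsub>GU\<^esub> b))) frags ract (\<lambda>x. x) {0}"
  unfolding frags_def ract_def by (rule presents_free_on_pairs) auto

definition relators where "relators =
  {frag_of (a \<oplus>\<^bsub>CU\<^esub> a', b) - frag_of (a, b) - frag_of (a', b) | a a' b.
         a \<in> carrier CU \<and> a' \<in> carrier CU \<and> b \<in> carrier GU} \<union>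
  {frag_of (a, b \<oplus>\<^bsub>GU\<^esub> b') - frag_of (a, b) - frag_of (a, b') | a b b'.
         a \<in> carrier CU \<and> b \<in> carrier GU \<and> b' \<in> carrier GU} \<union>
  {frag_of (c \<odot>\<^bsub>CU\<^esub> a, b) - frag_of (a, c \<odot>\<^bsub>GU\<^esub> b) | c a b.
         c \<in> constants U \<and> a \<in> carrier CU \<and> b \<in> carrier GU}"

lemma constants_in: "c \<in> constants U ==> c \<in> carrier CU"
  using const_in_smooth_ring[OF U] by (auto simp: constants_def)

lemma relators_frags: "relators \<subseteq> frags"
  using constants_in by (auto simp: relators_def smult_mult intro!: frags_closed)

text \<open>The additive group of \<open>free_on_pairs\<close> is the same for all actions, so one
  set of relations serves both tensor modules.\<close>

lemma N0_generate: "N0 = generate (add_monoid (free_on_pairs CU GU act)) relators"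
  unfolding tensor_relations_def relators_def
  by (rule generate_cong) (simp_all add: free_on_pairs_def free_Abelian_group_def)

lemma N0_subgroup: "additive_subgroup N0 (free_on_pairs CU GU act)"
  unfolding N0_generate[of act]
  by (rule additive_subgroup_generate[OF abelian_group_free_on_pairs]) (simp add: relators_frags frags_carrier)

lemma N0_induct [consumes 2, case_names add_left add_right const]:
  assumes x: "x \<in> N0" and S: "additive_closed S"
    and "\<And>f g s. f \<in> carrier CU ==> g \<in> carrier CU ==> s \<in> carrier GU ==>
      frag_of (f \<oplus>\<^bsub>CU\<^esub> g, s) - frag_of (f, s) - frag_of (g, s) \<in> S"
    and "\<And>f s t. f \<in> carrier CU ==> s \<in> carrier GU ==> t \<in> carrier GU ==>
      frag_of (f, s \<oplus>\<^bsub>GU\<^esub> t) - frag_of (f, s) - frag_of (f, t) \<in> S"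
    and "\<And>c f s. c \<in> constants U ==> f \<in> carrier CU ==> s \<in> carrier GU ==>
      frag_of (c \<otimes>\<^bsub>CU\<^esub> f, s) - frag_of (f, c \<odot>\<^bsub>GU\<^esub> s) \<in> S"
  shows "x \<in> S"
proof -
  interpret presentation "carrier CU" "free_on_pairs CU GU (\<lambda>f (a, b). (f \<odot>\<^bsub>CU\<^esub> a, b))" frags lact "\<lambda>x. x" "{0}"
    by (rule presentation.intro[OF presents_left])
  have "x \<in> frags" using x additive_subgroup.a_subset[OF N0_subgroup] by (auto simp: frags_carrier)
  moreover have "relators \<subseteq> S"
    unfolding relators_def smult_mult Un_subset_iff using assms(3-5) by (intro conjI subsetI) (elim CollectE exE conjE, simp)+
  ultimately show ?thesis
    by (intro generate_preimage[OF S, of relators]) (use additive_closedD(1)[OF S] relators_frags x N0_generate in auto)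
qed

lemma additive_closed_N0: "additive_closed N0"
proof -
  let ?P = "free_on_pairs CU GU (\<lambda>f (a, b). (f \<odot>\<^bsub>CU\<^esub> a, b))"
  interpret presentation "carrier CU" ?P frags lact "\<lambda>x. x" "{0}"
    by (rule presentation.intro[OF presents_left])
  note sub = N0_subgroup[of "\<lambda>f (a, b). (f \<odot>\<^bsub>CU\<^esub> a, b)"]
  have "- x \<in> N0" if "x \<in> N0" for x
    using additive_subgroup.a_inv_closed[OF sub that] pi_uminus[of x] that additive_subgroup.a_subset[OF sub] by (auto simp: frags_carrier)
  moreover have "x + y \<in> N0" if "x \<in> N0" "y \<in> N0" for x y
    using additive_subgroup.a_closed[OF sub that] by (simp add: free_on_pairs_def)
  moreover have "0 \<in> N0" using additive_subgroup.zero_closed[OF sub] by (simp add: free_on_pairs_def)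
  ultimately show ?thesis by (simp add: additive_closed_def)
qed

lemma N0_frags: "N0 \<subseteq> frags"
  using additive_subgroup.a_subset[OF N0_subgroup] by (simp add: frags_carrier)

lemma relators_N0: "relators \<subseteq> N0"
  unfolding N0_generate[of "\<lambda>_ p. p"] by (auto intro: generate.incl)

lemma N0_add_left: "a \<in> carrier CU ==> a' \<in> carrier CU ==> b \<in> carrier GU ==>
    frag_of (a \<oplus>\<^bsub>CU\<^esub> a', b) - frag_of (a, b) - frag_of (a', b) \<in> N0"
  and N0_add_right: "a \<in> carrier CU ==> b \<in> carrier GU ==> b' \<in> carrier GU ==>
    frag_of (a, b \<oplus>\<^bsub>GU\<^esub> b') - frag_of (a, b) - frag_of (a, b') \<in> N0"
  and N0_const: "c \<in> constants U ==> a \<in> carrier CU ==> b \<in> carrier GU ==>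
    frag_of (c \<otimes>\<^bsub>CU\<^esub> a, b) - frag_of (a, c \<odot>\<^bsub>GU\<^esub> b) \<in> N0"
proof -
  show "frag_of (a \<oplus>\<^bsub>CU\<^esub> a', b) - frag_of (a, b) - frag_of (a', b) \<in> N0"
    if "a \<in> carrier CU" "a' \<in> carrier CU" "b \<in> carrier GU"
    by (rule subsetD[OF relators_N0]) (unfold relators_def, rule UnI1, rule UnI1, use that in blast)
  show "frag_of (a, b \<oplus>\<^bsub>GU\<^esub> b') - frag_of (a, b) - frag_of (a, b') \<in> N0"
    if "a \<in> carrier CU" "b \<in> carrier GU" "b' \<in> carrier GU"
    by (rule subsetD[OF relators_N0]) (unfold relators_def, rule UnI1, rule UnI2, use that in blast)
  show "frag_of (c \<otimes>\<^bsub>CU\<^esub> a, b) - frag_of (a, c \<odot>\<^bsub>GU\<^esub> b) \<in> N0"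
    if "c \<in> constants U" "a \<in> carrier CU" "b \<in> carrier GU"
    by (rule subsetD[OF relators_N0]) (unfold relators_def smult_mult, rule UnI2, use that in blast)
qed

lemma act_N0:
  assumes f: "f \<in> carrier CU" and x: "x \<in> N0"
  shows lact_N0: "lact f x \<in> N0" and ract_N0: "ract f x \<in> N0"
proof -
  have S: "additive_closed {x. lact f x \<in> N0 \<and> ract f x \<in> N0}"
    using additive_closedD[OF additive_closed_N0]
    by (auto simp: additive_closed_def lact_add ract_add lact_minus ract_minus lact_0 ract_0)
  have "x \<in> {x. lact f x \<in> N0 \<and> ract f x \<in> N0}"
    using x S
  proof (induction rule: N0_induct)
    case (add_left g h s)
    thus ?case
      using f N0_add_left[of "f \<otimes>\<^bsub>CU\<^esub> g" "f \<otimes>\<^bsub>CU\<^esub> h" s] N0_add_left[of g h "f \<odot>\<^bsub>GU\<^esub> s"]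
      by (simp add: lact_diff ract_diff lact_of ract_of GU.R.r_distr)
  next
    case (add_right g s t)
    thus ?case
      using f N0_add_right[of g "f \<odot>\<^bsub>GU\<^esub> s" "f \<odot>\<^bsub>GU\<^esub> t"] N0_add_right[of "f \<otimes>\<^bsub>CU\<^esub> g" s t]
      by (simp add: lact_diff ract_diff lact_of ract_of GU.smult_r_distr)
  next
    case (const c g s)
    hence c: "c \<in> carrier CU" by (intro constants_in)
    have "f \<otimes>\<^bsub>CU\<^esub> (c \<otimes>\<^bsub>CU\<^esub> g) = c \<otimes>\<^bsub>CU\<^esub> (f \<otimes>\<^bsub>CU\<^esub> g)" using f c const by (simp add: GU.R.m_lcomm)
    moreover have "f \<odot>\<^bsub>GU\<^esub> (c \<odot>\<^bsub>GU\<^esub> s) = c \<odot>\<^bsub>GU\<^esub> (f \<odot>\<^bsub>GU\<^esub> s)"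
      using f c const GU.smult_assoc1[of f c s] GU.smult_assoc1[of c f s] GU.R.m_comm[of f c] by simp
    ultimately show ?case
      using f c const N0_const[of c "f \<otimes>\<^bsub>CU\<^esub> g" s] N0_const[of c g "f \<odot>\<^bsub>GU\<^esub> s"]
      by (simp add: lact_diff ract_diff lact_of ract_of)
  qed
  thus "lact f x \<in> N0" "ract f x \<in> N0" by auto
qed

lemma dact_N0: "f \<in> carrier CU ==> x \<in> N0 ==> dact f x \<in> N0"
  unfolding dact_def by (intro additive_closedD(4)[OF additive_closed_N0] lact_N0 ract_N0)

text \<open>In the free group a pair with a sum of functions is a new symbol, unrelated to the pairs
  with the summands; additivity in the scalar is a tensor relation.\<close>

lemma lact_add_N0:
  assumes "f \<in> carrier CU" "g \<in> carrier CU" "x \<in> frags" shows "lact (f \<oplus>\<^bsub>CU\<^esub> g) x - (lact f x + lact g x) \<in> N0"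
proof -
  let ?d = "\<lambda>x. lact (f \<oplus>\<^bsub>CU\<^esub> g) x - (lact f x + lact g x)"
  have d: "?d 0 = 0" "?d (x + y) = ?d x + ?d y" "?d (- x) = - ?d x" for x y
    by (simp_all add: lact_0 lact_add lact_minus algebra_simps)
  have "additive_closed {x. ?d x \<in> N0}"
    unfolding additive_closed_def mem_Collect_eq Ball_def d using additive_closedD[OF additive_closed_N0] by blast
  from frags_induct[OF assms(3) this] show ?thesis
    using assms N0_add_left[of "f \<otimes>\<^bsub>CU\<^esub> g'" "g \<otimes>\<^bsub>CU\<^esub> g'" for g'] by (simp add: lact_of GU.R.l_distr diff_diff_eq)
qed

text \<open>Real constants pass from one factor to the other in the tensor product, so \<delta> of a
  constant is 0 there.\<close>

lemma lact_ract_const: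
  assumes c: "c \<in> constants U" and x: "x \<in> frags" shows "lact c x - ract c x \<in> N0"
proof -
  have "additive_closed {x. dact c x \<in> N0}"
    using additive_closedD[OF additive_closed_N0] by (auto simp: additive_closed_def dact_add dact_minus dact_0)
  from frags_induct[OF x this] show ?thesis
    using N0_const[OF c] by (simp add: dact_def lact_of ract_of)
qed

lemma cl0_coset: "N0 +>\<^bsub>free_on_pairs CU GU act\<^esub> x = cl0 x"
  by (simp add: cl0_def free_on_pairs_coset)

text \<open>Both records have the same classes \<open>cl0\<close> and differ in the action, which is
  why \<open>delta\<close> can subtract a value of one action from a value of the other.\<close>

lemma presents_XL: "presents (carrier CU) XL frags lact cl0 N0"
  and presents_XR: "presents (carrier CU) XR frags ract cl0 N0"
proof -
  have N: "{x \<in> frags. x \<in> N0} = N0" using N0_frags by auto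
  interpret L: presentation "carrier CU" "free_on_pairs CU GU (\<lambda>f (a, b). (f \<odot>\<^bsub>CU\<^esub> a, b))" frags lact "\<lambda>x. x" "{0}"
    by (rule presentation.intro[OF presents_left])
  interpret R: presentation "carrier CU" "free_on_pairs CU GU (\<lambda>f (a, b). (a, f \<odot>\<^bsub>GU\<^esub> b))" frags ract "\<lambda>x. x" "{0}"
    by (rule presentation.intro[OF presents_right])
  have 1: "f \<odot>\<^bsub>free_on_pairs CU GU (\<lambda>f (a, b). (f \<odot>\<^bsub>CU\<^esub> a, b))\<^esub> x = lact f x"
    "f \<odot>\<^bsub>free_on_pairs CU GU (\<lambda>f (a, b). (a, f \<odot>\<^bsub>GU\<^esub> b))\<^esub> x = ract f x" for f x
    by (simp_all add: free_on_pairs_def lact_def ract_def)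
  show "presents (carrier CU) XL frags lact cl0 N0"
    using L.presents_quot[OF N0_subgroup] lact_N0 unfolding tensor_left_def cl0_coset N 1 by blast
  show "presents (carrier CU) XR frags ract cl0 N0"
    using R.presents_quot[OF N0_subgroup] ract_N0 unfolding tensor_right_def cl0_coset N 1 by blast
qed

sublocale XL: presentation "carrier CU" XL frags lact cl0 N0 by (rule presentation.intro[OF presents_XL])
sublocale XR: presentation "carrier CU" XR frags ract cl0 N0 by (rule presentation.intro[OF presents_XR])

end

context jet_presentation
begin

lemma module_XL: "module CU XL"
  by (rule XL.module_presented[OF GU.R.is_cring refl])
    (use lact_add_N0 XL.N_zero in \<open>auto simp: lact_one lact_lact\<close>)

sublocale XM: smodule CU XL by (rule smodule.intro[OF module_XL])

subsection \<open>The differential operators\<close>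

lemma delta_cl0: "f \<in> carrier CU ==> x \<in> frags ==> delta M E U f (cl0 x) = cl0 (dact f x)"
  by (simp add: delta_def XL.pi_act[symmetric] XR.pi_act[symmetric] XL.pi_diff[symmetric] lact_frags ract_frags dact_def)

primrec dset :: "nat => ('m, 'e) fpairs set" where
  "dset 0 = {frag_of (g, \<psi>) | g \<psi>. g \<in> carrier CU \<and> \<psi> \<in> carrier GU}"
| "dset (Suc m) = {dact f x | f x. f \<in> carrier CU \<and> x \<in> dset m}"

lemma dset_frags: "dset m \<subseteq> frags"
  by (induction m) (auto intro: dact_frags)

lemma X_pure_cl0: "X_pure M E U g \<psi> = cl0 (frag_of (g, \<psi>))"
  by (simp add: pure_tensor_def cl0_coset)

lemma delta_products_dset: "delta_products M E U m = cl0 ` dset m"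
proof (induction m)
  case 0
  show ?case by (auto simp: X_pure_cl0)
next
  case (Suc m)
  show ?case
  proof (intro equalityI subsetI)
    fix y assume "y \<in> delta_products M E U (Suc m)"
    then obtain f x where f: "f \<in> carrier CU" and x: "x \<in> dset m" and y: "y = delta M E U f (cl0 x)"
      using Suc by auto
    hence "y = cl0 (dact f x)" using delta_cl0[OF f subsetD[OF dset_frags x]] by simp
    thus "y \<in> cl0 ` dset (Suc m)" using f x by auto
  next
    fix y assume "y \<in> cl0 ` dset (Suc m)"
    then obtain f x where f: "f \<in> carrier CU" and x: "x \<in> dset m" and y: "y = cl0 (dact f x)" by auto
    hence "y = delta M E U f (cl0 x)" using delta_cl0[OF f subsetD[OF dset_frags x]] by simp
    thus "y \<in> delta_products M E U (Suc m)" using f x Suc by auto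
  qed
qed

lemma lact_dset: "f \<in> carrier CU ==> x \<in> dset m ==> lact f x \<in> dset m"
proof (induction m arbitrary: x)
  case 0
  then obtain g \<psi> where "g \<in> carrier CU" "\<psi> \<in> carrier GU" "x = frag_of (g, \<psi>)" by auto
  hence "lact f x = frag_of (f \<otimes>\<^bsub>CU\<^esub> g, \<psi>)" "f \<otimes>\<^bsub>CU\<^esub> g \<in> carrier CU" using 0 by (simp_all add: lact_of)
  thus ?case using \<open>\<psi> \<in> carrier GU\<close> unfolding dset.simps by blast
next
  case (Suc m)
  then obtain g y where "g \<in> carrier CU" "y \<in> dset m" "x = dact g y" by auto
  thus ?case using Suc lact_dact[of y f g] dset_frags[of m] by auto
qed

definition relators1 where "relators1 = {lact c x | c x. c \<in> constants U \<and> x \<in> dset (Suc k)}"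

lemma relators1_frags: "relators1 \<subseteq> frags"
  using dset_frags constants_in by (auto simp: relators1_def intro!: lact_frags simp del: dset.simps)

lemma V_sub_generate: "V_sub M E k U = generate (add_monoid XL) (cl0 ` relators1)"
proof -
  have "{c \<odot>\<^bsub>XL\<^esub> x | c x. c \<in> constants U \<and> x \<in> delta_products M E U (Suc k)} = cl0 ` relators1"
    unfolding delta_products_dset
  proof (intro equalityI subsetI)
    fix y assume "y \<in> {c \<odot>\<^bsub>XL\<^esub> x | c x. c \<in> constants U \<and> x \<in> cl0 ` dset (Suc k)}"
    then obtain c x where c: "c \<in> constants U" "x \<in> dset (Suc k)" "y = c \<odot>\<^bsub>XL\<^esub> cl0 x" by blast
    have "y = cl0 (lact c x)" unfolding c(3) XL.pi_act[OF constants_in[OF c(1)] subsetD[OF dset_frags c(2)]] ..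
    with c show "y \<in> cl0 ` relators1" unfolding relators1_def by blast
  next
    fix y assume "y \<in> cl0 ` relators1"
    then obtain c x where c: "c \<in> constants U" "x \<in> dset (Suc k)" "y = cl0 (lact c x)" unfolding relators1_def by blast
    have "y = c \<odot>\<^bsub>XL\<^esub> cl0 x" unfolding c(3) XL.pi_act[OF constants_in[OF c(1)] subsetD[OF dset_frags c(2)]] ..
    with c show "y \<in> {c \<odot>\<^bsub>XL\<^esub> x | c x. c \<in> constants U \<and> x \<in> cl0 ` dset (Suc k)}" by blast
  qed
  thus ?thesis by (simp only: V_sub_def)
qed

lemma V_sub_subgroup: "additive_subgroup (V_sub M E k U) XL"
  unfolding V_sub_generate
  by (rule additive_subgroup_generate[OF XL.P.abelian_group_axioms]) (use relators1_frags in auto)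

lemma one_constant: "\<one>\<^bsub>CU\<^esub> \<in> constants U"
  by (simp add: smooth_ring_simps constants_def)

lemma dset_V_sub: "x \<in> dset (Suc k) ==> cl0 x \<in> V_sub M E k U"
proof -
  assume x: "x \<in> dset (Suc k)"
  hence "lact \<one>\<^bsub>CU\<^esub> x \<in> relators1" using one_constant unfolding relators1_def by blast
  hence "x \<in> relators1" by (simp only: lact_one[OF subsetD[OF dset_frags x]])
  thus ?thesis unfolding V_sub_generate by (intro incl_generate imageI)
qed

text \<open>Defined as a real span, the subgroup is nevertheless stable under all functions: the
  left action commutes with every \<delta> and is absorbed by the left factor of the pure
  tensor.\<close>

lemma V_sub_smult:
  assumes f: "f \<in> carrier CU" and X: "X \<in> V_sub M E k U" shows "f \<odot>\<^bsub>XL\<^esub> X \<in> V_sub M E k U"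
proof -
  have "V_sub M E k U \<subseteq> {X \<in> carrier XL. f \<odot>\<^bsub>XL\<^esub> X \<in> V_sub M E k U}"
    unfolding V_sub_generate
  proof (rule generate_subset_additive_subgroup[OF XL.P.abelian_group_axioms], fold V_sub_generate)
    show "additive_subgroup {X \<in> carrier XL. f \<odot>\<^bsub>XL\<^esub> X \<in> V_sub M E k U} XL"
      by (rule XM.additive_subgroup_smult_preimage[OF V_sub_subgroup f])
    show "cl0 ` relators1 \<subseteq> {X \<in> carrier XL. f \<odot>\<^bsub>XL\<^esub> X \<in> V_sub M E k U}"
    proof
      fix Y assume "Y \<in> cl0 ` relators1"
      then obtain c x where c: "c \<in> constants U" and x: "x \<in> dset (Suc k)" and Y: "Y = cl0 (lact c x)"
        unfolding relators1_def by blast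
      have cC: "c \<in> carrier CU" by (rule constants_in[OF c])
      have d: "lact f (lact c x) \<in> dset (Suc k)" "lact c x \<in> dset (Suc k)" by (intro lact_dset f cC x)+
      have lf: "lact c x \<in> frags" by (rule subsetD[OF dset_frags d(2)])
      have "f \<odot>\<^bsub>XL\<^esub> Y = cl0 (lact f (lact c x))" unfolding Y XL.pi_act[OF f lf] ..
      thus "Y \<in> {X \<in> carrier XL. f \<odot>\<^bsub>XL\<^esub> X \<in> V_sub M E k U}"
        using dset_V_sub[OF d(1)] XL.pi_closed[OF lf] Y by simp
    qed
  qed
  thus ?thesis using X by blast
qed

subsection \<open>Algebraic jets\<close>

abbreviation PJet where "PJet \<equiv> pJet M E k U"

definition cl1 where "cl1 x = V_sub M E k U +>\<^bsub>XL\<^esub> cl0 x"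
definition N1 where "N1 = {x \<in> frags. cl0 x \<in> V_sub M E k U}"

lemma presents_pJet: "presents (carrier CU) PJet frags lact cl1 N1"
  using XL.presents_quot[OF V_sub_subgroup V_sub_smult] by (simp add: pJet_def cl1_def[abs_def] N1_def)

sublocale PJ: presentation "carrier CU" PJet frags lact cl1 N1 by (rule presentation.intro[OF presents_pJet])

lemma N0_N1: "N0 \<subseteq> N1"
proof
  fix x assume x: "x \<in> N0"
  hence "x \<in> frags" using N0_frags by blast
  moreover from this have "cl0 x = \<zero>\<^bsub>XL\<^esub>" using XL.pi_zero_iff x by blast
  ultimately show "x \<in> N1" using additive_subgroup.zero_closed[OF V_sub_subgroup] by (simp add: N1_def)
qed

lemma dset_N1: "dset (Suc k) \<subseteq> N1"
proof
  fix x assume x: "x \<in> dset (Suc k)"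
  thus "x \<in> N1" using dset_V_sub[OF x] subsetD[OF dset_frags x] unfolding N1_def by blast
qed

lemma N1_induct:
  assumes x: "x \<in> N1" and S: "additive_closed S" and N: "N0 \<subseteq> S" and G: "relators1 \<subseteq> S" shows "x \<in> S"
  by (rule XL.generate_preimage[OF S N relators1_frags G])
    (use x in \<open>auto simp: N1_def V_sub_generate\<close>)

lemma module_pJet: "module CU PJet"
  by (rule PJ.module_presented[OF GU.R.is_cring refl])
    (use lact_add_N0 N0_N1 PJ.N_zero in \<open>auto simp: lact_one lact_lact\<close>)

sublocale PM: smodule CU PJet by (rule smodule.intro[OF module_pJet])

abbreviation powers where "powers q a \<equiv> ideal_power_mod PJet (vanishing_ideal M a U) q"

lemma vanishing_CU: "vanishing_ideal M a U \<subseteq> carrier CU"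
  by (rule S.vanishing_ideal_subset)

lemma powers_subgroup: "additive_subgroup (powers q a) PJet"
  by (rule PM.ideal_power_additive_subgroup[OF vanishing_CU])

definition fpow :: "nat => 'm => ('m, 'e) fpairs set" where
  "fpow q a = {x \<in> frags. cl1 x \<in> powers q a}"

lemma fpow_frags: "fpow q a \<subseteq> frags"
  by (auto simp: fpow_def)

lemma fpow_0: "fpow 0 a = frags"
  by (auto simp: fpow_def PM.ideal_power_0)

lemma additive_closed_fpow: "additive_closed (fpow q a)"
  using additive_subgroup.zero_closed[OF powers_subgroup] additive_subgroup.a_closed[OF powers_subgroup]
    additive_subgroup.a_inv_closed[OF powers_subgroup]
  by (auto simp: additive_closed_def fpow_def PJ.pi_zero PJ.pi_add PJ.pi_uminus)

lemma N1_fpow: "N1 \<subseteq> fpow q a"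
proof
  fix x assume x: "x \<in> N1"
  have xf: "x \<in> frags" by (rule subsetD[OF PJ.N_subset x])
  thus "x \<in> fpow q a"
    using PJ.pi_zero_iff[OF xf] x additive_subgroup.zero_closed[OF powers_subgroup] by (simp add: fpow_def)
qed

lemma lact_fpow: "f \<in> carrier CU ==> x \<in> fpow q a ==> lact f x \<in> fpow q a"
  using PM.ideal_power_closed[OF vanishing_CU] by (auto simp: fpow_def PJ.pi_act)

lemma lact_fpow_Suc: "f \<in> carrier CU ==> f a = 0 ==> x \<in> fpow q a ==> lact f x \<in> fpow (Suc q) a"
  using PM.ideal_power_smult[OF vanishing_CU, of f a] by (auto simp: fpow_def PJ.pi_act vanishing_ideal_def)

text \<open>Generators of the next power are represented by \<open>lact f y\<close> with
  \<open>y\<close> representing a generator of the previous one. The premise \<open>G\<close> asks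
  for all \<open>y\<close> in \<open>fpow q a\<close>, the form in which a hypothesis about the
  previous power is available.\<close>

lemma fpow_Suc_induct:
  assumes x: "x \<in> fpow (Suc q) a" and S: "additive_closed S" and N: "N1 \<subseteq> S"
    and G: "\<And>f y. f \<in> carrier CU ==> f a = 0 ==> y \<in> fpow q a ==> lact f y \<in> S"
  shows "x \<in> S"
proof -
  let ?J = "vanishing_ideal M a U"
  let ?G = "{lact f y | f y. f \<in> ?J \<and> y \<in> frags \<and> cl1 y \<in> ideal_products PJet ?J q}"
  have J: "f \<in> carrier CU" "f a = 0" if "f \<in> ?J" for f using that by (auto simp: vanishing_ideal_def)
  have "ideal_products PJet ?J (Suc q) \<subseteq> cl1 ` ?G"
  proof
    fix X assume "X \<in> ideal_products PJet ?J (Suc q)"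
    then obtain f Y where f: "f \<in> ?J" "Y \<in> ideal_products PJet ?J q" "X = f \<odot>\<^bsub>PJet\<^esub> Y" by auto
    have "Y \<in> carrier PJet" using f(2) PM.ideal_products_subset[OF vanishing_CU] by blast
    then obtain y where y: "y \<in> frags" "Y = cl1 y" using PJ.pi_image by blast
    hence "X = cl1 (lact f y)" using f PJ.pi_act[OF J(1)[OF f(1)] y(1)] by simp
    thus "X \<in> cl1 ` ?G" using f y by blast
  qed
  moreover have "cl1 ` ?G \<subseteq> ideal_products PJet ?J (Suc q)"
  proof
    fix X assume "X \<in> cl1 ` ?G"
    then obtain f y where f: "f \<in> ?J" "y \<in> frags" "cl1 y \<in> ideal_products PJet ?J q" "X = cl1 (lact f y)" by blast
    hence "X = f \<odot>\<^bsub>PJet\<^esub> cl1 y" using PJ.pi_act[OF J(1)[OF f(1)] f(2)] by simp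
    thus "X \<in> ideal_products PJet ?J (Suc q)" using f by auto
  qed
  ultimately have eq: "powers (Suc q) a = generate (add_monoid PJet) (cl1 ` ?G)"
    unfolding ideal_power_mod_def by (metis (no_types, lifting) subset_antisym)
  show ?thesis
  proof (rule PJ.generate_preimage[OF S N])
    show "?G \<subseteq> frags" using J lact_frags by blast
    show "?G \<subseteq> S"
    proof
      fix z assume "z \<in> ?G"
      then obtain f y where f: "f \<in> ?J" "y \<in> frags" "cl1 y \<in> ideal_products PJet ?J q" "z = lact f y" by blast
      hence "y \<in> fpow q a" by (simp add: fpow_def ideal_power_mod_def incl_generate)
      thus "z \<in> S" using G[OF J[OF f(1)]] f(4) by simp
    qed
  qed (use x eq in \<open>auto simp: fpow_def\<close>)
qed

abbreviation Bul where "Bul \<equiv> bullet M U PJet"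

lemma Bul_subgroup: "additive_subgroup Bul PJet"
  by (rule additive_subgroupI'[OF PJ.P.abelian_group_axioms])
    (use additive_subgroup.zero_closed[OF powers_subgroup] additive_subgroup.a_closed[OF powers_subgroup]
      additive_subgroup.a_inv_closed[OF powers_subgroup] in \<open>auto simp: bullet_def\<close>)

lemma Bul_smult: "f \<in> carrier CU ==> X \<in> Bul ==> f \<odot>\<^bsub>PJet\<^esub> X \<in> Bul"
  using PM.ideal_power_closed[OF vanishing_CU] by (auto simp: bullet_def)

abbreviation GJet where "GJet \<equiv> sec (gpJet M E k) U"

definition cl2 where "cl2 x = Bul +>\<^bsub>PJet\<^esub> cl1 x"
definition N2 where "N2 = {x \<in> frags. cl1 x \<in> Bul}"

lemma presents_gpJet: "presents (carrier CU) GJet frags lact cl2 N2"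
  using PJ.presents_quot[OF Bul_subgroup Bul_smult] by (simp add: gpJet_def cl2_def[abs_def] N2_def)

sublocale GJ: presentation "carrier CU" GJet frags lact cl2 N2 by (rule presentation.intro[OF presents_gpJet])

lemma N2_iff: "x \<in> N2 \<longleftrightarrow> x \<in> frags \<and> (\<forall>q. \<forall>a\<in>U. x \<in> fpow q a)"
  by (auto simp: N2_def bullet_def fpow_def)

lemma N1_N2: "N1 \<subseteq> N2"
  unfolding N2_iff[abs_def] subset_iff using N1_fpow PJ.N_subset by blast

lemma module_gpJet: "module CU GJet"
  by (rule GJ.module_presented[OF GU.R.is_cring refl])
    (use subsetD[OF N1_N2 subsetD[OF N0_N1 lact_add_N0]] GJ.N_zero in \<open>auto simp: lact_one lact_lact\<close>)

end

subsection \<open>Restriction to smaller open sets\<close>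

locale jet_restriction = vbdl M E + A: jet_presentation M E U k + B: jet_presentation M E V k
  for M :: "'m manifold" and E :: "('m, 'e, 'i) vbundle" and U V :: "'m set" and k :: nat +
  assumes VU: "V \<subseteq> U"
begin

definition restr :: "('m, 'e) fpairs => ('m, 'e) fpairs" where
  "restr = frag_extend (\<lambda>(g, \<psi>). frag_of (restrict g V, restrict \<psi> V))"

lemma restr_of: "restr (frag_of (g, \<psi>)) = frag_of (restrict g V, restrict \<psi> V)"
  and restr_diff: "restr (x - y) = restr x - restr y"
  and restr_add: "restr (x + y) = restr x + restr y"
  and restr_minus: "restr (- x) = - restr x"
  and restr_0: "restr 0 = 0"
  by (simp_all add: restr_def frag_extend_diff frag_extend_add frag_extend_minus)

lemma restrict_CU: "f \<in> fcts U ==> restrict f V \<in> fcts V"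
  using C.res_closed[OF A.U B.U VU] by (simp add: smooth_ring_simps(7))

lemma restrict_GU: "s \<in> sects U ==> restrict s V \<in> sects V"
  by (rule section_restrict[OF _ B.U VU])

lemma restrict_ops:
  "f \<in> fcts U ==> g \<in> fcts U ==>
    restrict (f \<otimes>\<^bsub>smooth_ring M U\<^esub> g) V = restrict f V \<otimes>\<^bsub>smooth_ring M V\<^esub> restrict g V"
  "f \<in> fcts U ==> g \<in> fcts U ==>
    restrict (f \<oplus>\<^bsub>smooth_ring M U\<^esub> g) V = restrict f V \<oplus>\<^bsub>smooth_ring M V\<^esub> restrict g V"
  "f \<in> fcts U ==> s \<in> sects U ==>
    restrict (f \<odot>\<^bsub>sec \<Gamma> U\<^esub> s) V = restrict f V \<odot>\<^bsub>sec \<Gamma> V\<^esub> restrict s V"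
  "s \<in> sects U ==> t \<in> sects U ==>
    restrict (s \<oplus>\<^bsub>sec \<Gamma> U\<^esub> t) V = restrict s V \<oplus>\<^bsub>sec \<Gamma> V\<^esub> restrict t V"
  "c \<in> constants U ==> restrict c V \<in> constants V"
proof -
  show "restrict (f \<otimes>\<^bsub>smooth_ring M U\<^esub> g) V = restrict f V \<otimes>\<^bsub>smooth_ring M V\<^esub> restrict g V"
    "restrict (f \<oplus>\<^bsub>smooth_ring M U\<^esub> g) V = restrict f V \<oplus>\<^bsub>smooth_ring M V\<^esub> restrict g V"
    using VU by (auto simp: smooth_ring_simps fun_eq_iff)
  show "restrict (f \<odot>\<^bsub>sec \<Gamma> U\<^esub> s) V = restrict f V \<odot>\<^bsub>sec \<Gamma> V\<^esub> restrict s V"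
    "restrict (s \<oplus>\<^bsub>sec \<Gamma> U\<^esub> t) V = restrict s V \<oplus>\<^bsub>sec \<Gamma> V\<^esub> restrict t V"
    using VU by (auto simp: section_simps fun_eq_iff)
  assume "c \<in> constants U"
  then obtain d where "c = (\<lambda>x\<in>U. d)" unfolding constants_def by blast
  hence "restrict c V = (\<lambda>x\<in>V. d)" using VU by (auto simp: fun_eq_iff)
  thus "restrict c V \<in> constants V" unfolding constants_def by blast
qed

lemma restr_frags: "x \<in> A.frags ==> restr x \<in> B.frags"
proof (rule A.frags_induct[where S = "{x. restr x \<in> B.frags}", simplified])
  show "additive_closed {x. restr x \<in> B.frags}"
    using additive_closedD[OF B.additive_closed_frags]
    by (auto simp: additive_closed_def restr_add restr_minus restr_0)
qed (auto simp: restr_of restrict_CU restrict_GU)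

lemma restr_acts:
  assumes f: "f \<in> fcts U" and x: "x \<in> A.frags"
  shows restr_lact: "restr (A.lact f x) = B.lact (restrict f V) (restr x)"
    and restr_dact: "restr (A.dact f x) = B.dact (restrict f V) (restr x)"
proof -
  show l: "restr (A.lact f x) = B.lact (restrict f V) (restr x)"
  proof (rule A.frags_eqI[OF x])
    fix g \<psi> assume "g \<in> carrier A.CU" "\<psi> \<in> carrier A.GU"
    thus "restr (A.lact f (frag_of (g, \<psi>))) = B.lact (restrict f V) (restr (frag_of (g, \<psi>)))"
      by (simp only: restr_of A.lact_of B.lact_of restrict_ops(1)[OF f])
  qed (simp_all only: restr_diff A.lact_diff B.lact_diff)
  have "restr (A.ract f x) = B.ract (restrict f V) (restr x)"
  proof (rule A.frags_eqI[OF x])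
    fix g \<psi> assume "g \<in> carrier A.CU" "\<psi> \<in> carrier A.GU"
    thus "restr (A.ract f (frag_of (g, \<psi>))) = B.ract (restrict f V) (restr (frag_of (g, \<psi>)))"
      by (simp only: restr_of A.ract_of B.ract_of restrict_ops(3)[OF f])
  qed (simp_all only: restr_diff A.ract_diff B.ract_diff)
  thus "restr (A.dact f x) = B.dact (restrict f V) (restr x)" using l by (simp add: A.dact_def B.dact_def restr_diff)
qed

lemma preimage_closed: "additive_closed S ==> additive_closed {x. restr x \<in> S}"
  using additive_closedD[of S] by (auto simp: additive_closed_def[of "{x. restr x \<in> S}"] restr_add restr_minus restr_0)

lemma restr_N0:
  assumes "x \<in> A.N0" shows "restr x \<in> B.N0"
proof -
  have "x \<in> {x. restr x \<in> B.N0}"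
    using assms preimage_closed[OF B.additive_closed_N0]
  proof (induction rule: A.N0_induct)
    case (add_left f g s)
    thus ?case
      unfolding mem_Collect_eq restr_diff restr_of restrict_ops(2)[OF add_left(1,2)] by (intro B.N0_add_left restrict_CU restrict_GU)
  next
    case (add_right f s t)
    thus ?case
      unfolding mem_Collect_eq restr_diff restr_of restrict_ops(4)[OF add_right(2,3)] by (intro B.N0_add_right restrict_CU restrict_GU)
  next
    case (const c f s)
    hence c: "c \<in> carrier A.CU" by (intro A.constants_in)
    show ?case
      unfolding mem_Collect_eq restr_diff restr_of restrict_ops(1)[OF c const(2)] restrict_ops(3)[OF c const(3)]
      by (intro B.N0_const restrict_CU restrict_GU const restrict_ops(5))
  qed
  thus ?thesis by simp
qed

lemma restr_dset: "x \<in> A.dset m ==> restr x \<in> B.dset m"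
proof (induction m arbitrary: x)
  case 0
  then obtain g \<psi> where "g \<in> carrier A.CU" "\<psi> \<in> carrier A.GU" "x = frag_of (g, \<psi>)" by auto
  hence "restr x = frag_of (restrict g V, restrict \<psi> V)" "restrict g V \<in> carrier B.CU" "restrict \<psi> V \<in> carrier B.GU"
    using restr_of restrict_CU restrict_GU by blast+
  thus ?case unfolding B.dset.simps by blast
next
  case (Suc m)
  then obtain f y where y: "f \<in> carrier A.CU" "y \<in> A.dset m" "x = A.dact f y" by auto
  hence "restr x = B.dact (restrict f V) (restr y)" using restr_dact[OF y(1)] A.dset_frags by blast
  thus ?case using Suc.IH[OF y(2)] restrict_CU[OF y(1)] by auto
qed

lemma restr_N1: "x \<in> A.N1 ==> restr x \<in> B.N1"
proof -
  assume x: "x \<in> A.N1"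
  have "A.relators1 \<subseteq> {x. restr x \<in> B.N1}"
  proof
    fix y assume "y \<in> A.relators1"
    then obtain c z where c: "c \<in> constants U" and z: "z \<in> A.dset (Suc k)" and y: "y = A.lact c z"
      unfolding A.relators1_def by blast
    have cC: "c \<in> carrier A.CU" by (rule A.constants_in[OF c])
    have "restr y = B.lact (restrict c V) (restr z)"
      unfolding y by (rule restr_lact[OF cC subsetD[OF A.dset_frags z]])
    moreover have "B.lact (restrict c V) (restr z) \<in> B.dset (Suc k)"
      by (rule B.lact_dset[OF restrict_CU[OF cC] restr_dset[OF z]])
    ultimately show "y \<in> {x. restr x \<in> B.N1}" using B.dset_N1 by auto
  qed
  moreover have "A.N0 \<subseteq> {x. restr x \<in> B.N1}" using restr_N0 B.N0_N1 by blast
  ultimately show ?thesis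
    using A.N1_induct[OF x preimage_closed[OF B.PJ.additive_closed_N]] by blast
qed

lemma restr_fpow: "a \<in> V ==> x \<in> A.fpow q a ==> restr x \<in> B.fpow q a"
proof (induction q arbitrary: x)
  case 0
  thus ?case by (simp add: A.fpow_0 B.fpow_0 restr_frags)
next
  case (Suc q)
  have "x \<in> {x. restr x \<in> B.fpow (Suc q) a}"
  proof (rule A.fpow_Suc_induct[OF Suc.prems(2) preimage_closed[OF B.additive_closed_fpow]])
    show "A.N1 \<subseteq> {x. restr x \<in> B.fpow (Suc q) a}" using restr_N1 B.N1_fpow by blast
    fix f y assume f: "f \<in> carrier A.CU" "f a = 0" and y: "y \<in> A.fpow q a"
    have "restr (A.lact f y) = B.lact (restrict f V) (restr y)"
      by (rule restr_lact[OF f(1) subsetD[OF A.fpow_frags y]])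
    thus "A.lact f y \<in> {x. restr x \<in> B.fpow (Suc q) a}"
      using B.lact_fpow_Suc[OF restrict_CU[OF f(1)] _ Suc.IH[OF Suc.prems(1) y]] f(2) Suc.prems(1) by simp
  qed
  thus ?case by simp
qed

lemma restr_N2: "x \<in> A.N2 ==> restr x \<in> B.N2"
  unfolding A.N2_iff B.N2_iff using restr_frags restr_fpow VU by blast

lemma res_gpJet:
  assumes x: "x \<in> A.frags" shows "res (gpJet M E k) U V (A.cl2 x) = B.cl2 (restr x)"
proof -
  let ?h0 = "quot_map (free_on_pairs (smooth_ring M V) (sec \<Gamma> V) (\<lambda>_ p. p)) B.N0 restr"
  let ?h1 = "quot_map B.XL (V_sub M E k V) ?h0"
  have h0: "?h0 (A.cl0 x) = B.cl0 (restr x)" if x: "x \<in> A.frags" for x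
  proof -
    interpret P: presentation "carrier A.CU" "free_on_pairs A.CU A.GU (\<lambda>f (a, b). (f \<odot>\<^bsub>A.CU\<^esub> a, b))" A.frags A.lact "\<lambda>x. x" "{0}"
      by (rule presentation.intro[OF A.presents_left])
    \<comment> \<open>The innermost \<open>quot_map\<close> in the definition writes the free group
      with the trivial action; an empty set of scalars makes this a presentation.\<close>
    have Q: "presentation {} (free_on_pairs B.CU B.GU (\<lambda>_ p. p)) B.frags (\<lambda>r. frag_extend (\<lambda>p. frag_of p)) (\<lambda>x. x) {0}"
      unfolding B.frags_def using presents_free_on_pairs[of "{}" B.CU B.GU "\<lambda>_ p. p"] by (intro presentation.intro) simp
    from P.quot_map_induced[OF A.N0_subgroup Q B.N0_subgroup, of restr restr x]
    show ?thesis unfolding A.cl0_coset B.cl0_coset using restr_frags restr_diff restr_N0 x by blast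
  qed
  have h1: "?h1 (A.cl1 x) = B.cl1 (restr x)" if x: "x \<in> A.frags" for x
    unfolding A.cl1_def B.cl1_def
    by (rule A.XL.quot_map_induced[OF A.V_sub_subgroup B.XL.presentation_axioms B.V_sub_subgroup h0 restr_frags restr_diff _ x])
      (use restr_N1 in \<open>auto simp: A.N1_def B.N1_def\<close>)
  have "quot_map B.PJet B.Bul ?h1 (A.cl2 x) = B.cl2 (restr x)"
    unfolding A.cl2_def B.cl2_def
    by (rule A.PJ.quot_map_induced[OF A.Bul_subgroup B.PJ.presentation_axioms B.Bul_subgroup h1 restr_frags restr_diff _ x])
      (use restr_N2 in \<open>auto simp: A.N2_def B.N2_def\<close>)
  thus ?thesis by (simp add: gpJet_def restr_def[symmetric])
qed

end

context vbdl
begin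

abbreviation gpj where "gpj k \<equiv> gpJet M E k"

lemma jet_presentationI: "opn U ==> jet_presentation M E U"
  by (intro jet_presentation.intro jet_presentation_axioms.intro vbdl_axioms)

lemma jet_restrictionI: "opn U ==> opn V ==> V \<subseteq> U ==> jet_restriction M E U V"
  by (intro jet_restriction.intro jet_restriction_axioms.intro vbdl_axioms jet_presentationI)

lemma module_presheaf_gpJet: "module_presheaf M (gpj k)"
proof (intro module_presheaf.intro module_presheaf_axioms.intro smooth_mfd_axioms)
  show "module (smooth_ring M U) (sec (gpj k) U)" if "opn U" for U
    by (rule jet_presentation.module_gpJet[OF jet_presentationI[OF that]])
  {
    fix U V s assume U: "opn U" and V: "opn V" "V \<subseteq> U" and s: "s \<in> carrier (sec (gpj k) U)"
    interpret R: jet_restriction M E U V k by (rule jet_restrictionI[OF U V])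
    obtain x where x: "x \<in> R.A.frags" "s = R.A.cl2 x" using s R.A.GJ.pi_image by blast
    show "res (gpj k) U V s \<in> carrier (sec (gpj k) V)"
      using R.res_gpJet[OF x(1)] x(2) R.B.GJ.pi_closed[OF R.restr_frags[OF x(1)]] by simp
    show "res (gpj k) U V (s \<oplus>\<^bsub>sec (gpj k) U\<^esub> t) = res (gpj k) U V s \<oplus>\<^bsub>sec (gpj k) V\<^esub> res (gpj k) U V t"
      if t: "t \<in> carrier (sec (gpj k) U)" for t
    proof -
      obtain y where y: "y \<in> R.A.frags" "t = R.A.cl2 y" using t R.A.GJ.pi_image by blast
      show ?thesis
        using x y R.res_gpJet[OF x(1)] R.res_gpJet[OF y(1)] R.res_gpJet[OF R.A.GJ.F_add[OF x(1) y(1)]]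
          R.A.GJ.pi_add[OF x(1) y(1)] R.B.GJ.pi_add[OF R.restr_frags[OF x(1)] R.restr_frags[OF y(1)]]
        by (simp add: R.restr_add)
    qed
    show "res (gpj k) U V (f \<odot>\<^bsub>sec (gpj k) U\<^esub> s) = restrict f V \<odot>\<^bsub>sec (gpj k) V\<^esub> res (gpj k) U V s"
      if f: "f \<in> fcts U" for f
      using x R.res_gpJet[OF x(1)] R.res_gpJet[OF R.A.lact_frags[OF f x(1)]] R.restr_lact[OF f x(1)]
        R.A.GJ.pi_act[OF f x(1)] R.B.GJ.pi_act[OF R.restrict_CU[OF f] R.restr_frags[OF x(1)]] by simp
    fix W assume W: "opn W" "W \<subseteq> V"
    interpret R2: jet_restriction M E V W k by (rule jet_restrictionI[OF V(1) W])
    interpret R3: jet_restriction M E U W k by (rule jet_restrictionI[OF U W(1) subset_trans[OF W(2) V(2)]])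
    have "R2.restr (R.restr x) = R3.restr x"
      by (rule R.A.frags_eqI[OF x(1)])
        (use W(2) in \<open>auto simp: R.restr_diff R2.restr_diff R3.restr_diff R.restr_of R2.restr_of R3.restr_of Int_absorb1\<close>)
    thus "res (gpj k) V W (res (gpj k) U V s) = res (gpj k) U W s"
      using x(2) R.res_gpJet[OF x(1)] R2.res_gpJet[OF R.restr_frags[OF x(1)]] R3.res_gpJet[OF x(1)] by simp
  }
  fix U s assume U: "opn U" and s: "s \<in> carrier (sec (gpj k) U)"
  interpret R: jet_restriction M E U U k by (rule jet_restrictionI[OF U U order_refl])
  obtain x where x: "x \<in> R.A.frags" "s = R.A.cl2 x" using s R.A.GJ.pi_image by blast
  have "R.restr x = x"
    by (rule R.A.frags_eqI[OF x(1)])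
      (auto simp: R.restr_diff R.restr_of smooth_ring_simps section_ext extensional_restrict)
  thus "res (gpj k) U U s = s" using R.res_gpJet[OF x(1)] x(2) by simp
qed

end

subsection \<open>Evaluation of algebraic jets\<close>

context vbdl
begin

lemma shift_prod_restrict:
  "b \<in> V ==> shift_prod V b (map (\<lambda>f. restrict f V) fs) s = shift_prod V b fs s"
  by (induction fs) (auto cong: restrict_cong)

lemma jbun_disjoint_union:
  obtains T where "jbun k = disjoint_union_bundle M (jet_space M \<Gamma> (Suc k)) (jidx k) T"
  unfolding usual_jet_bundle_def by blast

lemma vbdl_jbun: "vbdl M (jbun k)"
  by (intro vbdl.intro vbdl_axioms.intro smooth_mfd_axioms vector_bundle_usual_jet_bundle)

end

context jet_presentation
begin

text \<open>The head of the list acts first. On \<open>frags\<close> the operators commute, so the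
  order is a matter of which end an induction starts from.\<close>

definition dword :: "('m => real) list => ('m, 'e) fpairs => ('m, 'e) fpairs" where
  "dword fs = fold dact fs"

lemma dword_Nil: "dword [] x = x" and dword_Cons: "dword (f # fs) x = dword fs (dact f x)"
  and dword_snoc: "dword (fs @ [f]) x = dact f (dword fs x)"
  by (simp_all add: dword_def)

lemma dword_diff: "dword fs (x - y) = dword fs x - dword fs y"
  by (induction fs arbitrary: x y) (simp_all add: dword_Nil dword_Cons dact_diff)

lemma dword_frags: "set fs \<subseteq> carrier CU ==> x \<in> frags ==> dword fs x \<in> frags"
  by (induction fs arbitrary: x) (simp_all add: dword_Nil dword_Cons dact_frags)

lemma dword_N0: "set fs \<subseteq> carrier CU ==> x \<in> N0 ==> dword fs x \<in> N0"
  by (induction fs arbitrary: x) (simp_all add: dword_Nil dword_Cons dact_N0)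

lemma lact_dword: "f \<in> carrier CU ==> set fs \<subseteq> carrier CU ==> x \<in> frags ==> lact f (dword fs x) = dword fs (lact f x)"
  by (induction fs arbitrary: x) (simp_all add: dword_Nil dword_Cons dact_frags lact_dact)

lemma dset_dword:
  "x \<in> dset m \<longleftrightarrow> (\<exists>fs g \<psi>. set fs \<subseteq> carrier CU \<and> length fs = m \<and> g \<in> carrier CU \<and> \<psi> \<in> carrier GU \<and>
    x = dword fs (frag_of (g, \<psi>)))"
proof (induction m arbitrary: x)
  case 0
  show ?case by (auto simp: dword_Nil)
next
  case (Suc m)
  show ?case
  proof
    assume "x \<in> dset (Suc m)"
    then obtain f fs g \<psi> where f: "f \<in> carrier CU" "set fs \<subseteq> carrier CU" "length fs = m" "g \<in> carrier CU" "\<psi> \<in> carrier GU"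
      "x = dact f (dword fs (frag_of (g, \<psi>)))" using Suc by auto
    thus "\<exists>fs g \<psi>. set fs \<subseteq> carrier CU \<and> length fs = Suc m \<and> g \<in> carrier CU \<and> \<psi> \<in> carrier GU \<and>
      x = dword fs (frag_of (g, \<psi>))"
      by (intro exI[of _ "fs @ [f]"] exI[of _ g] exI[of _ \<psi>]) (simp add: dword_snoc)
  next
    assume "\<exists>fs g \<psi>. set fs \<subseteq> carrier CU \<and> length fs = Suc m \<and> g \<in> carrier CU \<and> \<psi> \<in> carrier GU \<and>
      x = dword fs (frag_of (g, \<psi>))"
    then obtain fs g \<psi> where fs: "set fs \<subseteq> carrier CU" "length fs = Suc m" "g \<in> carrier CU" "\<psi> \<in> carrier GU"
      "x = dword fs (frag_of (g, \<psi>))" by blast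
    then obtain fs' f where f: "fs = fs' @ [f]" by (metis length_0_conv Zero_not_Suc rev_exhaust)
    have "dword fs' (frag_of (g, \<psi>)) \<in> dset m" unfolding Suc using fs f by auto
    moreover have "x = dact f (dword fs' (frag_of (g, \<psi>)))" "f \<in> carrier CU" using fs f by (auto simp: dword_snoc)
    ultimately show "x \<in> dset (Suc m)" unfolding dset.simps by blast
  qed
qed

text \<open>Evaluation followed by a real functional on sections. The coordinates of
  \<open>ev\<close> have this form, and real numbers are easier to add than points of a
  fibre.\<close>

definition fev :: "'m => (('m => 'e) => real) => ('m, 'e) fpairs => real" where
  "fev b T = int_extend (\<lambda>(g, \<psi>). g b * T \<psi>)"

lemma fev_of: "fev b T (frag_of (g, \<psi>)) = g b * T \<psi>"
  and fev_diff: "fev b T (x - y) = fev b T x - fev b T y" and fev_add: "fev b T (x + y) = fev b T x + fev b T y"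
  and fev_minus: "fev b T (- x) = - fev b T x" and fev_0: "fev b T 0 = 0"
  by (simp_all add: fev_def int_extend_diff int_extend_add int_extend_minus)

lemma fev_sum: "fev b T (\<Sum>j\<in>J. x j) = (\<Sum>j\<in>J. fev b T (x j))"
  by (induction J rule: infinite_finite_induct) (simp_all add: fev_0 fev_add)

lemma fev_cong:
  assumes "x \<in> frags" "\<And>\<psi>. \<psi> \<in> carrier GU ==> T \<psi> = T' \<psi>" shows "fev b T x = fev b T' x"
  by (rule frags_eqI[OF assms(1)]) (use assms(2) in \<open>simp_all add: fev_diff fev_of\<close>)

lemma fev_lact:
  assumes "b \<in> U" "f \<in> carrier CU" "x \<in> frags" shows "fev b T (lact f x) = f b * fev b T x"
  by (rule frags_eqI[OF assms(3), where h = "\<lambda>x. fev b T (lact f x)"])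
    (use assms(1) in \<open>simp_all add: fev_diff lact_diff lact_of fev_of smooth_ring_simps right_diff_distrib\<close>)

text \<open>The functionals on sections that factor through the k-jet at b.\<close>

definition jet_functional :: "'m => (('m => 'e) => real) => bool" where
  "jet_functional b T \<longleftrightarrow> b \<in> U \<and>
    (\<forall>s\<in>carrier GU. \<forall>t\<in>carrier GU. T (s \<oplus>\<^bsub>GU\<^esub> t) = T s + T t) \<and>
    (\<forall>c. \<forall>s\<in>carrier GU. T ((\<lambda>x\<in>U. c) \<odot>\<^bsub>GU\<^esub> s) = c * T s) \<and>
    (\<forall>s\<in>S.vanishing_sections (Suc k) b U. T s = 0)"

text \<open>At \<open>b\<close> the left action multiplies by the number \<open>f b\<close> and the
  right action by the function \<open>f\<close>, so each \<delta> acts on the section as the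
  negative of \<open>f - f b\<close>. This is where the sign and the shifted products come
  from.\<close>

lemma fev_dword:
  assumes T: "jet_functional b T"
  shows "set fs \<subseteq> carrier CU ==> g \<in> carrier CU ==> \<psi> \<in> carrier GU ==>
    fev b T (dword fs (frag_of (g, \<psi>))) = (- 1) ^ length fs * (g b * T (shift_prod U b fs \<psi>))"
proof (induction fs arbitrary: g \<psi>)
  case Nil
  show ?case by (simp add: dword_Nil fev_of)
next
  case (Cons f fs)
  have f: "f \<in> carrier CU" and fs: "set fs \<subseteq> carrier CU" using Cons.prems by auto
  have sm: "\<forall>f\<in>set fs. smooth_fun M U f" using fs smooth_ring_fun by blast
  have bU: "b \<in> U" using T by (simp add: jet_functional_def)
  let ?p = "shift_prod U b fs \<psi>" and ?d = "\<lambda>x\<in>U. f x - f b" and ?c = "\<lambda>x\<in>U. f b"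
  have p: "?p \<in> carrier GU" by (rule shift_prod_section[OF U sm Cons.prems(3)])
  have d: "?d \<in> carrier CU" by (rule shift_factor[OF U smooth_ring_fun[OF f]])
  have c: "?c \<in> carrier CU" by (rule const_in_smooth_ring[OF U])
  have "f = ?d \<oplus>\<^bsub>CU\<^esub> ?c" using f by (auto simp: smooth_ring_simps fun_eq_iff extensional_def)
  hence "f \<odot>\<^bsub>GU\<^esub> ?p = ?d \<odot>\<^bsub>GU\<^esub> ?p \<oplus>\<^bsub>GU\<^esub> ?c \<odot>\<^bsub>GU\<^esub> ?p"
    using GU.smult_l_distr[OF d c p] by simp
  hence "T (f \<odot>\<^bsub>GU\<^esub> ?p) = T (?d \<odot>\<^bsub>GU\<^esub> ?p) + f b * T ?p"
    using T d c p unfolding jet_functional_def by simp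
  moreover have "shift_prod U b fs (f \<odot>\<^bsub>GU\<^esub> \<psi>) = f \<odot>\<^bsub>GU\<^esub> ?p"
    by (rule shift_prod_smult[OF U sm Cons.prems(3) f])
  moreover have "dword (f # fs) (frag_of (g, \<psi>)) = dword fs (frag_of (f \<otimes>\<^bsub>CU\<^esub> g, \<psi>)) - dword fs (frag_of (g, f \<odot>\<^bsub>GU\<^esub> \<psi>))"
    by (simp only: dword_Cons dact_def lact_of ract_of dword_diff)
  moreover have "(f \<otimes>\<^bsub>CU\<^esub> g) b = f b * g b" using bU by (simp add: smooth_ring_simps)
  moreover have "f \<otimes>\<^bsub>CU\<^esub> g \<in> carrier CU" "f \<odot>\<^bsub>GU\<^esub> \<psi> \<in> carrier GU" using Cons.prems f by simp_all
  ultimately show ?case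
    using Cons.IH[OF fs, of "f \<otimes>\<^bsub>CU\<^esub> g" \<psi>] Cons.IH[OF fs, of g "f \<odot>\<^bsub>GU\<^esub> \<psi>"] Cons.prems(2,3)
    by (simp only: fev_diff) (simp add: algebra_simps)
qed

lemma fev_closed: "additive_closed {x. fev b T x = 0}"
  by (auto simp: additive_closed_def fev_add fev_minus fev_0)

lemma fev_N0:
  assumes T: "jet_functional b T" and x: "x \<in> N0" shows "fev b T x = 0"
proof -
  have b: "b \<in> U" using T by (simp add: jet_functional_def)
  have "x \<in> {x. fev b T x = 0}"
    using x fev_closed
  proof (induction rule: N0_induct)
    case (add_left f g s)
    have "(f \<oplus>\<^bsub>CU\<^esub> g) b = f b + g b" using b by (simp add: smooth_ring_simps)
    thus ?case by (simp add: fev_diff fev_of distrib_right)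
  next
    case (add_right f s t)
    hence "T (s \<oplus>\<^bsub>GU\<^esub> t) = T s + T t" using T by (simp add: jet_functional_def)
    thus ?case by (simp add: fev_diff fev_of distrib_left)
  next
    case (const c f s)
    then obtain d where c: "c = (\<lambda>x\<in>U. d)" unfolding constants_def by blast
    have "T (c \<odot>\<^bsub>GU\<^esub> s) = d * T s" using T const(3) unfolding c jet_functional_def by blast
    moreover have "(c \<otimes>\<^bsub>CU\<^esub> f) b = d * f b" using b c by (simp add: smooth_ring_simps)
    ultimately show ?case by (simp add: fev_diff fev_of)
  qed
  thus ?thesis by simp
qed

text \<open>A word of \<open>k + 1\<close> operators becomes a product of \<open>k + 1\<close>
  functions that vanish at \<open>b\<close>, and a functional of k-jets kills it.\<close>

lemma fev_N1:
  assumes T: "jet_functional b T" and x: "x \<in> N1" shows "fev b T x = 0"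
proof -
  have b: "b \<in> U" using T by (simp add: jet_functional_def)
  have "relators1 \<subseteq> {x. fev b T x = 0}"
  proof
    fix y assume "y \<in> relators1"
    then obtain c z where c: "c \<in> constants U" and z: "z \<in> dset (Suc k)" and y: "y = lact c z"
      unfolding relators1_def by blast
    obtain fs g \<psi> where fs: "set fs \<subseteq> carrier CU" "length fs = Suc k" "g \<in> carrier CU" "\<psi> \<in> carrier GU"
      "z = dword fs (frag_of (g, \<psi>))" using z unfolding dset_dword by blast
    have "\<forall>f\<in>set fs. smooth_fun M U f" using fs(1) smooth_ring_fun by blast
    from shift_prod_vanishing[OF U this fs(4) b] have "T (shift_prod U b fs \<psi>) = 0"
      using T fs(2) by (simp add: jet_functional_def)
    hence "fev b T z = 0" unfolding fs(5) fev_dword[OF T fs(1,3,4)] by simp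
    thus "y \<in> {x. fev b T x = 0}"
      using fev_lact[OF b constants_in[OF c] subsetD[OF dset_frags z]] by (simp add: y)
  qed
  moreover have "N0 \<subseteq> {x. fev b T x = 0}" using fev_N0[OF T] by blast
  ultimately show ?thesis using N1_induct[OF x fev_closed[of b T]] by blast
qed

text \<open>Membership in the first power of the ideal of \<open>b\<close> already forces evaluation
  at \<open>b\<close> to vanish: a factor \<open>f\<close> of the left action contributes the number
  \<open>f b\<close>.\<close>

lemma fev_N2:
  assumes T: "jet_functional b T" and x: "x \<in> N2" shows "fev b T x = 0"
proof -
  have b: "b \<in> U" using T by (simp add: jet_functional_def)
  have "x \<in> fpow (Suc 0) b" using x b by (simp add: N2_iff)
  moreover have "N1 \<subseteq> {x. fev b T x = 0}" using fev_N1[OF T] by blast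
  moreover have "lact f y \<in> {x. fev b T x = 0}" if "f \<in> carrier CU" "f b = 0" "y \<in> fpow 0 b" for f y
    using fev_lact[OF b that(1), of y T] that by (simp add: fpow_0)
  ultimately show ?thesis using fpow_Suc_induct[OF _ fev_closed[of b T], of x 0 b] by blast
qed

interpretation JB: vbdl M "jbun k" by (rule vbdl_jbun)

text \<open>The multiplicities of a formal combination are integers; \<open>fibre_sum\<close> turns
  them, times the values of the functions, into coefficients of jets in one fibre.\<close>

definition ev :: "'m => ('m, 'e) fpairs => 'm \<times> ('m set \<times> ('m => 'e)) set set" where
  "ev b x = JB.fibre_sum b (Poly_Mapping.keys x) (\<lambda>p. of_int (Poly_Mapping.lookup x p) * fst p b)
    (\<lambda>p. (b, jets k b U (snd p)))"

context
  fixes b assumes b: "b \<in> U"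
begin

lemma jets_fibre: "\<psi> \<in> carrier GU ==> (b, jets k b U \<psi>) \<in> fibre (jbun k) b"
  by (rule jbun_disjoint_union, erule S.jet_fibre) (use b U in simp)

lemma ev_props:
  assumes x: "x \<in> frags"
  shows ev_fibre: "ev b x \<in> fibre (jbun k) b"
    and ev_triv: "(V, t) \<in> trivs (jbun k) ==> b \<in> V ==> t (ev b x) i = fev b (\<lambda>\<psi>. t (b, jets k b U \<psi>) i) x"
proof -
  have bM: "b \<in> points M" using b U opn_points by blast
  have f: "(b, jets k b U (snd p)) \<in> fibre (jbun k) b" if "p \<in> Poly_Mapping.keys x" for p
    using jets_fibre[of "snd p"] x that by (auto simp: frags_def)
  show "ev b x \<in> fibre (jbun k) b" unfolding ev_def by (rule JB.fibre_sum(1)[OF bM finite_keys f])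
  assume t: "(V, t) \<in> trivs (jbun k)" "b \<in> V"
  show "t (ev b x) i = fev b (\<lambda>\<psi>. t (b, jets k b U \<psi>) i) x"
  proof -
    have "t (ev b x) i = (\<Sum>p\<in>Poly_Mapping.keys x. of_int (Poly_Mapping.lookup x p) * fst p b * t (b, jets k b U (snd p)) i)"
      unfolding ev_def by (rule JB.fibre_sum(2)[OF bM finite_keys f t])
    also have "\<dots> = fev b (\<lambda>\<psi>. t (b, jets k b U \<psi>) i) x"
      unfolding fev_def int_extend_def by (rule sum.cong) (simp_all add: case_prod_beta mult.assoc)
    finally show ?thesis .
  qed
qed

lemma jet_functional_triv:
  assumes t: "(V, t) \<in> trivs (jbun k)" "b \<in> V"
  shows "jet_functional b (\<lambda>\<psi>. t (b, jets k b U \<psi>) i)"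
proof -
  obtain T where D: "jbun k = disjoint_union_bundle M (jet_space M \<Gamma> (Suc k)) (jidx k) T"
    by (rule jbun_disjoint_union)
  have at: "S.section_at b U s" if "s \<in> carrier GU" for s using that b U by simp
  have 1: "t (b, jets k b U (r \<oplus>\<^bsub>GU\<^esub> s)) i = t (b, jets k b U r) i + t (b, jets k b U s) i"
    if "r \<in> carrier GU" "s \<in> carrier GU" for r s
    using JB.triv_add[OF t jets_fibre[OF that(1)] jets_fibre[OF that(2)]] S.jet_vadd[OF D at[OF that(1)] at[OF that(2)]] by simp
  have 2: "t (b, jets k b U ((\<lambda>x\<in>U. c) \<odot>\<^bsub>GU\<^esub> s)) i = c * t (b, jets k b U s) i" if "s \<in> carrier GU" for s c
    using JB.triv_scale[OF t jets_fibre[OF that], of c] S.jet_vscale[OF D at[OF that], of c] by simp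
  have 3: "t (b, jets k b U s) i = 0" if s: "s \<in> S.vanishing_sections (Suc k) b U" for s
  proof -
    have sG: "s \<in> carrier GU" using s S.vanishing_sections_subset[OF U] by blast
    have "s \<ominus>\<^bsub>GU\<^esub> \<zero>\<^bsub>GU\<^esub> = s" using sG by (simp add: a_minus_def)
    moreover have "res \<Gamma> U U s = s" using sG section_ext by (simp add: section_simps(5) extensional_restrict)
    ultimately have "jets k b U s = jets k b U \<zero>\<^bsub>GU\<^esub>"
      unfolding S.jet_eq_iff[OF at[OF sG] at[OF GU.zero_closed]] using s b U by (intro exI[of _ U]) simp
    thus ?thesis using S.jet_vzero[OF D U b] JB.triv_zero[OF t] by simp
  qed
  show ?thesis unfolding jet_functional_def using b 1 2 3 by simp
qed

lemma ev_eqI: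
  assumes x: "x \<in> frags" "y \<in> frags" and t: "(V, t) \<in> trivs (jbun k)" "b \<in> V"
    and eq: "\<And>i. i \<in> idx (jbun k) ==> t (ev b x) i = t (ev b y) i"
  shows "ev b x = ev b y"
  by (rule JB.triv_inj[OF t ev_fibre[OF x(1)] ev_fibre[OF x(2)] eq])

lemma ev_N2:
  assumes x: "x \<in> frags" "y \<in> frags" "x - y \<in> N2" shows "ev b x = ev b y"
proof -
  have "b \<in> points M" using b U opn_points by blast
  then obtain V t where t: "(V, t) \<in> trivs (jbun k)" "b \<in> V" by (rule JB.triv_cover)
  show ?thesis
    by (rule ev_eqI[OF x(1,2) t])
      (use fev_N2[OF jet_functional_triv[OF t] x(3)] in \<open>simp add: ev_triv[OF x(1) t] ev_triv[OF x(2) t] fev_diff\<close>)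
qed

lemma ev_of:
  assumes g: "g \<in> carrier CU" "g b = 1" and \<psi>: "\<psi> \<in> carrier GU"
  shows "ev b (frag_of (g, \<psi>)) = (b, jets k b U \<psi>)"
proof -
  have "b \<in> points M" using b U opn_points by blast
  then obtain V t where t: "(V, t) \<in> trivs (jbun k)" "b \<in> V" by (rule JB.triv_cover)
  have x: "frag_of (g, \<psi>) \<in> frags" using g \<psi> by simp
  show ?thesis
    by (rule JB.triv_inj[OF t ev_fibre[OF x] jets_fibre[OF \<psi>]]) (simp add: ev_triv[OF x t] fev_of g)
qed

end

end

context jet_restriction
begin

interpretation JB: vbdl M "jbun k" by (rule vbdl_jbun)

text \<open>A section and its restriction have the same jet at \<open>b\<close>. Distinct pairs may
  become equal on \<open>V\<close>; additivity of the extension to formal combinations takes care of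
  the merged terms.\<close>

lemma ev_restr:
  assumes b: "b \<in> V" and x: "x \<in> A.frags" shows "B.ev b (restr x) = A.ev b x"
proof -
  have bU: "b \<in> U" "b \<in> points M" using b VU A.U opn_points by blast+
  obtain W t where t: "(W, t) \<in> trivs (jbun k)" "b \<in> W" using bU(2) by (rule JB.triv_cover)
  have "jets k b V (restrict \<psi> V) = jets k b U \<psi>" if "\<psi> \<in> carrier A.GU" for \<psi>
    using S.jet_class_res[of U b \<psi> V "Suc k"] that A.U B.U b bU VU by (simp add: section_simps(5))
  hence "B.fev b (\<lambda>\<psi>. t (b, jets k b V \<psi>) i) (restr x) = A.fev b (\<lambda>\<psi>. t (b, jets k b U \<psi>) i) x" for i
    unfolding A.fev_def B.fev_def restr_def case_prod_beta
    by (intro int_extend_frag_extend[where S = "carrier A.CU \<times> carrier A.GU"]) (use x b in \<open>auto simp: A.frags_def\<close>)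
  thus ?thesis
    by (intro JB.triv_inj[OF t B.ev_fibre[OF b restr_frags[OF x]] A.ev_fibre[OF bU(1) x]])
      (simp add: B.ev_triv[OF b restr_frags[OF x] t] A.ev_triv[OF bU(1) x t])
qed

end

subsection \<open>Algebraic jets over a cube\<close>

locale jet_chart = chart_frame M E U \<phi> \<Phi>
  for M :: "'m manifold" and E :: "('m, 'e, 'i) vbundle" and U \<phi> \<Phi> +
  fixes k :: nat and b0 r
  assumes cube: "\<phi> ` U = cube dm b0 r"
begin

sublocale jet_presentation M E U k by (rule jet_presentationI[OF F.frame_open])

abbreviation K where "K \<equiv> jidx k"

definition crd where "crd i = (\<lambda>x\<in>U. \<phi> x i)"
definition word where "word I = map (\<lambda>f. restrict f U) (coord_word \<phi> I)"
definition jval where "jval j b = fev b (\<lambda>\<psi>. jcoord k U \<psi> b j)"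
definition deg where "deg I = (\<Sum>i<dm. I i)" for I :: "nat => nat"
definition gen where "gen j = dword (word (snd j)) (frag_of (\<one>\<^bsub>CU\<^esub>, \<Phi> (fst j)))"
text \<open>By \<open>jval_gen\<close> the coordinate of \<open>gen j\<close> with index
  \<open>j\<close> is a sign times \<open>mfact\<close>; the constant here is its inverse, so
  \<open>cf\<close> gives the coefficient 1 on the generator itself.\<close>

definition cf where "cf x j = (\<lambda>b\<in>U. (- 1) ^ deg (snd j) / mfact dm (snd j) * jval j b x)"
text \<open>The candidate for \<open>x\<close> modulo \<open>N2\<close>. It depends on
  \<open>x\<close> through its evaluations alone, so elements with zero evaluations are sent to
  tensor relations.\<close>

definition pr where "pr x = (\<Sum>j\<in>K. lact (cf x j) (gen j))"

section \<open>Generators over a cube and the projection onto their span\<close>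

lemma finite_K: "finite K"
  by (simp add: finite_idx finite_multi_indices)

lemma crd_CU: "crd i \<in> carrier CU"
  unfolding crd_def by (rule restrict_smooth[OF U smooth_fun_coord[OF chart]])

lemma word_CU: "set (word I) \<subseteq> carrier CU"
  unfolding word_def using coord_word_smooth[OF order_refl] restrict_smooth[OF U] by auto

lemma length_word: "length (word I) = deg I"
  by (simp add: word_def length_coord_word deg_def)

lemma frame_GU: "l \<in> idx E ==> \<Phi> l \<in> carrier GU"
  using frame by (simp add: local_frame_def)

lemma gen_frags: "j \<in> K ==> gen j \<in> frags"
  unfolding gen_def by (rule dword_frags[OF word_CU]) (use frame_GU in auto)

lemma jet_functional_jcoord: "b \<in> U ==> jet_functional b (\<lambda>\<psi>. jcoord k U \<psi> b j)"
  unfolding jet_functional_def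
  by (simp add: jcoord_add[OF U order_refl] jcoord_scale[OF U order_refl] jcoord_vanishing[OF U order_refl])

lemma jval_diff: "jval j b (x - y) = jval j b x - jval j b y"
  and jval_lact: "b \<in> U ==> f \<in> carrier CU ==> x \<in> frags ==> jval j b (lact f x) = f b * jval j b x"
  and jval_N2: "b \<in> U ==> x \<in> N2 ==> jval j b x = 0"
  by (simp_all add: jval_def fev_diff fev_lact fev_N2[OF jet_functional_jcoord])

lemma jval_add: "jval j b (x + y) = jval j b x + jval j b y"
  by (simp add: jval_def fev_add)

lemma jval_gen:
  assumes b: "b \<in> U" and j: "j \<in> K"
  shows "jval j' b (gen j) = (if j' = j then (- 1) ^ deg (snd j) * mfact dm (snd j) else 0)"
proof -
  obtain l I where jl: "j = (l, I)" "l \<in> idx E" "I \<in> multi_indices dm k" using j by auto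
  have r: "res \<Gamma> U U (\<Phi> l) = \<Phi> l" using section_ext[OF frame_GU[OF jl(2)]] by (simp add: section_simps(5) extensional_restrict)
  have one: "\<one>\<^bsub>CU\<^esub> b = 1" using b by (simp add: smooth_ring_simps)
  have "jval j' b (gen j) = (- 1) ^ length (word I) * (\<one>\<^bsub>CU\<^esub> b * jcoord k U (shift_prod U b (word I) (\<Phi> l)) b j')"
    unfolding jval_def gen_def jl fst_conv snd_conv
    by (rule fev_dword[OF jet_functional_jcoord[OF b] word_CU GU.R.one_closed frame_GU[OF jl(2)]])
  moreover have "shift_prod U b (word I) (\<Phi> l) = shift_prod U b (coord_word \<phi> I) (\<Phi> l)"
    unfolding word_def by (rule shift_prod_restrict[OF b])
  ultimately show ?thesis
    using fun_cong[OF jcoord_shift_prod[OF U order_refl b jl(2,3)], of j'] by (simp add: r one jl length_word)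
qed

lemma smooth_jval:
  assumes x: "x \<in> frags" shows "smooth_fun M U (\<lambda>b. jval j b x)"
proof -
  have "smooth_fun M U (\<lambda>b. fst p b * jcoord k U (snd p) b j)" if "p \<in> Poly_Mapping.keys x" for p
    using x that unfolding frags_def
    by (intro smooth_fun_mult[OF U] smooth_jcoord[OF U order_refl] smooth_ring_fun) auto
  thus ?thesis
    unfolding jval_def fev_def int_extend_def case_prod_beta
    by (intro smooth_fun_sum[OF U] smooth_fun_cmult[OF U])
qed

lemma cf_CU: "x \<in> frags ==> cf x j \<in> carrier CU"
  unfolding cf_def by (intro restrict_smooth[OF U] smooth_fun_cmult[OF U] smooth_jval)

lemma lact_sum: "lact f (\<Sum>j\<in>J. x j) = (\<Sum>j\<in>J. lact f (x j))"
  by (induction J rule: infinite_finite_induct) (simp_all add: lact_0 lact_add)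

lemma sum_frags: "(\<And>j. j \<in> J ==> x j \<in> frags) ==> (\<Sum>j\<in>J. x j) \<in> frags"
  by (rule additive_closed_sum[OF additive_closed_frags])

lemma pr_frags: "x \<in> frags ==> pr x \<in> frags"
  unfolding pr_def by (intro sum_frags lact_frags cf_CU gen_frags)

text \<open>Coefficients are added in the ring of functions, so additivity holds up to tensor
  relations.\<close>

lemma pr_add: "x \<in> frags ==> y \<in> frags ==> pr (x + y) - (pr x + pr y) \<in> N0"
proof -
  assume x: "x \<in> frags" and y: "y \<in> frags"
  have "cf (x + y) j = cf x j \<oplus>\<^bsub>CU\<^esub> cf y j" for j
    by (auto simp: cf_def smooth_ring_simps jval_add algebra_simps)
  hence eq: "pr (x + y) - (pr x + pr y) =
      (\<Sum>j\<in>K. lact (cf x j \<oplus>\<^bsub>CU\<^esub> cf y j) (gen j) - (lact (cf x j) (gen j) + lact (cf y j) (gen j)))"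
    by (simp add: pr_def sum_subtractf sum.distrib)
  show ?thesis
    unfolding eq by (intro additive_closed_sum[OF additive_closed_N0] lact_add_N0 cf_CU gen_frags x y)
qed

lemma lact_zero_N0: "x \<in> frags ==> lact \<zero>\<^bsub>CU\<^esub> x \<in> N0"
  using lact_add_N0[of "\<zero>\<^bsub>CU\<^esub>" "\<zero>\<^bsub>CU\<^esub>" x] additive_closedD(3)[OF additive_closed_N0, of "- lact \<zero>\<^bsub>CU\<^esub> x"] by simp

lemma pr_eq_0:
  assumes "\<And>j b. j \<in> K ==> b \<in> U ==> jval j b x = 0" shows "pr x \<in> N0"
  unfolding pr_def
proof (rule additive_closed_sum[OF additive_closed_N0])
  fix j assume j: "j \<in> K"
  have "cf x j = \<zero>\<^bsub>CU\<^esub>" using assms[OF j] by (auto simp: cf_def smooth_ring_simps)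
  thus "lact (cf x j) (gen j) \<in> N0" using lact_zero_N0[OF gen_frags[OF j]] by simp
qed

lemma pr_lact: "f \<in> carrier CU ==> x \<in> frags ==> pr (lact f x) = lact f (pr x)"
proof -
  assume f: "f \<in> carrier CU" and x: "x \<in> frags"
  have "cf (lact f x) j = f \<otimes>\<^bsub>CU\<^esub> cf x j" for j
    using f x by (auto simp: cf_def smooth_ring_simps(2) jval_lact)
  thus ?thesis unfolding pr_def lact_sum using lact_lact[OF gen_frags f cf_CU[OF x]] by (intro sum.cong) auto
qed

lemma pr_gen:
  assumes j: "j \<in> K" shows "pr (gen j) - gen j \<in> N0"
proof -
  have c: "cf (gen j) i = (if i = j then \<one>\<^bsub>CU\<^esub> else \<zero>\<^bsub>CU\<^esub>)" for i
    using mfact_pos[of dm "snd j"] by (auto simp: cf_def smooth_ring_simps jval_gen[OF _ j] simp flip: power_mult_distrib)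
  have eq: "pr (gen j) - gen j = (\<Sum>i\<in>K - {j}. lact \<zero>\<^bsub>CU\<^esub> (gen i))"
    unfolding pr_def using sum.remove[OF finite_K j, of "\<lambda>i. lact (cf (gen j) i) (gen i)"] by (simp add: c lact_one[OF gen_frags[OF j]])
  show ?thesis unfolding eq by (rule additive_closed_sum[OF additive_closed_N0], rule lact_zero_N0, rule gen_frags) simp
qed

lemma N0_fpow: "N0 \<subseteq> fpow q a"
  using N0_N1 N1_fpow by blast

lemma pr_closed:
  assumes S: "additive_closed S" "N0 \<subseteq> S"
  shows "additive_closed {x \<in> frags. pr x \<in> S}" (is "additive_closed ?A")
proof -
  have 0: "pr 0 \<in> S" using pr_eq_0[of 0] S(2) by (simp add: jval_def fev_0 subset_iff)
  have 1: "pr (x + y) \<in> S \<longleftrightarrow> pr x + pr y \<in> S" if "x \<in> frags" "y \<in> frags" for x y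
    by (rule additive_closed_congruent[OF S(1) subsetD[OF S(2) pr_add[OF that]]])
  have 2: "pr (- x) \<in> S" if "x \<in> frags" "pr x \<in> S" for x
    using 1[OF that(1) frags_closed(3)[OF that(1)]] 0 additive_closedD(4)[OF S(1), of "pr x + pr (- x)" "pr x"] that(2) by simp
  show ?thesis unfolding additive_closed_def using 0 1 2 additive_closedD[OF S(1)] frags_closed by simp
qed

text \<open>Elements of \<open>N1\<close> have zero evaluations, so \<open>pr\<close> maps them into
  \<open>N0\<close>; functions acting on the left pass through \<open>pr\<close>. These are the two
  cases of the induction over powers.\<close>

lemma pr_fpow:
  assumes a: "a \<in> U" shows "x \<in> fpow q a ==> pr x \<in> fpow q a"
proof (induction q arbitrary: x)
  case 0
  thus ?case by (simp add: fpow_0 pr_frags)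
next
  case (Suc q)
  let ?S = "{x \<in> frags. pr x \<in> fpow (Suc q) a}"
  have "x \<in> ?S"
  proof (rule fpow_Suc_induct[OF Suc.prems pr_closed[OF additive_closed_fpow N0_fpow]])
    show "N1 \<subseteq> ?S"
    proof
      fix y assume y: "y \<in> N1"
      hence "y \<in> N2" using N1_N2 by blast
      hence "pr y \<in> N0" "y \<in> frags" using pr_eq_0[of y] jval_N2[of _ y] by (auto simp: N2_iff)
      thus "y \<in> ?S" using N0_fpow by blast
    qed
    fix f y assume f: "f \<in> carrier CU" "f a = 0" and y: "y \<in> fpow q a"
    have yf: "y \<in> frags" using y fpow_frags by blast
    show "lact f y \<in> ?S"
      using lact_fpow_Suc[OF f Suc.IH[OF y]] pr_lact[OF f(1) yf] lact_frags[OF f(1) yf] by simp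
  qed
  thus ?case by simp
qed

text \<open>The combinations that agree with their projection up to order \<open>q\<close> at
  \<open>a\<close>; the aim is to see that these are all of \<open>frags\<close>, for every
  \<open>q\<close> and every \<open>a\<close> in \<open>U\<close>.\<close>

definition near where "near q a = {x \<in> frags. x - pr x \<in> fpow q a}"

lemma near_closed: "additive_closed (near q a)"
proof -
  note S = additive_closed_fpow[of q a]
  have 0: "pr 0 \<in> fpow q a" using pr_eq_0[of 0] N0_fpow by (simp add: jval_def fev_0 subset_iff)
  have 1: "x + y - pr (x + y) \<in> fpow q a \<longleftrightarrow> (x - pr x) + (y - pr y) \<in> fpow q a" if "x \<in> frags" "y \<in> frags" for x y
  proof (rule additive_closed_congruent[OF S])
    have eq: "x + y - pr (x + y) - ((x - pr x) + (y - pr y)) = - (pr (x + y) - (pr x + pr y))" by simp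
    show "x + y - pr (x + y) - ((x - pr x) + (y - pr y)) \<in> fpow q a"
      unfolding eq by (rule additive_closedD(3)[OF S subsetD[OF N0_fpow pr_add[OF that]]])
  qed
  have 2: "- x - pr (- x) \<in> fpow q a" if x: "x \<in> frags" "x - pr x \<in> fpow q a" for x
  proof -
    have "x + - x - pr (x + - x) \<in> fpow q a" using additive_closedD(3)[OF S 0] by simp
    hence "(x - pr x) + (- x - pr (- x)) \<in> fpow q a" by (rule 1[OF x(1) frags_closed(3)[OF x(1)], THEN iffD1])
    hence "(x - pr x) + (- x - pr (- x)) - (x - pr x) \<in> fpow q a" by (rule additive_closedD(4)[OF S _ x(2)])
    thus ?thesis by (simp only: add_diff_cancel_left')
  qed
  show ?thesis
    unfolding additive_closed_def near_def using 0 1 2 additive_closedD[OF S] frags_closed by simp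
qed

text \<open>\<open>pr\<close> is linear over functions, so a factor that vanishes at
  \<open>a\<close> improves the agreement by one order. This gain drives the induction on
  \<open>q\<close>.\<close>

lemma near_lact: "f \<in> carrier CU ==> x \<in> near q a ==> lact f x \<in> near q a"
  and near_lact_Suc: "f \<in> carrier CU ==> f a = 0 ==> x \<in> near q a ==> lact f x \<in> near (Suc q) a"
  using lact_fpow[of f "x - pr x" q a] lact_fpow_Suc[of f a "x - pr x" q]
  by (auto simp: near_def lact_frags pr_lact lact_diff)

lemma near_fpow: "a \<in> U ==> fpow q a \<subseteq> near q a"
  using pr_fpow subsetD[OF fpow_frags] additive_closedD(4)[OF additive_closed_fpow] by (auto simp: near_def)

lemma near_N0: "a \<in> U ==> N0 \<subseteq> near q a"
  using near_fpow N0_fpow by blast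

lemma gen_near: "j \<in> K ==> gen j \<in> near q a"
  using gen_frags additive_closedD(3)[OF additive_closed_fpow subsetD[OF N0_fpow pr_gen]] by (simp add: near_def)

text \<open>Raising the exponent of coordinate \<open>i\<close> inserts its letter somewhere inside
  the word; as the operators commute, it may be applied first.\<close>

lemma word_update:
  assumes i: "i < dm" and x: "x \<in> frags"
  shows "dword (word (I(i := Suc (I i)))) x = dword (word I) (dact (crd i) x)"
proof -
  have "mset (coord_word \<phi> J) = (\<Sum>j<dm. replicate_mset (J j) (\<lambda>x. \<phi> x j))" for J
    by (simp add: coord_word_def mset_concat comp_def sum_list_distinct_conv_sum_set lessThan_atLeast0)
  hence m: "mset (word J) = image_mset (\<lambda>f. restrict f U) (\<Sum>j<dm. replicate_mset (J j) (\<lambda>x. \<phi> x j))" for J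
    by (simp add: word_def)
  have "(\<Sum>j<dm. replicate_mset ((I(i := Suc (I i))) j) (\<lambda>x. \<phi> x j)) =
      add_mset (\<lambda>x. \<phi> x i) (\<Sum>j<dm. replicate_mset (I j) (\<lambda>x. \<phi> x j))"
    using i by (simp add: sum.remove[of "{..<dm}" i])
  hence "mset (word (I(i := Suc (I i)))) = mset (crd i # word I)"
    unfolding m by (simp add: m crd_def)
  hence "fold dact (word (I(i := Suc (I i)))) x = fold dact (crd i # word I) x"
    by (rule fold_permuted_eq[where P = "\<lambda>x. x \<in> frags"])
      (use x word_CU dact_frags dact_commute in blast)+
  thus ?thesis by (simp add: dword_def)
qed

lemma frag_one_add_N0:
  assumes "s \<in> carrier GU" "t \<in> carrier GU"
  shows "dword (word I) (frag_of (\<one>\<^bsub>CU\<^esub>, s \<oplus>\<^bsub>GU\<^esub> t)) -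
    (dword (word I) (frag_of (\<one>\<^bsub>CU\<^esub>, s)) + dword (word I) (frag_of (\<one>\<^bsub>CU\<^esub>, t))) \<in> N0"
  using dword_N0[OF word_CU[of I] N0_add_right[OF GU.R.one_closed assms]] by (simp only: dword_diff) (simp only: diff_diff_eq)

text \<open>
  Hadamard's lemma for a coefficient f turns its higher order part into a combination of the
  \<open>crd i - crd i a\<close> acting on the right factor; that action is the one on the left factor, which gains
  an order of vanishing at a, minus a derivation, which lengthens the word.
\<close>

lemma dword_near:
  assumes a: "a \<in> U" and l: "l \<in> idx E" and all: "frags \<subseteq> near q a"
  shows "f \<in> carrier CU ==> (\<forall>i\<ge>dm. I i = 0) ==> deg I + m = Suc k ==>
    dword (word I) (frag_of (\<one>\<^bsub>CU\<^esub>, f \<odot>\<^bsub>GU\<^esub> \<Phi> l)) \<in> near (Suc q) a"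
proof (induction m arbitrary: f I)
  case 0
  \<comment> \<open>With \<open>k + 1\<close> letters the element is among the relations that define
    algebraic jets.\<close>
  have "dword (word I) (frag_of (\<one>\<^bsub>CU\<^esub>, f \<odot>\<^bsub>GU\<^esub> \<Phi> l)) \<in> dset (Suc k)"
    unfolding dset_dword using word_CU length_word[of I] 0 frame_GU[OF l]
    by (intro exI[of _ "word I"] exI[of _ "\<one>\<^bsub>CU\<^esub>"] exI[of _ "f \<odot>\<^bsub>GU\<^esub> \<Phi> l"]) simp
  thus ?case using dset_N1 N1_fpow near_fpow[OF a] by blast
next
  case (Suc m)
  let ?Y = "near (Suc q) a" and ?w = "\<lambda>s. dword (word I) (frag_of (\<one>\<^bsub>CU\<^esub>, s))"
  note Y = near_closed[of "Suc q" a]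
  have wf: "?w s \<in> frags" if "s \<in> carrier GU" for s using that by (intro dword_frags word_CU) simp
  have \<Phi>: "\<Phi> l \<in> carrier GU" by (rule frame_GU[OF l])
  have I: "I \<in> multi_indices dm k" using Suc.prems by (simp add: multi_indices_def deg_def)
  \<comment> \<open>A constant coefficient moves to the left factor, where it multiplies the
    generator \<open>gen (l, I)\<close>; the degree of \<open>I\<close> is at most \<open>k\<close>
    here.\<close>
  have base: "?w (c \<odot>\<^bsub>GU\<^esub> \<Phi> l) \<in> ?Y" if c: "c \<in> constants U" for c
  proof -
    have cC: "c \<in> carrier CU" by (rule constants_in[OF c])
    have "lact c (gen (l, I)) = dword (word I) (frag_of (c \<otimes>\<^bsub>CU\<^esub> \<one>\<^bsub>CU\<^esub>, \<Phi> l))"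
      using lact_dword[OF cC word_CU, of "frag_of (\<one>\<^bsub>CU\<^esub>, \<Phi> l)" I] \<Phi> by (simp only: gen_def fst_conv snd_conv lact_of) simp
    hence "lact c (gen (l, I)) - ?w (c \<odot>\<^bsub>GU\<^esub> \<Phi> l) \<in> N0"
      using dword_N0[OF word_CU N0_const[OF c GU.R.one_closed \<Phi>]] by (simp only: dword_diff)
    hence "lact c (gen (l, I)) - ?w (c \<odot>\<^bsub>GU\<^esub> \<Phi> l) \<in> ?Y" using near_N0[OF a] by blast
    moreover have "lact c (gen (l, I)) \<in> ?Y" using near_lact[OF cC gen_near] l I by simp
    ultimately show ?thesis using additive_closed_congruent[OF Y] by blast
  qed
  \<comment> \<open>With \<open>?z\<close> the coordinate minus its value at \<open>a\<close>,
    \<open>ract ?z\<close> equals \<open>lact ?z\<close> minus \<open>dact (crd i)\<close> modulo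
    tensor relations, because the constants cancel. The first term gains an order by
    \<open>all\<close>; the second has one letter more and falls under the induction on
    \<open>m\<close>.\<close>
  have step: "?w ((\<lambda>x\<in>U. crd i x - crd i a) \<odot>\<^bsub>GU\<^esub> (h \<odot>\<^bsub>GU\<^esub> \<Phi> l)) \<in> ?Y" if i: "i < dm" and h: "h \<in> carrier CU" for i h
  proof -
    let ?z = "\<lambda>x\<in>U. crd i x - crd i a" and ?c = "\<lambda>x\<in>U. crd i a" and ?s = "h \<odot>\<^bsub>GU\<^esub> \<Phi> l"
    have s: "?s \<in> carrier GU" using h \<Phi> by simp
    let ?F = "frag_of (\<one>\<^bsub>CU\<^esub>, ?s)"
    have F: "?F \<in> frags" using s by simp
    have z: "?z \<in> carrier CU" by (rule shift_factor[OF U smooth_ring_fun[OF crd_CU]])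
    have c: "?c \<in> carrier CU" "?c \<in> constants U" by (auto simp: const_in_smooth_ring[OF U] constants_def)
    have zc: "?z \<oplus>\<^bsub>CU\<^esub> ?c = crd i" using crd_CU[of i] by (auto simp: smooth_ring_simps fun_eq_iff extensional_def)
    have e1: "lact (crd i) ?F - (lact ?z ?F + lact ?c ?F) \<in> N0" using lact_add_N0[OF z c(1) F] by (simp only: zc)
    have e2: "ract (crd i) ?F - ract ?z ?F - ract ?c ?F \<in> N0"
      using N0_add_right[OF GU.R.one_closed, of "?z \<odot>\<^bsub>GU\<^esub> ?s" "?c \<odot>\<^bsub>GU\<^esub> ?s"] z c(1) s
      by (simp only: ract_of GU.smult_l_distr[OF z c(1) s, symmetric, unfolded zc]) simp
    have e3: "lact ?c ?F - ract ?c ?F \<in> N0" by (rule lact_ract_const[OF c(2) F])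
    have "(lact (crd i) ?F - (lact ?z ?F + lact ?c ?F)) - (ract (crd i) ?F - ract ?z ?F - ract ?c ?F) +
        (lact ?c ?F - ract ?c ?F) \<in> N0"
      by (rule additive_closedD(2)[OF additive_closed_N0 additive_closedD(4)[OF additive_closed_N0 e1 e2] e3])
    hence "dact (crd i) ?F - (lact ?z ?F - ract ?z ?F) \<in> N0" by (simp add: dact_def algebra_simps)
    hence "dword (word I) (dact (crd i) ?F) - (dword (word I) (lact ?z ?F) - dword (word I) (ract ?z ?F)) \<in> N0"
      using dword_N0[OF word_CU] by (simp only: dword_diff[symmetric])
    hence N: "dword (word I) (dact (crd i) ?F) - (dword (word I) (lact ?z ?F) - dword (word I) (ract ?z ?F)) \<in> ?Y"
      using near_N0[OF a] by blast
    have "deg (I(i := Suc (I i))) = Suc (deg I)"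
      unfolding deg_def using i by (simp add: sum.remove[of "{..<dm}" i])
    hence "deg (I(i := Suc (I i))) + m = Suc k" "\<forall>j\<ge>dm. (I(i := Suc (I i))) j = 0" using Suc.prems i by simp_all
    from Suc.IH[OF h this(2,1)] have d: "dword (word I) (dact (crd i) ?F) \<in> ?Y" unfolding word_update[OF i F] .
    have "dword (word I) ?F \<in> near q a" using all wf[OF s] by blast
    hence "lact ?z (dword (word I) ?F) \<in> ?Y" using near_lact_Suc[OF z] a by simp
    hence e: "dword (word I) (lact ?z ?F) \<in> ?Y" using lact_dword[OF z word_CU F] by simp
    have "dword (word I) (ract ?z ?F) = (dword (word I) (dact (crd i) ?F) -
        (dword (word I) (lact ?z ?F) - dword (word I) (ract ?z ?F))) - dword (word I) (dact (crd i) ?F) + dword (word I) (lact ?z ?F)"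
      by simp
    also have "\<dots> \<in> ?Y" by (rule additive_closedD(2)[OF Y additive_closedD(4)[OF Y N d] e])
    finally show ?thesis by (simp add: ract_of)
  qed
  obtain h where h: "\<And>i. i < dm ==> smooth_fun M U (h i)"
    "\<And>x. x \<in> U ==> f x = f a + (\<Sum>i<dm. (\<phi> x i - \<phi> a i) * h i x)"
    using chart_hadamard[OF chart cube a smooth_ring_fun[OF Suc.prems(1)]] by blast
  \<comment> \<open>The Hadamard expansion is summed term by term: each addition in the right factor
    holds up to an element of \<open>N0\<close>, which \<open>near\<close> absorbs.\<close>
  define g where "g n = (\<lambda>x\<in>U. f a + (\<Sum>i<n. (\<phi> x i - \<phi> a i) * h i x))" for n
  have part: "g n \<in> carrier CU \<and> ?w (g n \<odot>\<^bsub>GU\<^esub> \<Phi> l) \<in> ?Y" if "n \<le> dm" for n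
    using that
  proof (induction n)
    case 0
    have "g 0 = (\<lambda>x\<in>U. f a)" by (simp add: g_def)
    hence "g 0 \<in> constants U" by (simp add: constants_def)
    thus ?case using base constants_in by blast
  next
    case (Suc n)
    let ?z = "\<lambda>x\<in>U. crd n x - crd n a" and ?h = "restrict (h n) U"
    have n: "n < dm" and g: "g n \<in> carrier CU" "?w (g n \<odot>\<^bsub>GU\<^esub> \<Phi> l) \<in> ?Y" using Suc by auto
    have z: "?z \<in> carrier CU" by (rule shift_factor[OF U smooth_ring_fun[OF crd_CU]])
    have hC: "?h \<in> carrier CU" by (rule restrict_smooth[OF U h(1)[OF n]])
    have zh: "?z \<otimes>\<^bsub>CU\<^esub> ?h \<in> carrier CU" using z hC by (rule GU.R.m_closed)
    have eq: "g (Suc n) = g n \<oplus>\<^bsub>CU\<^esub> ?z \<otimes>\<^bsub>CU\<^esub> ?h"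
      using a by (auto simp: smooth_ring_simps crd_def g_def fun_eq_iff)
    have "?w (g (Suc n) \<odot>\<^bsub>GU\<^esub> \<Phi> l) - (?w (g n \<odot>\<^bsub>GU\<^esub> \<Phi> l) + ?w (?z \<odot>\<^bsub>GU\<^esub> (?h \<odot>\<^bsub>GU\<^esub> \<Phi> l))) \<in> ?Y"
      unfolding eq GU.smult_l_distr[OF g(1) zh \<Phi>] GU.smult_assoc1[OF z hC \<Phi>]
      by (intro subsetD[OF near_N0[OF a] frag_one_add_N0] GU.smult_closed g(1) z hC \<Phi>)
    moreover have "?w (g n \<odot>\<^bsub>GU\<^esub> \<Phi> l) + ?w (?z \<odot>\<^bsub>GU\<^esub> (?h \<odot>\<^bsub>GU\<^esub> \<Phi> l)) \<in> ?Y"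
      by (rule additive_closedD(2)[OF Y g(2) step[OF n hC]])
    ultimately have "?w (g (Suc n) \<odot>\<^bsub>GU\<^esub> \<Phi> l) \<in> ?Y" using additive_closed_congruent[OF Y] by blast
    moreover have "g (Suc n) \<in> carrier CU" unfolding eq using g(1) zh by (rule GU.R.a_closed)
    ultimately show ?case by blast
  qed
  have "f x = g dm x" for x
    using h(2)[of x] Suc.prems(1) by (cases "x \<in> U") (auto simp: g_def smooth_ring_simps extensional_def)
  hence "f = g dm" by (rule ext)
  thus ?case using part[OF order_refl] by simp
qed

text \<open>The empty word in \<open>dword_near\<close>, with \<open>k + 1\<close> letters still to
  come, covers a function times a frame element; sums over the frame and the left action reach all
  formal combinations.\<close>

lemma frags_near: "a \<in> U ==> frags \<subseteq> near q a"
proof (induction q)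
  case 0
  thus ?case by (auto simp: near_def fpow_0 intro: frags_closed pr_frags)
next
  case (Suc q)
  note Y = near_closed[of "Suc q" a]
  let ?w = "\<lambda>s. frag_of (\<one>\<^bsub>CU\<^esub>, s)"
  let ?H = "{s \<in> carrier GU. ?w s \<in> near (Suc q) a}"
  have w0: "word (\<lambda>_. 0) = []" by (simp add: word_def coord_word_def concat_eq_Nil_conv)
  have add: "?w (s \<oplus>\<^bsub>GU\<^esub> t) \<in> near (Suc q) a \<longleftrightarrow> ?w s + ?w t \<in> near (Suc q) a" if "s \<in> carrier GU" "t \<in> carrier GU" for s t
    using additive_closed_congruent[OF Y subsetD[OF near_N0[OF Suc.prems] frag_one_add_N0[OF that, of "\<lambda>_. 0"]]]
    by (simp add: w0 dword_Nil)
  have zero: "?w \<zero>\<^bsub>GU\<^esub> \<in> near (Suc q) a"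
    using additive_closed_congruent[OF Y subsetD[OF near_N0[OF Suc.prems] N0_add_right[OF GU.R.one_closed GU.zero_closed GU.zero_closed]]]
      additive_closedD(1,3)[OF Y] near_N0[OF Suc.prems]
      additive_closedD(3)[OF Y subsetD[OF near_N0[OF Suc.prems] N0_add_right[OF GU.R.one_closed GU.zero_closed GU.zero_closed]]] by simp
  have fr: "f \<odot>\<^bsub>GU\<^esub> \<Phi> l \<in> ?H" if "f \<in> carrier CU" "l \<in> idx E" for f l
    using dword_near[OF Suc.prems that(2) Suc.IH[OF Suc.prems] that(1), of "\<lambda>_. 0" "Suc k"] that frame_GU[OF that(2)]
    by (simp add: w0 dword_Nil deg_def)
  have sub: "additive_subgroup ?H GU"
  proof (rule additive_subgroupI'[OF GU.abelian_group_axioms])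
    show "\<zero>\<^bsub>GU\<^esub> \<in> ?H" using zero by simp
    fix s assume s: "s \<in> ?H"
    hence "?w s + ?w (\<ominus>\<^bsub>GU\<^esub> s) \<in> near (Suc q) a" using add[of s "\<ominus>\<^bsub>GU\<^esub> s"] zero by (simp add: GU.r_neg)
    thus "\<ominus>\<^bsub>GU\<^esub> s \<in> ?H" using s additive_closedD(4)[OF Y, of "?w s + ?w (\<ominus>\<^bsub>GU\<^esub> s)" "?w s"] by simp
    fix t assume "t \<in> ?H"
    thus "s \<oplus>\<^bsub>GU\<^esub> t \<in> ?H" using s add[of s t] additive_closedD(2)[OF Y] by simp
  qed auto
  have one: "?w \<psi> \<in> near (Suc q) a" if \<psi>: "\<psi> \<in> carrier GU" for \<psi>
  proof -
    have r: "res \<Gamma> U U (\<Phi> l) = \<Phi> l" if "l \<in> idx E" for l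
      using section_ext[OF frame_GU[OF that]] by (simp add: section_simps(5) extensional_restrict)
    have "lin_comb \<Gamma> (idx E) U U \<Phi> (F.coef U \<psi>) \<in> ?H"
      unfolding lin_comb_def
      by (rule additive_subgroup_finsum[OF GU.abelian_group_axioms sub])
        (use fr[OF F.coef_in[OF U order_refl \<psi>]] r in simp)
    thus ?thesis using F.lin_comb_coef[OF U order_refl \<psi>] by simp
  qed
  show ?case
  proof
    fix x assume x: "x \<in> frags"
    show "x \<in> near (Suc q) a"
    proof (rule frags_induct[OF x Y])
      fix g \<psi> assume g: "g \<in> carrier CU" "\<psi> \<in> carrier GU"
      hence "frag_of (g, \<psi>) = lact g (?w \<psi>)" by (simp add: lact_of)
      thus "frag_of (g, \<psi>) \<in> near (Suc q) a" using near_lact[OF g(1) one[OF g(2)]] by simp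
    qed
  qed
qed

text \<open>If all evaluations vanish, \<open>pr x\<close> consists of tensor relations, and by
  \<open>frags_near\<close> the difference of \<open>x\<close> and \<open>pr x\<close> lies in every
  power at every point, that is, in \<open>N2\<close>.\<close>

lemma N2_jval:
  assumes x: "x \<in> frags" shows "x \<in> N2 \<longleftrightarrow> (\<forall>j\<in>K. \<forall>b\<in>U. jval j b x = 0)"
proof
  assume "\<forall>j\<in>K. \<forall>b\<in>U. jval j b x = 0"
  hence "pr x \<in> N0" by (intro pr_eq_0) blast
  hence "pr x \<in> N2" using N0_N1 N1_N2 by blast
  moreover have "x - pr x \<in> N2"
    unfolding N2_iff using frags_near x frags_closed(4)[OF x pr_frags[OF x]] unfolding near_def by blast
  ultimately have "(x - pr x) + pr x \<in> N2" by (rule additive_closedD(2)[OF GJ.additive_closed_N, rotated])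
  thus "x \<in> N2" by simp
qed (use jval_N2 in blast)

text \<open>The prescribed functions, rescaled by the constants of \<open>cf\<close>, serve as
  coefficients of the generators.\<close>

lemma jval_surj:
  assumes "\<And>j. j \<in> K ==> smooth_fun M U (c j)"
  shows "\<exists>x\<in>frags. \<forall>j\<in>K. \<forall>b\<in>U. jval j b x = c j b"
proof
  let ?c = "\<lambda>j. \<lambda>b\<in>U. (- 1) ^ deg (snd j) / mfact dm (snd j) * c j b"
  let ?x = "\<Sum>j\<in>K. lact (?c j) (gen j)"
  have c: "?c j \<in> carrier CU" if "j \<in> K" for j
    by (intro restrict_smooth[OF U] smooth_fun_cmult[OF U] assms that)
  thus "?x \<in> frags" by (intro sum_frags lact_frags gen_frags)
  show "\<forall>j\<in>K. \<forall>b\<in>U. jval j b ?x = c j b"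
  proof (intro ballI)
    fix j b assume j: "j \<in> K" and b: "b \<in> U"
    have "jval j b ?x = (\<Sum>i\<in>K. jval j b (lact (?c i) (gen i)))" unfolding jval_def by (rule fev_sum)
    also have "\<dots> = (\<Sum>i\<in>K. if i = j then c j b else 0)"
    proof (rule sum.cong[OF refl])
      fix i assume i: "i \<in> K"
      have "(- 1) ^ deg (snd i) * (- 1) ^ deg (snd i) = (1 :: real)" by (simp flip: power_mult_distrib)
      thus "jval j b (lact (?c i) (gen i)) = (if i = j then c j b else 0)"
        unfolding jval_lact[OF b c[OF i] gen_frags[OF i]] jval_gen[OF b i]
        using b mfact_pos[of dm "snd i"] by (simp add: field_simps)
    qed
    finally show "jval j b ?x = c j b" using j finite_K by simp
  qed
qed

lemma ev_jval:
  assumes t: "reads_jets k U \<phi> \<Phi> t" and b: "b \<in> U" and x: "x \<in> frags"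
  shows "t (ev b x) j = jval j b x"
proof -
  have T: "(U, t) \<in> trivs (jbun k)" unfolding usual_trivs using t by (intro exI)
  have "t (b, jets k b U \<psi>) j = jcoord k U \<psi> b j" if "\<psi> \<in> carrier GU" for \<psi>
    using conjunct2[OF t[unfolded reads_jets_def], rule_format, of U b \<psi>] that b U by simp
  thus ?thesis unfolding ev_triv[OF b x T b] jval_def by (rule fev_cong[OF x])
qed

end

section \<open>The sheaf of algebraic jets\<close>

context jet_presentation
begin

definition represents where
  "represents x s \<longleftrightarrow> x \<in> frags \<and> (\<forall>b\<in>U. s b = germ M (gpJet M E k) b U (cl2 x))"

end

context vbdl
begin

abbreviation represents where "represents k V \<equiv> jet_presentation.represents M E V k"
abbreviation ev where "ev k V \<equiv> jet_presentation.ev M E V k"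
abbreviation frags where "frags \<equiv> jet_presentation.frags M E"

context
  fixes k :: nat
begin

abbreviation agerm where "agerm b V x \<equiv> germ M (gpj k) b V (jet_presentation.cl2 M E V k x)"

interpretation G: module_presheaf M "gpj k" by (rule module_presheaf_gpJet)
interpretation JB: vbdl M "jbun k" by (rule vbdl_jbun)

text \<open>Equal germs have equal evaluations because evaluation kills \<open>N2\<close>.
  Conversely, restricting to a cube around \<open>b\<close> makes \<open>N2_jval\<close> applicable,
  so equal evaluations on the overlap force equal germs.\<close>

lemma germ_ev_iff:
  assumes U: "opn U" "b \<in> U" "x \<in> frags U" and V: "opn V" "b \<in> V" "y \<in> frags V"
  shows germ_ev_eqD: "agerm b U x = agerm b V y ==>
      ev k U b x = ev k V b y"
    and germ_ev_eqI: "(\<And>c. c \<in> U ==> c \<in> V ==> ev k U c x = ev k V c y) ==>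
      agerm b U x = agerm b V y"
proof -
  let ?germs = "agerm b U x = agerm b V y"
  interpret A: jet_presentation M E U k by (rule jet_presentationI[OF U(1)])
  interpret B: jet_presentation M E V k by (rule jet_presentationI[OF V(1)])
  have at: "G.section_at b U (A.cl2 x)" "G.section_at b V (B.cl2 y)"
    using U V A.GJ.pi_closed B.GJ.pi_closed by blast+
  {
    assume ?germs
    then obtain W where W: "opn W" "b \<in> W" "W \<subseteq> U \<inter> V" "res (gpj k) U W (A.cl2 x) = res (gpj k) V W (B.cl2 y)"
      using G.germ_eqD[OF at] by blast
    interpret R1: jet_restriction M E U W k by (rule jet_restrictionI[OF U(1) W(1)]) (use W in blast)
    interpret R2: jet_restriction M E V W k by (rule jet_restrictionI[OF V(1) W(1)]) (use W in blast)
    have f: "R1.restr x \<in> R1.B.frags" "R2.restr y \<in> R1.B.frags" by (rule R1.restr_frags[OF U(3)], rule R2.restr_frags[OF V(3)])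
    have "R1.B.cl2 (R1.restr x) = R1.B.cl2 (R2.restr y)"
      using W(4) unfolding R1.res_gpJet[OF U(3)] R2.res_gpJet[OF V(3)] .
    hence "R1.restr x - R2.restr y \<in> R1.B.N2" using R1.B.GJ.pi_eq_iff[OF f] by blast
    from R1.B.ev_N2[OF W(2) f this] show "A.ev b x = B.ev b y"
      unfolding R1.ev_restr[OF W(2) U(3)] R2.ev_restr[OF W(2) V(3)] .
  }
  assume eq: "\<And>c. c \<in> U ==> c \<in> V ==> A.ev c x = B.ev c y"
  have "opn (U \<inter> V)" "b \<in> U \<inter> V" using U V by auto
  then obtain W \<phi> \<Phi> r where W: "chart_frame M E W \<phi> \<Phi>" "b \<in> W" "W \<subseteq> U \<inter> V" "\<phi> ` W = cube dm (\<phi> b) r"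
    by (rule chart_frame_cover)
  interpret W: jet_chart M E W \<phi> \<Phi> k "\<phi> b" r by (intro jet_chart.intro jet_chart_axioms.intro W)
  interpret R1: jet_restriction M E U W k by (rule jet_restrictionI[OF U(1) W.U]) (use W in blast)
  interpret R2: jet_restriction M E V W k by (rule jet_restrictionI[OF V(1) W.U]) (use W in blast)
  have f: "R1.restr x \<in> W.frags" "R2.restr y \<in> W.frags" by (rule R1.restr_frags[OF U(3)], rule R2.restr_frags[OF V(3)])
  obtain t where t: "reads_jets k W \<phi> \<Phi> t" using reads_jets_exists[OF W(1)] by blast
  have "W.jval j c (R1.restr x - R2.restr y) = 0" if c: "c \<in> W" for j c
  proof -
    have cUV: "c \<in> U" "c \<in> V" using c W(3) by auto
    have "W.ev c (R1.restr x) = W.ev c (R2.restr y)"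
      unfolding R1.ev_restr[OF c U(3)] R2.ev_restr[OF c V(3)] by (rule eq[OF cUV])
    thus ?thesis
      unfolding W.jval_diff W.ev_jval[OF t c f(1), symmetric] W.ev_jval[OF t c f(2), symmetric] by simp
  qed
  hence "R1.restr x - R2.restr y \<in> W.N2" using W.N2_jval[OF W.frags_closed(4)[OF f]] by blast
  hence "W.cl2 (R1.restr x) = W.cl2 (R2.restr y)" using W.GJ.pi_eq_iff[OF f] by blast
  thus ?germs
    by (intro G.germ_eqI[OF at W.U W(2,3)]) (simp add: R1.res_gpJet[OF U(3)] R2.res_gpJet[OF V(3)])
qed

section \<open>Evaluation on sections of the sheafification\<close>

definition germ_ev :: "'m => _ => 'm \<times> ('m set \<times> ('m => 'e)) set set" where
  "germ_ev b \<gamma> = (SOME u. \<exists>V x. opn V \<and> b \<in> V \<and> x \<in> frags V \<and>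
    \<gamma> = agerm b V x \<and> u = ev k V b x)"

lemma germ_ev_germ:
  assumes "opn V" "b \<in> V" "x \<in> frags V"
  shows "germ_ev b (agerm b V x) = ev k V b x"
  unfolding germ_ev_def
proof (rule someI2)
  show "\<exists>W y. opn W \<and> b \<in> W \<and> y \<in> frags W \<and> agerm b V x =
      agerm b W y \<and> ev k V b x = ev k W b y" using assms by blast
  fix u
  assume "\<exists>W y. opn W \<and> b \<in> W \<and> y \<in> frags W \<and> agerm b V x =
      agerm b W y \<and> u = ev k W b y"
  thus "u = ev k V b x" using germ_ev_eqD[OF assms] by metis
qed

lemma represents_iff:
  "opn V ==> represents k V x s \<longleftrightarrow>
    x \<in> frags V \<and> (\<forall>b\<in>V. s b = agerm b V x)"
  by (rule jet_presentation.represents_def[OF jet_presentationI])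

lemma represents_ev: "opn V ==> represents k V x s ==> b \<in> V ==> germ_ev b (s b) = ev k V b x"
  by (simp add: represents_iff germ_ev_germ)

lemma represents_restrict:
  assumes U: "opn U" and V: "opn V" "V \<subseteq> U" and x: "represents k U x s"
  obtains y where "represents k V y s"
proof -
  interpret R: jet_restriction M E U V k by (rule jet_restrictionI[OF U V])
  have xf: "x \<in> R.A.frags" using x by (simp add: R.A.represents_def)
  have "germ M (gpj k) b V (R.B.cl2 (R.restr x)) = s b" if b: "b \<in> V" for b
    using G.germ_res[of U b "R.A.cl2 x" V] x b V U R.A.GJ.pi_closed[OF xf] subsetD[OF V(2) b]
    by (simp add: R.res_gpJet[OF xf] R.A.represents_def)
  hence "represents k V (R.restr x) s" using R.restr_frags[OF xf] by (simp add: R.B.represents_def)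
  thus thesis by (rule that)
qed

abbreviation JS where "JS \<equiv> Jet M E k"

lemma Jet_simps:
  "\<zero>\<^bsub>sec JS U\<^esub> = (\<lambda>a\<in>U. \<zero>\<^bsub>stalk M (gpj k) a\<^esub>)"
  "s \<oplus>\<^bsub>sec JS U\<^esub> t = (\<lambda>a\<in>U. s a \<oplus>\<^bsub>stalk M (gpj k) a\<^esub> t a)"
  "f \<odot>\<^bsub>sec JS U\<^esub> s = (\<lambda>a\<in>U. germ M (smooth_functions M) a U f \<odot>\<^bsub>stalk M (gpj k) a\<^esub> s a)"
  "res JS U V s = restrict s V"
  by (simp_all add: Jet_def sheafify_def)

text \<open>Sections of the sheafification are locally given by germs of classes; choosing formal
  combinations for these classes makes evaluation available.\<close>

lemma Jet_carrier:
  "s \<in> carrier (sec JS U) \<longleftrightarrow> s \<in> extensional U \<and> (\<forall>a\<in>U. \<exists>V x. opn V \<and> a \<in> V \<and> V \<subseteq> U \<and> represents k V x s)"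
proof -
  have "(\<exists>t. opn V \<and> a \<in> V \<and> V \<subseteq> U \<and> t \<in> carrier (sec (gpj k) V) \<and> (\<forall>b\<in>V. s b = germ M (gpj k) b V t)) \<longleftrightarrow>
      (\<exists>x. opn V \<and> a \<in> V \<and> V \<subseteq> U \<and> represents k V x s)" for V a
  proof (cases "opn V")
    case True
    interpret V: jet_presentation M E V k by (rule jet_presentationI[OF True])
    show ?thesis
    proof
      assume "\<exists>t. opn V \<and> a \<in> V \<and> V \<subseteq> U \<and> t \<in> carrier (sec (gpj k) V) \<and> (\<forall>b\<in>V. s b = germ M (gpj k) b V t)"
      then obtain t where t: "a \<in> V" "V \<subseteq> U" "t \<in> carrier (sec (gpj k) V)" "\<forall>b\<in>V. s b = germ M (gpj k) b V t"
        by (elim exE conjE)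
      from t(3) obtain x where x: "t = V.cl2 x" "x \<in> V.frags" unfolding V.GJ.pi_image[symmetric] by (elim imageE)
      show "\<exists>x. opn V \<and> a \<in> V \<and> V \<subseteq> U \<and> represents k V x s"
        unfolding V.represents_def using True t(1,2) x(2) t(4)[unfolded x(1)] by (intro exI[of _ x] conjI)
    next
      assume "\<exists>x. opn V \<and> a \<in> V \<and> V \<subseteq> U \<and> represents k V x s"
      then obtain x where x: "a \<in> V" "V \<subseteq> U" "x \<in> V.frags" "\<forall>b\<in>V. s b = germ M (gpj k) b V (V.cl2 x)"
        unfolding V.represents_def by (elim exE conjE)
      show "\<exists>t. opn V \<and> a \<in> V \<and> V \<subseteq> U \<and> t \<in> carrier (sec (gpj k) V) \<and> (\<forall>b\<in>V. s b = germ M (gpj k) b V t)"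
        using True x V.GJ.pi_closed[OF x(3)] by (intro exI[of _ "V.cl2 x"] conjI)
    qed
  qed simp
  hence "(\<exists>V t. opn V \<and> a \<in> V \<and> V \<subseteq> U \<and> t \<in> carrier (sec (gpj k) V) \<and> (\<forall>b\<in>V. s b = germ M (gpj k) b V t)) \<longleftrightarrow>
      (\<exists>V x. opn V \<and> a \<in> V \<and> V \<subseteq> U \<and> represents k V x s)" for a by (intro ex_cong1)
  thus ?thesis by (simp add: Jet_def sheafify_def)
qed

lemma Jet_common_domain:
  assumes s: "s \<in> carrier (sec JS U)" and t: "t \<in> carrier (sec JS U)" and a: "a \<in> U"
  obtains V x y where "opn V" "a \<in> V" "V \<subseteq> U" "represents k V x s" "represents k V y t"
proof -
  obtain V x where V: "opn V" "a \<in> V" "V \<subseteq> U" "represents k V x s" using s a unfolding Jet_carrier by blast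
  obtain W y where W: "opn W" "a \<in> W" "W \<subseteq> U" "represents k W y t" using t a unfolding Jet_carrier by blast
  have VW: "opn (V \<inter> W)" "V \<inter> W \<subseteq> V" "V \<inter> W \<subseteq> W" "a \<in> V \<inter> W" "V \<inter> W \<subseteq> U" using V W by auto
  obtain x' where x': "represents k (V \<inter> W) x' s" by (rule represents_restrict[OF V(1) VW(1,2) V(4)])
  obtain y' where y': "represents k (V \<inter> W) y' t" by (rule represents_restrict[OF W(1) VW(1,3) W(4)])
  show thesis by (rule that[OF VW(1,4,5) x' y'])
qed

lemma represents_cong: "opn V ==> represents k V x s ==> (\<And>b. b \<in> V ==> s b = t b) ==> represents k V x t"
  by (simp add: represents_iff)

definition jev :: "'m set => ('m => _) => 'm => 'm \<times> ('m set \<times> ('m => 'e)) set set" where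
  "jev U s = (\<lambda>b\<in>U. germ_ev b (s b))"

context
  fixes U assumes U: "opn U"
begin

text \<open>Over a small cube the coordinates of the evaluation are the functions
  \<open>jval\<close>, which are smooth in the base point.\<close>

lemma jev_section:
  assumes s: "s \<in> carrier (sec JS U)" shows "jev U s \<in> carrier (sec JB.\<Gamma> U)"
proof (rule JB.section_local[OF U])
  show "jev U s \<in> extensional U" by (simp add: jev_def)
  fix a assume a: "a \<in> U"
  obtain V x where V: "opn V" "a \<in> V" "V \<subseteq> U" "represents k V x s" using Jet_common_domain[OF s s a] by metis
  obtain W \<phi> \<Phi> r where W: "chart_frame M E W \<phi> \<Phi>" "a \<in> W" "W \<subseteq> V" "\<phi> ` W = cube dm (\<phi> a) r"
    by (rule chart_frame_cover[OF V(1,2)])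
  interpret W: jet_chart M E W \<phi> \<Phi> k "\<phi> a" r by (intro jet_chart.intro jet_chart_axioms.intro W)
  obtain y where y: "represents k W y s" by (rule represents_restrict[OF V(1) W.U W(3) V(4)])
  have yf: "y \<in> W.frags" using y by (simp add: W.represents_def)
  have e: "jev U s b = W.ev b y" if "b \<in> W" for b
    using represents_ev[OF W.U y that] that W(3) V(3) by (auto simp: jev_def)
  show "jev U s a \<in> fibre (jbun k) a" unfolding e[OF W(2)] by (rule W.ev_fibre[OF W(2) yf])
  obtain t where t: "reads_jets k W \<phi> \<Phi> t" using reads_jets_exists[OF W(1)] by blast
  hence "(W, t) \<in> trivs (jbun k)" unfolding usual_trivs by (intro exI)
  moreover have "smooth_fun M W (\<lambda>b. t (jev U s b) i)" for i
    using W.smooth_jval[OF yf, of i] smooth_fun_cong[OF W.U, of "\<lambda>b. t (jev U s b) i" "\<lambda>b. W.jval i b y"]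
    by (simp add: e W.ev_jval[OF t _ yf])
  ultimately show "\<exists>V t W. (V, t) \<in> trivs (jbun k) \<and> opn W \<and> a \<in> W \<and> W \<subseteq> U \<inter> V \<and>
      (\<forall>i\<in>idx (jbun k). smooth_fun M W (\<lambda>a. t (jev U s a) i))"
    using W(2,3) V(3) W.U by blast
qed

lemma jev_inj:
  assumes s: "s \<in> carrier (sec JS U)" and t: "t \<in> carrier (sec JS U)" and eq: "jev U s = jev U t"
  shows "s = t"
proof (rule extensionalityI)
  show "s \<in> extensional U" "t \<in> extensional U" using s t by (auto simp: Jet_carrier)
  fix a assume a: "a \<in> U"
  obtain V x y where V: "opn V" "a \<in> V" "V \<subseteq> U" "represents k V x s" "represents k V y t"
    by (rule Jet_common_domain[OF s t a])
  have xy: "x \<in> frags V" "y \<in> frags V" using V by (simp_all add: represents_iff)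
  have "ev k V c x = ev k V c y" if c: "c \<in> V" for c
    using fun_cong[OF eq, of c] subsetD[OF V(3) c] represents_ev[OF V(1) V(4) c] represents_ev[OF V(1) V(5) c] by (simp add: jev_def)
  thus "s a = t a"
    using germ_ev_eqI[OF V(1,2) xy(1) V(1,2) xy(2)] V(2,4,5) by (simp add: represents_iff[OF V(1)])
qed

text \<open>Over each cube \<open>jval_surj\<close> finds a formal combination with the given
  evaluations. The germs chosen at different points fit together, since a germ is determined by the
  evaluations near its point.\<close>

lemma jev_surj:
  assumes \<sigma>: "\<sigma> \<in> carrier (sec JB.\<Gamma> U)" shows "\<exists>s\<in>carrier (sec JS U). jev U s = \<sigma>"
proof -
  let ?P = "\<lambda>a V x. opn V \<and> a \<in> V \<and> V \<subseteq> U \<and> x \<in> frags V \<and> (\<forall>b\<in>V. ev k V b x = \<sigma> b)"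
  have ex: "\<exists>V x. ?P a V x" if a: "a \<in> U" for a
  proof -
    obtain W \<phi> \<Phi> r where W: "chart_frame M E W \<phi> \<Phi>" "a \<in> W" "W \<subseteq> U" "\<phi> ` W = cube dm (\<phi> a) r"
      by (rule chart_frame_cover[OF U a])
    interpret W: jet_chart M E W \<phi> \<Phi> k "\<phi> a" r by (intro jet_chart.intro jet_chart_axioms.intro W)
    obtain t where t: "reads_jets k W \<phi> \<Phi> t" using reads_jets_exists[OF W(1)] by blast
    hence T: "(W, t) \<in> trivs (jbun k)" unfolding usual_trivs by (intro exI)
    have K: "idx (jbun k) = W.K" by (simp add: usual_jet_bundle_def)
    have "smooth_fun M W (\<lambda>b. t (\<sigma> b) j)" if "j \<in> W.K" for j
      using JB.section_smooth[OF \<sigma> T, of j] that W(3) by (simp add: K Int_absorb1)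
    then obtain x where x: "x \<in> W.frags" "\<forall>j\<in>W.K. \<forall>b\<in>W. W.jval j b x = t (\<sigma> b) j"
      using W.jval_surj[of "\<lambda>j b. t (\<sigma> b) j"] by blast
    have "W.ev b x = \<sigma> b" if b: "b \<in> W" for b
      by (rule JB.triv_inj[OF T b W.ev_fibre[OF b x(1)] JB.section_fibre[OF \<sigma> subsetD[OF W(3) b]]])
        (simp only: W.ev_jval[OF t b x(1)] K bspec[OF bspec[OF x(2)] b])
    thus ?thesis using W.U W(2,3) x(1) by blast
  qed
  define s where "s = (\<lambda>a\<in>U. SOME \<gamma>. \<exists>V x. ?P a V x \<and> \<gamma> = agerm a V x)"
  have s: "s b = agerm b V x" if P: "?P a V x" and b: "b \<in> V" for a V x b
  proof -
    have "(SOME \<gamma>. \<exists>V x. ?P b V x \<and> \<gamma> = agerm b V x) =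
        agerm b V x"
    proof (rule someI2)
      show "\<exists>V' x'. ?P b V' x' \<and> agerm b V x =
          agerm b V' x'" using P b by blast
      fix \<gamma> assume "\<exists>V x. ?P b V x \<and> \<gamma> = agerm b V x"
      then obtain W y where W: "?P b W y" "\<gamma> = agerm b W y" by blast
      have "agerm b W y = agerm b V x"
        by (rule germ_ev_eqI) (use W(1) P b in auto)
      thus "\<gamma> = agerm b V x" unfolding W(2) .
    qed
    thus ?thesis using P b by (auto simp: s_def)
  qed
  have rep: "represents k V x s" if P: "?P a V x" for a V x
    using P s[OF P] by (simp add: represents_iff)
  have sJ: "s \<in> carrier (sec JS U)"
    unfolding Jet_carrier
  proof (intro conjI ballI)
    show "s \<in> extensional U" by (simp add: s_def)
    fix a assume "a \<in> U"
    then obtain V x where P: "?P a V x" using ex by blast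
    thus "\<exists>V x. opn V \<and> a \<in> V \<and> V \<subseteq> U \<and> represents k V x s" using rep[OF P] by blast
  qed
  have "jev U s b = \<sigma> b" for b
  proof (cases "b \<in> U")
    case True
    then obtain V x where P: "?P b V x" using ex by blast
    thus ?thesis using represents_ev[OF _ rep[OF P], of b] True by (simp add: jev_def)
  next
    case False
    thus ?thesis using JB.section_ext[OF \<sigma>] by (simp add: jev_def extensional_def)
  qed
  thus ?thesis using sJ by blast
qed

lemma jev_prolongation:
  assumes \<psi>: "\<psi> \<in> sects U"
  shows "jet_prolongation M E k U \<psi> \<in> carrier (sec JS U)"
    and "a \<in> U ==> jev U (jet_prolongation M E k U \<psi>) a = (a, jets k a U \<psi>)"
proof -
  interpret U: jet_presentation M E U k by (rule jet_presentationI[OF U])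
  let ?x = "frag_of (\<one>\<^bsub>U.CU\<^esub>, \<psi>)"
  have x: "?x \<in> U.frags" using \<psi> by simp
  have eq: "jet_prolongation M E k U \<psi> = (\<lambda>a\<in>U. germ M (gpj k) a U (U.cl2 ?x))"
    by (simp add: jet_prolongation_def sheafify_unit_def U.X_pure_cl0 U.cl2_def U.cl1_def)
  have rep: "represents k U ?x (jet_prolongation M E k U \<psi>)" using x by (simp add: represents_iff[OF U] eq)
  thus "jet_prolongation M E k U \<psi> \<in> carrier (sec JS U)" unfolding Jet_carrier using U by (auto simp: eq)
  assume a: "a \<in> U"
  show "jev U (jet_prolongation M E k U \<psi>) a = (a, jets k a U \<psi>)"
    using represents_ev[OF U rep a] U.ev_of[OF a U.GU.R.one_closed _ \<psi>] a by (simp add: jev_def smooth_ring_simps)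
qed

end

text \<open>Closure of an operation on the sheafification and its compatibility with
  \<open>jev\<close> are local: representatives with the expected evaluations settle both at
  once.\<close>

lemma jev_operation:
  assumes U: "opn U" and ext: "s \<in> extensional U" "\<sigma> \<in> extensional U"
    and loc: "\<And>a. a \<in> U ==> \<exists>V x. opn V \<and> a \<in> V \<and> V \<subseteq> U \<and> represents k V x s \<and> (\<forall>b\<in>V. ev k V b x = \<sigma> b)"
  shows "s \<in> carrier (sec JS U) \<and> jev U s = \<sigma>"
proof
  show "s \<in> carrier (sec JS U)" unfolding Jet_carrier using ext loc by blast
  show "jev U s = \<sigma>"
  proof (rule extensionalityI[OF _ ext(2)])
    fix a assume a: "a \<in> U"
    then obtain V x where V: "opn V" "a \<in> V" "represents k V x s" "\<forall>b\<in>V. ev k V b x = \<sigma> b" using loc by blast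
    show "jev U s a = \<sigma> a" using represents_ev[OF V(1,3,2)] V(2,4) a by (simp add: jev_def)
  qed (simp add: jev_def)
qed

lemma sheaf_iso_jev: "sheaf_iso M (jbun k) JS jev"
proof (intro sheaf_iso.intro sheaf_iso_axioms.intro vbdl_jbun)
  fix U :: "'m set" assume U: "opn U"
  show "bij_betw (jev U) (carrier (sec JS U)) (carrier (sec JB.\<Gamma> U))"
    unfolding bij_betw_def inj_on_def using jev_inj[OF U] jev_surj[OF U] jev_section[OF U] by blast
  show "\<zero>\<^bsub>sec JS U\<^esub> \<in> carrier (sec JS U) \<and> jev U \<zero>\<^bsub>sec JS U\<^esub> = \<zero>\<^bsub>sec JB.\<Gamma> U\<^esub>"
  proof (rule jev_operation[OF U])
    interpret U: jet_presentation M E U k by (rule jet_presentationI[OF U])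
    fix a assume a: "a \<in> U"
    have rep: "represents k U 0 \<zero>\<^bsub>sec JS U\<^esub>"
      unfolding U.represents_def by (simp add: Jet_simps G.stalk_zero[OF U] U.GJ.pi_zero)
    have "U.ev b 0 = \<zero>\<^bsub>sec JB.\<Gamma> U\<^esub> b" if b: "b \<in> U" for b
    proof -
      have bM: "b \<in> points M" using b U opn_points by blast
      then obtain V t where t: "(V, t) \<in> trivs (jbun k)" "b \<in> V" by (rule JB.triv_cover)
      have "U.ev b 0 = vzero (jbun k) b"
        by (rule JB.triv_inj[OF t U.ev_fibre[OF b U.GJ.F_zero] JB.fibre_closed(1)[OF bM]])
          (simp add: U.ev_triv[OF b U.GJ.F_zero t] U.fev_0 JB.triv_zero[OF t])
      thus ?thesis using b by (simp add: JB.section_simps(2))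
    qed
    thus "\<exists>V x. opn V \<and> a \<in> V \<and> V \<subseteq> U \<and> represents k V x \<zero>\<^bsub>sec JS U\<^esub> \<and> (\<forall>b\<in>V. ev k V b x = \<zero>\<^bsub>sec JB.\<Gamma> U\<^esub> b)"
      using rep U a by (intro exI[of _ U] exI[of _ 0]) simp
  qed (simp_all add: Jet_simps JB.section_simps(2))
  fix s assume s: "s \<in> carrier (sec JS U)"
  show "s \<oplus>\<^bsub>sec JS U\<^esub> t \<in> carrier (sec JS U) \<and> jev U (s \<oplus>\<^bsub>sec JS U\<^esub> t) = jev U s \<oplus>\<^bsub>sec JB.\<Gamma> U\<^esub> jev U t"
    if t: "t \<in> carrier (sec JS U)" for t
  proof (rule jev_operation[OF U])
    fix a assume a: "a \<in> U"
    obtain V x y where V: "opn V" "a \<in> V" "V \<subseteq> U" "represents k V x s" "represents k V y t"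
      by (rule Jet_common_domain[OF s t a])
    interpret V: jet_presentation M E V k by (rule jet_presentationI[OF V(1)])
    have xy: "x \<in> V.frags" "y \<in> V.frags" using V(4,5) by (simp_all add: V.represents_def)
    have "germ M (gpj k) b V (V.cl2 (x + y)) = s b \<oplus>\<^bsub>stalk M (gpj k) b\<^esub> t b" if b: "b \<in> V" for b
      using G.stalk_add[of V b "V.cl2 x" "V.cl2 y"] V(1,4,5) b xy by (simp add: V.represents_def V.GJ.pi_add)
    hence rep: "represents k V (x + y) (s \<oplus>\<^bsub>sec JS U\<^esub> t)"
      using V(3) xy by (auto simp: V.represents_def Jet_simps intro: V.frags_closed)
    have "V.ev b (x + y) = (jev U s \<oplus>\<^bsub>sec JB.\<Gamma> U\<^esub> jev U t) b" if b: "b \<in> V" for b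
    proof -
      have bM: "b \<in> points M" using b V(1) opn_points by blast
      then obtain W \<tau> where \<tau>: "(W, \<tau>) \<in> trivs (jbun k)" "b \<in> W" by (rule JB.triv_cover)
      note f = V.ev_fibre[OF b xy(1)] V.ev_fibre[OF b xy(2)] V.frags_closed(2)[OF xy]
      have "V.ev b (x + y) = vadd (jbun k) (V.ev b x) (V.ev b y)"
        by (rule JB.triv_inj[OF \<tau> V.ev_fibre[OF b f(3)] JB.fibre_closed(2)[OF bM f(1,2)]])
          (simp add: JB.triv_add[OF \<tau> f(1,2)] V.ev_triv[OF b f(3) \<tau>] V.ev_triv[OF b xy(1) \<tau>] V.ev_triv[OF b xy(2) \<tau>] V.fev_add)
      thus ?thesis
        using represents_ev[OF V(1,4) b] represents_ev[OF V(1,5) b] subsetD[OF V(3) b] by (simp add: JB.section_simps(3) jev_def)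
    qed
    thus "\<exists>V x. opn V \<and> a \<in> V \<and> V \<subseteq> U \<and> represents k V x (s \<oplus>\<^bsub>sec JS U\<^esub> t) \<and>
        (\<forall>b\<in>V. ev k V b x = (jev U s \<oplus>\<^bsub>sec JB.\<Gamma> U\<^esub> jev U t) b)"
      using rep V(1-3) by blast
  qed (simp_all add: Jet_simps JB.section_simps(3))
  show "f \<odot>\<^bsub>sec JS U\<^esub> s \<in> carrier (sec JS U) \<and> jev U (f \<odot>\<^bsub>sec JS U\<^esub> s) = f \<odot>\<^bsub>sec JB.\<Gamma> U\<^esub> jev U s"
    if f: "f \<in> fcts U" for f
  proof (rule jev_operation[OF U])
    fix a assume a: "a \<in> U"
    obtain V x where V: "opn V" "a \<in> V" "V \<subseteq> U" "represents k V x s" using Jet_common_domain[OF s s a] by metis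
    interpret V: jet_presentation M E V k by (rule jet_presentationI[OF V(1)])
    have x: "x \<in> V.frags" using V(4) by (simp add: V.represents_def)
    let ?f = "restrict f V"
    have fV: "?f \<in> carrier V.CU" using smooth_fun_subset[OF smooth_ring_fun[OF f] V(3)] by (rule restrict_smooth[OF V(1)])
    have "germ M (gpj k) b V (V.cl2 (V.lact ?f x)) = germ M (smooth_functions M) b U f \<odot>\<^bsub>stalk M (gpj k) b\<^esub> s b" if b: "b \<in> V" for b
    proof -
      have "germ M (smooth_functions M) b V ?f = germ M (smooth_functions M) b U f"
        using C.germ_res[of U b f V] f U V(1,3) b by (auto simp: smooth_ring_simps(7))
      moreover have "G.section_at b V (V.cl2 x)" using V(1) b V.GJ.pi_closed[OF x] by blast
      ultimately show ?thesis
        using G.stalk_smult_same[OF fV, of b "V.cl2 x"] V(4) b by (simp add: V.represents_def V.GJ.pi_act[OF fV x])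
    qed
    hence rep: "represents k V (V.lact ?f x) (f \<odot>\<^bsub>sec JS U\<^esub> s)"
      unfolding V.represents_def Jet_simps using V(3) V.lact_frags[OF fV x] by auto
    have "V.ev b (V.lact ?f x) = (f \<odot>\<^bsub>sec JB.\<Gamma> U\<^esub> jev U s) b" if b: "b \<in> V" for b
    proof -
      have bM: "b \<in> points M" using b V(1) opn_points by blast
      then obtain W \<tau> where \<tau>: "(W, \<tau>) \<in> trivs (jbun k)" "b \<in> W" by (rule JB.triv_cover)
      note e = V.ev_fibre[OF b x] V.lact_frags[OF fV x]
      have "V.ev b (V.lact ?f x) = vscale (jbun k) (f b) (V.ev b x)"
        by (rule JB.triv_inj[OF \<tau> V.ev_fibre[OF b e(2)] JB.fibre_closed(3)[OF bM e(1)]])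
          (simp add: JB.triv_scale[OF \<tau> e(1)] V.ev_triv[OF b e(2) \<tau>] V.ev_triv[OF b x \<tau>] V.fev_lact[OF b fV x] b del: restrict_apply, simp add: b)
      thus ?thesis
        using represents_ev[OF V(1,4) b] subsetD[OF V(3) b] by (simp add: JB.section_simps(4) jev_def)
    qed
    thus "\<exists>V x. opn V \<and> a \<in> V \<and> V \<subseteq> U \<and> represents k V x (f \<odot>\<^bsub>sec JS U\<^esub> s) \<and>
        (\<forall>b\<in>V. ev k V b x = (f \<odot>\<^bsub>sec JB.\<Gamma> U\<^esub> jev U s) b)"
      using rep V(1-3) by blast
  qed (simp_all add: Jet_simps JB.section_simps(4))
  show "res JS U V s \<in> carrier (sec JS V) \<and> jev V (res JS U V s) = restrict (jev U s) V"
    if V: "opn V" "V \<subseteq> U" for V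
  proof (rule jev_operation[OF V(1)])
    fix a assume a: "a \<in> V"
    obtain W x where W: "opn W" "a \<in> W" "W \<subseteq> U" "represents k W x s" using Jet_common_domain[OF s s subsetD[OF V(2) a]] by metis
    have VW: "opn (V \<inter> W)" "V \<inter> W \<subseteq> W" using V W by auto
    obtain y where y: "represents k (V \<inter> W) y s" by (rule represents_restrict[OF W(1) VW W(4)])
    have "represents k (V \<inter> W) y (res JS U V s)" by (rule represents_cong[OF VW(1) y]) (simp add: Jet_simps)
    moreover have "ev k (V \<inter> W) b y = restrict (jev U s) V b" if "b \<in> V \<inter> W" for b
      using represents_ev[OF VW(1) y that] that W(3) by (auto simp: jev_def)
    ultimately show "\<exists>W x. opn W \<and> a \<in> W \<and> W \<subseteq> V \<and> represents k W x (res JS U V s) \<and> (\<forall>b\<in>W. ev k W b x = restrict (jev U s) V b)"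
      using VW(1) a W(2) by (intro exI[of _ "V \<inter> W"] exI[of _ y]) auto
  qed (simp_all add: Jet_simps)
qed

theorem canonical_isomorphism:
  "\<exists>!\<Psi>. \<Psi> \<in> extensional (tot (algebraic_jet_bundle M E k)) \<and>
    vb_isomorphism M (algebraic_jet_bundle M E k) (jbun k) \<Psi> \<and> preserves_jets M E k \<Psi>"
proof -
  interpret J: sheaf_iso M "jbun k" JS jev by (rule sheaf_iso_jev)
  obtain \<Psi>0 where \<Psi>0: "\<Psi>0 \<in> extensional (tot J.SB)" "vb_isomorphism M J.SB (jbun k) \<Psi>0"
    "\<And>a U s. J.F.section_at a U s ==> \<Psi>0 (a, jet_class M JS 1 a U s) = jev U s a"
    using J.sheaf_bundle_iso unfolding One_nat_def by blast
  have jets0: "preserves_jets M E k \<Psi>0"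
    unfolding preserves_jets_def using \<Psi>0(3) jev_prolongation by metis
  \<comment> \<open>The image of \<open>u\<close> is the jet of some local section;
    \<open>\<Psi>0\<close> takes the class of its prolongation to the same point and is injective,
    so \<open>u\<close> is that class.\<close>
  have rep: "\<exists>U \<psi> a. opn U \<and> \<psi> \<in> sects U \<and> a \<in> U \<and> u = (a, jet_class M JS 1 a U (jet_prolongation M E k U \<psi>))"
    if u: "u \<in> tot J.SB" for u
  proof -
    have bij: "bij_betw \<Psi>0 (tot J.SB) (tot (jbun k))" using \<Psi>0(2) by (simp add: vb_isomorphism_def)
    have "\<Psi>0 u \<in> tot (jbun k)" by (rule bij_betw_apply[OF bij u])
    hence f: "\<Psi>0 u \<in> fibre (jbun k) (vproj (jbun k) (\<Psi>0 u))" "vproj (jbun k) (\<Psi>0 u) \<in> points M"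
      using JB.tot_proj by (auto simp: fibre_def)
    obtain T where D: "jbun k = disjoint_union_bundle M (jet_space M \<Gamma> (Suc k)) (jidx k) T"
      by (rule jbun_disjoint_union)
    obtain a U \<psi> where \<psi>: "S.section_at a U \<psi>" "\<Psi>0 u = (a, jets k a U \<psi>)"
      using S.jet_fibreE[OF D f openin_topspace] by metis
    have at: "J.F.section_at a U (jet_prolongation M E k U \<psi>)" using jev_prolongation(1) \<psi>(1) by blast
    have "(a, jet_class M JS 1 a U (jet_prolongation M E k U \<psi>)) \<in> tot J.SB"
      using J.F.jet_fibre[OF sheaf_bundle_def at] by (simp add: fibre_def)
    moreover have "\<Psi>0 (a, jet_class M JS 1 a U (jet_prolongation M E k U \<psi>)) = \<Psi>0 u"
      using \<Psi>0(3)[OF at] jev_prolongation(2) \<psi> by simp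
    ultimately have "u = (a, jet_class M JS 1 a U (jet_prolongation M E k U \<psi>))"
      using inj_onD[OF bij_betw_imp_inj_on[OF bij]] u by metis
    thus ?thesis using \<psi>(1) by blast
  qed
  show ?thesis
    unfolding algebraic_jet_bundle_def
  proof (intro ex1I[of _ \<Psi>0] conjI \<Psi>0(1,2) jets0)
    fix \<Psi> assume \<Psi>: "\<Psi> \<in> extensional (tot J.SB) \<and> vb_isomorphism M J.SB (jbun k) \<Psi> \<and> preserves_jets M E k \<Psi>"
    show "\<Psi> = \<Psi>0"
    proof (rule extensionalityI[OF conjunct1[OF \<Psi>] \<Psi>0(1)])
      fix u assume "u \<in> tot J.SB"
      then obtain U \<psi> a where u: "opn U" "\<psi> \<in> sects U" "a \<in> U"
        "u = (a, jet_class M JS 1 a U (jet_prolongation M E k U \<psi>))" using rep by blast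
      show "\<Psi> u = \<Psi>0 u"
        using \<Psi> jets0 u(1-3) unfolding u(4) preserves_jets_def by simp
    qed
  qed
qed

end

end

theorem proposition8p10:
  fixes M :: "'m manifold" and E :: "('m, 'e, 'i) vbundle" and k :: nat
  assumes "smooth_manifold M" and "vector_bundle M E"
  shows "\<exists>!\<Psi>. \<Psi> \<in> extensional (tot (algebraic_jet_bundle M E k)) \<and>
           vb_isomorphism M (algebraic_jet_bundle M E k) (usual_jet_bundle M E k) \<Psi> \<and>
           preserves_jets M E k \<Psi>"
  by (rule vbdl.canonical_isomorphism) (intro vbdl.intro vbdl_axioms.intro smooth_mfd.intro assms)

end
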